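(* There is a universal constant $C>0$ such that the following holds. Let $n,p\ge 3$ and $K\ge 1$, and let $X_1,\dots,X_n$ be independent (not necessarily identically distributed) centered random vectors in $\mathbb{R}^p$ with $\|X_{ij}\|_{\psi_1}\le K$ for all $1\le i\le n$, $1\le j\le p$. Let $S_n=\frac{1}{\sqrt n}\sum_{i=1}^n X_i$, $\Sigma=\mathbb{E}[S_nS_n^\top]$, and $\sigma_{\max}^2=\max_{1\le j\le p}\Sigma_{jj}$. Let $Z\sim N(0,\Sigma)$ and suppose that $\mu=\mathbb{E}[\max_{1\le j\le p}Z_j]>0$. Assume that $$K^2(\log p)^{1/2}(\log n)^2\le \sqrt n .$$ Then $$\sup_{t \in \mathbb{R}} \left| \mathbb{P}\left\{\max_{1 \le j \le p} Z_j \le t\right\} - \mathbb{P}\left\{\max_{1 \le j \le p} \frac{1}{\sqrt n} \sum_{i=1}^{n}X_{ij}\le t \right\}\right| \;\le\; C\left[\exp\left(\frac{-\mu^2}{8\sigma_{\max}^2}\right) + \mu^{-2/3}\left(\frac{K^4\log^7p}{n}\right)^{1/6}\right].$$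
   Context: $\|\xi\|_{\psi_1}=\inf\{c>0:\mathbb{E}\exp(|\xi|/c)\le 2\}$ is the sub-exponential Orlicz norm, $X_{ij}$ is the $j$-th coordinate of $X_i$, $\log$ is the natural logarithm and $\log^7 p=(\log p)^7$. (The assumption $\mu>0$ forces $\sigma_{\max}>0$.) No lower bound on the smallest diagonal entry of $\Sigma$ is assumed. *)

theory Defs
  imports "HOL-Probability.Probability"
begin

(* Vectors of R^p are functions on {1..p} that are undefined elsewhere, because p is quantified
   after the universal constant and hence cannot be a type. *)
abbreviation euclid :: "nat \<Rightarrow> (nat \<Rightarrow> real) measure" where
  "euclid p \<equiv> Pi\<^sub>M {1..p} (\<lambda>_. borel)"

(* The expectation is a nonnegative integral and the infimum is taken in the extended reals:
   a variable without any exponential moment has norm infinity. *)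
definition psi1_norm :: "'a measure \<Rightarrow> ('a \<Rightarrow> real) \<Rightarrow> ereal" where
  "psi1_norm M \<xi> =
     Inf {ereal c | c. c > 0 \<and> (\<integral>\<^sup>+ \<omega>. ennreal (exp (\<bar>\<xi> \<omega>\<bar> / c)) \<partial>M) \<le> 2}"

definition scaled_sum :: "nat \<Rightarrow> (nat \<Rightarrow> 'a \<Rightarrow> nat \<Rightarrow> real) \<Rightarrow> 'a \<Rightarrow> nat \<Rightarrow> real" where
  "scaled_sum n X \<omega> j = 1 / sqrt (real n) * (\<Sum>i=1..n. X i \<omega> j)"

definition second_moment :: "'a measure \<Rightarrow> ('a \<Rightarrow> nat \<Rightarrow> real) \<Rightarrow> nat \<Rightarrow> nat \<Rightarrow> real" where
  "second_moment M S j k = (\<integral>\<omega>. S \<omega> j * S \<omega> k \<partial>M)"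

(* The law N(0, Sigma) on R^p, given by its characteristic function so that Sigma may be singular. *)
definition centered_gaussian_law ::
    "nat \<Rightarrow> (nat \<Rightarrow> nat \<Rightarrow> real) \<Rightarrow> (nat \<Rightarrow> real) measure \<Rightarrow> bool" where
  "centered_gaussian_law p \<Sigma> \<gamma> \<longleftrightarrow>
     prob_space \<gamma> \<and> sets \<gamma> = sets (euclid p) \<and>
     (\<forall>a :: nat \<Rightarrow> real.
        (\<integral>z. exp (\<i> * complex_of_real (\<Sum>j=1..p. a j * z j)) \<partial>\<gamma>) =
        complex_of_real (exp (- (\<Sum>j=1..p. \<Sum>k=1..p. a j * \<Sigma> j k * a k) / 2)))"

definition vec_max :: "nat \<Rightarrow> (nat \<Rightarrow> real) \<Rightarrow> real" where
  "vec_max p v = (MAX j\<in>{1..p}. v j)"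

(* C is an admissible constant for all random vectors on probability spaces over the type 'a.
   Z enters through its law gamma only. Integrability of the coordinates of X i, and of their
   products, follows from the bound on the psi_1 norms. *)
definition gaussian_max_approx_const :: "'a itself \<Rightarrow> real \<Rightarrow> bool" where
  "gaussian_max_approx_const T C \<longleftrightarrow>
     (\<forall>(n::nat) (p::nat) (K::real) (M::'a measure) (X :: nat \<Rightarrow> 'a \<Rightarrow> nat \<Rightarrow> real)
        (\<gamma> :: (nat \<Rightarrow> real) measure) (\<Sigma> :: nat \<Rightarrow> nat \<Rightarrow> real) (\<sigma>max :: real) (\<mu> :: real).
        n \<ge> 3 \<longrightarrow> p \<ge> 3 \<longrightarrow> K \<ge> 1 \<longrightarrow>
        prob_space M \<longrightarrow>
        prob_space.indep_vars M (\<lambda>_. euclid p) X {1..n} \<longrightarrow>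
        (\<forall>i\<in>{1..n}. \<forall>j\<in>{1..p}. (\<integral>\<omega>. X i \<omega> j \<partial>M) = 0) \<longrightarrow>
        (\<forall>i\<in>{1..n}. \<forall>j\<in>{1..p}. psi1_norm M (\<lambda>\<omega>. X i \<omega> j) \<le> ereal K) \<longrightarrow>
        \<Sigma> = second_moment M (scaled_sum n X) \<longrightarrow>
        \<sigma>max = sqrt (MAX j\<in>{1..p}. \<Sigma> j j) \<longrightarrow>
        centered_gaussian_law p \<Sigma> \<gamma> \<longrightarrow>
        \<mu> = (\<integral>z. vec_max p z \<partial>\<gamma>) \<longrightarrow>
        \<mu> > 0 \<longrightarrow>
        K\<^sup>2 * (ln (real p)) powr (1/2) * (ln (real n))\<^sup>2 \<le> sqrt (real n) \<longrightarrow>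
        (SUP t::real. \<bar>measure \<gamma> {z \<in> space \<gamma>. vec_max p z \<le> t} -
                       measure M {\<omega> \<in> space M. vec_max p (scaled_sum n X \<omega>) \<le> t}\<bar>)
          \<le> C * (exp (- \<mu>\<^sup>2 / (8 * \<sigma>max\<^sup>2)) +
                 \<mu> powr (-2/3) * (K ^ 4 * (ln (real p)) ^ 7 / real n) powr (1/6)))"

end

theory Submission
  imports Defs
begin

text \<open>The maximum is replaced by the softmax \<open>F\<close> x = ln(sum_j exp(b x_j)) / b,
  which exceeds it by at most ln p / b, and the indicator of (-inf, t] by \<open>u\<close> x =
  cutoff((F x - t) / d). With b d = ln p both smoothing errors have size d. Two things are then
  needed: a bound on |E u(S_n) - E u(Z)|, and a bound on the mass that max Z puts on intervals of
  length of order d. The derivatives of \<open>F\<close> are cumulants under the softmax weights,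
  which form a probability vector, so derivative bounds carry no power of p.

  Smooth comparison. Exchanging X_i directly for a Gaussian vector would leave a third-order Taylor
  term. Instead X_i is first exchanged for e_i X_i, where the e_i are independent of the data,
  bounded, with E e = 0 and E e^2 = E e^3 = 1 (\<open>skew_law\<close>). As X_i is centred, the
  Taylor expansions agree in mean up to third order, and the total error is of order n kappa^4 b^3 /
  d with kappa = 2K / sqrt n (\<open>Taylor_u\<close>, \<open>exchange_one\<close>,
  \<open>exchange\<close>). Given the data, the sum of e_i X_i is then compared with Z. Each e_i has
  a bounded Stein kernel tau of mean 1, so trigonometric interpolation and integration by parts
  leave only second derivatives of \<open>u\<close> against the matrix sum_i tau(e_i) X_i X_i^T -
  Sigma (\<open>path_derivative\<close>, \<open>interpolation\<close>). This costs b/d times the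
  expected largest entry of that matrix, which truncation and exponential moments bound by a
  multiple of kappa^2 sqrt(n ln p) (\<open>covariance_fluctuation\<close>).

  From smooth functions to distribution functions. Variances have no lower bound, so
  anti-concentration is proved at positive levels t only. Coordinates with standard deviation below
  t / sqrt(4 ln p) rarely come near t and are summed one by one. The others are normalised to unit
  variance, where the shifted maximum has density at most a multiple of sqrt(ln p)
  (\<open>gaussian_softmax_density\<close>, \<open>gaussian_max_anticoncentration\<close>). Together
  this gives a multiple of eps ln p / t (\<open>anticoncentration\<close>). Levels below mu/5 are
  covered by Gaussian concentration of the softmax: the event max Z <= mu/5 has probability at most
  exp(-mu^2 / (8 sigma^2)) (\<open>gaussian_softmax_exponential\<close>, \<open>lower_tail\<close>),
  and monotonicity of the distribution functions does the rest
  (\<open>distribution_comparison\<close>).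

  Choice of scale. Let r be the second term of the claimed bound. With d = r mu / ln p the
  anti-concentration term and the covariance term are multiples of r and the exchange term a
  multiple of r^2. If r > 1/50 the bound is trivial; if r is smaller, the smallness conditions of
  the previous steps follow from r itself (\<open>gaussian_approximation_rate\<close>). Finally the
  laws of the vectors X_i / sqrt n are substituted (\<open>gaussian_max_approx\<close>).\<close>

section \<open>The softmax function\<close>

locale softmax =
  fixes b :: real and J :: "nat set"
  assumes b_pos: "b > 0" and finJ: "finite J" and J_ne: "J \<noteq> {}"
begin

definition F :: "(nat \<Rightarrow> real) \<Rightarrow> real" where
  "F x = ln (\<Sum>k\<in>J. exp (b * x k)) / b"

text \<open>The gradient of \<open>F\<close>, a probability vector on \<open>J\<close>. All
  derivatives of \<open>F\<close> are expressed through averages under it, so their bounds do not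
  see the size of \<open>J\<close>.\<close>

definition weight :: "(nat \<Rightarrow> real) \<Rightarrow> nat \<Rightarrow> real" where
  "weight x j = exp (b * x j) / (\<Sum>k\<in>J. exp (b * x k))"

definition avg :: "(nat \<Rightarrow> real) \<Rightarrow> (nat \<Rightarrow> real) \<Rightarrow> real" where
  "avg x y = (\<Sum>j\<in>J. weight x j * y j)"

lemma partition_pos: "(\<Sum>k\<in>J. exp (b * x k)) > 0"
  using finJ J_ne by (intro sum_pos) auto

lemma weight_nonneg: "weight x j \<ge> 0"
  using partition_pos[of x] by (simp add: weight_def less_imp_le)

lemma sum_weight: "(\<Sum>j\<in>J. weight x j) = 1"
  using partition_pos[of x] by (simp add: weight_def flip: sum_divide_distrib)

lemma avg_const: "avg x (\<lambda>_. c) = c"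
  by (simp add: avg_def flip: sum_distrib_right add: sum_weight)

lemma avg_add: "avg x (\<lambda>j. y j + z j) = avg x y + avg x z"
  by (simp add: avg_def algebra_simps sum.distrib)

lemma avg_cmult: "avg x (\<lambda>j. c * y j) = c * avg x y"
  by (simp add: avg_def sum_distrib_left algebra_simps)

lemma avg_sum: "avg x (\<lambda>j. \<Sum>m\<in>A. y m j) = (\<Sum>m\<in>A. avg x (y m))"
  unfolding avg_def sum_distrib_left by (rule sum.swap)

lemma avg_mono: "(\<And>j. j \<in> J \<Longrightarrow> y j \<le> z j) \<Longrightarrow> avg x y \<le> avg x z"
  unfolding avg_def by (intro sum_mono mult_left_mono weight_nonneg)

lemma avg_le: "(\<And>j. j \<in> J \<Longrightarrow> y j \<le> c) \<Longrightarrow> avg x y \<le> c"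
  using avg_mono[of y "\<lambda>_. c" x] by (simp add: avg_const)

lemma avg_nonneg: "(\<And>j. j \<in> J \<Longrightarrow> 0 \<le> y j) \<Longrightarrow> 0 \<le> avg x y"
  using avg_mono[of "\<lambda>_. 0" y x] by (simp add: avg_const)

lemma abs_avg_le: "\<bar>avg x y\<bar> \<le> avg x (\<lambda>j. \<bar>y j\<bar>)"
  unfolding avg_def by (rule order.trans[OF sum_abs]) (simp add: abs_mult weight_nonneg)

lemma abs_avg_bound: "(\<And>j. j \<in> J \<Longrightarrow> \<bar>y j\<bar> \<le> c) \<Longrightarrow> \<bar>avg x y\<bar> \<le> c"
  by (rule order.trans[OF abs_avg_le avg_le])

lemma avg_Cauchy_Schwarz: "(avg x (\<lambda>j. y j * z j))\<^sup>2 \<le> avg x (\<lambda>j. (y j)\<^sup>2) * avg x (\<lambda>j. (z j)\<^sup>2)"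
proof -
  have "(\<Sum>j\<in>J. (sqrt (weight x j) * y j) * (sqrt (weight x j) * z j))\<^sup>2
     \<le> (\<Sum>j\<in>J. (sqrt (weight x j) * y j)\<^sup>2) * (\<Sum>j\<in>J. (sqrt (weight x j) * z j)\<^sup>2)"
    by (rule Cauchy_Schwarz_ineq_sum)
  moreover have "sqrt (weight x j) * y j * (sqrt (weight x j) * z j) = weight x j * (y j * z j)" for j
    using weight_nonneg[of x j] real_sqrt_mult_self[of "weight x j"]
    by (metis (no_types, lifting) abs_of_nonneg mult.assoc mult.left_commute)
  ultimately show ?thesis
    by (simp add: avg_def power_mult_distrib weight_nonneg)
qed

lemma avg_power2_le: "(avg x y)\<^sup>2 \<le> avg x (\<lambda>j. (y j)\<^sup>2)"
  using avg_Cauchy_Schwarz[of x y "\<lambda>_. 1"] by (simp add: avg_const)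

lemma F_ge: assumes "j \<in> J" shows "x j \<le> F x"
proof -
  have "exp (b * x j) \<le> (\<Sum>k\<in>J. exp (b * x k))"
    using assms finJ by (intro member_le_sum) auto
  then have "b * x j \<le> ln (\<Sum>k\<in>J. exp (b * x k))"
    by (subst ln_ge_iff) (auto simp: partition_pos)
  then show ?thesis using b_pos by (simp add: F_def field_simps)
qed

text \<open>Each of the \<open>card J\<close> summands is at most exp(b c). With \<open>F_ge\<close>
  this places the softmax within ln(card J) / b above the maximum.\<close>

lemma F_le: assumes "\<And>j. j \<in> J \<Longrightarrow> x j \<le> c" shows "F x \<le> c + ln (card J) / b"
proof -
  have c: "card J > 0" using finJ J_ne by auto
  have "(\<Sum>k\<in>J. exp (b * x k)) \<le> card J * exp (b * c)"
    using assms b_pos by (intro sum_bounded_above) auto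
  then have "ln (\<Sum>k\<in>J. exp (b * x k)) \<le> ln (card J * exp (b * c))"
    using partition_pos[of x] by (simp add: c)
  also have "\<dots> = ln (card J) + b * c"
    using c by (simp add: ln_mult)
  finally show ?thesis using b_pos by (simp add: F_def field_simps)
qed

lemma F_abs_le: assumes "\<And>j. j \<in> J \<Longrightarrow> \<bar>x j\<bar> \<le> c" shows "\<bar>F x\<bar> \<le> c + ln (card J) / b"
proof -
  obtain j where j: "j \<in> J" using J_ne by auto
  have "card J \<ge> 1" using finJ J_ne by (simp add: Suc_leI card_gt_0_iff)
  then have "ln (card J) / b \<ge> 0" using b_pos by simp
  moreover have "F x \<ge> - c" using F_ge[OF j, of x] assms[OF j] by linarith
  moreover have "F x \<le> c + ln (card J) / b" using assms by (intro F_le) (fastforce simp: abs_le_iff)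
  ultimately show ?thesis by linarith
qed

lemma DERIV_F:
  assumes "\<And>j. j \<in> J \<Longrightarrow> ((\<lambda>s. x s j) has_real_derivative y j) (at s)"
  shows "((\<lambda>s. F (x s)) has_real_derivative avg (x s) y) (at s)"
  unfolding F_def
  by (auto intro!: derivative_eq_intros assms partition_pos
      simp: avg_def weight_def sum_divide_distrib b_pos[THEN less_imp_neq] field_simps)
   (use b_pos partition_pos[of "x s"] in \<open>auto simp: sum_divide_distrib sum_distrib_left field_simps intro!: sum.cong\<close>)

lemma DERIV_weight:
  assumes "\<And>j. j \<in> J \<Longrightarrow> ((\<lambda>s. x s j) has_real_derivative y j) (at s)" and j: "j \<in> J"
  shows "((\<lambda>s. weight (x s) j) has_real_derivative
           b * (weight (x s) j * y j - weight (x s) j * avg (x s) y)) (at s)"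
proof -
  let ?S = "\<Sum>k\<in>J. exp (b * x s k)"
  have S: "?S \<noteq> 0" using partition_pos[of "x s"] by simp
  have "((\<lambda>s. weight (x s) j) has_real_derivative
      (exp (b * x s j) * (b * y j) * ?S - exp (b * x s j) * (\<Sum>k\<in>J. exp (b * x s k) * (b * y k))) / (?S * ?S)) (at s)"
    unfolding weight_def using S
    by (auto intro!: derivative_eq_intros assms j) (auto intro!: sum.cong)
  moreover have "avg (x s) y = (\<Sum>k\<in>J. exp (b * x s k) * y k) / ?S"
    by (simp add: avg_def weight_def sum_divide_distrib)
  moreover have "(\<Sum>k\<in>J. exp (b * x s k) * (b * y k)) = b * (\<Sum>k\<in>J. exp (b * x s k) * y k)"
    by (auto simp: sum_distrib_left intro!: sum.cong)
  ultimately have "((\<lambda>s. weight (x s) j) has_real_derivative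
      (exp (b * x s j) * (b * y j) * ?S - exp (b * x s j) * (b * avg (x s) y * ?S)) / (?S * ?S)) (at s)"
    using S by simp
  moreover have "(e * (b * z) * S - e * (b * a * S)) / (S * S) = b * (e / S * z - e / S * a)" if "S \<noteq> 0" for e z a S :: real
    using that by (simp add: field_simps)
  ultimately show ?thesis using S by (simp add: weight_def)
qed

text \<open>Differentiating a Gibbs average yields \<open>b\<close> times a covariance under the
  same weights. Iterating this produces the cumulants in the higher derivatives of
  \<open>F\<close>.\<close>

lemma DERIV_avg:
  assumes "\<And>j. j \<in> J \<Longrightarrow> ((\<lambda>s. x s j) has_real_derivative y j) (at s)"
  shows "((\<lambda>s. avg (x s) z) has_real_derivative
           b * (avg (x s) (\<lambda>j. z j * y j) - avg (x s) z * avg (x s) y)) (at s)"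
proof -
  have "((\<lambda>s. avg (x s) z) has_real_derivative
      (\<Sum>j\<in>J. b * (weight (x s) j * y j - weight (x s) j * avg (x s) y) * z j)) (at s)"
    unfolding avg_def[of _ z] by (auto intro!: derivative_eq_intros DERIV_weight assms)
  moreover have "(\<Sum>j\<in>J. b * (weight (x s) j * y j - weight (x s) j * avg (x s) y) * z j)
     = b * (avg (x s) (\<lambda>j. z j * y j) - avg (x s) z * avg (x s) y)"
    unfolding avg_def[of "x s" z] avg_def[of "x s" "\<lambda>j. z j * y j"]
    by (simp add: sum_distrib_left sum_distrib_right algebra_simps sum_subtractf)
  ultimately show ?thesis by simp
qed

text \<open>A perturbation of size at most 1/b changes the numerator and the partition function by a
  factor of at most e each. It lets a derivative taken at an intermediate point be estimated with
  the weights at the base point.\<close>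

lemma weight_stable:
  assumes "\<And>j. j \<in> J \<Longrightarrow> \<bar>b * z j\<bar> \<le> 1" and j: "j \<in> J"
  shows "weight (\<lambda>k. x k + z k) j \<le> exp 2 * weight x j"
proof -
  have a: "- 1 \<le> b * z k \<and> b * z k \<le> 1" if "k \<in> J" for k
    using assms(1)[OF that] by linarith
  have "(\<Sum>k\<in>J. exp (b * x k)) * exp (-1) \<le> (\<Sum>k\<in>J. exp (b * (x k + z k)))"
    unfolding sum_distrib_right by (intro sum_mono) (auto simp: ring_distribs a simp flip: exp_add)
  moreover have "exp (b * (x j + z j)) \<le> exp (b * x j) * exp 1"
    using a[OF j] by (simp add: ring_distribs flip: exp_add)
  ultimately have "weight (\<lambda>k. x k + z k) j \<le> (exp (b * x j) * exp 1) / ((\<Sum>k\<in>J. exp (b * x k)) * exp (-1))"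
    unfolding weight_def using partition_pos[of x] by (intro frac_le) auto
  also have "\<dots> = exp 2 * weight x j"
    by (simp add: weight_def exp_minus field_simps flip: exp_add)
  finally show ?thesis .
qed

lemma F_measurable:
  assumes [measurable]: "\<And>j. j \<in> J \<Longrightarrow> (\<lambda>\<omega>. x \<omega> j) \<in> borel_measurable M"
  shows "(\<lambda>\<omega>. F (x \<omega>)) \<in> borel_measurable M"
  unfolding F_def by measurable

lemma avg_measurable:
  assumes [measurable]: "\<And>j. j \<in> J \<Longrightarrow> (\<lambda>\<omega>. x \<omega> j) \<in> borel_measurable M"
    "\<And>j. j \<in> J \<Longrightarrow> (\<lambda>\<omega>. y \<omega> j) \<in> borel_measurable M"
  shows "(\<lambda>\<omega>. avg (x \<omega>) (y \<omega>)) \<in> borel_measurable M"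
  unfolding avg_def weight_def by measurable

end

section \<open>A C^4 cutoff with bounded derivatives\<close>

section \<open>A smooth cutoff\<close>

text \<open>Clamping to [0, 1] is a contraction that fixes \<open>x\<close>, so the estimate |P y -
  P x| <= e |y - x| survives it.\<close>

lemma DERIV_zero_clamp:
  fixes P :: "real \<Rightarrow> real"
  assumes D: "(P has_real_derivative 0) (at x)" and x: "x = 0 \<or> x = 1"
  shows "((\<lambda>x. P (max 0 (min 1 x))) has_real_derivative 0) (at x)"
proof -
  have cx: "max 0 (min 1 x) = x" using x by auto
  have "\<exists>d>0. \<forall>y. norm (y - x) < d \<longrightarrow> norm (P (max 0 (min 1 y)) - P x) \<le> e * norm (y - x)" if e: "e > 0" for e
  proof -
    obtain d where d: "d > 0" "\<And>y. norm (y - x) < d \<Longrightarrow> norm (P y - P x) \<le> e * norm (y - x)"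
      using D e unfolding has_field_derivative_def has_derivative_at_alt by auto
    have "norm (P (max 0 (min 1 y)) - P x) \<le> e * norm (y - x)" if "norm (y - x) < d" for y
    proof -
      have "norm (max 0 (min 1 y) - x) \<le> norm (y - x)" using x by auto
      then show ?thesis using d(2)[of "max 0 (min 1 y)"] that e
        by (meson less_le_trans mult_le_cancel_left_pos order_trans le_less_trans)
    qed
    with d(1) show ?thesis by blast
  qed
  then show ?thesis
    unfolding has_field_derivative_def has_derivative_at_alt cx
    by (auto intro: bounded_linear_mult_right)
qed

text \<open>Clamping the argument continues \<open>P\<close> by constants. The pieces fit together
  differentiably because \<open>P'\<close> vanishes at both ends.\<close>

lemma DERIV_clamp:
  fixes P P' :: "real \<Rightarrow> real"
  assumes D: "\<And>x. (P has_real_derivative P' x) (at x)" and 0: "P' 0 = 0" "P' 1 = 0"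
  shows "((\<lambda>x. P (max 0 (min 1 x))) has_real_derivative P' (max 0 (min 1 x))) (at x)"
proof -
  consider "x = 0 \<or> x = 1" | "x < 0" | "x > 1" | "0 < x" "x < 1" by linarith
  then show ?thesis
  proof cases
    case 1
    then show ?thesis using DERIV_zero_clamp[of P x] D[of x] 0 by auto
  next
    case 2
    then have "((\<lambda>x. P (max 0 (min 1 x))) has_real_derivative 0) (at x)"
      by (intro has_field_derivative_transform_within_open[OF DERIV_const[of "P 0"], where S="{..<0}"])
         auto
    then show ?thesis using 2 0 by simp
  next
    case 3
    then have "((\<lambda>x. P (max 0 (min 1 x))) has_real_derivative 0) (at x)"
      by (intro has_field_derivative_transform_within_open[OF DERIV_const[of "P 1"], where S="{1<..}"])
         auto
    then show ?thesis using 3 0 by simp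
  next
    case 4
    then have "((\<lambda>x. P (max 0 (min 1 x))) has_real_derivative P' x) (at x)"
      by (intro has_field_derivative_transform_within_open[OF D, where S="{0<..<1}"]) auto
    then show ?thesis using 4 by simp
  qed
qed

text \<open>The decreasing smoothstep of degree 9 with its first four derivatives. The first is
  proportional to x^4 (1 - x)^4, with 1/630 the integral of that polynomial over [0, 1]; hence all
  four derivatives vanish at 0 and 1 and clamping gives a C^4 function.\<close>

definition step_poly :: "nat \<Rightarrow> real \<Rightarrow> real" where
  "step_poly k x =
    (if k = 0 then 1 - (126 * x^5 - 420 * x^6 + 540 * x^7 - 315 * x^8 + 70 * x^9)
     else if k = 1 then - 630 * (x^4 * (1 - x)^4)
     else if k = 2 then - 2520 * (x^3 * (1 - x)^3 * (1 - 2 * x))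
     else if k = 3 then - 2520 * (x\<^sup>2 * (1 - x)\<^sup>2 * (3 - 14 * x + 14 * x\<^sup>2))
     else - 2520 * (2 * x * (1 - x) * (1 - 2 * x) * (3 - 14 * x + 14 * x\<^sup>2) + x\<^sup>2 * (1 - x)\<^sup>2 * (28 * x - 14)))"

definition cutoff :: "nat \<Rightarrow> real \<Rightarrow> real" where
  "cutoff k x = step_poly k (max 0 (min 1 x))"

lemma DERIV_step_poly:
  assumes "k < 4" shows "(step_poly k has_real_derivative step_poly (Suc k) x) (at x)"
proof -
  consider "k = 0" | "k = 1" | "k = 2" | "k = 3" using assms by linarith
  then show ?thesis
    by cases (auto simp: step_poly_def[abs_def] intro!: derivative_eq_intros,
      simp_all add: algebra_simps power_numeral_reduce)
qed

lemma DERIV_cutoff: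
  assumes "k < 4" shows "(cutoff k has_real_derivative cutoff (Suc k) x) (at x)"
  unfolding cutoff_def[abs_def]
  by (rule DERIV_clamp[OF DERIV_step_poly[OF assms]]) (auto simp: step_poly_def)

lemma continuous_step_poly: "continuous_on A (step_poly k)"
  unfolding step_poly_def[abs_def]
  by (cases "k = 0"; cases "k = 1"; cases "k = 2"; cases "k = 3"; simp; intro continuous_intros)

lemma continuous_cutoff: "continuous_on A (cutoff k)"
  unfolding cutoff_def[abs_def]
  by (rule continuous_on_compose2[OF continuous_step_poly[of UNIV]]) (auto intro!: continuous_intros)

text \<open>Continuity of the polynomials on the compact unit interval. The final constant is
  \<open>10 ^ 8 * B\<close> for this \<open>B\<close>, which depends on nothing but the
  cutoff.\<close>

lemma cutoff_bounded: obtains B where "B \<ge> 1" "\<And>k x. k \<le> 4 \<Longrightarrow> \<bar>cutoff k x\<bar> \<le> B"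
proof -
  have "bounded (step_poly k ` {0..1})" for k
    by (intro compact_imp_bounded compact_continuous_image continuous_step_poly) simp
  then have "\<forall>k. \<exists>B. \<forall>x\<in>{0..1}. \<bar>step_poly k x\<bar> \<le> B"
    unfolding bounded_real by blast
  then obtain B where B: "\<And>k x. x \<in> {0..1} \<Longrightarrow> \<bar>step_poly k x\<bar> \<le> B k" by metis
  have "\<bar>cutoff k x\<bar> \<le> max 1 (Max (B ` {..4}))" if "k \<le> 4" for k x
  proof -
    have "\<bar>cutoff k x\<bar> \<le> B k" unfolding cutoff_def by (rule B) auto
    also have "\<dots> \<le> Max (B ` {..4})" using that by simp
    finally show ?thesis by simp
  qed
  with that[of "max 1 (Max (B ` {..4}))"] show ?thesis by auto
qed

lemma cutoff_eq_1: "x \<le> 0 \<Longrightarrow> cutoff 0 x = 1"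
  by (simp add: cutoff_def step_poly_def)

lemma cutoff_eq_0: "x \<ge> 1 \<Longrightarrow> cutoff 0 x = 0"
  by (simp add: cutoff_def step_poly_def)

lemma cutoff_range: "0 \<le> cutoff 0 x" "cutoff 0 x \<le> 1"
proof -
  have "cutoff (Suc 0) x \<le> 0" for x
    by (simp add: cutoff_def step_poly_def)
  then have anti: "cutoff 0 y \<le> cutoff 0 x" if "x \<le> y" for x y
    using DERIV_nonpos_imp_nonincreasing[OF that, of "cutoff 0"] DERIV_cutoff[of 0] by auto
  show "0 \<le> cutoff 0 x" using anti[of x "max x 1"] cutoff_eq_0[of "max x 1"] by auto
  show "cutoff 0 x \<le> 1" using anti[of "min x 0" x] cutoff_eq_1[of "min x 0"] by auto
qed

section \<open>Derivatives of the smoothed indicator and its Taylor expansion\<close>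

section \<open>Smoothed indicators of the maximum\<close>

text \<open>The condition \<open>bd\<close> says that the softmax resolves the maximum at least as
  finely as the cutoff width \<open>d\<close>. It allows a factor 1/d from differentiating the
  cutoff to be traded for a factor \<open>b\<close>.\<close>

locale smooth_max = softmax +
  fixes t d B :: real
  assumes d_pos: "d > 0" and bd: "b * d \<ge> 1"
    and B_ge_1: "B \<ge> 1" and B: "\<And>k x. k \<le> 4 \<Longrightarrow> \<bar>cutoff k x\<bar> \<le> B"
begin

text \<open>The \<open>k\<close>-th derivative of the smoothed indicator of (-inf, t], which falls
  from 1 to 0 on [t, t + d]. Below, \<open>D1\<close> to \<open>D4\<close> are the derivatives of
  \<open>u\<close> in direction \<open>y\<close>, by the chain rule of higher order applied to the
  cumulants of \<open>y\<close> under the weights.\<close>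

definition psi :: "nat \<Rightarrow> real \<Rightarrow> real" where
  "psi k x = cutoff k ((x - t) / d) / d ^ k"

definition u :: "(nat \<Rightarrow> real) \<Rightarrow> real" where
  "u x = psi 0 (F x)"

definition D1 :: "(nat \<Rightarrow> real) \<Rightarrow> (nat \<Rightarrow> real) \<Rightarrow> real" where
  "D1 x y = psi 1 (F x) * avg x y"

definition D2 :: "(nat \<Rightarrow> real) \<Rightarrow> (nat \<Rightarrow> real) \<Rightarrow> real" where
  "D2 x y = psi 2 (F x) * (avg x y)\<^sup>2 + psi 1 (F x) * (b * (avg x (\<lambda>j. (y j)\<^sup>2) - (avg x y)\<^sup>2))"

definition D3 :: "(nat \<Rightarrow> real) \<Rightarrow> (nat \<Rightarrow> real) \<Rightarrow> real" where
  "D3 x y = psi 3 (F x) * avg x y ^ 3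
     + 3 * psi 2 (F x) * avg x y * (b * (avg x (\<lambda>j. (y j)\<^sup>2) - (avg x y)\<^sup>2))
     + psi 1 (F x) * (b\<^sup>2 * (avg x (\<lambda>j. y j ^ 3) - 3 * avg x y * avg x (\<lambda>j. (y j)\<^sup>2) + 2 * avg x y ^ 3))"

text \<open>The cumulants are expanded into raw moments so that every monomial has total degree four
  and can be bounded by \<open>m4\<close>. The factor of \<open>psi 1\<close> is the fourth
  cumulant.\<close>

definition D4 :: "(nat \<Rightarrow> real) \<Rightarrow> (nat \<Rightarrow> real) \<Rightarrow> real" where
  "D4 x y = (let m1 = avg x y; m2 = avg x (\<lambda>j. (y j)\<^sup>2); m3 = avg x (\<lambda>j. y j ^ 3); m4 = avg x (\<lambda>j. y j ^ 4) in
     psi 4 (F x) * m1 ^ 4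
     + psi 3 (F x) * b * (6 * (m1\<^sup>2 * m2) - 6 * m1 ^ 4)
     + psi 2 (F x) * b\<^sup>2 * (4 * (m1 * m3) - 18 * (m1\<^sup>2 * m2) + 11 * m1 ^ 4 + 3 * m2\<^sup>2)
     + psi 1 (F x) * b ^ 3 * (m4 - 4 * (m1 * m3) - 3 * m2\<^sup>2 + 12 * (m1\<^sup>2 * m2) - 6 * m1 ^ 4))"

lemma DERIV_psi: "k < 4 \<Longrightarrow> (psi k has_real_derivative psi (Suc k) x) (at x)"
  unfolding psi_def[abs_def] using d_pos
  by (auto intro!: derivative_eq_intros DERIV_chain2[OF DERIV_cutoff])

lemma psi_bound: assumes "k \<le> 4" shows "\<bar>psi k x\<bar> \<le> B / d ^ k"
  unfolding psi_def using B[OF assms] d_pos by (simp add: abs_div divide_right_mono)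

text \<open>Since 1/d <= b, all but one of the factors 1/d may be replaced by \<open>b\<close>.
  Every term of \<open>D4\<close> is therefore of the common order b^3 / d.\<close>

lemma psi_bound_scaled: assumes "1 \<le> k" "k \<le> 4" shows "\<bar>psi k x\<bar> * b ^ (4 - k) \<le> B * b ^ 3 / d"
proof -
  have "(1 / d) ^ (k - 1) \<le> b ^ (k - 1)"
    using bd d_pos by (intro power_mono) (auto simp: field_simps)
  then have "(1 / d) ^ (k - 1) * b ^ (4 - k) \<le> b ^ (k - 1) * b ^ (4 - k)"
    using b_pos by (intro mult_right_mono) auto
  also have "\<dots> = b ^ 3" using assms by (simp flip: power_add)
  finally have *: "(1 / d) ^ (k - 1) * b ^ (4 - k) \<le> b ^ 3" .
  have "\<bar>psi k x\<bar> * b ^ (4 - k) \<le> B / d ^ k * b ^ (4 - k)"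
    using psi_bound[OF assms(2), of x] b_pos by (intro mult_right_mono) auto
  also have "d ^ k = d * d ^ (k - 1)" using assms by (cases k) auto
  also have "B / (d * d ^ (k - 1)) * b ^ (4 - k) = B / d * ((1 / d) ^ (k - 1) * b ^ (4 - k))"
    by (simp add: power_divide)
  also have "\<dots> \<le> B / d * b ^ 3"
    using * B_ge_1 d_pos by (intro mult_left_mono) auto
  finally show ?thesis by simp
qed

lemma DERIV_psi_F:
  assumes "k < 4" "\<And>j. j \<in> J \<Longrightarrow> ((\<lambda>s. x s j) has_real_derivative y j) (at s)"
  shows "((\<lambda>s. psi k (F (x s))) has_real_derivative psi (Suc k) (F (x s)) * avg (x s) y) (at s)"
  by (rule DERIV_chain2[OF DERIV_psi[OF assms(1)] DERIV_F[OF assms(2)]])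

lemma DERIV_u:
  assumes "\<And>j. j \<in> J \<Longrightarrow> ((\<lambda>s. x s j) has_real_derivative y j) (at s)"
  shows "((\<lambda>s. u (x s)) has_real_derivative D1 (x s) y) (at s)"
  using DERIV_psi_F[of 0 x y s] assms by (simp add: u_def D1_def)

context
  fixes w y :: "nat \<Rightarrow> real"
begin

private lemma line: "((\<lambda>s. w j + s * y j) has_real_derivative y j) (at s)"
  by (auto intro!: derivative_eq_intros)

private lemmas dF = DERIV_psi_F[where x="\<lambda>s j. w j + s * y j", OF _ line]
private lemmas dA = DERIV_avg[where x="\<lambda>s j. w j + s * y j", OF line]

lemma DERIV_D1: "((\<lambda>s. D1 (\<lambda>j. w j + s * y j) y) has_real_derivative D2 (\<lambda>j. w j + s * y j) y) (at s)"
  unfolding D1_def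
  by (auto intro!: derivative_eq_intros dF dA simp: D2_def numeral_2_eq_2 power2_eq_square algebra_simps)

lemma DERIV_D2: "((\<lambda>s. D2 (\<lambda>j. w j + s * y j) y) has_real_derivative D3 (\<lambda>j. w j + s * y j) y) (at s)"
  unfolding D2_def
  by (auto intro!: derivative_eq_intros dF dA simp: D3_def numeral_2_eq_2 numeral_3_eq_3 algebra_simps)

lemma DERIV_D3: "((\<lambda>s. D3 (\<lambda>j. w j + s * y j) y) has_real_derivative D4 (\<lambda>j. w j + s * y j) y) (at s)"
  unfolding D3_def
  apply (auto intro!: derivative_eq_intros dF dA)
  apply (simp add: D4_def Let_def eval_nat_numeral algebra_simps)
  done

end

text \<open>By Jensen and Cauchy-Schwarz the fourth moment dominates every product of moments of
  total degree four that occurs in \<open>D4\<close>.\<close>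

lemma moment_bounds:
  fixes x y
  defines "m k \<equiv> avg x (\<lambda>j. y j ^ k)"
  shows "avg x y ^ 4 \<le> m 4" "(avg x y)\<^sup>2 * m 2 \<le> m 4" "(m 2)\<^sup>2 \<le> m 4" "\<bar>avg x y * m 3\<bar> \<le> m 4" "0 \<le> m 2" "0 \<le> m 4"
proof -
  have a: "(avg x y)\<^sup>2 \<le> m 2" unfolding m_def by (rule avg_power2_le)
  show b: "(m 2)\<^sup>2 \<le> m 4"
    using avg_power2_le[of x "\<lambda>j. (y j)\<^sup>2"] by (simp add: m_def flip: power_mult)
  show p: "0 \<le> m 2" "0 \<le> m 4" unfolding m_def by (auto intro: avg_nonneg)
  have "(avg x y)\<^sup>2 * m 2 \<le> m 2 * m 2" using a p by (intro mult_right_mono)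
  then show "(avg x y)\<^sup>2 * m 2 \<le> m 4" using b by (simp add: power2_eq_square)
  have "avg x y ^ 4 = ((avg x y)\<^sup>2)\<^sup>2" by (simp flip: power_mult)
  also have "\<dots> \<le> (m 2)\<^sup>2" using a by (intro power_mono) auto
  finally show "avg x y ^ 4 \<le> m 4" using b by linarith
  have "(m 3)\<^sup>2 \<le> m 2 * m 4"
    using avg_Cauchy_Schwarz[of x y "\<lambda>j. (y j)\<^sup>2"]
    by (simp add: m_def eval_nat_numeral mult_ac)
  then have "(avg x y)\<^sup>2 * (m 3)\<^sup>2 \<le> m 2 * (m 2 * m 4)"
    using a p by (intro mult_mono) auto
  also have "\<dots> \<le> m 4 * m 4" using b p by (simp add: power2_eq_square mult_right_mono flip: mult.assoc)
  finally have "(avg x y * m 3)\<^sup>2 \<le> (m 4)\<^sup>2" by (simp add: power_mult_distrib power2_eq_square mult_ac)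
  then show "\<bar>avg x y * m 3\<bar> \<le> m 4" using p abs_le_square_iff[of "avg x y * m 3" "m 4"] by simp
qed

lemma D4_bound: "\<bar>D4 x y\<bar> \<le> 100 * (B * b ^ 3 / d) * avg x (\<lambda>j. y j ^ 4)"
proof -
  define P where "P = B * b ^ 3 / d"
  define m1 where "m1 = avg x y"
  define m2 where "m2 = avg x (\<lambda>j. (y j)\<^sup>2)"
  define m3 where "m3 = avg x (\<lambda>j. y j ^ 3)"
  define m4 where "m4 = avg x (\<lambda>j. y j ^ 4)"
  have P: "P \<ge> 0" using B_ge_1 b_pos d_pos by (simp add: P_def)
  note mb = moment_bounds[of x y, folded m1_def m2_def m3_def m4_def]
  have nn: "0 \<le> m1 ^ 4" "0 \<le> m1\<^sup>2 * m2" "0 \<le> m2\<^sup>2" using mb by auto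
  have q: "\<bar>psi 4 (F x)\<bar> \<le> P" "\<bar>psi 3 (F x) * b\<bar> \<le> P" "\<bar>psi 2 (F x) * b\<^sup>2\<bar> \<le> P" "\<bar>psi 1 (F x) * b ^ 3\<bar> \<le> P"
    using psi_bound_scaled[of 4 "F x"] psi_bound_scaled[of 3 "F x"] psi_bound_scaled[of 2 "F x"] psi_bound_scaled[of 1 "F x"] b_pos
    by (simp_all add: P_def abs_mult)
  \<comment> \<open>The constants are the sums of the absolute coefficients: 6 + 6, then 4 + 18 + 11
    + 3, then 1 + 4 + 3 + 12 + 6. Together with 1 they add up to 75, rounded to 100 below.\<close>
  have c: "\<bar>m1 ^ 4\<bar> \<le> m4" "\<bar>6 * (m1\<^sup>2 * m2) - 6 * m1 ^ 4\<bar> \<le> 12 * m4"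
    "\<bar>4 * (m1 * m3) - 18 * (m1\<^sup>2 * m2) + 11 * m1 ^ 4 + 3 * m2\<^sup>2\<bar> \<le> 36 * m4"
    "\<bar>m4 - 4 * (m1 * m3) - 3 * m2\<^sup>2 + 12 * (m1\<^sup>2 * m2) - 6 * m1 ^ 4\<bar> \<le> 26 * m4"
    using mb nn by linarith+
  have "\<bar>D4 x y\<bar> \<le> P * m4 + P * (12 * m4) + P * (36 * m4) + P * (26 * m4)"
    unfolding D4_def Let_def m1_def[symmetric] m2_def[symmetric] m3_def[symmetric] m4_def[symmetric]
    by (intro order.trans[OF abs_triangle_ineq] add_mono; simp only: abs_mult[of "psi _ _ * _"] abs_mult[of "psi _ _" "m1 ^ 4"];
        rule mult_mono; (rule q c P | simp))
  also have "\<dots> \<le> 100 * P * m4" using P mb by (simp add: algebra_simps)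
  finally show ?thesis by (simp add: P_def m4_def)
qed

text \<open>The first summand serves increments of size at most 1/b, for which the weights at
  \<open>w\<close> still describe the whole segment. The second serves large increments, where the
  average is bounded crudely by a maximum; there b^3 / d <= b^4.\<close>

definition remainder_bound :: "(nat \<Rightarrow> real) \<Rightarrow> (nat \<Rightarrow> real) \<Rightarrow> real" where
  "remainder_bound w y = 40 * B * (b ^ 3 / d * avg w (\<lambda>j. y j ^ 4)
      + b ^ 4 * (\<Sum>j\<in>J. y j ^ 4 * indicator {r. b * \<bar>r\<bar> > 1} (y j)))"

lemma Taylor_u:
  "\<bar>u (\<lambda>j. w j + y j) - u w - D1 w y - D2 w y / 2 - D3 w y / 6\<bar> \<le> remainder_bound w y"
proof -
  define line where "line s = (\<lambda>j. w j + s * y j)" for s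
  define df where "df k s = (if k = 0 then u (line s) else if k = 1 then D1 (line s) y else if k = 2 then D2 (line s) y
      else if k = 3 then D3 (line s) y else D4 (line s) y)" for k :: nat and s
  have "\<forall>m t. m < 4 \<and> 0 \<le> t \<and> t \<le> 1 \<longrightarrow> (df m has_real_derivative df (Suc m) t) (at t)"
  proof (intro allI impI)
    fix m :: nat and t :: real assume "m < 4 \<and> 0 \<le> t \<and> t \<le> 1"
    then consider "m = 0" | "m = 1" | "m = 2" | "m = 3" by linarith
    then show "(df m has_real_derivative df (Suc m) t) (at t)"
      by cases (auto simp: df_def[abs_def] line_def intro!: DERIV_u DERIV_D1 DERIV_D2 DERIV_D3 derivative_eq_intros)
  qed
  then obtain s where s: "0 < s" "s < 1"
    and eq: "u (line 1) = (\<Sum>m<4. df m 0 / fact m * 1 ^ m) + df 4 s / fact 4 * 1 ^ 4"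
    using Maclaurin[of 1 4 df "\<lambda>s. u (line s)"] by (auto simp: df_def[abs_def])
  have eq': "u (\<lambda>j. w j + y j) - u w - D1 w y - D2 w y / 2 - D3 w y / 6 = D4 (line s) y / 24"
    using eq by (simp add: df_def line_def eval_nat_numeral)
  have Bb: "B * b ^ 3 / d \<ge> 0" using B_ge_1 b_pos d_pos by simp
  \<comment> \<open>The 900 is 100 times the bound 9 for exp 2 from \<open>weight_stable\<close>,
    and 24 is the factorial in the Lagrange remainder; 24 * 40 = 960 covers both cases.\<close>
  have rb: "900 * B * A \<le> 24 * (40 * B * (A + C))" "100 * B * C \<le> 24 * (40 * B * (A + C))" if "A \<ge> 0" "C \<ge> 0" for A C
    using B_ge_1 mult_nonneg_nonneg[of B A] mult_nonneg_nonneg[of B C] that by (simp_all add: algebra_simps)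
  have r: "b ^ 3 / d * avg w (\<lambda>j. y j ^ 4) \<ge> 0"
    "b ^ 4 * (\<Sum>j\<in>J. y j ^ 4 * indicator {r. b * \<bar>r\<bar> > 1} (y j)) \<ge> 0"
    using b_pos d_pos avg_nonneg[of "\<lambda>j. y j ^ 4" w] by (auto intro!: mult_nonneg_nonneg sum_nonneg)
  have "\<bar>D4 (line s) y\<bar> \<le> 24 * remainder_bound w y"
  proof (cases "\<forall>j\<in>J. b * \<bar>y j\<bar> \<le> 1")
    \<comment> \<open>All increments are at most 1/b, so the weights at the intermediate point are
      at most exp 2 times those at \<open>w\<close>.\<close>
    case True
    have "weight (\<lambda>k. w k + s * y k) j \<le> exp 2 * weight w j" if "j \<in> J" for j
    proof (rule weight_stable[OF _ that])
      fix j assume "j \<in> J"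
      have "s * (b * \<bar>y j\<bar>) \<le> 1 * 1" using s True \<open>j \<in> J\<close> b_pos by (intro mult_mono) auto
      then show "\<bar>b * (s * y j)\<bar> \<le> 1" using s b_pos by (simp add: abs_mult mult_ac)
    qed
    then have "avg (line s) (\<lambda>j. y j ^ 4) \<le> (\<Sum>j\<in>J. (exp 2 * weight w j) * y j ^ 4)"
      unfolding avg_def line_def by (intro sum_mono mult_right_mono) auto
    also have "\<dots> = exp 2 * avg w (\<lambda>j. y j ^ 4)" by (simp add: avg_def sum_distrib_left mult_ac)
    also have "\<dots> \<le> 9 * avg w (\<lambda>j. y j ^ 4)"
    proof (rule mult_right_mono)
      have "exp (2::real) = exp 1 * exp 1" by (simp flip: exp_add)
      also have "\<dots> \<le> 3 * 3" using exp_le by (intro mult_mono) auto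
      finally show "exp (2::real) \<le> 9" by simp
    qed (rule avg_nonneg, simp)
    finally have "\<bar>D4 (line s) y\<bar> \<le> 100 * (B * b ^ 3 / d) * (9 * avg w (\<lambda>j. y j ^ 4))"
      using Bb by (intro order.trans[OF D4_bound] mult_left_mono) auto
    also have "\<dots> = 900 * B * (b ^ 3 / d * avg w (\<lambda>j. y j ^ 4))" by simp
    also have "\<dots> \<le> 24 * remainder_bound w y"
      unfolding remainder_bound_def by (intro rb r)
    finally show ?thesis .
  next
    \<comment> \<open>Some increment exceeds 1/b, hence so does the largest one. Its fourth power
      dominates the average and is itself a term of the sum with indicators.\<close>
    case False
    define M where "M = Max ((\<lambda>j. \<bar>y j\<bar>) ` J)"
    obtain i where i: "i \<in> J" "\<bar>y i\<bar> = M"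
      using Max_in[of "(\<lambda>j. \<bar>y j\<bar>) ` J"] finJ J_ne unfolding M_def by (metis finite_imageI imageE image_is_empty)
    have M: "\<bar>y j\<bar> \<le> M" if "j \<in> J" for j using that finJ by (simp add: M_def)
    have big: "b * \<bar>y i\<bar> > 1"
    proof -
      obtain j where "j \<in> J" "b * \<bar>y j\<bar> > 1" using False by auto
      then show ?thesis using M[of j] i b_pos by (smt (verit) mult_le_cancel_left_pos)
    qed
    have "avg (line s) (\<lambda>j. y j ^ 4) \<le> M ^ 4"
    proof (rule avg_le)
      fix j assume "j \<in> J"
      then have "\<bar>y j\<bar> ^ 4 \<le> M ^ 4" using M by (intro power_mono) auto
      then show "y j ^ 4 \<le> M ^ 4" by simp
    qed
    also have "M ^ 4 = y i ^ 4 * indicator {r. b * \<bar>r\<bar> > 1} (y i)" using big by (simp flip: i(2))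
    also have "\<dots> \<le> (\<Sum>j\<in>J. y j ^ 4 * indicator {r. b * \<bar>r\<bar> > 1} (y j))"
      using finJ i by (intro member_le_sum) auto
    finally have a: "avg (line s) (\<lambda>j. y j ^ 4) \<le> (\<Sum>j\<in>J. y j ^ 4 * indicator {r. b * \<bar>r\<bar> > 1} (y j))" .
    have "B * b ^ 3 / d \<le> B * b ^ 4"
    proof -
      have "B * b ^ 3 * 1 \<le> B * b ^ 3 * (b * d)" using bd B_ge_1 b_pos by (intro mult_left_mono) auto
      then show ?thesis using d_pos by (simp add: field_simps eval_nat_numeral)
    qed
    then have "\<bar>D4 (line s) y\<bar> \<le> 100 * (B * b ^ 4) * (\<Sum>j\<in>J. y j ^ 4 * indicator {r. b * \<bar>r\<bar> > 1} (y j))"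
      using a Bb by (intro order.trans[OF D4_bound] mult_mono avg_nonneg) auto
    also have "\<dots> = 100 * B * (b ^ 4 * (\<Sum>j\<in>J. y j ^ 4 * indicator {r. b * \<bar>r\<bar> > 1} (y j)))" by simp
    also have "\<dots> \<le> 24 * remainder_bound w y"
      unfolding remainder_bound_def by (intro rb r)
    finally show ?thesis .
  qed
  then show ?thesis unfolding eq' by simp
qed

end

section \<open>One-dimensional laws with bounded Stein kernels\<close>

section \<open>Stein kernels\<close>

text \<open>The identity E[x f(x)] = E[\<tau>(x) f'(x)] is demanded for C^1 functions of exponential
  growth; all exponential moments are required so that both sides are integrable. The bound 2 covers
  the two laws in use, the standard normal with kernel 1 and the skewed law below.\<close>

definition has_stein_kernel :: "real measure \<Rightarrow> (real \<Rightarrow> real) \<Rightarrow> bool" where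
  "has_stein_kernel N \<tau> \<longleftrightarrow>
     prob_space N \<and> sets N = sets borel \<and> \<tau> \<in> borel_measurable borel \<and>
     (\<forall>x. 0 \<le> \<tau> x \<and> \<tau> x \<le> 2) \<and> (\<forall>c. integrable N (\<lambda>x. exp (c * \<bar>x\<bar>))) \<and>
     (\<forall>f f' C c. (\<forall>x. (f has_real_derivative f' x) (at x)) \<longrightarrow> continuous_on UNIV f' \<longrightarrow>
        (\<forall>x. \<bar>f x\<bar> \<le> C * exp (c * \<bar>x\<bar>)) \<longrightarrow> (\<forall>x. \<bar>f' x\<bar> \<le> C * exp (c * \<bar>x\<bar>)) \<longrightarrow>
        (\<integral>x. x * f x \<partial>N) = (\<integral>x. \<tau> x * f' x \<partial>N))"

lemma integrable_exp_abs_std_normal: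
  "integrable std_normal_distribution (\<lambda>x. exp (c * \<bar>x\<bar>))"
proof -
  have *: "integrable lborel (\<lambda>x. std_normal_density x * exp (a * x))" for a :: real
  proof -
    \<comment> \<open>Completing the square: the product is a multiple of a shifted normal
      density.\<close>
    have "std_normal_density x * exp (a * x) = exp (a\<^sup>2 / 2) * normal_density a 1 x" for x
      by (simp add: normal_density_def power2_eq_square field_simps flip: exp_add)
    then show ?thesis by simp
  qed
  have "integrable lborel (\<lambda>x. std_normal_density x * exp (c * \<bar>x\<bar>))"
  proof (rule Bochner_Integration.integrable_bound[OF Bochner_Integration.integrable_add[OF *[of c] *[of "-c"]]])
    show "AE x in lborel. norm (std_normal_density x * exp (c * \<bar>x\<bar>))
        \<le> norm (std_normal_density x * exp (c * x) + std_normal_density x * exp (- c * x))"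
    proof (intro AE_I2)
      fix x :: real
      have "exp (c * \<bar>x\<bar>) \<le> exp (c * x) + exp (- c * x)" by (cases "x \<ge> 0") auto
      then have "std_normal_density x * exp (c * \<bar>x\<bar>) \<le> std_normal_density x * (exp (c * x) + exp (- c * x))"
        by (intro mult_left_mono) auto
      then show "norm (std_normal_density x * exp (c * \<bar>x\<bar>))
        \<le> norm (std_normal_density x * exp (c * x) + std_normal_density x * exp (- c * x))"
        unfolding ring_distribs(1)[symmetric] by (simp add: abs_mult)
    qed
  qed measurable
  then show ?thesis by (subst integrable_density) auto
qed

text \<open>The fundamental theorem of calculus for \<open>f\<close> times the density, which
  vanishes at both infinities because Gaussian decay beats the exponential growth of
  \<open>f\<close>.\<close>

lemma std_normal_stein: "has_stein_kernel std_normal_distribution (\<lambda>_. 1)"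
proof -
  interpret real_distribution std_normal_distribution by (rule real_dist_normal_dist)
  have "(\<integral>x. x * f x \<partial>std_normal_distribution) = (\<integral>x. 1 * f' x \<partial>std_normal_distribution)"
    if D: "\<And>x. (f has_real_derivative f' x) (at x)" and cont: "continuous_on UNIV f'"
      and f: "\<And>x. \<bar>f x\<bar> \<le> C * exp (c * \<bar>x\<bar>)" and f': "\<And>x. \<bar>f' x\<bar> \<le> C * exp (c * \<bar>x\<bar>)"
    for f f' :: "real \<Rightarrow> real" and C c
  proof -
    have C: "C \<ge> 0" using f[of 0] by simp
    have [measurable]: "f \<in> borel_measurable borel" "f' \<in> borel_measurable borel"
      using D cont by (auto intro!: borel_measurable_continuous_onI continuous_at_imp_continuous_on DERIV_isCont)
    have i1: "integrable lborel (\<lambda>x. std_normal_density x * f' x)"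
    proof -
      have "integrable std_normal_distribution f'"
        by (rule Bochner_Integration.integrable_bound[OF integrable_mult_right[OF integrable_exp_abs_std_normal[of c], of C]])
          (auto intro!: AE_I2 order.trans[OF f'])
      then show ?thesis by (subst (asm) integrable_density) auto
    qed
    have i2: "integrable lborel (\<lambda>x. std_normal_density x * (x * f x))"
    proof -
      have "\<bar>x * f x\<bar> \<le> C * exp ((c + 1) * \<bar>x\<bar>)" for x
      proof -
        have "\<bar>x\<bar> \<le> exp \<bar>x\<bar>" using exp_ge_add_one_self[of "\<bar>x\<bar>"] by linarith
        then have "\<bar>x\<bar> * \<bar>f x\<bar> \<le> exp \<bar>x\<bar> * (C * exp (c * \<bar>x\<bar>))" using f by (intro mult_mono) auto
        then show ?thesis by (simp add: abs_mult ring_distribs exp_add mult_ac)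
      qed
      then have "integrable std_normal_distribution (\<lambda>x. x * f x)"
        by (intro Bochner_Integration.integrable_bound[OF integrable_mult_right[OF integrable_exp_abs_std_normal[of "c + 1"], of C]])
          (auto intro!: AE_I2 order.trans[OF _ abs_ge_self])
      then show ?thesis by (subst (asm) integrable_density) auto
    qed
    define G where "G x = f x * std_normal_density x" for x
    define g where "g x = std_normal_density x * f' x - std_normal_density x * (x * f x)" for x
    have DG: "(G has_real_derivative g x) (at x)" for x
    proof -
      have "(std_normal_density has_real_derivative - x * std_normal_density x) (at x)"
      proof -
        have "((\<lambda>x. K * exp (- x\<^sup>2 / 2)) has_real_derivative - x * (K * exp (- x\<^sup>2 / 2))) (at x)" for K
          by (auto intro!: derivative_eq_intros)
        then show ?thesis unfolding std_normal_density_def[abs_def] .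
      qed
      then show ?thesis
        unfolding G_def g_def by (auto intro!: derivative_eq_intros D simp: algebra_simps)
    qed
    have contg: "isCont g x" for x
      unfolding g_def std_normal_density_def using cont D
      by (intro continuous_intros) (auto intro!: DERIV_isCont simp: continuous_on_eq_continuous_at)
    \<comment> \<open>The exponent is bounded by expanding the square of |x| - (c + 1), which leaves
      the integrable decay exp(-|x|).\<close>
    have Gb: "\<bar>G x\<bar> \<le> C * exp ((c + 1)\<^sup>2 / 2) * exp (- \<bar>x\<bar>)" for x
    proof -
      have "\<bar>G x\<bar> \<le> C * exp (c * \<bar>x\<bar>) * (1 * exp (- x\<^sup>2 / 2))"
        unfolding G_def abs_mult std_normal_density_def using f C pi_gt3
        by (intro mult_mono) (auto simp: real_le_rsqrt)
      also have "\<dots> = C * exp (c * \<bar>x\<bar> - x\<^sup>2 / 2)" by (simp add: mult_exp_exp mult.assoc)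
      also have "\<dots> \<le> C * exp ((c + 1)\<^sup>2 / 2 - \<bar>x\<bar>)"
      proof -
        have "0 \<le> (\<bar>x\<bar> - (c + 1))\<^sup>2" by simp
        then have "c * \<bar>x\<bar> - x\<^sup>2 / 2 \<le> (c + 1)\<^sup>2 / 2 - \<bar>x\<bar>"
          by (simp add: power2_eq_square algebra_simps)
        then show ?thesis using C by (intro mult_left_mono) auto
      qed
      finally show ?thesis by (simp add: mult_exp_exp mult.assoc)
    qed
    have lim: "(G \<longlongrightarrow> 0) at_top" "(G \<longlongrightarrow> 0) at_bot"
    proof -
      have e: "((\<lambda>x. C * exp ((c + 1)\<^sup>2 / 2) * exp (- \<bar>x\<bar>)) \<longlongrightarrow> 0) F" if "filterlim abs at_top F" for F :: "real filter"
      proof -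
        have "((\<lambda>x. exp (- \<bar>x\<bar>)) \<longlongrightarrow> (0::real)) F"
          using that by (intro filterlim_compose[OF exp_at_bot] filterlim_uminus_at_bot[THEN iffD2]) simp
        then show ?thesis by (auto intro: tendsto_mult_right_zero)
      qed
      have Ge: "eventually (\<lambda>x. norm (G x) \<le> C * exp ((c + 1)\<^sup>2 / 2) * exp (- \<bar>x\<bar>)) F" for F
        using Gb by (intro always_eventually) auto
      have "filterlim (abs :: real \<Rightarrow> real) at_top at_bot"
      proof (rule filterlim_cong[OF refl refl, THEN iffD1, OF _ filterlim_uminus_at_top_at_bot])
        show "eventually (\<lambda>x::real. - x = \<bar>x\<bar>) at_bot"
          using eventually_le_at_bot[of "0::real"] by eventually_elim simp
      qed
      then show "(G \<longlongrightarrow> 0) at_bot" by (rule Lim_null_comparison[OF Ge e])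
      show "(G \<longlongrightarrow> 0) at_top" by (rule Lim_null_comparison[OF Ge e[OF filterlim_abs_real]])
    qed
    have "(LBINT x=-\<infinity>..\<infinity>. g x) = 0 - 0"
    proof (rule interval_integral_FTC_integrable[where F=G])
      have "integrable lborel g" unfolding g_def[abs_def] using i1 i2 by simp
      then show "set_integrable lborel (einterval (-\<infinity>) \<infinity>) g" by (simp add: set_integrable_def)
    qed (use DG contg lim in \<open>auto simp: ereal_tendsto_simps has_real_derivative_iff_has_vector_derivative\<close>)
    then have "(\<integral>x. std_normal_density x * f' x - std_normal_density x * (x * f x) \<partial>lborel) = 0"
      by (simp add: interval_lebesgue_integral_def set_lebesgue_integral_def g_def)
    then show ?thesis
      using i1 i2 by (simp add: integral_density)
  qed
  then show ?thesis
    unfolding has_stein_kernel_def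
    using prob_space_axioms integrable_exp_abs_std_normal by auto
qed

section \<open>A bounded law with first three moments 0, 1, 1\<close>

text \<open>The law of $4 \sin^2 \theta - 1$ for $\theta$ with density $(4/\pi) \cos^2\theta$ on
  $[0, \pi/2]$, i.e. an affine image of the Beta$(1/2, 3/2)$ distribution. Its second and third moments
  are both equal to 1 and it is bounded.\<close>
definition skew_law :: "real measure" where
  "skew_law = distr (density lborel (\<lambda>\<theta>. ennreal (indicator {0..pi/2} \<theta> * (4 / pi * (cos \<theta>)\<^sup>2)))) borel
     (\<lambda>\<theta>. 4 * (sin \<theta>)\<^sup>2 - 1)"

lemma sets_skew_law [measurable_cong, simp]: "sets skew_law = sets borel"
  by (simp add: skew_law_def)

lemma space_skew_law [simp]: "space skew_law = UNIV"
  by (simp add: skew_law_def)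

lemma skew_law_integral:
  fixes h :: "real \<Rightarrow> real"
  assumes [measurable]: "h \<in> borel_measurable borel"
  shows "(\<integral>x. h x \<partial>skew_law)
    = (\<integral>\<theta>. indicator {0..pi/2} \<theta> *\<^sub>R (4 / pi * (cos \<theta>)\<^sup>2 * h (4 * (sin \<theta>)\<^sup>2 - 1)) \<partial>lborel)"
  unfolding skew_law_def
  by (subst integral_distr) (auto simp: integral_density mult_ac)

lemma prob_space_skew_law: "prob_space skew_law"
proof -
  have F: "integral\<^sup>L lborel (\<lambda>\<theta>. indicator {0..pi/2} \<theta> *\<^sub>R (4 / pi * (cos \<theta>)\<^sup>2))
    = 2 / pi * (pi / 2 + sin (pi / 2) * cos (pi / 2)) - 2 / pi * (0 + sin 0 * cos 0)"
  proof (rule integral_FTC_atLeastAtMost)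
    fix x :: real
    have "cos x * cos x - sin x * sin x = 2 * (cos x * cos x) - 1"
      using sin_cos_squared_add3[of x] by linarith
    then have "2 / pi * (1 + (cos x * cos x - sin x * sin x)) = 4 / pi * (cos x)\<^sup>2"
      by (simp add: power2_eq_square)
    moreover have "((\<lambda>x. 2 / pi * (x + sin x * cos x)) has_real_derivative
        2 / pi * (1 + (cos x * cos x - sin x * sin x))) (at x)"
      by (auto intro!: derivative_eq_intros)
    ultimately have "((\<lambda>x. 2 / pi * (x + sin x * cos x)) has_real_derivative 4 / pi * (cos x)\<^sup>2) (at x)"
      by simp
    then show "((\<lambda>x. 2 / pi * (x + sin x * cos x)) has_vector_derivative 4 / pi * (cos x)\<^sup>2) (at x within {0..pi/2})"
      unfolding has_real_derivative_iff_has_vector_derivative by (rule has_vector_derivative_at_within)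
  qed (auto intro!: continuous_intros)
  have i: "integrable lborel (\<lambda>\<theta>. indicator {0..pi/2} \<theta> *\<^sub>R (4 / pi * (cos \<theta>)\<^sup>2))"
    by (rule borel_integrable_atLeastAtMost'[unfolded set_integrable_def]) (intro continuous_intros)
  have "emeasure (density lborel (\<lambda>\<theta>. ennreal (indicator {0..pi/2} \<theta> * (4 / pi * (cos \<theta>)\<^sup>2)))) UNIV
     = (\<integral>\<^sup>+\<theta>. ennreal (indicator {0..pi/2} \<theta> *\<^sub>R (4 / pi * (cos \<theta>)\<^sup>2)) \<partial>lborel)"
    by (subst emeasure_density) (auto intro!: nn_integral_cong)
  also have "\<dots> = 1"
    using F by (subst nn_integral_eq_integral[OF i]) auto
  finally have "prob_space (density lborel (\<lambda>\<theta>. ennreal (indicator {0..pi/2} \<theta> * (4 / pi * (cos \<theta>)\<^sup>2))))"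
    by (intro prob_spaceI) simp
  then show ?thesis
    unfolding skew_law_def by (rule prob_space.prob_space_distr) simp
qed

lemma skew_law_bounded: "AE x in skew_law. \<bar>x\<bar> \<le> 3"
proof -
  have "\<bar>4 * (sin \<theta>)\<^sup>2 - 1\<bar> \<le> 3" for \<theta> :: real
  proof -
    have "(sin \<theta>)\<^sup>2 \<le> 1" by (simp add: abs_square_le_1)
    then show ?thesis using zero_le_power2[of "sin \<theta>"] by linarith
  qed
  then show ?thesis unfolding skew_law_def by (subst AE_distr_iff) auto
qed

lemma integrable_skew_law:
  fixes h :: "real \<Rightarrow> real"
  assumes [measurable]: "h \<in> borel_measurable borel" and "\<And>x. \<bar>x\<bar> \<le> 3 \<Longrightarrow> \<bar>h x\<bar> \<le> C"
  shows "integrable skew_law h"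
proof -
  interpret prob_space skew_law by (rule prob_space_skew_law)
  show ?thesis
    by (rule integrable_const_bound[where B=C]) (use skew_law_bounded assms in auto)
qed

text \<open>On the support [-1, 3] the kernel is (1 + x)(3 - x)/2, with maximum 2 at x = 1. The
  truncation at 0 makes it nonnegative on the whole line, as \<open>has_stein_kernel\<close>
  asks.\<close>

definition skew_kernel :: "real \<Rightarrow> real" where
  "skew_kernel x = max 0 ((1 + x) * (3 - x) / 2)"

text \<open>In the angular variable the kernel becomes 8 sin^2 cos^2, and the difference of the two
  integrands has an explicit antiderivative. The angle also removes the singularity of the Beta
  density at -1.\<close>

lemma skew_law_stein: "has_stein_kernel skew_law skew_kernel"
proof -
  interpret prob_space skew_law by (rule prob_space_skew_law)
  have [measurable]: "skew_kernel \<in> borel_measurable borel"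
    unfolding skew_kernel_def[abs_def] by measurable
  have k: "0 \<le> skew_kernel x \<and> skew_kernel x \<le> 2" for x
  proof -
    have "0 \<le> (x - 1)\<^sup>2" by simp
    then show ?thesis by (simp add: skew_kernel_def power2_eq_square algebra_simps)
  qed
  have e: "integrable skew_law (\<lambda>x. exp (c * \<bar>x\<bar>))" for c
    by (rule integrable_skew_law[where C="exp (\<bar>c\<bar> * 3)"]) (auto intro!: order.trans[OF abs_ge_self[of "c * _"]] simp: abs_mult mult_left_mono)
  have "(\<integral>x. x * f x \<partial>skew_law) = (\<integral>x. skew_kernel x * f' x \<partial>skew_law)"
    if D: "\<And>x. (f has_real_derivative f' x) (at x)" and cont: "continuous_on UNIV f'"
    for f f' :: "real \<Rightarrow> real"
  proof -
    have cf: "continuous_on UNIV f"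
      using D by (auto intro!: continuous_at_imp_continuous_on DERIV_isCont)
    have [measurable]: "f \<in> borel_measurable borel" "f' \<in> borel_measurable borel"
      using cf cont by (auto intro!: borel_measurable_continuous_onI)
    let ?e = "\<lambda>\<theta>::real. 4 * (sin \<theta>)\<^sup>2 - 1"
    have cc: "continuous_on A (\<lambda>\<theta>. f (?e \<theta>))" "continuous_on A (\<lambda>\<theta>. f' (?e \<theta>))" for A
      by (rule continuous_on_compose2[OF cf] continuous_on_compose2[OF cont], intro continuous_intros, simp)+
    let ?g1 = "\<lambda>\<theta>. 4 / pi * (cos \<theta>)\<^sup>2 * (?e \<theta> * f (?e \<theta>))"
    let ?g2 = "\<lambda>\<theta>. 4 / pi * (cos \<theta>)\<^sup>2 * (skew_kernel (?e \<theta>) * f' (?e \<theta>))"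
    have ck: "continuous_on A (\<lambda>\<theta>. skew_kernel (?e \<theta>))" for A
      unfolding skew_kernel_def by (intro continuous_intros) auto
    have i: "integrable lborel (\<lambda>\<theta>. indicator {0..pi/2} \<theta> *\<^sub>R ?g1 \<theta>)" "integrable lborel (\<lambda>\<theta>. indicator {0..pi/2} \<theta> *\<^sub>R ?g2 \<theta>)"
      by (rule borel_integrable_atLeastAtMost'[unfolded set_integrable_def], intro continuous_intros cc ck)+
    \<comment> \<open>It vanishes at 0 through the sine and at pi/2 through the cosine.\<close>
    define G where "G \<theta> = 4 / pi * (sin \<theta> * cos \<theta> ^ 3) * f (?e \<theta>)" for \<theta>
    have "integral\<^sup>L lborel (\<lambda>\<theta>. indicator {0..pi/2} \<theta> *\<^sub>R (?g2 \<theta> - ?g1 \<theta>)) = G (pi / 2) - G 0"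
    proof (rule integral_FTC_atLeastAtMost)
      fix x :: real
      define s where "s = sin x"
      define c where "c = cos x"
      have sc: "s\<^sup>2 = 1 - c\<^sup>2" unfolding s_def c_def by (rule sin_squared_eq)
      have kx: "skew_kernel (?e x) = 8 * s\<^sup>2 * c\<^sup>2"
      proof -
        have "(1 + ?e x) * (3 - ?e x) / 2 = 8 * s\<^sup>2 * c\<^sup>2"
        proof -
          have c2: "c\<^sup>2 = 1 - s\<^sup>2" using sc by simp
          show ?thesis unfolding c2 s_def[symmetric] by (simp add: power2_eq_square field_simps)
        qed
        then show ?thesis by (simp add: skew_kernel_def)
      qed
      have 1: "(G has_real_derivative
          4 / pi * (cos x * cos x ^ 3 + sin x * (3 * (cos x)\<^sup>2 * (- sin x))) * f (?e x)
          + 4 / pi * (sin x * cos x ^ 3) * (f' (?e x) * (8 * sin x * cos x))) (at x)"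
      proof -
        have "((\<lambda>\<theta>. K * (sin \<theta> * cos \<theta> ^ 3) * f (?e \<theta>)) has_real_derivative
          K * (cos x * cos x ^ 3 + sin x * (3 * (cos x)\<^sup>2 * (- sin x))) * f (?e x)
          + K * (sin x * cos x ^ 3) * (f' (?e x) * (8 * sin x * cos x))) (at x)" for K
          by (auto intro!: derivative_eq_intros DERIV_chain2[OF D] simp: algebra_simps)
        then show ?thesis unfolding G_def[abs_def] .
      qed
      have 2: "cos x * cos x ^ 3 + sin x * (3 * (cos x)\<^sup>2 * (- sin x)) = - (c\<^sup>2 * (4 * s\<^sup>2 - 1))"
      proof -
        have "c * c ^ 3 + s * (3 * c\<^sup>2 * (- s)) = c\<^sup>2 * (c\<^sup>2 - 3 * s\<^sup>2)"
          by (simp add: power2_eq_square eval_nat_numeral algebra_simps)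
        also have "c\<^sup>2 - 3 * s\<^sup>2 = - (4 * s\<^sup>2 - 1)" using sc by simp
        finally show ?thesis by (simp only: s_def c_def mult_minus_right)
      qed
      have 3: "4 / pi * (sin x * cos x ^ 3) * (f' (?e x) * (8 * sin x * cos x)) = ?g2 x"
        unfolding kx by (simp add: s_def c_def power2_eq_square eval_nat_numeral)
      have "(G has_real_derivative (?g2 x - ?g1 x)) (at x)"
        using 1 unfolding 2 3 by (simp add: s_def c_def algebra_simps)
      then show "(G has_vector_derivative (?g2 x - ?g1 x)) (at x within {0..pi/2})"
        unfolding has_real_derivative_iff_has_vector_derivative by (rule has_vector_derivative_at_within)
    qed (auto intro!: continuous_intros cc ck)
    then have "integral\<^sup>L lborel (\<lambda>\<theta>. indicator {0..pi/2} \<theta> *\<^sub>R ?g2 \<theta> - indicator {0..pi/2} \<theta> *\<^sub>R ?g1 \<theta>) = 0"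
      by (simp add: G_def algebra_simps)
    then have "integral\<^sup>L lborel (\<lambda>\<theta>. indicator {0..pi/2} \<theta> *\<^sub>R ?g2 \<theta>) = integral\<^sup>L lborel (\<lambda>\<theta>. indicator {0..pi/2} \<theta> *\<^sub>R ?g1 \<theta>)"
      using i by simp
    then show ?thesis by (subst (1 2) skew_law_integral) auto
  qed
  then show ?thesis
    unfolding has_stein_kernel_def using prob_space_axioms k e by auto
qed

text \<open>Everything follows from the Stein identity. As the kernel is quadratic, f = 1, x, x^2
  give 0 for the mean and the linear equations m2 = (3 - m2)/2 and m3 = 2 m2 - m3.\<close>

lemma skew_law_moments:
  "(\<integral>x. x \<partial>skew_law) = 0" "(\<integral>x. x\<^sup>2 \<partial>skew_law) = 1" "(\<integral>x. x ^ 3 \<partial>skew_law) = 1"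
  "(\<integral>x. skew_kernel x \<partial>skew_law) = 1"
proof -
  interpret prob_space skew_law by (rule prob_space_skew_law)
  have S: "(\<integral>x. x * f x \<partial>skew_law) = (\<integral>x. skew_kernel x * f' x \<partial>skew_law)"
    if "\<And>x. (f has_real_derivative f' x) (at x)" "continuous_on UNIV f'"
      "\<And>x. \<bar>f x\<bar> \<le> C * exp (c * \<bar>x\<bar>)" "\<And>x. \<bar>f' x\<bar> \<le> C * exp (c * \<bar>x\<bar>)" for f f' C c
    using skew_law_stein that unfolding has_stein_kernel_def by blast
  have e1: "\<bar>x\<bar> \<le> 2 * exp \<bar>x\<bar>" "1 \<le> 2 * exp \<bar>x\<bar>" "x\<^sup>2 \<le> 2 * exp \<bar>x\<bar>" for x :: real
    using exp_lower_Taylor_quadratic[of "\<bar>x\<bar>", OF abs_ge_zero] zero_le_power2[of x] abs_ge_zero[of x]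
    unfolding power2_abs by linarith+
  have i [simp]: "integrable skew_law (\<lambda>x. x ^ k)" for k
  proof (rule integrable_skew_law[where C="3 ^ k"])
    show "\<bar>x ^ k\<bar> \<le> 3 ^ k" if "\<bar>x\<bar> \<le> 3" for x :: real
      using that by (simp add: power_abs power_mono)
  qed simp
  note i' [simp] = i[of 1, simplified]
  have [measurable]: "skew_kernel \<in> borel_measurable borel"
    unfolding skew_kernel_def[abs_def] by measurable
  \<comment> \<open>The law lives on [-1, 3], so the truncation at 0 in \<open>skew_kernel\<close>
    is almost surely inactive.\<close>
  have kernel: "AE x in skew_law. skew_kernel x = (3 + 2 * x - x\<^sup>2) / 2"
  proof -
    have id: "(1 + x) * (3 - x) / 2 = (3 + 2 * x - x\<^sup>2) / 2" for x :: real
      by (simp add: power2_eq_square algebra_simps)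
    have e: "(3 + 2 * (4 * (sin \<theta>)\<^sup>2 - 1) - (4 * (sin \<theta>)\<^sup>2 - 1)\<^sup>2) / 2 = 8 * ((sin \<theta>)\<^sup>2 * (cos \<theta>)\<^sup>2)" for \<theta> :: real
      unfolding cos_squared_eq by (simp add: power2_eq_square field_simps)
    have "skew_kernel (4 * (sin \<theta>)\<^sup>2 - 1) = (3 + 2 * (4 * (sin \<theta>)\<^sup>2 - 1) - (4 * (sin \<theta>)\<^sup>2 - 1)\<^sup>2) / 2" for \<theta> :: real
      unfolding skew_kernel_def id e by simp
    then show ?thesis unfolding skew_law_def by (subst AE_distr_iff) simp_all
  qed
  show m1: "(\<integral>x. x \<partial>skew_law) = 0"
    using S[of "\<lambda>_. 1" "\<lambda>_. 0" 1 1] by auto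
  have k1: "(\<integral>x. skew_kernel x \<partial>skew_law) = (\<integral>x. (3 + 2 * x - x\<^sup>2) / 2 \<partial>skew_law)"
    by (rule integral_cong_AE) (use kernel in auto)
  have k2: "(\<integral>x. skew_kernel x * (2 * x) \<partial>skew_law) = (\<integral>x. 3 * x + 2 * x\<^sup>2 - x ^ 3 \<partial>skew_law)"
  proof (rule integral_cong_AE)
    show "AE x in skew_law. skew_kernel x * (2 * x) = 3 * x + 2 * x\<^sup>2 - x ^ 3"
      using kernel
    proof eventually_elim
      case (elim x)
      show ?case unfolding elim by (simp add: power2_eq_square eval_nat_numeral field_simps)
    qed
  qed measurable
  have k1': "(\<integral>x. skew_kernel x \<partial>skew_law) = (3 - (\<integral>x. x\<^sup>2 \<partial>skew_law)) / 2"
    unfolding k1 using m1 prob_space by simp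
  moreover have "(\<integral>x. x\<^sup>2 \<partial>skew_law) = (\<integral>x. skew_kernel x \<partial>skew_law)"
    using S[of "\<lambda>x. x" "\<lambda>_. 1" 2 1] e1 by (auto simp: power2_eq_square)
  ultimately show m2: "(\<integral>x. x\<^sup>2 \<partial>skew_law) = 1" by simp
  then show "(\<integral>x. skew_kernel x \<partial>skew_law) = 1" using k1' by simp
  have "(\<integral>x. x * x\<^sup>2 \<partial>skew_law) = (\<integral>x. skew_kernel x * (2 * x) \<partial>skew_law)"
  proof (rule S[of "\<lambda>x. x\<^sup>2" "\<lambda>x. 2 * x" 4 1])
    show "\<bar>x\<^sup>2\<bar> \<le> 4 * exp (1 * \<bar>x\<bar>)" "\<bar>2 * x\<bar> \<le> 4 * exp (1 * \<bar>x\<bar>)" for x :: real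
      using e1(1,3)[of x] exp_ge_zero[of "\<bar>x\<bar>"] by simp_all
  qed (auto intro!: derivative_eq_intros continuous_intros)
  then have "(\<integral>x. x ^ 3 \<partial>skew_law) = (\<integral>x. skew_kernel x * (2 * x) \<partial>skew_law)"
    by (simp add: power3_eq_cube power2_eq_square mult.assoc)
  also have "\<dots> = 2 - (\<integral>x. x ^ 3 \<partial>skew_law)"
    unfolding k2 using m1 m2 by simp
  finally show "(\<integral>x. x ^ 3 \<partial>skew_law) = 1" by simp
qed

section \<open>Stein's identity for independent coordinates and derivatives along paths\<close>

section \<open>Integration by parts and interpolation on product spaces\<close>

text \<open>Dominated convergence of the difference quotients along sequences; the mean value
  inequality turns the bound on \<open>f'\<close> into a bound on the quotients.\<close>

lemma DERIV_integral_dominated: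
  fixes f f' :: "real \<Rightarrow> 'a \<Rightarrow> real"
  assumes int: "\<And>s. integrable M (f s)" and [measurable]: "f' s \<in> borel_measurable M"
    and D: "\<And>s x. x \<in> space M \<Longrightarrow> ((\<lambda>s. f s x) has_real_derivative f' s x) (at s)"
    and bound: "\<And>s x. x \<in> space M \<Longrightarrow> \<bar>f' s x\<bar> \<le> B x" and B: "integrable M B"
  shows "((\<lambda>s. \<integral>x. f s x \<partial>M) has_real_derivative (\<integral>x. f' s x \<partial>M)) (at s)"
  unfolding DERIV_def tendsto_at_iff_sequentially comp_def
proof (intro allI impI)
  fix h :: "nat \<Rightarrow> real" assume h: "\<forall>i. h i \<in> UNIV - {0}" "h \<longlonglongrightarrow> 0"
  have [measurable]: "f s \<in> borel_measurable M" for s using int[of s] by simp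
  have "(\<lambda>i. \<integral>x. (f (s + h i) x - f s x) / h i \<partial>M) \<longlonglongrightarrow> (\<integral>x. f' s x \<partial>M)"
  proof (rule integral_dominated_convergence[OF _ _ B])
    show "AE x in M. (\<lambda>i. (f (s + h i) x - f s x) / h i) \<longlonglongrightarrow> f' s x"
    proof (rule AE_I2)
      fix x assume x: "x \<in> space M"
      show "(\<lambda>i. (f (s + h i) x - f s x) / h i) \<longlonglongrightarrow> f' s x"
        using D[OF x, of s] h unfolding DERIV_def tendsto_at_iff_sequentially comp_def by auto
    qed
    show "AE x in M. norm ((f (s + h i) x - f s x) / h i) \<le> B x" for i
    proof (rule AE_I2)
      fix x assume x: "x \<in> space M"
      have hi: "h i \<noteq> 0" using h by auto
      have "norm (f (s + h i) x - f s x) \<le> B x * norm (s + h i - s)"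
        by (rule field_differentiable_bound[where S=UNIV and f'="\<lambda>s. f' s x"])
           (use D[OF x] bound[OF x] in auto)
      then show "norm ((f (s + h i) x - f s x) / h i) \<le> B x"
        using hi by (simp add: field_simps)
    qed
  qed measurable
  then show "(\<lambda>i. ((\<integral>x. f (s + h i) x \<partial>M) - (\<integral>x. f s x \<partial>M)) / h i) \<longlonglongrightarrow> (\<integral>x. f' s x \<partial>M)"
    using int by simp
qed

lemma stein_identity:
  assumes "has_stein_kernel N \<tau>" "\<And>x. (f has_real_derivative f' x) (at x)" "continuous_on UNIV f'"
    "\<And>x. \<bar>f x\<bar> \<le> C * exp (c * \<bar>x\<bar>)" "\<And>x. \<bar>f' x\<bar> \<le> C * exp (c * \<bar>x\<bar>)"
  shows "(\<integral>x. x * f x \<partial>N) = (\<integral>x. \<tau> x * f' x \<partial>N)"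
  by (rule assms(1)[unfolded has_stein_kernel_def, THEN conjunct2, THEN conjunct2, THEN conjunct2, THEN conjunct2,
      THEN conjunct2, rule_format, of f f' C c]) (use assms in auto)

locale stein_product =
  fixes I :: "nat set" and N :: "nat \<Rightarrow> real measure" and \<tau> :: "nat \<Rightarrow> real \<Rightarrow> real"
  assumes finI: "finite I" and stein: "\<And>m. has_stein_kernel (N m) (\<tau> m)"
begin

lemma prob_N: "prob_space (N m)" and sets_N [measurable_cong, simp]: "sets (N m) = sets borel"
  and \<tau>_measurable [measurable]: "\<tau> m \<in> borel_measurable borel"
  and \<tau>_bounds: "0 \<le> \<tau> m x" "\<tau> m x \<le> 2" and exp_N: "integrable (N m) (\<lambda>x. exp (c * \<bar>x\<bar>))"
  using stein[of m] unfolding has_stein_kernel_def by auto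

lemma space_N [simp]: "space (N m) = UNIV"
  using sets_eq_imp_space_eq[OF sets_N[of m]] by simp

sublocale product_prob_space N I
  by (rule product_prob_spaceI) (rule prob_N)

sublocale P: prob_space "PiM I N"
  by (rule prob_space_PiM) (rule prob_N)

text \<open>The common dominating function. It is integrable because every factor has all
  exponential moments, and multiplication by a coordinate only raises \<open>c\<close> by 1.\<close>

definition growth :: "real \<Rightarrow> (nat \<Rightarrow> real) \<Rightarrow> real" where
  "growth c \<xi> = exp (c * (\<Sum>m\<in>I. \<bar>\<xi> m\<bar>))"

lemma integrable_growth: "integrable (PiM I N) (\<lambda>\<xi>. C * growth c \<xi>)"
proof -
  have "integrable (PiM I N) (\<lambda>\<xi>. \<Prod>m\<in>I. exp (c * \<bar>\<xi> m\<bar>))"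
    by (intro product_integrable_prod finI exp_N)
  then show ?thesis by (simp add: growth_def sum_distrib_left exp_sum finI)
qed

lemma integrable_of_growth:
  assumes "f \<in> borel_measurable (PiM I N)" "\<And>\<xi>. \<bar>f \<xi>\<bar> \<le> C * growth c \<xi>"
  shows "integrable (PiM I N) f"
  by (rule Bochner_Integration.integrable_bound[OF integrable_growth[of C c] assms(1)])
     (auto intro!: AE_I2 order.trans[OF assms(2)])

lemma coordinate_growth:
  assumes "m \<in> I" "\<bar>y\<bar> \<le> C * growth c \<xi>" shows "\<bar>\<xi> m * y\<bar> \<le> C * growth (c + 1) \<xi>"
proof -
  have "\<bar>\<xi> m\<bar> \<le> (\<Sum>m\<in>I. \<bar>\<xi> m\<bar>)" using assms finI by (intro member_le_sum) auto
  also have "\<dots> \<le> exp (\<Sum>m\<in>I. \<bar>\<xi> m\<bar>)"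
    using exp_ge_add_one_self[of "\<Sum>m\<in>I. \<bar>\<xi> m\<bar>"] by linarith
  finally have "\<bar>\<xi> m\<bar> * \<bar>y\<bar> \<le> exp (\<Sum>m\<in>I. \<bar>\<xi> m\<bar>) * (C * growth c \<xi>)"
    using assms by (intro mult_mono) auto
  then show ?thesis by (simp add: abs_mult growth_def ring_distribs exp_add mult_ac)
qed

lemma growth_scale:
  assumes "\<And>m. \<bar>a m\<bar> \<le> 1" "c \<ge> 0" "C \<ge> 0" shows "C * growth c (\<lambda>m. a m * \<xi> m) \<le> C * growth c \<xi>"
proof -
  have "\<bar>a m * \<xi> m\<bar> \<le> \<bar>\<xi> m\<bar>" for m
    using mult_right_mono[OF assms(1)[of m], of "\<bar>\<xi> m\<bar>"] by (simp add: abs_mult)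
  then show ?thesis using assms unfolding growth_def
    by (intro mult_left_mono) (auto intro!: mult_left_mono sum_mono)
qed

text \<open>Fubini isolates coordinate \<open>m\<close>. On each section \<open>growth\<close> is a
  constant times exp(c |x|), so the one-dimensional identity applies.\<close>

lemma integration_by_parts:
  assumes m: "m \<in> I" and [measurable]: "f \<in> borel_measurable (PiM I N)" "f' \<in> borel_measurable (PiM I N)"
    and D: "\<And>\<xi> x. ((\<lambda>x. f (\<xi>(m := x))) has_real_derivative f' (\<xi>(m := x))) (at x)"
    and cont: "\<And>\<xi>. continuous_on UNIV (\<lambda>x. f' (\<xi>(m := x)))"
    and f: "\<And>\<xi>. \<bar>f \<xi>\<bar> \<le> C * growth c \<xi>" and f': "\<And>\<xi>. \<bar>f' \<xi>\<bar> \<le> C * growth c \<xi>"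
  shows "(\<integral>\<xi>. \<xi> m * f \<xi> \<partial>PiM I N) = (\<integral>\<xi>. \<tau> m (\<xi> m) * f' \<xi> \<partial>PiM I N)"
proof -
  have I: "insert m (I - {m}) = I" using m by auto
  have [measurable]: "(\<lambda>\<xi>. \<xi> m) \<in> borel_measurable (PiM I N)"
    using m measurable_component_singleton[of m I N] by simp
  have i1: "integrable (PiM I N) (\<lambda>\<xi>. \<xi> m * f \<xi>)"
    by (rule integrable_of_growth[where C=C and c="c+1"]) (auto intro!: coordinate_growth m f)
  have i2: "integrable (PiM I N) (\<lambda>\<xi>. \<tau> m (\<xi> m) * f' \<xi>)"
  proof (rule integrable_of_growth[where C="2*C" and c=c])
    show "\<bar>\<tau> m (\<xi> m) * f' \<xi>\<bar> \<le> 2 * C * growth c \<xi>" for \<xi>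
    proof -
      have "\<bar>\<tau> m (\<xi> m)\<bar> * \<bar>f' \<xi>\<bar> \<le> 2 * (C * growth c \<xi>)"
        using \<tau>_bounds[of m "\<xi> m"] f' by (intro mult_mono) auto
      then show ?thesis by (simp add: abs_mult)
    qed
  qed measurable
  have g: "growth c (\<xi>(m := x)) = exp (c * (\<Sum>m\<in>I - {m}. \<bar>\<xi> m\<bar>)) * exp (c * \<bar>x\<bar>)" for \<xi> x
  proof -
    have "(\<Sum>k\<in>I. \<bar>(\<xi>(m := x)) k\<bar>) = \<bar>x\<bar> + (\<Sum>k\<in>I - {m}. \<bar>(\<xi>(m := x)) k\<bar>)"
      using finI m by (simp add: sum.remove)
    also have "(\<Sum>k\<in>I - {m}. \<bar>(\<xi>(m := x)) k\<bar>) = (\<Sum>k\<in>I - {m}. \<bar>\<xi> k\<bar>)"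
      by (intro sum.cong) auto
    finally show ?thesis by (simp add: growth_def ring_distribs flip: exp_add)
  qed
  have inner: "(\<integral>x. x * f (\<xi>(m := x)) \<partial>N m) = (\<integral>x. \<tau> m x * f' (\<xi>(m := x)) \<partial>N m)" for \<xi>
  proof -
    have "\<And>x. \<bar>f (\<xi>(m := x))\<bar> \<le> (C * exp (c * (\<Sum>m\<in>I - {m}. \<bar>\<xi> m\<bar>))) * exp (c * \<bar>x\<bar>)"
      "\<And>x. \<bar>f' (\<xi>(m := x))\<bar> \<le> (C * exp (c * (\<Sum>m\<in>I - {m}. \<bar>\<xi> m\<bar>))) * exp (c * \<bar>x\<bar>)"
      using f[of "\<xi>(m := _)"] f'[of "\<xi>(m := _)"] unfolding g by (simp_all add: mult.assoc)
    then show ?thesis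
      by (intro stein_identity[OF stein D cont])
  qed
  have "(\<integral>\<xi>. \<xi> m * f \<xi> \<partial>PiM I N) = (\<integral>\<xi>. (\<integral>x. x * f (\<xi>(m := x)) \<partial>N m) \<partial>PiM (I - {m}) N)"
    using product_integral_insert[of "I - {m}" m "\<lambda>\<xi>. \<xi> m * f \<xi>"] i1 finI unfolding I by simp
  also have "\<dots> = (\<integral>\<xi>. (\<integral>x. \<tau> m x * f' (\<xi>(m := x)) \<partial>N m) \<partial>PiM (I - {m}) N)"
    unfolding inner ..
  also have "\<dots> = (\<integral>\<xi>. \<tau> m (\<xi> m) * f' \<xi> \<partial>PiM I N)"
    using product_integral_insert[of "I - {m}" m "\<lambda>\<xi>. \<tau> m (\<xi> m) * f' \<xi>"] i2 finI unfolding I by simp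
  finally show ?thesis .
qed

text \<open>The chain rule produces the terms c' \<xi>_m H1_m. Integration by parts in \<xi>_m
  replaces the factor \<xi>_m by \<tau>_m and \<open>H1\<close> by c H2, which removes the unbounded
  factor. The coefficients bounded by 1 are sines and cosines in both applications.\<close>

lemma path_derivative:
  fixes c c' :: "nat \<Rightarrow> real \<Rightarrow> real" and H :: "(nat \<Rightarrow> real) \<Rightarrow> real" and H1 H2 :: "nat \<Rightarrow> (nat \<Rightarrow> real) \<Rightarrow> real"
  defines "X \<equiv> (\<lambda>s \<xi> m. c m s * \<xi> m)"
  assumes c_le: "\<And>m s. \<bar>c m s\<bar> \<le> 1" and c'_le: "\<And>m s. \<bar>c' m s\<bar> \<le> 1"
    and DH: "\<And>\<xi> s. ((\<lambda>s. H (X s \<xi>)) has_real_derivative (\<Sum>m\<in>I. c' m s * \<xi> m * H1 m (X s \<xi>))) (at s)"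
    and DH1: "\<And>m \<zeta> x. m \<in> I \<Longrightarrow> ((\<lambda>x. H1 m (\<zeta>(m := x))) has_real_derivative H2 m (\<zeta>(m := x))) (at x)"
    and cont: "\<And>m \<zeta>. m \<in> I \<Longrightarrow> continuous_on UNIV (\<lambda>x. H2 m (\<zeta>(m := x)))"
    and growthH: "\<And>\<zeta>. \<bar>H \<zeta>\<bar> \<le> C * growth r \<zeta>" "\<And>m \<zeta>. m \<in> I \<Longrightarrow> \<bar>H1 m \<zeta>\<bar> \<le> C * growth r \<zeta>"
      "\<And>m \<zeta>. m \<in> I \<Longrightarrow> \<bar>H2 m \<zeta>\<bar> \<le> C * growth r \<zeta>" and r: "r \<ge> 0"
    and meas: "\<And>a. (\<lambda>\<xi>. H (\<lambda>m. a m * \<xi> m)) \<in> borel_measurable (PiM I N)"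
      "\<And>a m. m \<in> I \<Longrightarrow> (\<lambda>\<xi>. H1 m (\<lambda>m. a m * \<xi> m)) \<in> borel_measurable (PiM I N)"
      "\<And>a m. m \<in> I \<Longrightarrow> (\<lambda>\<xi>. H2 m (\<lambda>m. a m * \<xi> m)) \<in> borel_measurable (PiM I N)"
  shows "((\<lambda>s. \<integral>\<xi>. H (X s \<xi>) \<partial>PiM I N) has_real_derivative
           (\<integral>\<xi>. (\<Sum>m\<in>I. c' m s * c m s * \<tau> m (\<xi> m) * H2 m (X s \<xi>)) \<partial>PiM I N)) (at s)"
proof -
  have C: "C \<ge> 0"
    using growthH(1)[of "\<lambda>_. 0"] by (simp add: growth_def)
  have meas' [measurable]: "(\<lambda>\<xi>. H (X s \<xi>)) \<in> borel_measurable (PiM I N)" for s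
    unfolding X_def by (rule meas)
  have meas1 [measurable]: "m \<in> I \<Longrightarrow> (\<lambda>\<xi>. H1 m (X s \<xi>)) \<in> borel_measurable (PiM I N)"
    "m \<in> I \<Longrightarrow> (\<lambda>\<xi>. H2 m (X s \<xi>)) \<in> borel_measurable (PiM I N)" for m s
    unfolding X_def by (rule meas; assumption)+
  have comp [measurable]: "m \<in> I \<Longrightarrow> (\<lambda>\<xi>. \<xi> m) \<in> borel_measurable (PiM I N)" for m
    using measurable_component_singleton[of m I N] by simp
  have grow: "\<bar>H (X s \<xi>)\<bar> \<le> C * growth r \<xi>" for s \<xi>
    unfolding X_def by (rule order.trans[OF growthH(1) growth_scale[OF c_le r C]])
  have grow1: "\<bar>H1 m (X s \<xi>)\<bar> \<le> C * growth r \<xi>" "\<bar>H2 m (X s \<xi>)\<bar> \<le> C * growth r \<xi>" if "m \<in> I" for s \<xi> m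
    unfolding X_def using that by (auto intro: order.trans[OF growthH(2) growth_scale[OF c_le r C]] order.trans[OF growthH(3) growth_scale[OF c_le r C]])
  have gterm: "\<bar>c' m s * \<xi> m * H1 m (X s \<xi>)\<bar> \<le> C * growth (r + 1) \<xi>" if "m \<in> I" for m s \<xi>
  proof -
    have "\<bar>c' m s\<bar> * \<bar>\<xi> m * H1 m (X s \<xi>)\<bar> \<le> 1 * (C * growth (r + 1) \<xi>)"
      using coordinate_growth[OF that grow1(1)[OF that]] c'_le by (intro mult_mono) auto
    then show ?thesis by (simp add: abs_mult mult_ac)
  qed
  have i1: "integrable (PiM I N) (\<lambda>\<xi>. c' m s * \<xi> m * H1 m (X s \<xi>))" if "m \<in> I" for m s
    by (rule integrable_of_growth[where C=C and c="r+1"]) (use that gterm in auto)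
  have i2: "integrable (PiM I N) (\<lambda>\<xi>. c' m s * c m s * \<tau> m (\<xi> m) * H2 m (X s \<xi>))" if "m \<in> I" for m s
  proof (rule integrable_of_growth[where C="2 * C" and c="r"])
    fix \<xi>
    have "\<bar>c' m s\<bar> * (\<bar>c m s\<bar> * (\<bar>\<tau> m (\<xi> m)\<bar> * \<bar>H2 m (X s \<xi>)\<bar>)) \<le> 1 * (1 * (2 * (C * growth r \<xi>)))"
      using c'_le c_le \<tau>_bounds[of m "\<xi> m"] grow1(2)[OF that] by (intro mult_mono) auto
    then show "\<bar>c' m s * c m s * \<tau> m (\<xi> m) * H2 m (X s \<xi>)\<bar> \<le> 2 * C * growth r \<xi>"
      by (simp add: abs_mult mult_ac)
  qed (use that in measurable)
  have ibp: "(\<integral>\<xi>. c' m s * \<xi> m * H1 m (X s \<xi>) \<partial>PiM I N) = (\<integral>\<xi>. c' m s * c m s * \<tau> m (\<xi> m) * H2 m (X s \<xi>) \<partial>PiM I N)" if m: "m \<in> I" for m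
  proof -
    have upd: "X s (\<xi>(m := x)) = (X s \<xi>)(m := c m s * x)" for \<xi> x by (auto simp: X_def)
    have "(\<integral>\<xi>. \<xi> m * H1 m (X s \<xi>) \<partial>PiM I N) = (\<integral>\<xi>. \<tau> m (\<xi> m) * (c m s * H2 m (X s \<xi>)) \<partial>PiM I N)"
    proof (rule integration_by_parts[OF m, where C=C and c=r])
      show "((\<lambda>x. H1 m (X s (\<xi>(m := x)))) has_real_derivative c m s * H2 m (X s (\<xi>(m := x)))) (at x)" for \<xi> x
        unfolding upd by (rule DERIV_chain2[OF DH1[OF m], THEN DERIV_cong]) (auto intro!: derivative_eq_intros)
      show "continuous_on UNIV (\<lambda>x. c m s * H2 m (X s (\<xi>(m := x))))" for \<xi>
        unfolding upd by (intro continuous_intros continuous_on_compose2[OF cont[OF m]]) auto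
      show "\<bar>H1 m (X s \<xi>)\<bar> \<le> C * growth r \<xi>" for \<xi> by (rule grow1[OF m])
      show "\<bar>c m s * H2 m (X s \<xi>)\<bar> \<le> C * growth r \<xi>" for \<xi>
        using mult_mono[OF c_le[of m s] grow1(2)[OF m, of s \<xi>]] by (simp add: abs_mult)
    qed (use m in measurable)
    moreover have "(\<integral>\<xi>. c' m s * \<xi> m * H1 m (X s \<xi>) \<partial>PiM I N) = c' m s * (\<integral>\<xi>. \<xi> m * H1 m (X s \<xi>) \<partial>PiM I N)"
      by (simp add: mult.assoc)
    moreover have "(\<integral>\<xi>. c' m s * c m s * \<tau> m (\<xi> m) * H2 m (X s \<xi>) \<partial>PiM I N)
        = c' m s * (\<integral>\<xi>. \<tau> m (\<xi> m) * (c m s * H2 m (X s \<xi>)) \<partial>PiM I N)"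
      by (subst integral_mult_right_zero[symmetric]) (simp add: mult_ac)
    ultimately show ?thesis by simp
  qed
  have "((\<lambda>s. \<integral>\<xi>. H (X s \<xi>) \<partial>PiM I N) has_real_derivative
           (\<integral>\<xi>. (\<Sum>m\<in>I. c' m s * \<xi> m * H1 m (X s \<xi>)) \<partial>PiM I N)) (at s)"
  proof (rule DERIV_integral_dominated[where B="\<lambda>\<xi>. (card I * C) * growth (r + 1) \<xi>"])
    show "integrable (PiM I N) (\<lambda>\<xi>. H (X s \<xi>))" for s
      by (rule integrable_of_growth[OF meas' grow])
    show "((\<lambda>s. H (X s \<xi>)) has_real_derivative (\<Sum>m\<in>I. c' m s * \<xi> m * H1 m (X s \<xi>))) (at s)" for s \<xi>
      by (rule DH)
    show "\<bar>\<Sum>m\<in>I. c' m s * \<xi> m * H1 m (X s \<xi>)\<bar> \<le> (card I * C) * growth (r + 1) \<xi>" for s \<xi>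
      using sum_bounded_above[of I "\<lambda>m. \<bar>c' m s * \<xi> m * H1 m (X s \<xi>)\<bar>" "C * growth (r + 1) \<xi>", OF gterm]
      by (intro order.trans[OF sum_abs]) (simp add: mult.assoc)
    show "integrable (PiM I N) (\<lambda>\<xi>. (card I * C) * growth (r + 1) \<xi>)" by (rule integrable_growth)
  qed measurable
  also have "(\<integral>\<xi>. (\<Sum>m\<in>I. c' m s * \<xi> m * H1 m (X s \<xi>)) \<partial>PiM I N)
      = (\<integral>\<xi>. (\<Sum>m\<in>I. c' m s * c m s * \<tau> m (\<xi> m) * H2 m (X s \<xi>)) \<partial>PiM I N)"
    by (simp add: i1 i2 ibp)
  finally show ?thesis .
qed

end

section \<open>Interpolation between skewed multiples and Gaussian multiples of fixed
  vectors\<close>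

section \<open>Comparison of a skewed sum with a Gaussian sum\<close>

context smooth_max
begin

lemma psi_measurable [measurable]: "psi k \<in> borel_measurable borel"
proof -
  have [measurable]: "cutoff k \<in> borel_measurable borel"
    by (intro borel_measurable_continuous_onI continuous_cutoff)
  show ?thesis unfolding psi_def[abs_def] by measurable
qed

lemma u_measurable:
  assumes "\<And>j. j \<in> J \<Longrightarrow> (\<lambda>\<omega>. x \<omega> j) \<in> borel_measurable M"
  shows "(\<lambda>\<omega>. u (x \<omega>)) \<in> borel_measurable M"
  unfolding u_def using F_measurable[of x M] assms by measurable

lemma D_measurable:
  assumes "\<And>j. j \<in> J \<Longrightarrow> (\<lambda>\<omega>. x \<omega> j) \<in> borel_measurable M"
  shows "(\<lambda>\<omega>. D1 (x \<omega>) y) \<in> borel_measurable M" "(\<lambda>\<omega>. D2 (x \<omega>) y) \<in> borel_measurable M"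
proof -
  have [measurable]: "(\<lambda>\<omega>. F (x \<omega>)) \<in> borel_measurable M" by (rule F_measurable[OF assms])
  have [measurable]: "(\<lambda>\<omega>. avg (x \<omega>) z) \<in> borel_measurable M" for z by (rule avg_measurable[OF assms]) auto
  show "(\<lambda>\<omega>. D1 (x \<omega>) y) \<in> borel_measurable M" "(\<lambda>\<omega>. D2 (x \<omega>) y) \<in> borel_measurable M"
    unfolding D1_def D2_def by measurable
qed

lemma u_bound: "\<bar>u x\<bar> \<le> B"
  using psi_bound[of 0] by (simp add: u_def)

lemma D1_bound: assumes "\<And>j. j \<in> J \<Longrightarrow> \<bar>y j\<bar> \<le> c" shows "\<bar>D1 x y\<bar> \<le> B / d * c"
  unfolding D1_def abs_mult
  using psi_bound[of 1 "F x"] abs_avg_bound[of y c x] assms B_ge_1 d_pos by (intro mult_mono) auto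

text \<open>A squared average is a double average over two independent indices j and k, so the sum
  over \<open>m\<close> turns into the entry (j, k) of a covariance matrix.\<close>

lemma sum_avg_power2:
  "(\<Sum>m\<in>I. a m * (avg x (v m))\<^sup>2) = avg x (\<lambda>j. avg x (\<lambda>k. \<Sum>m\<in>I. a m * v m j * v m k))"
proof -
  have "avg x (\<lambda>k. \<Sum>m\<in>I. a m * v m j * v m k) = (\<Sum>m\<in>I. (a m * avg x (v m)) * v m j)" for j
    by (simp only: avg_sum avg_cmult) (simp add: mult_ac)
  then show ?thesis by (simp only: avg_sum avg_cmult) (simp add: power2_eq_square mult_ac)
qed

lemma sum_avg_square: "(\<Sum>m\<in>I. a m * avg x (\<lambda>j. (v m j)\<^sup>2)) = avg x (\<lambda>j. \<Sum>m\<in>I. a m * v m j * v m j)"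
  by (simp add: avg_sum avg_cmult power2_eq_square mult.assoc)

text \<open>The second derivatives of \<open>u\<close> integrate the matrix sum_m a_m v_m v_m^T
  against probability weights, so only its largest entry counts. The 3 is 1 for \<open>psi 2\<close>
  plus 2 for the variance term of \<open>psi 1\<close>, using 1/d^2 <= b/d.\<close>

lemma D2_sum_bound:
  assumes R: "\<And>j k. j \<in> J \<Longrightarrow> k \<in> J \<Longrightarrow> \<bar>\<Sum>m\<in>I. a m * v m j * v m k\<bar> \<le> R"
  shows "\<bar>\<Sum>m\<in>I. a m * D2 x (v m)\<bar> \<le> 3 * B * b / d * R"
proof -
  have R0: "R \<ge> 0" using J_ne R by fastforce
  let ?s = "avg x (\<lambda>j. avg x (\<lambda>k. \<Sum>m\<in>I. a m * v m j * v m k))"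
  let ?t = "avg x (\<lambda>j. \<Sum>m\<in>I. a m * v m j * v m j)"
  have "(\<Sum>m\<in>I. a m * D2 x (v m)) = psi 2 (F x) * (\<Sum>m\<in>I. a m * (avg x (v m))\<^sup>2)
      + psi 1 (F x) * (b * ((\<Sum>m\<in>I. a m * avg x (\<lambda>j. (v m j)\<^sup>2)) - (\<Sum>m\<in>I. a m * (avg x (v m))\<^sup>2)))"
    unfolding D2_def by (simp add: sum_distrib_left sum.distrib sum_subtractf algebra_simps)
  also have "\<dots> = psi 2 (F x) * ?s + psi 1 (F x) * b * (?t - ?s)"
    unfolding sum_avg_power2 sum_avg_square by simp
  finally have eq: "(\<Sum>m\<in>I. a m * D2 x (v m)) = psi 2 (F x) * ?s + psi 1 (F x) * b * (?t - ?s)" .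
  have s: "\<bar>?s\<bar> \<le> R" by (intro abs_avg_bound R)
  have t: "\<bar>?t\<bar> \<le> R" by (intro abs_avg_bound R)
  have p2: "\<bar>psi 2 (F x)\<bar> \<le> B * b / d"
  proof -
    have "B / d\<^sup>2 \<le> B * b / d"
      using bd d_pos B_ge_1 by (simp add: field_simps power2_eq_square mult_left_mono[of 1 "b * d" B, simplified])
    then show ?thesis using psi_bound[of 2 "F x"] by simp
  qed
  have p1: "\<bar>psi 1 (F x) * b\<bar> \<le> B * b / d"
    using mult_right_mono[OF psi_bound[of 1 "F x"], of b] b_pos by (simp add: abs_mult)
  have Bb: "B * b / d \<ge> 0" using B_ge_1 b_pos d_pos by simp
  have "\<bar>psi 2 (F x) * ?s + psi 1 (F x) * b * (?t - ?s)\<bar> \<le> B * b / d * R + B * b / d * (2 * R)"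
  proof (intro order.trans[OF abs_triangle_ineq] add_mono)
    show "\<bar>psi 2 (F x) * ?s\<bar> \<le> B * b / d * R"
      unfolding abs_mult using p2 s Bb by (intro mult_mono) auto
    show "\<bar>psi 1 (F x) * b * (?t - ?s)\<bar> \<le> B * b / d * (2 * R)"
      unfolding abs_mult[of _ "?t - ?s"] using p1 s t Bb by (intro mult_mono) auto
  qed
  also have "\<dots> = 3 * B * b / d * R" by (simp add: algebra_simps)
  finally show ?thesis unfolding eq .
qed

lemma D2_bound:
  assumes c: "\<And>j. j \<in> J \<Longrightarrow> \<bar>y j\<bar> \<le> c" shows "\<bar>D2 x y\<bar> \<le> 3 * B * b / d * c\<^sup>2"
proof -
  have "\<bar>y j * y k\<bar> \<le> c\<^sup>2" if "j \<in> J" "k \<in> J" for j k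
    unfolding abs_mult power2_eq_square
    by (intro mult_mono c that abs_ge_zero order.trans[OF abs_ge_zero c[OF that(1)]])
  then show ?thesis
    using D2_sum_bound[where I="{0::nat}" and a="\<lambda>_. 1" and v="\<lambda>_. y" and R="c\<^sup>2" and x=x] by simp
qed

text \<open>The block \<open>A\<close> is multiplied by sin s and the block \<open>G\<close> by cos
  s. The derivative in s is sin s cos s times the second derivatives of \<open>u\<close> paired with
  the kernel-weighted covariance of \<open>A\<close> minus the covariance of \<open>G\<close>. The
  kernel is random, which is why \<open>R\<close> depends on \<xi>.\<close>

lemma interpolation:
  fixes v :: "nat \<Rightarrow> nat \<Rightarrow> real" and R :: "(nat \<Rightarrow> real) \<Rightarrow> real"
  assumes fin: "finite A" "finite G" and disj: "A \<inter> G = {}"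
  defines "N \<equiv> (\<lambda>m. if m \<in> A then skew_law else std_normal_distribution)"
  assumes R_int: "integrable (PiM (A \<union> G) N) R"
    and R: "\<And>\<xi> j k. j \<in> J \<Longrightarrow> k \<in> J \<Longrightarrow>
      \<bar>(\<Sum>m\<in>A. skew_kernel (\<xi> m) * v m j * v m k) - (\<Sum>m\<in>G. v m j * v m k)\<bar> \<le> R \<xi>"
  shows "\<bar>(\<integral>\<xi>. u (\<lambda>j. \<Sum>m\<in>A. \<xi> m * v m j) \<partial>PiM (A \<union> G) N) - (\<integral>\<xi>. u (\<lambda>j. \<Sum>m\<in>G. \<xi> m * v m j) \<partial>PiM (A \<union> G) N)\<bar>
    \<le> 3 * B * b / d * (\<integral>\<xi>. R \<xi> \<partial>PiM (A \<union> G) N)"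
proof -
  define \<tau> where "\<tau> m = (if m \<in> A then skew_kernel else (\<lambda>_. 1))" for m
  define I where "I = A \<union> G"
  interpret stein_product I N \<tau>
    by standard (use fin in \<open>auto simp: I_def N_def \<tau>_def skew_law_stein std_normal_stein\<close>)
  define S where "S \<zeta> = (\<lambda>j. \<Sum>m\<in>I. \<zeta> m * v m j)" for \<zeta> :: "nat \<Rightarrow> real"
  \<comment> \<open>At s = pi/2 only the skewed block is left, at s = 0 only the Gaussian
    one.\<close>
  define c where "c m s = (if m \<in> A then sin s else cos s)" for m :: nat and s :: real
  define c' where "c' m s = (if m \<in> A then cos s else - sin s)" for m :: nat and s :: real
  define Q where "Q = 3 * B * b / d"
  have Q: "Q \<ge> 0" using B_ge_1 b_pos d_pos by (simp add: Q_def)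
  define M where "M = (\<Sum>m\<in>I. \<Sum>j\<in>J. \<bar>v m j\<bar>)"
  have M: "\<bar>v m j\<bar> \<le> M" if "m \<in> I" "j \<in> J" for m j
  proof -
    have "\<bar>v m j\<bar> \<le> (\<Sum>j\<in>J. \<bar>v m j\<bar>)" using that finJ by (intro member_le_sum) auto
    also have "\<dots> \<le> M" unfolding M_def using that fin by (intro member_le_sum sum_nonneg) (auto simp: I_def)
    finally show ?thesis .
  qed
  have S_upd: "S (\<zeta>(m := x)) = (\<lambda>j. S (\<zeta>(m := 0)) j + x * v m j)" if "m \<in> I" for \<zeta> m x
  proof
    fix j
    have "S (\<zeta>(m := y)) j = y * v m j + (\<Sum>k\<in>I - {m}. \<zeta> k * v k j)" for y
      unfolding S_def using that fin by (subst sum.remove[of _ m]) (auto simp: I_def intro!: sum.cong)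
    then show "S (\<zeta>(m := x)) j = S (\<zeta>(m := 0)) j + x * v m j" by simp
  qed
  have comp [measurable]: "m \<in> I \<Longrightarrow> (\<lambda>\<xi>. \<xi> m) \<in> borel_measurable (PiM I N)" for m
    using measurable_component_singleton[of m I N] by simp
  have S_meas: "(\<lambda>\<xi>. S (\<lambda>m. a m * \<xi> m) j) \<in> borel_measurable (PiM I N)" for a j
    unfolding S_def by measurable
  define \<phi> where "\<phi> s = (\<integral>\<xi>. u (S (\<lambda>m. c m s * \<xi> m)) \<partial>PiM I N)" for s
  define \<phi>' where "\<phi>' s = (\<integral>\<xi>. (\<Sum>m\<in>I. c' m s * c m s * \<tau> m (\<xi> m) * D2 (S (\<lambda>m. c m s * \<xi> m)) (v m)) \<partial>PiM I N)" for s
  have deriv: "(\<phi> has_real_derivative \<phi>' s) (at s)" for s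
    unfolding \<phi>_def[abs_def] \<phi>'_def
  proof (rule path_derivative[where c=c and c'=c' and H="\<lambda>\<zeta>. u (S \<zeta>)" and ?H1.0="\<lambda>m \<zeta>. D1 (S \<zeta>) (v m)" and ?H2.0="\<lambda>m \<zeta>. D2 (S \<zeta>) (v m)"
        and C="B + B / d * M + 3 * B * b / d * M\<^sup>2" and r=0])
    show "\<bar>c m s\<bar> \<le> 1" "\<bar>c' m s\<bar> \<le> 1" for m s by (auto simp: c_def c'_def)
    have M0: "M \<ge> 0" unfolding M_def by (intro sum_nonneg) auto
    have nn: "B \<ge> 0" "B / d * M \<ge> 0" "3 * B * b / d * M\<^sup>2 \<ge> 0" using B_ge_1 b_pos d_pos M0 by auto
    show "\<bar>u (S \<zeta>)\<bar> \<le> (B + B / d * M + 3 * B * b / d * M\<^sup>2) * growth 0 \<zeta>" for \<zeta>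
      using u_bound[of "S \<zeta>"] nn by (simp add: growth_def)
    show "\<bar>D1 (S \<zeta>) (v m)\<bar> \<le> (B + B / d * M + 3 * B * b / d * M\<^sup>2) * growth 0 \<zeta>" if "m \<in> I" for m \<zeta>
      using D1_bound[of "v m" M "S \<zeta>"] M[OF that] nn by (simp add: growth_def)
    show "\<bar>D2 (S \<zeta>) (v m)\<bar> \<le> (B + B / d * M + 3 * B * b / d * M\<^sup>2) * growth 0 \<zeta>" if "m \<in> I" for m \<zeta>
      using D2_bound[of "v m" M "S \<zeta>"] M[OF that] nn by (simp add: growth_def)
    show "((\<lambda>s. u (S (\<lambda>m. c m s * \<xi> m))) has_real_derivative
        (\<Sum>m\<in>I. c' m s * \<xi> m * D1 (S (\<lambda>m. c m s * \<xi> m)) (v m))) (at s)" for \<xi> s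
    proof -
      have "((\<lambda>s. c m s * \<xi> m * v m j) has_real_derivative c' m s * \<xi> m * v m j) (at s)" for m j
        by (cases "m \<in> A") (auto simp: c_def c'_def intro!: derivative_eq_intros)
      then have "((\<lambda>s. S (\<lambda>m. c m s * \<xi> m) j) has_real_derivative (\<Sum>m\<in>I. (c' m s * \<xi> m) * v m j)) (at s)" for j
        unfolding S_def by (intro DERIV_sum) auto
      then have "((\<lambda>s. u (S (\<lambda>m. c m s * \<xi> m))) has_real_derivative
          D1 (S (\<lambda>m. c m s * \<xi> m)) (\<lambda>j. \<Sum>m\<in>I. (c' m s * \<xi> m) * v m j)) (at s)"
        by (intro DERIV_u)
      then show ?thesis
        by (simp add: D1_def avg_sum avg_cmult sum_distrib_left mult_ac)
    qed
    show "((\<lambda>x. D1 (S (\<zeta>(m := x))) (v m)) has_real_derivative D2 (S (\<zeta>(m := x))) (v m)) (at x)" if "m \<in> I" for m \<zeta> x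
    proof -
      define w where "w = S (\<zeta>(m := 0))"
      show ?thesis unfolding S_upd[OF that, of \<zeta>, folded w_def] by (rule DERIV_D1)
    qed
    show "continuous_on UNIV (\<lambda>x. D2 (S (\<zeta>(m := x))) (v m))" if "m \<in> I" for m \<zeta>
    proof -
      define w where "w = S (\<zeta>(m := 0))"
      show ?thesis unfolding S_upd[OF that, of \<zeta>, folded w_def]
        by (intro continuous_at_imp_continuous_on ballI DERIV_isCont[OF DERIV_D2])
    qed
  qed (auto intro!: u_measurable D_measurable S_meas)
  have bound: "\<bar>\<phi>' s\<bar> \<le> Q * (\<integral>\<xi>. R \<xi> \<partial>PiM I N) / 2" for s
  proof -
    have sc: "\<bar>sin s * cos s\<bar> \<le> 1 / 2"
      using abs_sin_le_one[of "2 * s"] by (simp add: sin_double)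
    have "\<bar>\<Sum>m\<in>I. c' m s * c m s * \<tau> m (\<xi> m) * D2 (S (\<lambda>m. c m s * \<xi> m)) (v m)\<bar> \<le> Q / 2 * R \<xi>" for \<xi>
    proof -
      define a where "a m = (if m \<in> A then skew_kernel (\<xi> m) else - 1)" for m
      let ?x = "S (\<lambda>m. c m s * \<xi> m)"
      have "(\<Sum>m\<in>I. c' m s * c m s * \<tau> m (\<xi> m) * D2 ?x (v m)) = sin s * cos s * (\<Sum>m\<in>I. a m * D2 ?x (v m))"
        unfolding sum_distrib_left by (intro sum.cong) (auto simp: a_def c_def c'_def \<tau>_def)
      moreover have "\<bar>\<Sum>m\<in>I. a m * D2 ?x (v m)\<bar> \<le> Q * R \<xi>"
        unfolding Q_def
      proof (rule D2_sum_bound)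
        fix j k assume jk: "j \<in> J" "k \<in> J"
        have "(\<Sum>m\<in>I. a m * v m j * v m k) = (\<Sum>m\<in>A. a m * v m j * v m k) + (\<Sum>m\<in>G. a m * v m j * v m k)"
          unfolding I_def using fin disj by (intro sum.union_disjoint)
        also have "(\<Sum>m\<in>A. a m * v m j * v m k) = (\<Sum>m\<in>A. skew_kernel (\<xi> m) * v m j * v m k)"
          by (intro sum.cong) (auto simp: a_def)
        also have "(\<Sum>m\<in>G. a m * v m j * v m k) = - (\<Sum>m\<in>G. v m j * v m k)"
          unfolding sum_negf[symmetric] using disj by (intro sum.cong) (auto simp: a_def)
        finally show "\<bar>\<Sum>m\<in>I. a m * v m j * v m k\<bar> \<le> R \<xi>" using R[OF jk, of \<xi>] by simp
      qed
      ultimately have "\<bar>\<Sum>m\<in>I. c' m s * c m s * \<tau> m (\<xi> m) * D2 ?x (v m)\<bar> \<le> 1 / 2 * (Q * R \<xi>)"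
        using sc by (simp only: abs_mult[of "sin s * cos s"]) (intro mult_mono, auto)
      then show ?thesis by simp
    qed
    note le = this
    have "0 \<le> Q / 2 * R \<xi>" for \<xi> using le[of \<xi>] by linarith
    then have "\<bar>\<phi>' s\<bar> \<le> (\<integral>\<xi>. Q / 2 * R \<xi> \<partial>PiM I N)"
      unfolding \<phi>'_def using R_int le
      by (intro integral_abs_bound[THEN order.trans] integral_mono_AE') (auto simp: I_def[symmetric] intro!: AE_I2)
    then show ?thesis by simp
  qed
  \<comment> \<open>The factor 1/2 from sin s cos s and the length pi/2 < 2 of the path leave the
    constant 1.\<close>
  have "norm (\<phi> (pi / 2) - \<phi> 0) \<le> Q * (\<integral>\<xi>. R \<xi> \<partial>PiM I N) / 2 * norm (pi / 2 - 0)"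
    by (rule field_differentiable_bound[where S=UNIV and f'=\<phi>']) (use deriv bound in auto)
  also have "\<dots> \<le> Q * (\<integral>\<xi>. R \<xi> \<partial>PiM I N) / 2 * 2"
    using pi_less_4 bound[of 0] by (intro mult_left_mono) auto
  finally have "\<bar>\<phi> (pi / 2) - \<phi> 0\<bar> \<le> Q * (\<integral>\<xi>. R \<xi> \<partial>PiM I N)" by simp
  moreover have "\<phi> (pi / 2) = (\<integral>\<xi>. u (\<lambda>j. \<Sum>m\<in>A. \<xi> m * v m j) \<partial>PiM I N)"
  proof -
    have "(\<Sum>m\<in>I. c m (pi / 2) * \<xi> m * v m j) = (\<Sum>m\<in>A. \<xi> m * v m j)" for \<xi> j
      using fin by (intro sum.mono_neutral_cong_right) (auto simp: I_def c_def)
    then show ?thesis by (simp add: \<phi>_def S_def)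
  qed
  moreover have "\<phi> 0 = (\<integral>\<xi>. u (\<lambda>j. \<Sum>m\<in>G. \<xi> m * v m j) \<partial>PiM I N)"
  proof -
    have "(\<Sum>m\<in>I. c m 0 * \<xi> m * v m j) = (\<Sum>m\<in>G. \<xi> m * v m j)" for \<xi> j
      using fin disj by (intro sum.mono_neutral_cong_right) (auto simp: I_def c_def)
    then show ?thesis by (simp add: \<phi>_def S_def)
  qed
  ultimately show ?thesis by (simp add: I_def Q_def)
qed

end

section \<open>Density bounds for maxima of unit-variance Gaussian vectors with shifts\<close>

section \<open>Anti-concentration and concentration of Gaussian maxima\<close>

lemma linear_form_update:
  fixes g :: "nat \<Rightarrow> nat \<Rightarrow> real"
  assumes "finite I" "m \<in> I"
  shows "(\<Sum>k\<in>I. (\<zeta>(m := x)) k * g k j) = (\<Sum>k\<in>I. (\<zeta>(m := 0)) k * g k j) + x * g m j"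
proof -
  have "(\<Sum>k\<in>I. (\<zeta>(m := y)) k * g k j) = y * g m j + (\<Sum>k\<in>I - {m}. \<zeta> k * g k j)" for y
    using assms by (subst sum.remove[of _ m]) (auto intro!: sum.cong)
  then show ?thesis by simp
qed

lemma abs_linear_form_le:
  fixes g :: "nat \<Rightarrow> nat \<Rightarrow> real"
  assumes "\<And>m. m \<in> I \<Longrightarrow> \<bar>g m j\<bar> \<le> M"
  shows "\<bar>\<Sum>m\<in>I. \<zeta> m * g m j\<bar> \<le> M * (\<Sum>m\<in>I. \<bar>\<zeta> m\<bar>)"
  unfolding sum_distrib_left
  by (intro order.trans[OF sum_abs] sum_mono) (simp add: abs_mult assms mult_right_mono mult.commute[of M] mult_left_mono)

lemma entries_bounded:
  fixes g :: "nat \<Rightarrow> nat \<Rightarrow> real"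
  assumes "finite I" "finite J"
  obtains M where "M \<ge> 0" "\<And>m j. m \<in> I \<Longrightarrow> j \<in> J \<Longrightarrow> \<bar>g m j\<bar> \<le> M"
proof
  show "\<bar>g m j\<bar> \<le> (\<Sum>m\<in>I. \<Sum>j\<in>J. \<bar>g m j\<bar>)" if "m \<in> I" "j \<in> J" for m j
    using member_le_sum[of j J "\<lambda>j. \<bar>g m j\<bar>"] member_le_sum[of m I "\<lambda>m. \<Sum>j\<in>J. \<bar>g m j\<bar>"] that assms
    by (fastforce intro: sum_nonneg)
qed (intro sum_nonneg, simp)

context softmax
begin

lemma variance_nonneg: "(avg x y)\<^sup>2 \<le> avg x (\<lambda>j. (y j)\<^sup>2)"
  by (rule avg_power2_le)

lemma variance_bound:
  assumes "\<And>j. j \<in> J \<Longrightarrow> \<bar>y j\<bar> \<le> M"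
  shows "\<bar>avg x (\<lambda>j. (y j)\<^sup>2) - (avg x y)\<^sup>2\<bar> \<le> M\<^sup>2" "(avg x y)\<^sup>2 \<le> M\<^sup>2"
proof -
  have "avg x (\<lambda>j. (y j)\<^sup>2) \<le> M\<^sup>2"
    using assms by (intro avg_le) (metis abs_ge_zero power2_abs power_mono)
  then show "\<bar>avg x (\<lambda>j. (y j)\<^sup>2) - (avg x y)\<^sup>2\<bar> \<le> M\<^sup>2" "(avg x y)\<^sup>2 \<le> M\<^sup>2"
    using avg_power2_le[of x y] zero_le_power2[of "avg x y"] by linarith+
qed

lemma isCont_F_line: "isCont (\<lambda>s. F (\<lambda>j. w j + s * y j)) s"
  by (rule DERIV_isCont[OF DERIV_F[where y=y]]) (auto intro!: derivative_eq_intros)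

lemma isCont_avg_line: "isCont (\<lambda>s. avg (\<lambda>j. w j + s * y j) z) s"
  by (rule DERIV_isCont[OF DERIV_avg[where y=y]]) (auto intro!: derivative_eq_intros)

text \<open>The heart of the anti-concentration bound: with weights $\pi = $ \<^term>\<open>weight\<close> at $V$, Gaussian
  integration by parts turns $\sum_j \pi_j G_j f(F(V))$ into $\rho f'(F(V)) + b (1 - \rho) f(F(V))$ for
  some $\rho \le 1$, because all $G_j$ have unit variance; and $b f \ge f'$ as soon as $b$ is large.\<close>
lemma gaussian_softmax_density:
  fixes g :: "nat \<Rightarrow> nat \<Rightarrow> real" and h :: "nat \<Rightarrow> real" and \<eta> :: real and I :: "nat set"
  defines "P \<equiv> PiM I (\<lambda>_. std_normal_distribution)"
    and "G \<equiv> (\<lambda>\<xi> j. \<Sum>m\<in>I. \<xi> m * g m j)"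
    and "V \<equiv> (\<lambda>\<xi> j. (\<Sum>m\<in>I. \<xi> m * g m j) - h j)"
  assumes fin: "finite I" and unit: "\<And>j. j \<in> J \<Longrightarrow> (\<Sum>m\<in>I. (g m j)\<^sup>2) = 1"
    and \<eta>: "\<eta> > 0" and b\<eta>: "b * \<eta> \<ge> 3"
  shows "(\<integral>\<xi>. 1 / \<eta> / (1 + (F (V \<xi>) / \<eta>)\<^sup>2) \<partial>P) \<le> 4 * (\<integral>\<xi>. (MAX j\<in>J. \<bar>G \<xi> j\<bar>) \<partial>P)"
    and "integrable P (\<lambda>\<xi>. 1 / \<eta> / (1 + (F (V \<xi>) / \<eta>)\<^sup>2))"
proof -
  interpret stein_product I "\<lambda>_. std_normal_distribution" "\<lambda>_ _. 1"
    by standard (use fin std_normal_stein in auto)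
  obtain M where M: "M \<ge> 0" "\<And>m j. m \<in> I \<Longrightarrow> j \<in> J \<Longrightarrow> \<bar>g m j\<bar> \<le> M"
    using entries_bounded[OF fin finJ] by blast
  \<comment> \<open>The derivative of arctan is a Cauchy kernel of width \<eta>, a smooth substitute
    for an indicator. The shift by 2 keeps \<open>f\<close> above 1/3 because pi/2 < 5/3, and this
    matches \<open>b * \<eta> \<ge> 3\<close>: f' <= 1/\<eta> <= b/3 <= b f.\<close>
  define f where "f y = 2 + arctan (y / \<eta>)" for y
  define f' where "f' y = 1 / \<eta> / (1 + (y / \<eta>)\<^sup>2)" for y
  have Df: "(f has_real_derivative f' y) (at y)" for y
    unfolding f_def[abs_def] f'_def using \<eta> by (auto intro!: derivative_eq_intros simp: field_simps)
  have contf': "isCont f' y" for y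
    unfolding f'_def[abs_def] using \<eta> by (intro continuous_intros) (auto simp: add_nonneg_eq_0_iff)
  have f: "1 / 3 \<le> f y" "f y \<le> 4" "\<bar>f y\<bar> \<le> 4" for y
    using arctan_lbound[of "y / \<eta>"] arctan_ubound[of "y / \<eta>"] pi_less_4 pi_approx unfolding f_def by (auto simp: abs_le_iff)
  have f': "0 \<le> f' y" "f' y \<le> 1 / \<eta>" "\<bar>f' y\<bar> \<le> 1 / \<eta>" for y
  proof -
    show "0 \<le> f' y" using \<eta> by (simp add: f'_def)
    have "1 / \<eta> / (1 + (y / \<eta>)\<^sup>2) \<le> 1 / \<eta> / 1" using \<eta> by (intro divide_left_mono) (auto intro: add_pos_nonneg)
    then show "f' y \<le> 1 / \<eta>" by (simp add: f'_def)
    then show "\<bar>f' y\<bar> \<le> 1 / \<eta>" using \<open>0 \<le> f' y\<close> by simp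
  qed
  have f'f: "f' y \<le> b * f y" for y
  proof -
    have "f' y \<le> 1 / \<eta>" by (rule f')
    also have "\<dots> \<le> b * (1 / 3)" using b\<eta> \<eta> by (simp add: field_simps)
    also have "\<dots> \<le> b * f y" using b_pos f by (intro mult_left_mono) auto
    finally show ?thesis .
  qed
  have comp [measurable]: "m \<in> I \<Longrightarrow> (\<lambda>\<xi>. \<xi> m) \<in> borel_measurable P" for m
    using measurable_component_singleton[of m I "\<lambda>_. std_normal_distribution"] by (simp add: P_def)
  have V_meas [measurable]: "(\<lambda>\<xi>. V \<xi> j) \<in> borel_measurable P" for j unfolding V_def by measurable
  have G_meas [measurable]: "(\<lambda>\<xi>. G \<xi> j) \<in> borel_measurable P" for j unfolding G_def by measurable
  have [measurable]: "(\<lambda>\<xi>. F (V \<xi>)) \<in> borel_measurable P" "(\<lambda>\<xi>. avg (V \<xi>) z) \<in> borel_measurable P" for z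
    by (auto intro!: F_measurable avg_measurable)
  have [measurable]: "f \<in> borel_measurable borel" "f' \<in> borel_measurable borel"
    by (intro borel_measurable_continuous_onI continuous_at_imp_continuous_on ballI DERIV_isCont[OF Df] contf')+
  define H1 where "H1 m \<xi> = f (F (V \<xi>)) * avg (V \<xi>) (g m)" for m \<xi>
  define H2 where "H2 m \<xi> = f' (F (V \<xi>)) * (avg (V \<xi>) (g m))\<^sup>2
      + f (F (V \<xi>)) * (b * (avg (V \<xi>) (\<lambda>j. (g m j)\<^sup>2) - (avg (V \<xi>) (g m))\<^sup>2))" for m \<xi>
  have V_upd: "V (\<xi>(m := x)) = (\<lambda>j. V (\<xi>(m := 0)) j + x * g m j)" if "m \<in> I" for \<xi> m x
    unfolding V_def using linear_form_update[OF fin that, of \<xi> x g] by (auto simp: fun_eq_iff)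
  define C where "C = 4 * M + (1 / \<eta> * M\<^sup>2 + 4 * (b * M\<^sup>2))"
  have H1_le: "\<bar>H1 m \<xi>\<bar> \<le> C * growth 0 \<xi>" if m: "m \<in> I" for m \<xi>
  proof -
    have "\<bar>H1 m \<xi>\<bar> \<le> 4 * M"
      unfolding H1_def abs_mult using f abs_avg_bound[of "g m" M] M m by (intro mult_mono) auto
    then show ?thesis using M b_pos \<eta> by (simp add: C_def growth_def add_increasing2)
  qed
  have H2_le: "\<bar>H2 m \<xi>\<bar> \<le> C * growth 0 \<xi>" if m: "m \<in> I" for m \<xi>
  proof -
    note vb = variance_bound[of "g m" M "V \<xi>", OF M(2)[OF m]]
    have "\<bar>H2 m \<xi>\<bar> \<le> 1 / \<eta> * M\<^sup>2 + 4 * (b * M\<^sup>2)"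
      unfolding H2_def
    proof (intro order.trans[OF abs_triangle_ineq] add_mono)
      show "\<bar>f' (F (V \<xi>)) * (avg (V \<xi>) (g m))\<^sup>2\<bar> \<le> 1 / \<eta> * M\<^sup>2"
        unfolding abs_mult using f' vb \<eta> by (intro mult_mono) auto
      show "\<bar>f (F (V \<xi>)) * (b * (avg (V \<xi>) (\<lambda>j. (g m j)\<^sup>2) - (avg (V \<xi>) (g m))\<^sup>2))\<bar> \<le> 4 * (b * M\<^sup>2)"
        unfolding abs_mult using f vb b_pos by (intro mult_mono) auto
    qed
    then show ?thesis using M by (simp add: C_def growth_def add_increasing)
  qed
  have [measurable]: "H1 m \<in> borel_measurable P" "H2 m \<in> borel_measurable P" for m
    unfolding H1_def[abs_def] H2_def[abs_def] by measurable
  have ibp: "(\<integral>\<xi>. \<xi> m * H1 m \<xi> \<partial>P) = (\<integral>\<xi>. H2 m \<xi> \<partial>P)" if m: "m \<in> I" for m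
  proof -
    have "(\<integral>\<xi>. \<xi> m * H1 m \<xi> \<partial>P) = (\<integral>\<xi>. 1 * H2 m \<xi> \<partial>P)"
      unfolding P_def
    proof (rule integration_by_parts[OF m, where C=C and c=0])
      fix \<xi> :: "nat \<Rightarrow> real"
      define w where "w = V (\<xi>(m := 0))"
      have upd: "V (\<xi>(m := x)) = (\<lambda>j. w j + x * g m j)" for x
        unfolding w_def using V_upd[OF m] .
      have line: "((\<lambda>s. w j + s * g m j) has_real_derivative g m j) (at s)" for j s
        by (auto intro!: derivative_eq_intros)
      show "((\<lambda>x. H1 m (\<xi>(m := x))) has_real_derivative H2 m (\<xi>(m := x))) (at x)" for x
        unfolding H1_def H2_def upd
        by (rule DERIV_cong[OF DERIV_mult[OF DERIV_chain2[OF Df DERIV_F[OF line]] DERIV_avg[OF line]]])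
           (simp add: power2_eq_square algebra_simps)
      have "isCont (\<lambda>x. f (F (\<lambda>j. w j + x * g m j))) x" "isCont (\<lambda>x. f' (F (\<lambda>j. w j + x * g m j))) x" for x
        using isCont_o2[OF isCont_F_line DERIV_isCont[OF Df]] isCont_o2[OF isCont_F_line contf'] by auto
      then show "continuous_on UNIV (\<lambda>x. H2 m (\<xi>(m := x)))"
        unfolding H2_def upd by (intro continuous_at_imp_continuous_on ballI continuous_intros isCont_avg_line)
      show "\<bar>H1 m \<xi>\<bar> \<le> C * growth 0 \<xi>" "\<bar>H2 m \<xi>\<bar> \<le> C * growth 0 \<xi>"
        using H1_le[OF m] H2_le[OF m] by auto
    qed (auto simp flip: P_def)
    then show ?thesis by simp
  qed
  have i1: "integrable P (\<lambda>\<xi>. \<xi> m * H1 m \<xi>)" if "m \<in> I" for m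
    unfolding P_def using coordinate_growth[OF that H1_le[OF that]] that
    by (intro integrable_of_growth[where C=C and c="0 + 1"]) (auto simp flip: P_def)
  have i2: "integrable P (H2 m)" if "m \<in> I" for m
    unfolding P_def using H2_le[OF that]
    by (intro integrable_of_growth[where C=C and c=0]) (auto simp flip: P_def)
  have maxG: "integrable P (\<lambda>\<xi>. (MAX j\<in>J. \<bar>G \<xi> j\<bar>))"
    unfolding P_def
  proof (rule integrable_of_growth[where C=M and c=1], unfold P_def[symmetric])
    show "(\<lambda>\<xi>. MAX j\<in>J. \<bar>G \<xi> j\<bar>) \<in> borel_measurable P"
      using finJ by (intro borel_measurable_Max) auto
    fix \<xi> :: "nat \<Rightarrow> real"
    have "\<bar>G \<xi> j\<bar> \<le> M * growth 1 \<xi>" if "j \<in> J" for j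
    proof -
      have "\<bar>G \<xi> j\<bar> \<le> M * (\<Sum>m\<in>I. \<bar>\<xi> m\<bar>)"
        unfolding G_def by (rule abs_linear_form_le) (use M that in auto)
      also have "\<dots> \<le> M * exp (\<Sum>m\<in>I. \<bar>\<xi> m\<bar>)"
        using M exp_ge_add_one_self[of "\<Sum>m\<in>I. \<bar>\<xi> m\<bar>"] by (intro mult_left_mono) linarith+
      finally show ?thesis by (simp add: growth_def)
    qed
    moreover have "0 \<le> (MAX j\<in>J. \<bar>G \<xi> j\<bar>)"
      using J_ne finJ by (subst Max_ge_iff) auto
    ultimately show "\<bar>MAX j\<in>J. \<bar>G \<xi> j\<bar>\<bar> \<le> M * growth 1 \<xi>"
      using J_ne finJ by (simp add: Max_le_iff)
  qed
  show intf': "integrable P (\<lambda>\<xi>. 1 / \<eta> / (1 + (F (V \<xi>) / \<eta>)\<^sup>2))"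
    unfolding f'_def[symmetric] P_def using f'(3)
    by (intro integrable_of_growth[where C="1/\<eta>" and c=0]) (auto simp: growth_def simp flip: P_def)
  have "(\<integral>\<xi>. f' (F (V \<xi>)) \<partial>P) \<le> (\<integral>\<xi>. (\<Sum>m\<in>I. H2 m \<xi>) \<partial>P)"
  proof (rule integral_mono)
    show "f' (F (V \<xi>)) \<le> (\<Sum>m\<in>I. H2 m \<xi>)" for \<xi>
    proof -
      define \<rho> where "\<rho> = (\<Sum>m\<in>I. (avg (V \<xi>) (g m))\<^sup>2)"
      have s: "(\<Sum>m\<in>I. avg (V \<xi>) (\<lambda>j. (g m j)\<^sup>2)) = 1"
      proof -
        have "(\<Sum>m\<in>I. avg (V \<xi>) (\<lambda>j. (g m j)\<^sup>2)) = avg (V \<xi>) (\<lambda>j. \<Sum>m\<in>I. (g m j)\<^sup>2)" by (simp add: avg_sum)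
        also have "\<dots> = avg (V \<xi>) (\<lambda>j. 1)" unfolding avg_def using unit by (intro sum.cong) auto
        finally show ?thesis by (simp add: avg_const)
      qed
      have \<rho>: "\<rho> \<le> 1" unfolding \<rho>_def s[symmetric] by (intro sum_mono avg_power2_le)
      have "(\<Sum>m\<in>I. H2 m \<xi>) = f' (F (V \<xi>)) * \<rho> + b * f (F (V \<xi>)) * (1 - \<rho>)"
        unfolding \<rho>_def s[symmetric] H2_def
        by (simp add: sum_distrib_left sum.distrib sum_subtractf algebra_simps)
      moreover have "f' (F (V \<xi>)) * (1 - \<rho>) \<le> b * f (F (V \<xi>)) * (1 - \<rho>)"
        using f'f \<rho> by (intro mult_right_mono) auto
      ultimately show ?thesis by (simp add: algebra_simps)
    qed
  qed (use i2 intf' in \<open>auto simp: f'_def\<close>)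
  also have "\<dots> = (\<integral>\<xi>. (\<Sum>m\<in>I. \<xi> m * H1 m \<xi>) \<partial>P)"
    using i1 i2 ibp by simp
  also have "\<dots> \<le> (\<integral>\<xi>. 4 * (MAX j\<in>J. \<bar>G \<xi> j\<bar>) \<partial>P)"
  proof (rule integral_mono)
    show "(\<Sum>m\<in>I. \<xi> m * H1 m \<xi>) \<le> 4 * (MAX j\<in>J. \<bar>G \<xi> j\<bar>)" for \<xi>
    proof -
      have "(\<Sum>m\<in>I. \<xi> m * H1 m \<xi>) = f (F (V \<xi>)) * avg (V \<xi>) (G \<xi>)"
        unfolding H1_def G_def avg_sum avg_cmult sum_distrib_left by (simp add: mult_ac)
      also have "\<dots> \<le> \<bar>f (F (V \<xi>))\<bar> * \<bar>avg (V \<xi>) (G \<xi>)\<bar>" by (metis abs_ge_self abs_mult)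
      also have "\<dots> \<le> 4 * (MAX j\<in>J. \<bar>G \<xi> j\<bar>)"
        using f finJ by (intro mult_mono abs_avg_bound) auto
      finally show ?thesis .
    qed
  qed (use i1 maxG in auto)
  finally show "(\<integral>\<xi>. 1 / \<eta> / (1 + (F (V \<xi>) / \<eta>)\<^sup>2) \<partial>P) \<le> 4 * (\<integral>\<xi>. (MAX j\<in>J. \<bar>G \<xi> j\<bar>) \<partial>P)"
    by (simp add: f'_def)
qed

end

text \<open>If the shifted maximum lies in (0, \<eta>], the softmax lies in (0, 2 \<eta>], where the
  Cauchy kernel is at least 1/(5 \<eta>). The softmax density bound with constant 4 then gives 5 * 4
  = 20.\<close>

lemma gaussian_max_anticoncentration:
  fixes g :: "nat \<Rightarrow> nat \<Rightarrow> real" and h :: "nat \<Rightarrow> real" and \<eta> :: real and I :: "nat set"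
  defines "P \<equiv> PiM I (\<lambda>_. std_normal_distribution)"
  assumes J: "finite J" "J \<noteq> {}" and fin: "finite I" and unit: "\<And>j. j \<in> J \<Longrightarrow> (\<Sum>m\<in>I. (g m j)\<^sup>2) = 1"
    and \<eta>: "\<eta> > 0"
  shows "measure P {\<xi> \<in> space P. 0 < (MAX j\<in>J. (\<Sum>m\<in>I. \<xi> m * g m j) - h j) \<and> (MAX j\<in>J. (\<Sum>m\<in>I. \<xi> m * g m j) - h j) \<le> \<eta>}
    \<le> 20 * \<eta> * (\<integral>\<xi>. (MAX j\<in>J. \<bar>\<Sum>m\<in>I. \<xi> m * g m j\<bar>) \<partial>P)"
proof -
  \<comment> \<open>The smallest inverse temperature with b \<eta> >= 3, as the density bound wants,
    and softmax error at most \<eta>.\<close>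
  define b where "b = max 3 (ln (card J)) / \<eta>"
  interpret softmax b J
    by standard (use J \<eta> in \<open>auto simp: b_def\<close>)
  interpret P: prob_space P
    unfolding P_def by (rule prob_space_PiM) (simp add: prob_space_normal_density)
  define V where "V \<xi> j = (\<Sum>m\<in>I. \<xi> m * g m j) - h j" for \<xi> :: "nat \<Rightarrow> real" and j
  have comp [measurable]: "m \<in> I \<Longrightarrow> (\<lambda>\<xi>. \<xi> m) \<in> borel_measurable P" for m
    using measurable_component_singleton[of m I "\<lambda>_. std_normal_distribution"] by (simp add: P_def)
  have [measurable]: "(\<lambda>\<xi>. V \<xi> j) \<in> borel_measurable P" for j unfolding V_def by measurable
  have [measurable]: "(\<lambda>\<xi>. MAX j\<in>J. V \<xi> j) \<in> borel_measurable P"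
    using J by (intro borel_measurable_Max) auto
  have b: "b * \<eta> \<ge> 3" "ln (card J) / b \<le> \<eta>"
    using \<eta> by (auto simp: b_def field_simps)
  note dens = gaussian_softmax_density[where g=g and h=h, OF fin unit \<eta> b(1), folded P_def V_def]
  let ?A = "{\<xi> \<in> space P. 0 < (MAX j\<in>J. V \<xi> j) \<and> (MAX j\<in>J. V \<xi> j) \<le> \<eta>}"
  have "measure P ?A = (\<integral>\<xi>. indicator ?A \<xi> \<partial>P)" by simp
  also have "\<dots> \<le> (\<integral>\<xi>. 5 * \<eta> * (1 / \<eta> / (1 + (F (V \<xi>) / \<eta>)\<^sup>2)) \<partial>P)"
  proof (rule integral_mono)
    show "integrable P (\<lambda>\<xi>. 5 * \<eta> * (1 / \<eta> / (1 + (F (V \<xi>) / \<eta>)\<^sup>2)))"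
      using dens(2) by (rule integrable_mult_right)
    show "indicator ?A \<xi> \<le> 5 * \<eta> * (1 / \<eta> / (1 + (F (V \<xi>) / \<eta>)\<^sup>2))" for \<xi>
    proof (cases "\<xi> \<in> ?A")
      case True
      obtain j where j: "j \<in> J" "(MAX j\<in>J. V \<xi> j) = V \<xi> j"
        using Max_in[of "V \<xi> ` J"] J by (metis finite_imageI imageE image_is_empty)
      have "0 < F (V \<xi>)" using F_ge[OF j(1), of "V \<xi>"] True j(2) by auto
      moreover have "F (V \<xi>) \<le> \<eta> + ln (card J) / b"
        using True J by (intro F_le) (auto simp: Max_le_iff)
      ultimately have "\<bar>F (V \<xi>) / \<eta>\<bar> \<le> 2" using b \<eta> by (auto simp: field_simps)
      then have "(F (V \<xi>) / \<eta>)\<^sup>2 \<le> 2\<^sup>2" by (rule power2_le_iff_abs_le[THEN iffD2, rotated]) simp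
      moreover have "0 < 1 + (F (V \<xi>) / \<eta>)\<^sup>2" by (intro add_pos_nonneg) auto
      ultimately have "1 \<le> 5 / (1 + (F (V \<xi>) / \<eta>)\<^sup>2)" by (simp add: le_divide_eq)
      then show ?thesis using True \<eta> by simp
    next
      case False
      then show ?thesis using \<eta> by simp
    qed
    show "integrable P (indicator ?A :: _ \<Rightarrow> real)"
    proof (rule P.integrable_const_bound[where B=1])
      show "AE \<xi> in P. norm (indicator ?A \<xi> :: real) \<le> 1" by (intro AE_I2) (auto simp: indicator_def)
    qed measurable
  qed
  also have "\<dots> \<le> 5 * \<eta> * (4 * (\<integral>\<xi>. (MAX j\<in>J. \<bar>\<Sum>m\<in>I. \<xi> m * g m j\<bar>) \<partial>P))"
    unfolding integral_mult_right_zero using dens(1) \<eta> by (intro mult_left_mono) auto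
  finally show ?thesis by (simp add: V_def)
qed

section \<open>Exponential moments of the Gaussian softmax\<close>

lemma sum_lessThan_triple:
  fixes f :: "nat \<Rightarrow> 'a::comm_monoid_add"
  shows "(\<Sum>i<3 * q. f i) = (\<Sum>m<q. f (3 * m) + f (3 * m + 1) + f (3 * m + 2))"
proof (induction q)
  case (Suc q)
  have "{..<3 * Suc q} = insert (3 * q + 2) (insert (3 * q + 1) (insert (3 * q) {..<3 * q}))" by auto
  then show ?case using Suc by (simp add: add_ac)
qed simp

context softmax
begin

text \<open>Interpolation between two independent copies ($s = \pi/2$) and two equal ones ($s = 0$): only the
  mixed second derivatives survive, which bounds the logarithmic derivative.\<close>
lemma gaussian_softmax_exponential:
  fixes a :: "nat \<Rightarrow> nat \<Rightarrow> real" and r \<sigma>2 :: real and q :: nat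
  defines "P \<equiv> PiM {..<3 * q} (\<lambda>_. std_normal_distribution)"
  assumes var: "\<And>j. j \<in> J \<Longrightarrow> (\<Sum>m<q. (a m j)\<^sup>2) \<le> \<sigma>2"
  shows "(\<integral>\<xi>. exp (r * (F (\<lambda>j. \<Sum>m<q. \<xi> (3 * m) * a m j) - F (\<lambda>j. \<Sum>m<q. \<xi> (3 * m + 1) * a m j))) \<partial>P)
    \<le> exp (r\<^sup>2 * \<sigma>2)"
    and "integrable P (\<lambda>\<xi>. exp (r * (F (\<lambda>j. \<Sum>m<q. \<xi> (3 * m) * a m j) - F (\<lambda>j. \<Sum>m<q. \<xi> (3 * m + 1) * a m j))))"
proof -
  define I where "I = {..<3 * q}"
  have fin: "finite I" by (simp add: I_def)
  interpret stein_product I "\<lambda>_. std_normal_distribution" "\<lambda>_ _. 1"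
    by standard (use fin std_normal_stein in auto)
  \<comment> \<open>Index 3m drives only \<open>X\<close>, index 3m + 1 only \<open>Y\<close>, and
    index 3m + 2 is shared. The shared part carries cos s and the private ones sin s, so the two
    vectors coincide at s = 0 and are independent at s = pi/2.\<close>
  define v where "v i j = (if i mod 3 = 1 then 0 else a (i div 3) j)" for i j
  define w where "w i j = (if i mod 3 = 0 then 0 else a (i div 3) j)" for i j
  define c where "c i s = (if i mod 3 = 2 then cos s else sin s)" for i :: nat and s :: real
  define c' where "c' i s = (if i mod 3 = 2 then - sin s else cos s)" for i :: nat and s :: real
  define X where "X \<zeta> = (\<lambda>j. \<Sum>i\<in>I. \<zeta> i * v i j)" for \<zeta> :: "nat \<Rightarrow> real"
  define Y where "Y \<zeta> = (\<lambda>j. \<Sum>i\<in>I. \<zeta> i * w i j)" for \<zeta> :: "nat \<Rightarrow> real"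
  define H where "H \<zeta> = exp (r * (F (X \<zeta>) - F (Y \<zeta>)))" for \<zeta>
  \<comment> \<open>\<open>L i\<close> and \<open>b * Q i\<close> are the first and second
    derivatives of F(X) - F(Y) in coordinate \<open>i\<close>.\<close>
  define L where "L i \<zeta> = avg (X \<zeta>) (v i) - avg (Y \<zeta>) (w i)" for i \<zeta>
  define Q where "Q i \<zeta> = (avg (X \<zeta>) (\<lambda>j. (v i j)\<^sup>2) - (avg (X \<zeta>) (v i))\<^sup>2)
      - (avg (Y \<zeta>) (\<lambda>j. (w i j)\<^sup>2) - (avg (Y \<zeta>) (w i))\<^sup>2)" for i \<zeta>
  define H1 where "H1 i \<zeta> = H \<zeta> * (r * L i \<zeta>)" for i \<zeta>
  define H2 where "H2 i \<zeta> = H \<zeta> * (r\<^sup>2 * (L i \<zeta>)\<^sup>2 + r * b * Q i \<zeta>)" for i \<zeta>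
  obtain M1 where M1: "M1 \<ge> 0" "\<And>m j. m \<in> I \<Longrightarrow> j \<in> J \<Longrightarrow> \<bar>v m j\<bar> \<le> M1"
    using entries_bounded[OF fin finJ] by blast
  obtain M2 where M2: "M2 \<ge> 0" "\<And>m j. m \<in> I \<Longrightarrow> j \<in> J \<Longrightarrow> \<bar>w m j\<bar> \<le> M2"
    using entries_bounded[OF fin finJ] by blast
  define M where "M = max M1 M2"
  have M: "M \<ge> 0" "\<And>m j. m \<in> I \<Longrightarrow> j \<in> J \<Longrightarrow> \<bar>v m j\<bar> \<le> M" "\<And>m j. m \<in> I \<Longrightarrow> j \<in> J \<Longrightarrow> \<bar>w m j\<bar> \<le> M"
    using M1 M2 by (fastforce simp: M_def)+
  define K where "K = exp (2 * \<bar>r\<bar> * (ln (card J) / b))"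
  define E where "E = 1 + \<bar>r\<bar> * (2 * M) + (r\<^sup>2 * (2 * M)\<^sup>2 + \<bar>r\<bar> * b * (2 * M\<^sup>2))"
  have comp [measurable]: "m \<in> I \<Longrightarrow> (\<lambda>\<xi>. \<xi> m) \<in> borel_measurable P" for m
    using measurable_component_singleton[of m I "\<lambda>_. std_normal_distribution"] by (simp add: P_def I_def)
  have XY_meas [measurable]: "(\<lambda>\<xi>. X (\<lambda>m. \<alpha> m * \<xi> m) j) \<in> borel_measurable P" "(\<lambda>\<xi>. Y (\<lambda>m. \<alpha> m * \<xi> m) j) \<in> borel_measurable P" for \<alpha> j
    unfolding X_def Y_def by measurable
  have [measurable]: "(\<lambda>\<xi>. F (X (\<lambda>m. \<alpha> m * \<xi> m))) \<in> borel_measurable P" "(\<lambda>\<xi>. F (Y (\<lambda>m. \<alpha> m * \<xi> m))) \<in> borel_measurable P"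
    "(\<lambda>\<xi>. avg (X (\<lambda>m. \<alpha> m * \<xi> m)) z) \<in> borel_measurable P" "(\<lambda>\<xi>. avg (Y (\<lambda>m. \<alpha> m * \<xi> m)) z) \<in> borel_measurable P" for \<alpha> z
    by (auto intro!: F_measurable avg_measurable)
  have HP: "H \<zeta> > 0" for \<zeta> by (simp add: H_def)
  have H_le: "H \<zeta> \<le> K * growth (2 * \<bar>r\<bar> * M) \<zeta>" for \<zeta>
  proof -
    have "\<bar>F (X \<zeta>)\<bar> \<le> M * (\<Sum>i\<in>I. \<bar>\<zeta> i\<bar>) + ln (card J) / b"
      unfolding X_def by (intro F_abs_le abs_linear_form_le M)
    moreover have "\<bar>F (Y \<zeta>)\<bar> \<le> M * (\<Sum>i\<in>I. \<bar>\<zeta> i\<bar>) + ln (card J) / b"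
      unfolding Y_def by (intro F_abs_le abs_linear_form_le M)
    ultimately have "\<bar>F (X \<zeta>) - F (Y \<zeta>)\<bar> \<le> 2 * (M * (\<Sum>i\<in>I. \<bar>\<zeta> i\<bar>) + ln (card J) / b)"
      unfolding mult_2 by (rule order.trans[OF abs_triangle_ineq4 add_mono])
    then have "\<bar>r\<bar> * \<bar>F (X \<zeta>) - F (Y \<zeta>)\<bar> \<le> \<bar>r\<bar> * (2 * (M * (\<Sum>i\<in>I. \<bar>\<zeta> i\<bar>) + ln (card J) / b))"
      by (intro mult_left_mono) auto
    then have "r * (F (X \<zeta>) - F (Y \<zeta>)) \<le> \<bar>r\<bar> * (2 * (M * (\<Sum>i\<in>I. \<bar>\<zeta> i\<bar>) + ln (card J) / b))"
      by (rule order.trans[OF order.trans[OF abs_ge_self eq_refl[OF abs_mult]]])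
    then have "H \<zeta> \<le> exp (\<bar>r\<bar> * (2 * (M * (\<Sum>i\<in>I. \<bar>\<zeta> i\<bar>) + ln (card J) / b)))" by (simp add: H_def)
    also have "\<dots> = K * growth (2 * \<bar>r\<bar> * M) \<zeta>"
      unfolding K_def growth_def mult_exp_exp by (simp add: algebra_simps)
    finally show ?thesis .
  qed
  have L_le: "\<bar>L i \<zeta>\<bar> \<le> 2 * M" if "i \<in> I" for i \<zeta>
  proof -
    have "\<bar>avg (X \<zeta>) (v i)\<bar> \<le> M" "\<bar>avg (Y \<zeta>) (w i)\<bar> \<le> M"
      by (rule abs_avg_bound[OF M(2)[OF that]] abs_avg_bound[OF M(3)[OF that]]; assumption)+
    then show ?thesis unfolding L_def by linarith
  qed
  have Q_le: "\<bar>Q i \<zeta>\<bar> \<le> 2 * M\<^sup>2" if "i \<in> I" for i \<zeta>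
    using variance_bound(1)[where y="v i" and x="X \<zeta>", OF M(2)[OF that]]
      variance_bound(1)[where y="w i" and x="Y \<zeta>", OF M(3)[OF that]]
    unfolding Q_def by linarith
  have growthH: "H \<zeta> * y \<le> K * E * growth (2 * \<bar>r\<bar> * M) \<zeta>" if "0 \<le> y" "y \<le> E" for \<zeta> y
    using mult_mono[OF H_le[of \<zeta>] that(2)] that(1) HP[of \<zeta>] by (simp add: K_def growth_def mult_ac)
  have nnE: "0 \<le> \<bar>r\<bar> * (2 * M)" "0 \<le> r\<^sup>2 * (2 * M)\<^sup>2" "0 \<le> \<bar>r\<bar> * b * (2 * M\<^sup>2)"
    using M b_pos by auto
  define \<phi> where "\<phi> s = (\<integral>\<xi>. H (\<lambda>m. c m s * \<xi> m) \<partial>P)" for s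
  define \<phi>' where "\<phi>' s = (\<integral>\<xi>. (\<Sum>m\<in>I. c' m s * c m s * 1 * H2 m (\<lambda>m. c m s * \<xi> m)) \<partial>P)" for s
  have deriv: "(\<phi> has_real_derivative \<phi>' s) (at s)" for s
    unfolding \<phi>_def[abs_def] \<phi>'_def P_def I_def[symmetric]
  proof (rule path_derivative[where c=c and c'=c' and H=H and ?H1.0=H1 and ?H2.0=H2 and C="K * E" and r="2 * \<bar>r\<bar> * M"])
    show "\<bar>c m s\<bar> \<le> 1" "\<bar>c' m s\<bar> \<le> 1" for m s by (auto simp: c_def c'_def)
    show "\<bar>H \<zeta>\<bar> \<le> K * E * growth (2 * \<bar>r\<bar> * M) \<zeta>" for \<zeta>
      using growthH[of 1 \<zeta>] nnE HP[of \<zeta>] by (simp add: E_def)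
    show "\<bar>H1 i \<zeta>\<bar> \<le> K * E * growth (2 * \<bar>r\<bar> * M) \<zeta>" if "i \<in> I" for i \<zeta>
    proof -
      have "\<bar>r\<bar> * \<bar>L i \<zeta>\<bar> \<le> \<bar>r\<bar> * (2 * M)" by (intro mult_left_mono L_le that) auto
      then have "\<bar>r * L i \<zeta>\<bar> \<le> E" unfolding E_def abs_mult using nnE by linarith
      then have "H \<zeta> * \<bar>r * L i \<zeta>\<bar> \<le> K * E * growth (2 * \<bar>r\<bar> * M) \<zeta>"
        by (intro growthH) auto
      then show ?thesis using HP[of \<zeta>] by (simp add: H1_def abs_mult)
    qed
    show "\<bar>H2 i \<zeta>\<bar> \<le> K * E * growth (2 * \<bar>r\<bar> * M) \<zeta>" if "i \<in> I" for i \<zeta>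
    proof -
      have "(L i \<zeta>)\<^sup>2 \<le> (2 * M)\<^sup>2" using power_mono[OF L_le[OF that, of \<zeta>], of 2] by simp
      then have "r\<^sup>2 * (L i \<zeta>)\<^sup>2 \<le> r\<^sup>2 * (2 * M)\<^sup>2" by (intro mult_left_mono) auto
      moreover have "\<bar>r\<bar> * b * \<bar>Q i \<zeta>\<bar> \<le> \<bar>r\<bar> * b * (2 * M\<^sup>2)" using b_pos by (intro mult_left_mono Q_le that) auto
      ultimately have "\<bar>r\<^sup>2 * (L i \<zeta>)\<^sup>2 + r * b * Q i \<zeta>\<bar> \<le> E"
        using nnE order.trans[OF abs_triangle_ineq, of "r\<^sup>2 * (L i \<zeta>)\<^sup>2" "r * b * Q i \<zeta>" "r\<^sup>2 * (L i \<zeta>)\<^sup>2 + \<bar>r\<bar> * b * \<bar>Q i \<zeta>\<bar>"] b_pos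
        unfolding E_def by (simp only: abs_mult abs_power2 abs_of_pos[OF b_pos]) linarith
      then have "H \<zeta> * \<bar>r\<^sup>2 * (L i \<zeta>)\<^sup>2 + r * b * Q i \<zeta>\<bar> \<le> K * E * growth (2 * \<bar>r\<bar> * M) \<zeta>"
        by (intro growthH) auto
      then show ?thesis using HP[of \<zeta>] by (simp add: H2_def abs_mult)
    qed
    show "0 \<le> 2 * \<bar>r\<bar> * M" using M by simp
    show "((\<lambda>s. H (\<lambda>m. c m s * \<xi> m)) has_real_derivative (\<Sum>m\<in>I. c' m s * \<xi> m * H1 m (\<lambda>m. c m s * \<xi> m))) (at s)" for \<xi> s
    proof -
      have d: "((\<lambda>s. c m s * \<xi> m * y) has_real_derivative c' m s * \<xi> m * y) (at s)" for m y
        by (cases "m mod 3 = 2") (auto simp: c_def c'_def intro!: derivative_eq_intros)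
      have "((\<lambda>s. X (\<lambda>m. c m s * \<xi> m) j) has_real_derivative (\<Sum>m\<in>I. (c' m s * \<xi> m) * v m j)) (at s)"
        "((\<lambda>s. Y (\<lambda>m. c m s * \<xi> m) j) has_real_derivative (\<Sum>m\<in>I. (c' m s * \<xi> m) * w m j)) (at s)" for j
        unfolding X_def Y_def by (auto intro!: DERIV_sum d)
      note D = DERIV_F[OF this(1)] DERIV_F[OF this(2)]
      have "((\<lambda>s. H (\<lambda>m. c m s * \<xi> m)) has_real_derivative
         H (\<lambda>m. c m s * \<xi> m) * (r * (avg (X (\<lambda>m. c m s * \<xi> m)) (\<lambda>j. \<Sum>m\<in>I. (c' m s * \<xi> m) * v m j)
            - avg (Y (\<lambda>m. c m s * \<xi> m)) (\<lambda>j. \<Sum>m\<in>I. (c' m s * \<xi> m) * w m j)))) (at s)"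
        unfolding H_def by (rule DERIV_fun_exp[THEN DERIV_cong]) (auto intro!: derivative_eq_intros D)
      then show ?thesis
        unfolding H1_def L_def avg_sum avg_cmult sum_subtractf[symmetric] sum_distrib_left
        by (simp add: algebra_simps)
    qed
    fix i \<zeta> assume i: "i \<in> I"
    define x0 where "x0 = X (\<zeta>(i := 0))"
    define y0 where "y0 = Y (\<zeta>(i := 0))"
    have X: "X (\<zeta>(i := x)) = (\<lambda>j. x0 j + x * v i j)" and Y: "Y (\<zeta>(i := x)) = (\<lambda>j. y0 j + x * w i j)" for x
      unfolding X_def Y_def x0_def y0_def using linear_form_update[OF fin i, of \<zeta> x] by auto
    have line: "((\<lambda>s. z0 j + s * z j) has_real_derivative z j) (at s)" for z0 z :: "nat \<Rightarrow> real" and j s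
      by (auto intro!: derivative_eq_intros)
    have DH: "((\<lambda>x. H (\<zeta>(i := x))) has_real_derivative H1 i (\<zeta>(i := x))) (at x)" for x
      unfolding H_def H1_def L_def X Y
      by (rule DERIV_fun_exp[THEN DERIV_cong]) (auto intro!: derivative_eq_intros DERIV_F line)
    have DL: "((\<lambda>x. L i (\<zeta>(i := x))) has_real_derivative b * Q i (\<zeta>(i := x))) (at x)" for x
      unfolding L_def Q_def X Y
      by (rule DERIV_diff[OF DERIV_avg[OF line] DERIV_avg[OF line], THEN DERIV_cong]) (simp add: power2_eq_square algebra_simps)
    show "((\<lambda>x. H1 i (\<zeta>(i := x))) has_real_derivative H2 i (\<zeta>(i := x))) (at x)" for x
      unfolding H1_def
      by (rule DERIV_mult[OF DH DERIV_cmult[OF DL], THEN DERIV_cong])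
         (simp add: H1_def H2_def power2_eq_square algebra_simps)
    have "isCont (\<lambda>x. Q i (\<zeta>(i := x))) x" for x
      unfolding Q_def X Y by (intro continuous_intros isCont_avg_line)
    then show "continuous_on UNIV (\<lambda>x. H2 i (\<zeta>(i := x)))"
      unfolding H2_def by (intro continuous_at_imp_continuous_on ballI continuous_intros DERIV_isCont[OF DH] DERIV_isCont[OF DL])
  next
    fix \<alpha> :: "nat \<Rightarrow> real" and i
    show "(\<lambda>\<xi>. H (\<lambda>m. \<alpha> m * \<xi> m)) \<in> borel_measurable (PiM I (\<lambda>_. std_normal_distribution))"
      "(\<lambda>\<xi>. H1 i (\<lambda>m. \<alpha> m * \<xi> m)) \<in> borel_measurable (PiM I (\<lambda>_. std_normal_distribution))"
      "(\<lambda>\<xi>. H2 i (\<lambda>m. \<alpha> m * \<xi> m)) \<in> borel_measurable (PiM I (\<lambda>_. std_normal_distribution))"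
      unfolding H1_def H2_def H_def L_def Q_def I_def P_def[symmetric] by measurable
  qed
  have intH: "integrable P (\<lambda>\<xi>. H (\<lambda>m. c m s * \<xi> m))" for s
    unfolding P_def I_def[symmetric]
  proof (rule integrable_of_growth[where C=K and c="2 * \<bar>r\<bar> * M"])
    show "(\<lambda>\<xi>. H (\<lambda>m. c m s * \<xi> m)) \<in> borel_measurable (PiM I (\<lambda>_. std_normal_distribution))"
      unfolding H_def I_def P_def[symmetric] by measurable
    fix \<xi> :: "nat \<Rightarrow> real"
    have "H (\<lambda>m. c m s * \<xi> m) \<le> K * growth (2 * \<bar>r\<bar> * M) (\<lambda>m. c m s * \<xi> m)" by (rule H_le)
    also have "\<dots> \<le> K * growth (2 * \<bar>r\<bar> * M) \<xi>"
      using M by (intro growth_scale) (auto simp: c_def K_def)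
    finally show "\<bar>H (\<lambda>m. c m s * \<xi> m)\<bar> \<le> K * growth (2 * \<bar>r\<bar> * M) \<xi>"
      using HP[of "\<lambda>m. c m s * \<xi> m"] by simp
  qed
  \<comment> \<open>The three indices of a triple have the factors sin cos, sin cos and - sin cos.
    Hence the \<open>Q\<close> terms cancel, and with x and y the two averages of \<open>a m\<close>
    the squares leave x^2 + y^2 - (x - y)^2 = 2 x y.\<close>
  have pointwise: "(\<Sum>i\<in>I. c' i s * c i s * 1 * H2 i \<zeta>) = 2 * sin s * cos s * r\<^sup>2 * H \<zeta> * (\<Sum>m<q. avg (X \<zeta>) (a m) * avg (Y \<zeta>) (a m))" for s \<zeta>
  proof -
    have z: "avg x (\<lambda>j. 0) = 0" for x by (simp add: avg_const)
    have m3: "Suc (Suc (3 * m)) mod 3 = 2" "Suc (3 * m) mod 3 = 1" "(3 * m) mod 3 = 0" "Suc (Suc (3 * m)) div 3 = m" "Suc (3 * m) div 3 = m" for m :: nat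
      by presburger+
    have e: "v (3 * m) = a m" "v (3 * m + 1) = (\<lambda>_. 0)" "v (3 * m + 2) = a m"
      "w (3 * m) = (\<lambda>_. 0)" "w (3 * m + 1) = a m" "w (3 * m + 2) = a m"
      "c (3 * m) s = sin s" "c (3 * m + 1) s = sin s" "c (3 * m + 2) s = cos s"
      "c' (3 * m) s = cos s" "c' (3 * m + 1) s = cos s" "c' (3 * m + 2) s = - sin s" for m
      by (auto simp: v_def[abs_def] w_def[abs_def] c_def c'_def m3 fun_eq_iff)
    show ?thesis
      unfolding I_def sum_lessThan_triple sum_distrib_left H2_def L_def Q_def e z
      by (intro sum.cong) (auto simp: z power2_eq_square algebra_simps)
  qed
  \<comment> \<open>Jensen bounds the squared averages by the variances, and 2 x y <= x^2 + y^2
    splits the mixed product.\<close>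
  have kappa: "(\<Sum>m<q. avg x (a m) * avg y (a m)) \<le> \<sigma>2" for x y
  proof -
    have s1: "(\<Sum>m<q. (avg x (a m))\<^sup>2) \<le> \<sigma>2" for x
    proof -
      have "(\<Sum>m<q. (avg x (a m))\<^sup>2) \<le> (\<Sum>m<q. avg x (\<lambda>j. (a m j)\<^sup>2))" by (intro sum_mono avg_power2_le)
      also have "\<dots> = avg x (\<lambda>j. \<Sum>m<q. (a m j)\<^sup>2)" by (simp add: avg_sum)
      also have "\<dots> \<le> \<sigma>2" by (intro avg_le var)
      finally show ?thesis .
    qed
    have "(\<Sum>m<q. avg x (a m) * avg y (a m)) \<le> (\<Sum>m<q. ((avg x (a m))\<^sup>2 + (avg y (a m))\<^sup>2) / 2)"
    proof (intro sum_mono)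
      fix m
      have "0 \<le> (avg x (a m) - avg y (a m))\<^sup>2" by simp
      then show "avg x (a m) * avg y (a m) \<le> ((avg x (a m))\<^sup>2 + (avg y (a m))\<^sup>2) / 2"
        by (simp add: power2_eq_square algebra_simps)
    qed
    also have "\<dots> = ((\<Sum>m<q. (avg x (a m))\<^sup>2) + (\<Sum>m<q. (avg y (a m))\<^sup>2)) / 2"
      by (simp add: sum.distrib flip: sum_divide_distrib)
    also have "\<dots> \<le> (\<sigma>2 + \<sigma>2) / 2" by (intro divide_right_mono add_mono s1) simp
    finally show ?thesis by simp
  qed
  have ineq: "\<phi>' s \<le> 2 * sin s * cos s * r\<^sup>2 * \<sigma>2 * \<phi> s" if s: "0 \<le> s" "s \<le> pi / 2" for s
  proof -
    have sc: "0 \<le> 2 * sin s * cos s * r\<^sup>2" using s sin_ge_zero[of s] cos_ge_zero[of s] by simp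
    have le: "(\<Sum>m\<in>I. c' m s * c m s * 1 * H2 m (\<lambda>m. c m s * \<xi> m)) \<le> 2 * sin s * cos s * r\<^sup>2 * \<sigma>2 * H (\<lambda>m. c m s * \<xi> m)" for \<xi>
    proof -
      have "2 * sin s * cos s * r\<^sup>2 * H \<zeta> * (\<Sum>m<q. avg (X \<zeta>) (a m) * avg (Y \<zeta>) (a m)) \<le> 2 * sin s * cos s * r\<^sup>2 * H \<zeta> * \<sigma>2" for \<zeta>
        using sc HP[of \<zeta>] by (intro mult_left_mono kappa) auto
      then show ?thesis
        unfolding pointwise by (rule order.trans) (rule eq_refl, simp)
    qed
    show ?thesis
    \<comment> \<open>A non-integrable function has integral 0 by convention, so in that case only
      the sign of the right-hand side matters.\<close>
    proof (cases "integrable P (\<lambda>\<xi>. \<Sum>m\<in>I. c' m s * c m s * 1 * H2 m (\<lambda>m. c m s * \<xi> m))")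
      case True
      have "\<phi>' s \<le> (\<integral>\<xi>. 2 * sin s * cos s * r\<^sup>2 * \<sigma>2 * H (\<lambda>m. c m s * \<xi> m) \<partial>P)"
        unfolding \<phi>'_def using le intH by (intro integral_mono True) auto
      then show ?thesis by (simp add: \<phi>_def)
    next
      case False
      have "\<phi> s \<ge> 0" unfolding \<phi>_def using HP by (intro integral_nonneg_AE AE_I2) (simp add: less_imp_le)
      moreover have "0 \<le> \<sigma>2"
      proof -
        obtain j where "j \<in> J" using J_ne by auto
        then show ?thesis by (intro order.trans[OF sum_nonneg var]) auto
      qed
      moreover have "\<phi>' s = 0" unfolding \<phi>'_def by (rule not_integrable_integral_eq[OF False])
      ultimately show ?thesis using mult_nonneg_nonneg[OF mult_nonneg_nonneg[OF sc], of \<sigma>2 "\<phi> s"] by simp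
    qed
  qed
  \<comment> \<open>Gronwall: the integrating factor for the rate 2 sin s cos s is the exponential
    of sin^2 s.\<close>
  define \<psi> where "\<psi> s = \<phi> s * exp (- (r\<^sup>2 * \<sigma>2 * (sin s)\<^sup>2))" for s
  have "\<psi> (pi / 2) \<le> \<psi> 0"
  proof (rule DERIV_nonpos_imp_nonincreasing[where f=\<psi>])
    fix s assume s: "0 \<le> s" "s \<le> pi / 2"
    have "(\<psi> has_real_derivative (\<phi>' s - 2 * sin s * cos s * r\<^sup>2 * \<sigma>2 * \<phi> s) * exp (- (r\<^sup>2 * \<sigma>2 * (sin s)\<^sup>2))) (at s)"
      unfolding \<psi>_def[abs_def]
    proof -
      have "((\<lambda>s. exp (- (r\<^sup>2 * \<sigma>2 * (sin s)\<^sup>2))) has_real_derivative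
          exp (- (r\<^sup>2 * \<sigma>2 * (sin s)\<^sup>2)) * (- (r\<^sup>2 * \<sigma>2 * (2 * sin s * cos s)))) (at s)"
        by (auto intro!: derivative_eq_intros)
      then show "((\<lambda>s. \<phi> s * exp (- (r\<^sup>2 * \<sigma>2 * (sin s)\<^sup>2))) has_real_derivative
          (\<phi>' s - 2 * sin s * cos s * r\<^sup>2 * \<sigma>2 * \<phi> s) * exp (- (r\<^sup>2 * \<sigma>2 * (sin s)\<^sup>2))) (at s)"
        by (rule DERIV_mult[OF deriv, THEN DERIV_cong]) (simp add: algebra_simps)
    qed
    moreover have "(\<phi>' s - 2 * sin s * cos s * r\<^sup>2 * \<sigma>2 * \<phi> s) * exp (- (r\<^sup>2 * \<sigma>2 * (sin s)\<^sup>2)) \<le> 0"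
      using ineq[OF s] by (intro mult_nonpos_nonneg) auto
    ultimately show "\<exists>y. (\<psi> has_real_derivative y) (at s) \<and> y \<le> 0" by blast
  qed simp
  moreover have "\<psi> 0 = 1"
  proof -
    interpret PP: prob_space P
      unfolding P_def by (rule prob_space_PiM) (simp add: prob_space_normal_density)
    have "(\<Sum>i\<in>I. c i 0 * \<xi> i * v i j) = (\<Sum>i\<in>I. c i 0 * \<xi> i * w i j)" for \<xi> j
      by (intro sum.cong) (auto simp: c_def v_def w_def)
    then have "H (\<lambda>m. c m 0 * \<xi> m) = 1" for \<xi> by (simp add: H_def X_def Y_def)
    then show ?thesis by (simp add: \<psi>_def \<phi>_def PP.prob_space)
  qed
  ultimately have "\<phi> (pi / 2) * exp (- (r\<^sup>2 * \<sigma>2)) \<le> 1" by (simp add: \<psi>_def)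
  then have le: "\<phi> (pi / 2) \<le> exp (r\<^sup>2 * \<sigma>2)" by (simp add: exp_minus field_simps)
  have XY: "X (\<lambda>m. c m (pi / 2) * \<xi> m) = (\<lambda>j. \<Sum>m<q. \<xi> (3 * m) * a m j)"
    "Y (\<lambda>m. c m (pi / 2) * \<xi> m) = (\<lambda>j. \<Sum>m<q. \<xi> (3 * m + 1) * a m j)" for \<xi>
  proof -
    have m3: "Suc (Suc (3 * m)) mod 3 = 2" "Suc (3 * m) mod 3 = 1" "(3 * m) mod 3 = 0" "Suc (3 * m) div 3 = m" for m :: nat
      by presburger+
    show "X (\<lambda>m. c m (pi / 2) * \<xi> m) = (\<lambda>j. \<Sum>m<q. \<xi> (3 * m) * a m j)"
      "Y (\<lambda>m. c m (pi / 2) * \<xi> m) = (\<lambda>j. \<Sum>m<q. \<xi> (3 * m + 1) * a m j)"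
      unfolding X_def Y_def I_def sum_lessThan_triple by (simp_all add: c_def v_def w_def m3)
  qed
  show "(\<integral>\<xi>. exp (r * (F (\<lambda>j. \<Sum>m<q. \<xi> (3 * m) * a m j) - F (\<lambda>j. \<Sum>m<q. \<xi> (3 * m + 1) * a m j))) \<partial>P)
    \<le> exp (r\<^sup>2 * \<sigma>2)"
    using le unfolding \<phi>_def H_def XY .
  show "integrable P (\<lambda>\<xi>. exp (r * (F (\<lambda>j. \<Sum>m<q. \<xi> (3 * m) * a m j) - F (\<lambda>j. \<Sum>m<q. \<xi> (3 * m + 1) * a m j))))"
    using intH[of "pi / 2"] unfolding H_def XY .
qed

lemma integrable_exp_softmax:
  fixes g :: "nat \<Rightarrow> nat \<Rightarrow> real"
  assumes fin: "finite I"
  shows "integrable (PiM I (\<lambda>_. std_normal_distribution)) (\<lambda>\<xi>. exp (r * F (\<lambda>j. \<Sum>m\<in>I. \<xi> m * g m j)))"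
proof -
  interpret stein_product I "\<lambda>_. std_normal_distribution" "\<lambda>_ _. 1"
    by standard (use fin std_normal_stein in auto)
  obtain M where M: "M \<ge> 0" "\<And>m j. m \<in> I \<Longrightarrow> j \<in> J \<Longrightarrow> \<bar>g m j\<bar> \<le> M"
    using entries_bounded[OF fin finJ] by blast
  show ?thesis
  proof (rule integrable_of_growth[where C="exp (\<bar>r\<bar> * (ln (card J) / b))" and c="\<bar>r\<bar> * M"])
    have comp [measurable]: "m \<in> I \<Longrightarrow> (\<lambda>\<xi>. \<xi> m) \<in> borel_measurable (PiM I (\<lambda>_. std_normal_distribution))" for m
      using measurable_component_singleton[of m I "\<lambda>_. std_normal_distribution"] by simp
    have [measurable]: "(\<lambda>\<xi>. F (\<lambda>j. \<Sum>m\<in>I. \<xi> m * g m j)) \<in> borel_measurable (PiM I (\<lambda>_. std_normal_distribution))"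
      by (intro F_measurable) measurable
    show "(\<lambda>\<xi>. exp (r * F (\<lambda>j. \<Sum>m\<in>I. \<xi> m * g m j))) \<in> borel_measurable (PiM I (\<lambda>_. std_normal_distribution))"
      by measurable
    fix \<xi> :: "nat \<Rightarrow> real"
    have "\<bar>F (\<lambda>j. \<Sum>m\<in>I. \<xi> m * g m j)\<bar> \<le> M * (\<Sum>i\<in>I. \<bar>\<xi> i\<bar>) + ln (card J) / b"
      by (intro F_abs_le abs_linear_form_le M)
    then have "\<bar>r\<bar> * \<bar>F (\<lambda>j. \<Sum>m\<in>I. \<xi> m * g m j)\<bar> \<le> \<bar>r\<bar> * (M * (\<Sum>i\<in>I. \<bar>\<xi> i\<bar>) + ln (card J) / b)"
      by (intro mult_left_mono) auto
    then have "r * F (\<lambda>j. \<Sum>m\<in>I. \<xi> m * g m j) \<le> \<bar>r\<bar> * (M * (\<Sum>i\<in>I. \<bar>\<xi> i\<bar>) + ln (card J) / b)"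
      by (rule order.trans[OF order.trans[OF abs_ge_self eq_refl[OF abs_mult]]])
    then have "exp (r * F (\<lambda>j. \<Sum>m\<in>I. \<xi> m * g m j)) \<le> exp (\<bar>r\<bar> * (M * (\<Sum>i\<in>I. \<bar>\<xi> i\<bar>) + ln (card J) / b))" by simp
    also have "\<dots> = exp (\<bar>r\<bar> * (ln (card J) / b)) * growth (\<bar>r\<bar> * M) \<xi>"
      unfolding growth_def mult_exp_exp by (simp add: algebra_simps)
    finally show "\<bar>exp (r * F (\<lambda>j. \<Sum>m\<in>I. \<xi> m * g m j))\<bar> \<le> exp (\<bar>r\<bar> * (ln (card J) / b)) * growth (\<bar>r\<bar> * M) \<xi>"
      by simp
  qed
qed

end

section \<open>Uniqueness of characteristic functions on R^p and factorisation of
  covariances\<close>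

section \<open>Centered Gaussian laws as linear images of standard Gaussian vectors\<close>

text \<open>After division by its total mass, \<open>f\<close> is a density under which
  \<open>X\<close> has the same characteristic function for \<open>M\<close> and \<open>N\<close>,
  so the one-dimensional uniqueness theorem applies. If the mass is 0 then \<open>f\<close> vanishes
  almost everywhere. The bound 2 fits the weights 1 + cos used next.\<close>

lemma weighted_char_uniqueness:
  fixes f X :: "'a \<Rightarrow> real"
  assumes M: "prob_space M" and N: "prob_space N" and sets: "sets N = sets M"
    and f [measurable]: "f \<in> borel_measurable M" and X [measurable]: "X \<in> borel_measurable M"
    and fb: "\<And>z. 0 \<le> f z" "\<And>z. f z \<le> 2"
    and eq: "\<And>t. (\<integral>z. complex_of_real (f z) * iexp (t * X z) \<partial>M) = (\<integral>z. complex_of_real (f z) * iexp (t * X z) \<partial>N)"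
    and A [measurable]: "A \<in> sets borel"
  shows "(\<integral>z. f z * indicator A (X z) \<partial>M) = (\<integral>z. f z * indicator A (X z) \<partial>N)"
proof -
  interpret M: prob_space M by fact
  interpret N: prob_space N by fact
  note sets [measurable_cong]
  have iM: "integrable M f" by (rule M.integrable_const_bound[where B=2]) (use fb in auto)
  have iN: "integrable N f" by (rule N.integrable_const_bound[where B=2]) (use fb in auto)
  define T where "T = (\<integral>z. f z \<partial>M)"
  have "complex_of_real (\<integral>z. f z \<partial>M) = complex_of_real (\<integral>z. f z \<partial>N)"
    using eq[of 0] iM iN by simp
  then have TN: "(\<integral>z. f z \<partial>N) = T" by (simp add: T_def)
  have T0: "T \<ge> 0" unfolding T_def using fb by (intro integral_nonneg_AE) auto
  have key: "\<exists>D. real_distribution D \<and> char D = (\<lambda>t. (\<integral>z. complex_of_real (f z) * iexp (t * X z) \<partial>L) / T)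
      \<and> measure D A = (\<integral>z. f z * indicator A (X z) \<partial>L) / T"
    if T: "T > 0" and L: "prob_space L" and [measurable_cong]: "sets L = sets M" and TL: "(\<integral>z. f z \<partial>L) = T" and iL: "integrable L f" for L
  proof -
    interpret L: prob_space L by fact
    define D0 where "D0 = density L (\<lambda>z. ennreal (f z / T))"
    have [measurable_cong]: "sets D0 = sets M" by (simp add: D0_def that(3))
    have "emeasure D0 (space D0) = (\<integral>\<^sup>+z. ennreal (f z / T) \<partial>L)"
      unfolding D0_def by (subst emeasure_density) (auto intro!: nn_integral_cong)
    also have "\<dots> = ennreal (\<integral>z. f z / T \<partial>L)"
      using iL T fb by (intro nn_integral_eq_integral) auto
    also have "\<dots> = 1" using TL T by simp
    finally interpret D0: prob_space D0 by (rule prob_spaceI)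
    define D where "D = distr D0 borel X"
    have X0 [measurable]: "X \<in> borel_measurable D0" by measurable
    have rd: "real_distribution D" unfolding D_def by (rule D0.real_distribution_distr) measurable
    have "char D t = (\<integral>z. complex_of_real (f z) * iexp (t * X z) \<partial>L) / T" for t
    proof -
      have "char D t = (\<integral>z. iexp (t * X z) \<partial>D0)"
        unfolding char_def D_def by (subst integral_distr) auto
      also have "\<dots> = (\<integral>z. (f z / T) *\<^sub>R iexp (t * X z) \<partial>L)"
        unfolding D0_def using fb T by (subst integral_density) auto
      also have "\<dots> = (\<integral>z. complex_of_real (f z) * iexp (t * X z) / T \<partial>L)"
        by (intro Bochner_Integration.integral_cong) (auto simp: scaleR_conv_of_real)
      finally show ?thesis by simp
    qed
    moreover have "measure D A = (\<integral>z. f z * indicator A (X z) \<partial>L) / T"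
    proof -
      interpret D: real_distribution D by (rule rd)
      have "measure D A = (\<integral>x. indicator A x \<partial>D)" using D.emeasure_finite by (simp add: D_def)
      also have "\<dots> = (\<integral>z. indicator A (X z) \<partial>D0)" unfolding D_def by (subst integral_distr) auto
      also have "\<dots> = (\<integral>z. (f z / T) *\<^sub>R indicator A (X z) \<partial>L)"
        unfolding D0_def using fb T by (subst integral_density) auto
      also have "\<dots> = (\<integral>z. f z * indicator A (X z) / T \<partial>L)" by simp
      finally show ?thesis by simp
    qed
    ultimately show ?thesis using rd by blast
  qed
  show ?thesis
  proof (cases "T = 0")
    case True
    have "(\<integral>z. f z * indicator A (X z) \<partial>L) = 0" if "integrable L f" "(\<integral>z. f z \<partial>L) = 0" "sets L = sets M" for L
    proof -
      have "AE z in L. f z = 0" using that fb by (subst integral_nonneg_eq_0_iff_AE[symmetric]) auto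
      then show ?thesis by (intro integral_eq_zero_AE) auto
    qed
    from this[OF iM] this[OF iN] show ?thesis using True TN sets by (simp add: T_def)
  next
    case False
    then have T: "T > 0" using T0 by simp
    obtain D where D: "real_distribution D" "char D = (\<lambda>t. (\<integral>z. complex_of_real (f z) * iexp (t * X z) \<partial>M) / T)"
      "measure D A = (\<integral>z. f z * indicator A (X z) \<partial>M) / T"
      using key[OF T M refl] iM by (auto simp: T_def)
    obtain E where E: "real_distribution E" "char E = (\<lambda>t. (\<integral>z. complex_of_real (f z) * iexp (t * X z) \<partial>N) / T)"
      "measure E A = (\<integral>z. f z * indicator A (X z) \<partial>N) / T"
      using key[OF T N sets TN iN] by auto
    have "char D = char E" unfolding D(2) E(2) eq ..
    then have "D = E" by (rule Levy_uniqueness[OF D(1) E(1)])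
    then show ?thesis using D(3) E(3) T by simp
  qed
qed

text \<open>Reduction to dimension one by converting coordinates one at a time. The inductive claim
  has indicators of Borel sets in the first \<open>k\<close> coordinates and a complex exponential
  in the rest; for k = p it says that both measures agree on boxes, which generate the product
  sigma-algebra.\<close>

theorem char_uniqueness_euclid:
  assumes M: "prob_space M" and N: "prob_space N"
    and setsM: "sets M = sets (euclid p)" and setsN: "sets N = sets (euclid p)"
    and eq: "\<And>a :: nat \<Rightarrow> real. (\<integral>z. iexp (\<Sum>j=1..p. a j * z j) \<partial>M) = (\<integral>z. iexp (\<Sum>j=1..p. a j * z j) \<partial>N)"
  shows "M = N"
proof -
  interpret M: prob_space M by fact
  interpret N: prob_space N by fact
  note setsM [measurable_cong] setsN [measurable_cong]
  have comp [measurable]: "j \<in> {1..p} \<Longrightarrow> (\<lambda>z. z j) \<in> borel_measurable (euclid p)" for j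
    by (rule measurable_component_singleton)
  define W where "W k A z = (\<Prod>j=1..k. indicator (A j) (z j) :: real)" for k and A :: "nat \<Rightarrow> real set" and z
  have W_meas: "W k A \<in> borel_measurable (euclid p)" if "k \<le> p" "\<And>j. A j \<in> sets borel" for k A
    unfolding W_def[abs_def]
  proof (rule borel_measurable_prod)
    fix j assume "j \<in> {1..k}"
    with that have [measurable]: "(\<lambda>z. z j) \<in> borel_measurable (euclid p)" "A j \<in> sets borel" by auto
    show "(\<lambda>z. indicator (A j) (z j) :: real) \<in> borel_measurable (euclid p)" by measurable
  qed
  have W01: "0 \<le> W k A z" "W k A z \<le> 1" for k A z
    unfolding W_def by (auto intro!: prod_nonneg prod_le_1)
  have "(\<integral>z. complex_of_real (W k A z) * iexp (\<Sum>j=Suc k..p. a j * z j) \<partial>M)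
      = (\<integral>z. complex_of_real (W k A z) * iexp (\<Sum>j=Suc k..p. a j * z j) \<partial>N)"
    if "k \<le> p" "\<And>j. A j \<in> sets borel" for k A a
    using that
  proof (induction k arbitrary: A a)
    case 0
    then show ?case using eq[of a] by (simp add: W_def)
  next
    case (Suc k)
    define S where "S z = (\<Sum>j=Suc (Suc k)..p. a j * z j)" for z :: "nat \<Rightarrow> real"
    have kp: "Suc k \<in> {1..p}" using Suc by auto
    have [measurable]: "(\<lambda>z. z (Suc k)) \<in> borel_measurable (euclid p)" by (rule comp[OF kp])
    note Suc.prems(2)[measurable]
    have [measurable]: "W k A \<in> borel_measurable (euclid p)" using Suc by (intro W_meas) auto
    have [measurable]: "S \<in> borel_measurable (euclid p)" unfolding S_def[abs_def] by measurable
    have IH: "(\<integral>z. complex_of_real (W k A z) * iexp (t * z (Suc k) + s * S z) \<partial>M)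
        = (\<integral>z. complex_of_real (W k A z) * iexp (t * z (Suc k) + s * S z) \<partial>N)" for t s
    proof -
      define a' where "a' j = (if j = Suc k then t else s * a j)" for j
      have "(\<Sum>j=Suc k..p. a' j * z j) = t * z (Suc k) + s * S z" for z
      proof -
        have "(\<Sum>j=Suc k..p. a' j * z j) = a' (Suc k) * z (Suc k) + (\<Sum>j=Suc (Suc k)..p. a' j * z j)"
          using kp by (subst sum.atLeast_Suc_atMost) auto
        also have "(\<Sum>j=Suc (Suc k)..p. a' j * z j) = s * S z"
          unfolding S_def sum_distrib_left by (intro sum.cong) (auto simp: a'_def)
        finally show ?thesis by (simp add: a'_def)
      qed
      then show ?thesis using Suc.IH[of A a'] Suc.prems by simp
    qed
    have intc: "integrable L (\<lambda>z. complex_of_real (W k A z) * g z)"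
      if "prob_space L" "sets L = sets (euclid p)" "g \<in> borel_measurable (euclid p)" "\<And>z. norm (g z) \<le> 1" for L g
    proof -
      interpret L: prob_space L by fact
      note that(2)[measurable_cong] that(3)[measurable]
      show ?thesis
      proof (rule L.integrable_const_bound[where B=1])
        show "AE z in L. norm (complex_of_real (W k A z) * g z) \<le> 1"
          using W01 that(4) by (intro AE_I2) (simp add: norm_mult mult_le_one)
      qed measurable
    qed
    \<comment> \<open>The exponential of the untreated coordinates is not a nonnegative weight, but
      1 + d cos(S + c) is. Its product with an exponential in coordinate k + 1 is a combination of
      three exponentials, to which the induction hypothesis applies.\<close>
    have cosint: "(\<integral>z. (W k A z * (1 + d * cos (S z + c))) * indicator (A (Suc k)) (z (Suc k)) \<partial>M)
        = (\<integral>z. (W k A z * (1 + d * cos (S z + c))) * indicator (A (Suc k)) (z (Suc k)) \<partial>N)" if d: "\<bar>d\<bar> \<le> 1" for c d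
    proof (rule weighted_char_uniqueness[OF M N])
      show "sets N = sets M" using setsM setsN by simp
      have dc: "\<bar>d * cos y\<bar> \<le> 1" for y using d abs_cos_le_one[of y] by (simp add: abs_mult mult_le_one)
      show "0 \<le> W k A z * (1 + d * cos (S z + c))" for z
        using dc[of "S z + c"] W01 by (intro mult_nonneg_nonneg) auto
      have "W k A z * (1 + d * cos (S z + c)) \<le> 1 * 2" for z
        using dc[of "S z + c"] W01 by (intro mult_mono) auto
      then show "W k A z * (1 + d * cos (S z + c)) \<le> 2" for z by simp
      fix t
      define E where "E s z = complex_of_real (W k A z) * iexp (t * z (Suc k) + s * S z)" for s z
      have e: "complex_of_real (W k A z * (1 + d * cos (S z + c))) * iexp (t * z (Suc k))
          = E 0 z + (d * exp (\<i> * c) / 2) * E 1 z + (d * exp (- \<i> * c) / 2) * E (-1) z" for z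
      proof -
        have "complex_of_real (cos (S z + c)) = (exp (\<i> * c) * exp (\<i> * S z) + exp (- \<i> * c) * exp (- \<i> * S z)) / 2"
        proof -
          have "exp (\<i> * complex_of_real (S z + c)) = exp (\<i> * c) * exp (\<i> * S z)"
            "exp (- (\<i> * complex_of_real (S z + c))) = exp (- \<i> * c) * exp (- \<i> * S z)"
            unfolding exp_add[symmetric] by (rule arg_cong[where f=exp], simp add: ring_distribs)+
          then show ?thesis unfolding cos_of_real[symmetric] cos_exp_eq by simp
        qed
        moreover have "iexp (t * z (Suc k) + 0 * S z) = iexp (t * z (Suc k))"
          "iexp (t * z (Suc k) + 1 * S z) = iexp (t * z (Suc k)) * exp (\<i> * S z)"
          "iexp (t * z (Suc k) + (-1) * S z) = iexp (t * z (Suc k)) * exp (- \<i> * S z)"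
          unfolding exp_add[symmetric] by (rule arg_cong[where f=exp], simp add: ring_distribs)+
        ultimately show ?thesis
          unfolding E_def of_real_mult of_real_add of_real_1 by (simp only:) (simp only: ring_distribs times_divide_eq_left times_divide_eq_right add_divide_distrib mult_ac add_ac mult_1_left mult_1_right)
      qed
      have i: "integrable L (E s)" if "prob_space L" "sets L = sets (euclid p)" for L s
        unfolding E_def[abs_def]
      proof (rule intc[OF that])
        show "(\<lambda>z. iexp (t * z (Suc k) + s * S z)) \<in> borel_measurable (euclid p)" by measurable
      qed simp
      have lin: "(\<integral>z. E 0 z + K1 * E 1 z + K2 * E (-1) z \<partial>L) = (\<integral>z. E 0 z \<partial>L) + K1 * (\<integral>z. E 1 z \<partial>L) + K2 * (\<integral>z. E (-1) z \<partial>L)"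
        if "prob_space L" "sets L = sets (euclid p)" for L K1 K2
        using i[OF that] by simp
      show "(\<integral>z. complex_of_real (W k A z * (1 + d * cos (S z + c))) * iexp (t * z (Suc k)) \<partial>M)
        = (\<integral>z. complex_of_real (W k A z * (1 + d * cos (S z + c))) * iexp (t * z (Suc k)) \<partial>N)"
      proof -
        have EE: "(\<integral>z. E s z \<partial>M) = (\<integral>z. E s z \<partial>N)" for s unfolding E_def by (rule IH)
        show ?thesis unfolding e lin[OF M setsM] lin[OF N setsN] EE ..
      qed
    next
      show "(\<lambda>z. W k A z * (1 + d * cos (S z + c))) \<in> borel_measurable M" by measurable
      show "(\<lambda>z. z (Suc k)) \<in> borel_measurable M" by measurable
      show "A (Suc k) \<in> sets borel" by (rule Suc.prems)
    qed
    have intr: "integrable L (\<lambda>z. W k A z * g z)"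
      if "prob_space L" "sets L = sets (euclid p)" "g \<in> borel_measurable (euclid p)" "\<And>z. \<bar>g z\<bar> \<le> 1" for L and g :: "_ \<Rightarrow> real"
    proof -
      interpret L: prob_space L by fact
      note that(2)[measurable_cong] that(3)[measurable]
      show ?thesis
      proof (rule L.integrable_const_bound[where B=1])
        show "AE z in L. norm (W k A z * g z) \<le> 1"
          using W01 that(4) by (intro AE_I2) (simp add: abs_mult mult_le_one)
      qed measurable
    qed
    have i3: "integrable L (\<lambda>z. W k A z * (indicator (A (Suc k)) (z (Suc k)) * cos (S z + c)))"
      "integrable L (\<lambda>z. W k A z * indicator (A (Suc k)) (z (Suc k)))"
      if "prob_space L" "sets L = sets (euclid p)" for L c
    proof -
      have "(\<lambda>z. indicator (A (Suc k)) (z (Suc k)) * cos (S z + c) :: real) \<in> borel_measurable (euclid p)"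
        "(\<lambda>z. indicator (A (Suc k)) (z (Suc k)) :: real) \<in> borel_measurable (euclid p)" by measurable
      note m = this
      have "\<bar>indicator (A (Suc k)) (z (Suc k)) * cos (S z + c)\<bar> \<le> 1" "\<bar>indicator (A (Suc k)) (z (Suc k))\<bar> \<le> (1::real)" for z
        by (auto simp: indicator_def)
      then show "integrable L (\<lambda>z. W k A z * (indicator (A (Suc k)) (z (Suc k)) * cos (S z + c)))"
        "integrable L (\<lambda>z. W k A z * indicator (A (Suc k)) (z (Suc k)))"
        using intr[OF that m(1)] intr[OF that m(2)] by blast+
    qed
    \<comment> \<open>Subtracting the case d = 0 from the case d = 1 isolates the cosine. The phases
      0 and -pi/2 then recover the real and imaginary parts of the exponential.\<close>
    have V: "(\<integral>z. W k A z * (indicator (A (Suc k)) (z (Suc k)) * cos (S z + c)) \<partial>M)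
        = (\<integral>z. W k A z * (indicator (A (Suc k)) (z (Suc k)) * cos (S z + c)) \<partial>N)" for c
    proof -
      have e: "W k A z * (1 + 1 * cos (S z + c)) * indicator (A (Suc k)) (z (Suc k))
        = W k A z * indicator (A (Suc k)) (z (Suc k)) + W k A z * (indicator (A (Suc k)) (z (Suc k)) * cos (S z + c))" for z
        by (simp add: algebra_simps)
      show ?thesis
        using cosint[of 1 c] cosint[of 0 c] i3[OF M setsM] i3[OF N setsN]
        unfolding e by simp
    qed
    have WS: "W (Suc k) A z = W k A z * indicator (A (Suc k)) (z (Suc k))" for z
      by (simp add: W_def)
    define U where "U c z = W k A z * (indicator (A (Suc k)) (z (Suc k)) * cos (S z + c))" for c z
    have e: "complex_of_real (W (Suc k) A z) * iexp (S z)
      = complex_of_real (U 0 z) + \<i> * complex_of_real (U (- pi / 2) z)" for z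
    proof -
      have cs: "cos (y + - pi / 2) = sin y" for y using cos_diff[of y "pi / 2"] by simp
      show ?thesis unfolding WS U_def cs by (simp add: exp_Euler cos_of_real sin_of_real algebra_simps)
    qed
    have lin: "(\<integral>z. complex_of_real (U 0 z) + \<i> * complex_of_real (U (- pi / 2) z) \<partial>L)
        = complex_of_real (\<integral>z. U 0 z \<partial>L) + \<i> * complex_of_real (\<integral>z. U (- pi / 2) z \<partial>L)"
      if "prob_space L" "sets L = sets (euclid p)" for L
    proof -
      have "integrable L (U c)" for c unfolding U_def[abs_def] by (rule i3(1)[OF that])
      then show ?thesis by simp
    qed
    show ?case
    proof -
      have UV: "(\<integral>z. U c z \<partial>M) = (\<integral>z. U c z \<partial>N)" for c unfolding U_def by (rule V)
      show ?thesis unfolding S_def[symmetric] e lin[OF M setsM] lin[OF N setsN] UV ..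
    qed
  qed
  from this[of p _ "\<lambda>_. 0"] have box: "(\<integral>z. W p A z \<partial>M) = (\<integral>z. W p A z \<partial>N)" if "\<And>j. A j \<in> sets borel" for A
    using that by simp
  show "M = N"
  proof (rule measure_eqI_PiM_finite[where I="{1..p}" and M="\<lambda>_. borel" and A="\<lambda>_. space (euclid p)"])
    show "sets M = sets (PiM {1..p} (\<lambda>_. borel))" "sets N = sets (PiM {1..p} (\<lambda>_. borel))"
      using setsM setsN by auto
    fix A :: "nat \<Rightarrow> real set" assume A: "\<And>i. i \<in> {1..p} \<Longrightarrow> A i \<in> sets borel"
    define A' where "A' i = (if i \<in> {1..p} then A i else UNIV)" for i
    have A': "A' i \<in> sets borel" for i using A by (auto simp: A'_def)
    have m: "emeasure L (Pi\<^sub>E {1..p} A) = ennreal (\<integral>z. W p A' z \<partial>L)" if "prob_space L" "sets L = sets (euclid p)" for L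
    proof -
      interpret L: prob_space L by fact
      have s: "Pi\<^sub>E {1..p} A \<in> sets L" unfolding that(2) by (rule sets_PiM_I_finite) (use A in auto)
      have sp: "space L = space (euclid p)" by (rule sets_eq_imp_space_eq[OF that(2)])
      have "(\<integral>z. W p A' z \<partial>L) = (\<integral>z. indicator (Pi\<^sub>E {1..p} A) z \<partial>L)"
      proof (rule Bochner_Integration.integral_cong[OF refl])
        fix z assume "z \<in> space L"
        then have z: "z \<in> extensional {1..p}" unfolding sp by (simp add: space_PiM PiE_def)
        show "W p A' z = indicator (Pi\<^sub>E {1..p} A) z"
        proof (cases "z \<in> Pi\<^sub>E {1..p} A")
          case True
          then have "W p A' z = (\<Prod>j=1..p. 1)" unfolding W_def
            by (intro prod.cong) (auto simp: A'_def PiE_def Pi_def)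
          then show ?thesis using True by simp
        next
          case False
          then obtain j where j: "j \<in> {1..p}" "z j \<notin> A j" using z by (auto simp: PiE_def Pi_def)
          then have "indicator (A' j) (z j) = (0 :: real)" by (simp add: A'_def)
          then have "W p A' z = 0" unfolding W_def using j by (intro prod_zero) auto
          then show ?thesis using False by simp
        qed
      qed
      then show ?thesis using s by (simp add: L.emeasure_eq_measure)
    qed
    show "emeasure M (Pi\<^sub>E {1..p} A) = emeasure N (Pi\<^sub>E {1..p} A)"
      unfolding m[OF M setsM] m[OF N setsN] box[OF A'] ..
  next
    show "range (\<lambda>_::nat. space (euclid p)) \<subseteq> prod_algebra {1..p} (\<lambda>_. borel)"
      using space_in_prod_algebra[of "{1..p}" "\<lambda>_. borel"] by (auto simp: space_PiM)
  qed (auto simp: M.emeasure_eq_measure)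
qed

text \<open>Cholesky by induction on the index set: remove the rank-one part of the pivot
  \<open>i\<close> and factor the Schur complement. If the pivot is 0, semidefiniteness forces its
  whole row to be 0, and division by 0 being 0 keeps the formulas valid.\<close>

lemma psd_factorization:
  fixes \<Sigma> :: "nat \<Rightarrow> nat \<Rightarrow> real"
  assumes "finite J" "\<And>j k. j \<in> J \<Longrightarrow> k \<in> J \<Longrightarrow> \<Sigma> j k = \<Sigma> k j"
    and "\<And>t :: nat \<Rightarrow> real. 0 \<le> (\<Sum>j\<in>J. \<Sum>k\<in>J. t j * \<Sigma> j k * t k)"
  shows "\<exists>g :: nat \<Rightarrow> nat \<Rightarrow> real. \<forall>j\<in>J. \<forall>k\<in>J. (\<Sum>m\<in>J. g m j * g m k) = \<Sigma> j k"
  using assms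
proof (induction J arbitrary: \<Sigma> rule: finite_induct)
  case (insert i J)
  define s where "s = \<Sigma> i i"
  note sym = insert.prems(1)
  have expand: "(\<Sum>j\<in>insert i J. \<Sum>k\<in>insert i J. (t(i := x)) j * \<Sigma> j k * (t(i := x)) k)
      = x\<^sup>2 * s + 2 * x * (\<Sum>j\<in>J. t j * \<Sigma> i j) + (\<Sum>j\<in>J. \<Sum>k\<in>J. t j * \<Sigma> j k * t k)" for t :: "nat \<Rightarrow> real" and x
  proof -
    let ?t = "t(i := x)"
    have "(\<Sum>j\<in>insert i J. \<Sum>k\<in>insert i J. ?t j * \<Sigma> j k * ?t k)
        = x * s * x + (\<Sum>k\<in>J. x * \<Sigma> i k * ?t k) + ((\<Sum>j\<in>J. ?t j * \<Sigma> j i * x) + (\<Sum>j\<in>J. \<Sum>k\<in>J. ?t j * \<Sigma> j k * ?t k))"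
      using insert.hyps by (simp add: sum.distrib s_def)
    also have "(\<Sum>k\<in>J. x * \<Sigma> i k * ?t k) = x * (\<Sum>j\<in>J. t j * \<Sigma> i j)"
      unfolding sum_distrib_left using insert.hyps by (intro sum.cong refl) auto
    also have "(\<Sum>j\<in>J. ?t j * \<Sigma> j i * x) = x * (\<Sum>j\<in>J. t j * \<Sigma> i j)"
      unfolding sum_distrib_left
    proof (intro sum.cong refl)
      fix j assume "j \<in> J"
      then show "?t j * \<Sigma> j i * x = x * (t j * \<Sigma> i j)" using sym[of j i] insert.hyps by auto
    qed
    also have "(\<Sum>j\<in>J. \<Sum>k\<in>J. ?t j * \<Sigma> j k * ?t k) = (\<Sum>j\<in>J. \<Sum>k\<in>J. t j * \<Sigma> j k * t k)"
      using insert.hyps by (intro sum.cong refl) auto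
    finally show ?thesis by (simp add: power2_eq_square algebra_simps)
  qed
  have psd: "0 \<le> x\<^sup>2 * s + 2 * x * (\<Sum>j\<in>J. t j * \<Sigma> i j) + (\<Sum>j\<in>J. \<Sum>k\<in>J. t j * \<Sigma> j k * t k)" for t x
    unfolding expand[symmetric] by (rule insert.prems(2))
  have s0: "s \<ge> 0" using psd[of 1 "\<lambda>_. 0"] by simp
  have zero: "\<Sigma> i j = 0" if "s = 0" "j \<in> J" for j
  proof (rule ccontr)
    assume ne: "\<Sigma> i j \<noteq> 0"
    define t where "t k = (if k = j then 1 else 0 :: real)" for k
    have a: "(\<Sum>k\<in>J. t k * \<Sigma> i k) = \<Sigma> i j" and b: "(\<Sum>l\<in>J. \<Sum>k\<in>J. t l * \<Sigma> l k * t k) = \<Sigma> j j"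
    proof -
      have delta: "(\<Sum>k\<in>J. if k = j then y else 0) = y" for y :: real
        using that insert.hyps by simp
      have "(\<Sum>k\<in>J. t k * \<Sigma> i k) = (\<Sum>k\<in>J. if k = j then \<Sigma> i j else 0)"
        by (intro sum.cong) (auto simp: t_def)
      then show "(\<Sum>k\<in>J. t k * \<Sigma> i k) = \<Sigma> i j" by (simp only: delta)
      have "(\<Sum>k\<in>J. t l * \<Sigma> l k * t k) = (if l = j then \<Sigma> j j else 0)" for l
      proof -
        have "(\<Sum>k\<in>J. t l * \<Sigma> l k * t k) = (\<Sum>k\<in>J. if k = j then t l * \<Sigma> l j else 0)"
          by (intro sum.cong) (auto simp: t_def)
        then show ?thesis by (simp only: delta) (simp add: t_def)
      qed
      then show "(\<Sum>l\<in>J. \<Sum>k\<in>J. t l * \<Sigma> l k * t k) = \<Sigma> j j" by (simp only: delta)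
    qed
    \<comment> \<open>Chosen so that the quadratic form takes the value -1 at x e_i + e_j,
      contradicting semidefiniteness.\<close>
    define x where "x = - (\<Sigma> j j + 1) / (2 * \<Sigma> i j)"
    have "2 * x * \<Sigma> i j = - (\<Sigma> j j + 1)" using ne by (simp add: x_def)
    then show False using psd[of x t] unfolding a b that(1) by simp
  qed
  define \<Sigma>' where "\<Sigma>' j k = \<Sigma> j k - \<Sigma> i j * \<Sigma> i k / s" for j k
  have "\<exists>g. \<forall>j\<in>J. \<forall>k\<in>J. (\<Sum>m\<in>J. g m j * g m k) = \<Sigma>' j k"
  proof (rule insert.IH)
    show "\<Sigma>' j k = \<Sigma>' k j" if "j \<in> J" "k \<in> J" for j k
      using sym[of j k] that by (simp add: \<Sigma>'_def)
    fix t :: "nat \<Rightarrow> real"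
    define L where "L = (\<Sum>j\<in>J. t j * \<Sigma> i j)"
    have "(\<Sum>j\<in>J. \<Sum>k\<in>J. t j * \<Sigma>' j k * t k) = (\<Sum>j\<in>J. \<Sum>k\<in>J. t j * \<Sigma> j k * t k) - (\<Sum>j\<in>J. \<Sum>k\<in>J. (t j * \<Sigma> i j) * (t k * \<Sigma> i k)) / s"
    proof -
      have "t j * \<Sigma>' j k * t k = t j * \<Sigma> j k * t k - (t j * \<Sigma> i j) * (t k * \<Sigma> i k) / s" for j k
        by (simp add: \<Sigma>'_def algebra_simps)
      then show ?thesis by (simp only: sum_subtractf sum_divide_distrib)
    qed
    also have "(\<Sum>j\<in>J. \<Sum>k\<in>J. (t j * \<Sigma> i j) * (t k * \<Sigma> i k)) = L * L"
      by (simp add: L_def sum_product)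
    \<comment> \<open>The Schur complement evaluates the original form at the vector extended by the
      minimising pivot entry -L/s.\<close>
    also have "(\<Sum>j\<in>J. \<Sum>k\<in>J. t j * \<Sigma> j k * t k) - L * L / s
       = (- L / s)\<^sup>2 * s + 2 * (- L / s) * L + (\<Sum>j\<in>J. \<Sum>k\<in>J. t j * \<Sigma> j k * t k)"
    proof -
      have "- (L * L / s) = (- L / s)\<^sup>2 * s + 2 * (- L / s) * L" if "s \<noteq> 0"
        using that by (simp add: power2_eq_square field_simps)
      then show ?thesis by (cases "s = 0") auto
    qed
    also have "\<dots> \<ge> 0" using psd[of "- L / s" t] by (simp add: L_def)
    finally show "0 \<le> (\<Sum>j\<in>J. \<Sum>k\<in>J. t j * \<Sigma>' j k * t k)" .
  qed
  then obtain g where g: "\<And>j k. j \<in> J \<Longrightarrow> k \<in> J \<Longrightarrow> (\<Sum>m\<in>J. g m j * g m k) = \<Sigma>' j k" by blast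
  define g' where "g' m j = (if m = i then \<Sigma> i j / sqrt s else if j = i then 0 else g m j)" for m j
  have "(\<Sum>m\<in>insert i J. g' m j * g' m k) = \<Sigma> j k" if j: "j \<in> insert i J" and k: "k \<in> insert i J" for j k
  proof -
    have "(\<Sum>m\<in>insert i J. g' m j * g' m k) = \<Sigma> i j * \<Sigma> i k / s + (\<Sum>m\<in>J. g' m j * g' m k)"
      using insert.hyps s0 by (simp add: g'_def)
    also have "(\<Sum>m\<in>J. g' m j * g' m k) = (if j = i \<or> k = i then 0 else \<Sigma>' j k)"
    proof (cases "j = i \<or> k = i")
      case True
      then have "g' m j * g' m k = 0" if "m \<in> J" for m using that insert.hyps by (auto simp: g'_def)
      then have "(\<Sum>m\<in>J. g' m j * g' m k) = 0" by (rule sum.neutral[rule_format])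
      then show ?thesis using True by simp
    next
      case False
      then have jk: "j \<in> J" "k \<in> J" using j k by auto
      have "(\<Sum>m\<in>J. g' m j * g' m k) = (\<Sum>m\<in>J. g m j * g m k)"
        using False insert.hyps by (intro sum.cong) (auto simp: g'_def)
      then show ?thesis using False g[OF jk] by simp
    qed
    also have "\<Sigma> i j * \<Sigma> i k / s + (if j = i \<or> k = i then 0 else \<Sigma>' j k) = \<Sigma> j k"
    proof (cases "j = i \<or> k = i")
      case True
      show ?thesis
      proof (cases "s = 0")
        case s: True
        then have "\<Sigma> j k = 0"
          using True zero[OF s] j k sym[of j k] by (auto simp: s_def)
        then show ?thesis using True s by simp
      next
        case False
        then show ?thesis using True sym[of j k] j k by (auto simp: s_def)
      qed
    qed (simp add: \<Sigma>'_def)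
    finally show ?thesis .
  qed
  then show ?case by blast
qed simp

text \<open>Both sides have the same characteristic function. The freedom in \<open>I\<close> and
  \<open>g\<close> is essential: the law \<gamma> is later realised on several disjoint index sets,
  with whatever factorisation is convenient there.\<close>

lemma gaussian_law_eq_distr:
  fixes g :: "nat \<Rightarrow> nat \<Rightarrow> real"
  assumes \<gamma>: "centered_gaussian_law p \<Sigma> \<gamma>" and fin: "finite I"
    and g: "\<And>j k. j \<in> {1..p} \<Longrightarrow> k \<in> {1..p} \<Longrightarrow> (\<Sum>m\<in>I. g m j * g m k) = \<Sigma> j k"
  shows "\<gamma> = distr (PiM I (\<lambda>_. std_normal_distribution)) (euclid p) (\<lambda>\<xi>. \<lambda>j\<in>{1..p}. \<Sum>m\<in>I. \<xi> m * g m j)"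
    and "(\<lambda>\<xi>. \<lambda>j\<in>{1..p}. \<Sum>m\<in>I. \<xi> m * g m j) \<in> measurable (PiM I (\<lambda>_. std_normal_distribution)) (euclid p)"
proof -
  let ?P = "PiM I (\<lambda>_. std_normal_distribution)"
  let ?Z = "\<lambda>\<xi>. \<lambda>j\<in>{1..p}. \<Sum>m\<in>I. \<xi> m * g m j"
  interpret product_prob_space "\<lambda>_. std_normal_distribution" I
    by (rule product_prob_spaceI) (simp add: prob_space_normal_density)
  have P: "prob_space ?P" by (rule prob_space_PiM) (simp add: prob_space_normal_density)
  have comp [measurable]: "m \<in> I \<Longrightarrow> (\<lambda>\<xi>. \<xi> m) \<in> borel_measurable ?P" for m
    using measurable_component_singleton[of m I "\<lambda>_. std_normal_distribution"] by simp
  show Z [measurable]: "?Z \<in> measurable ?P (euclid p)"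
    by (rule measurable_restrict) measurable
  show "\<gamma> = distr ?P (euclid p) ?Z"
  proof (rule char_uniqueness_euclid[where p=p])
    show "prob_space \<gamma>" "sets \<gamma> = sets (euclid p)" using \<gamma> by (auto simp: centered_gaussian_law_def)
    show "prob_space (distr ?P (euclid p) ?Z)" by (rule prob_space.prob_space_distr[OF P Z])
    fix a :: "nat \<Rightarrow> real"
    have comp' [measurable]: "j \<in> {1..p} \<Longrightarrow> (\<lambda>z. z j) \<in> borel_measurable (euclid p)" for j
      by (rule measurable_component_singleton)
    define s where "s m = (\<Sum>j=1..p. a j * g m j)" for m
    have "(\<integral>z. iexp (\<Sum>j=1..p. a j * z j) \<partial>distr ?P (euclid p) ?Z) = (\<integral>\<xi>. iexp (\<Sum>j=1..p. a j * ?Z \<xi> j) \<partial>?P)"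
      by (rule integral_distr[OF Z]) measurable
    also have "\<dots> = (\<integral>\<xi>. (\<Prod>m\<in>I. iexp (s m * \<xi> m)) \<partial>?P)"
    proof (rule Bochner_Integration.integral_cong[OF refl])
      fix \<xi>
      have "(\<Sum>j=1..p. a j * ?Z \<xi> j) = (\<Sum>j=1..p. \<Sum>m\<in>I. a j * (\<xi> m * g m j))"
        by (intro sum.cong) (auto simp: sum_distrib_left)
      also have "\<dots> = (\<Sum>m\<in>I. s m * \<xi> m)"
        by (subst sum.swap, unfold s_def sum_distrib_right, intro sum.cong refl, simp)
      finally have "(\<Sum>j=1..p. a j * ?Z \<xi> j) = (\<Sum>m\<in>I. s m * \<xi> m)" .
      then show "iexp (\<Sum>j=1..p. a j * ?Z \<xi> j) = (\<Prod>m\<in>I. iexp (s m * \<xi> m))"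
        using fin by (simp add: exp_sum sum_distrib_left)
    qed
    also have "\<dots> = (\<Prod>m\<in>I. char std_normal_distribution (s m))"
      unfolding char_def
    proof (rule product_integral_prod[OF fin])
      show "integrable std_normal_distribution (\<lambda>x. iexp (s m * x))" for m
        by (rule finite_measure.integrable_const_bound[where B=1])
          (auto intro!: prob_space.finite_measure prob_space_normal_density)
    qed
    also have "\<dots> = complex_of_real (\<Prod>m\<in>I. exp (- (s m)\<^sup>2 / 2))"
      by (simp add: char_std_normal_distribution)
    also have "(\<Prod>m\<in>I. exp (- (s m)\<^sup>2 / 2)) = exp (- (\<Sum>m\<in>I. (s m)\<^sup>2) / 2)"
      using fin by (simp add: sum_negf sum_divide_distrib flip: exp_sum)
    also have "(\<Sum>m\<in>I. (s m)\<^sup>2) = (\<Sum>j=1..p. \<Sum>k=1..p. a j * \<Sigma> j k * a k)"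
    proof -
      have "(\<Sum>m\<in>I. (s m)\<^sup>2) = (\<Sum>m\<in>I. \<Sum>j=1..p. \<Sum>k=1..p. a j * (g m j * g m k) * a k)"
        by (simp add: s_def power2_eq_square sum_product mult_ac)
      also have "\<dots> = (\<Sum>j=1..p. \<Sum>k=1..p. \<Sum>m\<in>I. a j * (g m j * g m k) * a k)"
        by (rule trans[OF sum.swap]) (intro sum.cong refl sum.swap)
      also have "\<dots> = (\<Sum>j=1..p. \<Sum>k=1..p. a j * \<Sigma> j k * a k)"
        by (intro sum.cong refl) (simp add: g flip: sum_distrib_left sum_distrib_right)
      finally show ?thesis .
    qed
    finally have eq: "(\<integral>z. iexp (\<Sum>j=1..p. a j * z j) \<partial>distr ?P (euclid p) ?Z)
      = complex_of_real (exp (- (\<Sum>j=1..p. \<Sum>k=1..p. a j * \<Sigma> j k * a k) / 2))" .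
    have "(\<integral>z. iexp (\<Sum>j=1..p. a j * z j) \<partial>\<gamma>)
      = complex_of_real (exp (- (\<Sum>j=1..p. \<Sum>k=1..p. a j * \<Sigma> j k * a k) / 2))"
      using \<gamma> unfolding centered_gaussian_law_def by blast
    then show "(\<integral>z. iexp (\<Sum>j=1..p. a j * z j) \<partial>\<gamma>) = (\<integral>z. iexp (\<Sum>j=1..p. a j * z j) \<partial>distr ?P (euclid p) ?Z)"
      by (rule trans[OF _ eq[symmetric]])
  qed simp
qed

lemma std_normal_integral_exp_square:
  "integrable std_normal_distribution (\<lambda>x. exp (x\<^sup>2 / 4))" "(\<integral>x. exp (x\<^sup>2 / 4) \<partial>std_normal_distribution) = sqrt 2"
proof -
  have e: "std_normal_density x * exp (x\<^sup>2 / 4) = sqrt 2 * normal_density 0 (sqrt 2) x" for x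
  proof -
    have k: "1 / sqrt (2 * pi) = sqrt 2 * (1 / sqrt (2 * pi * (sqrt 2)\<^sup>2))"
    proof -
      have "sqrt (2 * pi * (sqrt 2)\<^sup>2) = sqrt (2 * pi) * sqrt 2"
        using real_sqrt_mult[of "2 * pi" "(sqrt 2)\<^sup>2"] by simp
      moreover have "1 / a = c * (1 / (a * c))" if "c \<noteq> 0" for a c :: real using that by simp
      ultimately show ?thesis by simp
    qed
    have ex: "exp (- x\<^sup>2 / 2) * exp (x\<^sup>2 / 4) = exp (- (x - 0)\<^sup>2 / (2 * (sqrt 2)\<^sup>2))" by (simp flip: exp_add)
    have "std_normal_density x * exp (x\<^sup>2 / 4) = 1 / sqrt (2 * pi) * (exp (- x\<^sup>2 / 2) * exp (x\<^sup>2 / 4))"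
      unfolding std_normal_density_def by (rule mult.assoc)
    also have "\<dots> = sqrt 2 * normal_density 0 (sqrt 2) x"
      unfolding k ex normal_density_def by (rule mult.assoc)
    finally show ?thesis .
  qed
  show "integrable std_normal_distribution (\<lambda>x. exp (x\<^sup>2 / 4))"
    by (subst integrable_density) (auto simp: e)
  show "(\<integral>x. exp (x\<^sup>2 / 4) \<partial>std_normal_distribution) = sqrt 2"
    by (subst integral_density) (auto simp: e)
qed

lemma std_normal_interval:
  assumes "0 \<le> a" "a \<le> c"
  shows "measure std_normal_distribution {a<..c} \<le> (c - a) * exp (- a\<^sup>2 / 2)"
proof -
  have "emeasure std_normal_distribution {a<..c} = (\<integral>\<^sup>+x. ennreal (std_normal_density x) * indicator {a<..c} x \<partial>lborel)"
    by (rule emeasure_density) auto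
  also have "\<dots> \<le> (\<integral>\<^sup>+x. ennreal (exp (- a\<^sup>2 / 2)) * indicator {a<..c} x \<partial>lborel)"
  proof (rule nn_integral_mono)
    fix x
    have "std_normal_density x \<le> exp (- a\<^sup>2 / 2)" if "a < x"
    proof -
      have "a\<^sup>2 \<le> x\<^sup>2" using assms that by (intro power_mono) auto
      moreover have "1 / sqrt (2 * pi) \<le> 1" using pi_gt3 by (simp add: real_le_rsqrt)
      ultimately have "1 / sqrt (2 * pi) * exp (- x\<^sup>2 / 2) \<le> 1 * exp (- a\<^sup>2 / 2)"
        by (intro mult_mono) auto
      then show ?thesis by (simp add: std_normal_density_def)
    qed
    then show "ennreal (std_normal_density x) * indicator {a<..c} x \<le> ennreal (exp (- a\<^sup>2 / 2)) * indicator {a<..c} x"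
      by (auto simp: indicator_def intro!: ennreal_leI)
  qed
  also have "\<dots> = ennreal ((c - a) * exp (- a\<^sup>2 / 2))"
    using assms by (subst nn_integral_cmult_indicator) (auto simp: mult.commute simp flip: ennreal_mult)
  finally show ?thesis
    using assms by (subst (asm) finite_measure.emeasure_eq_measure)
      (auto intro!: prob_space.finite_measure prob_space_normal_density)
qed

section \<open>Mean and anti-concentration of the maximum of a possibly singular Gaussian
  vector\<close>

locale gaussian_vector =
  fixes p :: nat and \<Sigma> :: "nat \<Rightarrow> nat \<Rightarrow> real" and \<gamma> :: "(nat \<Rightarrow> real) measure"
  assumes p3: "p \<ge> 3" and law: "centered_gaussian_law p \<Sigma> \<gamma>"
    and sym: "\<And>j k. j \<in> {1..p} \<Longrightarrow> k \<in> {1..p} \<Longrightarrow> \<Sigma> j k = \<Sigma> k j"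
    and psd: "\<And>t :: nat \<Rightarrow> real. 0 \<le> (\<Sum>j=1..p. \<Sum>k=1..p. t j * \<Sigma> j k * t k)"
begin

definition fac :: "nat \<Rightarrow> nat \<Rightarrow> real" where
  "fac = (SOME g. \<forall>j\<in>{1..p}. \<forall>k\<in>{1..p}. (\<Sum>m=1..p. g m j * g m k) = \<Sigma> j k)"

lemma fac: "j \<in> {1..p} \<Longrightarrow> k \<in> {1..p} \<Longrightarrow> (\<Sum>m=1..p. fac m j * fac m k) = \<Sigma> j k"
proof -
  have "\<exists>g. \<forall>j\<in>{1..p}. \<forall>k\<in>{1..p}. (\<Sum>m=1..p. g m j * g m k) = \<Sigma> j k"
    by (rule psd_factorization, rule finite_atLeastAtMost, rule sym, assumption+, rule psd)
  from someI_ex[OF this] show "j \<in> {1..p} \<Longrightarrow> k \<in> {1..p} \<Longrightarrow> (\<Sum>m=1..p. fac m j * fac m k) = \<Sigma> j k"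
    unfolding fac_def[symmetric] by blast
qed

sublocale prob_space \<gamma> using law by (simp add: centered_gaussian_law_def)

lemma sets_\<gamma> [measurable_cong, simp]: "sets \<gamma> = sets (euclid p)"
  using law by (simp add: centered_gaussian_law_def)

lemma coord [measurable]: "j \<in> {1..p} \<Longrightarrow> (\<lambda>z. z j) \<in> borel_measurable \<gamma>"
  using measurable_component_singleton[of j "{1..p}" "\<lambda>_. borel"] by simp

lemma law_eq_distr:
  "\<gamma> = distr (PiM {1..p} (\<lambda>_. std_normal_distribution)) (euclid p) (\<lambda>\<xi>. \<lambda>j\<in>{1..p}. \<Sum>m=1..p. \<xi> m * fac m j)"
  "(\<lambda>\<xi>. \<lambda>j\<in>{1..p}. \<Sum>m=1..p. \<xi> m * fac m j) \<in> measurable (PiM {1..p} (\<lambda>_. std_normal_distribution)) (euclid p)"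
  by (rule gaussian_law_eq_distr[OF law finite_atLeastAtMost], rule fac, assumption+)+

definition s :: "nat \<Rightarrow> real" where "s j = sqrt (\<Sigma> j j)"

lemma diag_nonneg: "j \<in> {1..p} \<Longrightarrow> 0 \<le> \<Sigma> j j"
  by (subst fac[symmetric]) (auto intro!: sum_nonneg)

lemma s_nonneg: "j \<in> {1..p} \<Longrightarrow> 0 \<le> s j"
  using diag_nonneg by (simp add: s_def)

lemma vec_max_measurable [measurable]: "vec_max p \<in> borel_measurable \<gamma>"
  unfolding vec_max_def[abs_def] by (rule borel_measurable_Max) auto

lemma vec_max_attained: obtains j where "j \<in> {1..p}" "vec_max p z = z j"
proof -
  have "vec_max p z \<in> z ` {1..p}" unfolding vec_max_def by (rule Max_in) (use p3 in auto)
  with that show ?thesis by blast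
qed

lemma ln_p: "ln (real p) \<ge> 1"
proof -
  have "exp 1 \<le> real p" using exp_le p3 by linarith
  then show ?thesis using p3 by (subst ln_ge_iff) auto
qed

lemma AE_degenerate: assumes "j \<in> {1..p}" "s j = 0" shows "AE z in \<gamma>. z j = 0"
proof -
  note rep = law_eq_distr
  have "\<Sigma> j j = 0" using assms by (simp add: s_def)
  then have "(\<Sum>m=1..p. fac m j * fac m j) = 0" using fac[of j j] assms by simp
  then have "fac m j = 0" if "m \<in> {1..p}" for m
    using that by (subst (asm) sum_nonneg_eq_0_iff) auto
  then have "(\<Sum>m=1..p. \<xi> m * fac m j) = 0" for \<xi> :: "nat \<Rightarrow> real" by simp
  moreover have "{z \<in> space (euclid p). z j = 0} \<in> sets (euclid p)"
    using assms coord[of j] by measurable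
  ultimately show ?thesis
    using assms by (subst rep(1), subst AE_distr_iff[OF rep(2)]) auto
qed

lemma marginal:
  assumes j: "j \<in> {1..p}" and sj: "s j > 0"
  shows "distr \<gamma> borel (\<lambda>z. z j / s j) = std_normal_distribution"
proof (rule Levy_uniqueness)
  have [measurable]: "(\<lambda>z. z j / s j) \<in> borel_measurable \<gamma>" using coord[OF j] by measurable
  show "real_distribution (distr \<gamma> borel (\<lambda>z. z j / s j))" by (rule real_distribution_distr) measurable
  show "real_distribution std_normal_distribution" by (rule real_dist_normal_dist)
  show "char (distr \<gamma> borel (\<lambda>z. z j / s j)) = char std_normal_distribution"
  proof
    fix t
    define a where "a i = (if i = j then t / s j else 0)" for i
    have "char (distr \<gamma> borel (\<lambda>z. z j / s j)) t = (\<integral>z. iexp (t * (z j / s j)) \<partial>\<gamma>)"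
      unfolding char_def by (subst integral_distr) auto
    also have "\<dots> = (\<integral>z. exp (\<i> * complex_of_real (\<Sum>i=1..p. a i * z i)) \<partial>\<gamma>)"
    proof -
      have "(\<Sum>i=1..p. a i * z i) = (\<Sum>i=1..p. if i = j then t * (z j / s j) else 0)" for z :: "nat \<Rightarrow> real"
        by (intro sum.cong) (auto simp: a_def)
      then have "(\<Sum>i=1..p. a i * z i) = t * (z j / s j)" for z :: "nat \<Rightarrow> real" using j by simp
      then show ?thesis by simp
    qed
    also have "\<dots> = complex_of_real (exp (- (\<Sum>i=1..p. \<Sum>k=1..p. a i * \<Sigma> i k * a k) / 2))"
      using law unfolding centered_gaussian_law_def by blast
    also have "(\<Sum>i=1..p. \<Sum>k=1..p. a i * \<Sigma> i k * a k) = t\<^sup>2"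
    proof -
      have "(\<Sum>k=1..p. a i * \<Sigma> i k * a k) = (\<Sum>k=1..p. if k = j then a i * \<Sigma> i j * (t / s j) else 0)" for i
        by (intro sum.cong) (auto simp: a_def)
      then have "(\<Sum>k=1..p. a i * \<Sigma> i k * a k) = a i * \<Sigma> i j * (t / s j)" for i using j by simp
      then have "(\<Sum>i=1..p. \<Sum>k=1..p. a i * \<Sigma> i k * a k) = (\<Sum>i=1..p. if i = j then t / s j * \<Sigma> j j * (t / s j) else 0)"
        by (intro sum.cong) (auto simp: a_def)
      also have "\<dots> = t / s j * \<Sigma> j j * (t / s j)" using j by simp
      also have "\<Sigma> j j = (s j)\<^sup>2" using diag_nonneg[OF j] by (simp add: s_def)
      finally show ?thesis using sj by (simp add: power2_eq_square)
    qed
    finally show "char (distr \<gamma> borel (\<lambda>z. z j / s j)) t = char std_normal_distribution t"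
      by (simp add: char_std_normal_distribution)
  qed
qed

text \<open>Each normalised coordinate satisfies E exp(x^2/4) = sqrt 2. The sum of these
  exponentials controls all coordinates at once, at the price of the logarithm of at most p terms,
  and no independence is involved.\<close>

lemma max_normalized_bound:
  assumes J: "J \<subseteq> {1..p}" "J \<noteq> {}" and sJ: "\<And>j. j \<in> J \<Longrightarrow> s j > 0"
  shows "integrable \<gamma> (\<lambda>z. MAX j\<in>J. \<bar>z j / s j\<bar>)" "(\<integral>z. (MAX j\<in>J. \<bar>z j / s j\<bar>) \<partial>\<gamma>) \<le> 3 * sqrt (ln p)"
proof -
  have finJ: "finite J" using J finite_subset by blast
  have meas [measurable]: "(\<lambda>z. z j / s j) \<in> borel_measurable \<gamma>" if "j \<in> J" for j
    using coord[of j] that J by auto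
  have exp_int: "integrable \<gamma> (\<lambda>z. exp ((z j / s j)\<^sup>2 / 4))" "(\<integral>z. exp ((z j / s j)\<^sup>2 / 4) \<partial>\<gamma>) = sqrt 2" if "j \<in> J" for j
  proof -
    have j: "j \<in> {1..p}" using that J by auto
    note m = marginal[OF j sJ[OF that], symmetric]
    note meas[OF that, measurable]
    have "integrable (distr \<gamma> borel (\<lambda>z. z j / s j)) (\<lambda>x. exp (x\<^sup>2 / 4))"
      using std_normal_integral_exp_square(1) unfolding m .
    then show "integrable \<gamma> (\<lambda>z. exp ((z j / s j)\<^sup>2 / 4))" by (subst (asm) integrable_distr_eq) auto
    have "(\<integral>x. exp (x\<^sup>2 / 4) \<partial>distr \<gamma> borel (\<lambda>z. z j / s j)) = sqrt 2"
      using std_normal_integral_exp_square(2) unfolding m .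
    then show "(\<integral>z. exp ((z j / s j)\<^sup>2 / 4) \<partial>\<gamma>) = sqrt 2" by (subst (asm) integral_distr) auto
  qed
  define L where "L = ln (real p)"
  define A where "A = sqrt 2 * p"
  define a where "a = 2 * sqrt L"
  have L: "L \<ge> 1" using ln_p by (simp add: L_def)
  have A: "A > 0" using p3 by (simp add: A_def)
  have a: "a > 0" using L by (simp add: a_def)
  \<comment> \<open>Two linearisations: |x| <= (x^2 + a^2)/(2a) with a^2 = 4 ln p, and x^2/4 <= ln A
    - 1 + exp(x^2/4)/A with \<open>A\<close> a bound for the mean of the sum. In expectation they
    give 2 sqrt(ln p) + sqrt(ln p).\<close>
  define h where "h z = 4 / (2 * a) * (ln A - 1 + (\<Sum>j\<in>J. exp ((z j / s j)\<^sup>2 / 4)) / A) + a / 2" for z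
  have h_int: "integrable \<gamma> h"
    unfolding h_def[abs_def] using exp_int by simp
  have le: "\<bar>z j / s j\<bar> \<le> h z" if j: "j \<in> J" for z j
  proof -
    define x where "x = \<bar>z j / s j\<bar>"
    have "0 \<le> (x - a)\<^sup>2" by simp
    then have "2 * a * x \<le> x\<^sup>2 + a\<^sup>2" by (simp add: power2_eq_square algebra_simps)
    then have 1: "x \<le> 4 / (2 * a) * (x\<^sup>2 / 4) + a / 2" using a by (simp add: field_simps power2_eq_square)
    have "1 + (x\<^sup>2 / 4 - ln A) \<le> exp (x\<^sup>2 / 4 - ln A)" by (rule exp_ge_add_one_self)
    also have "\<dots> = exp (x\<^sup>2 / 4) / A" using A by (simp add: exp_diff)
    also have "\<dots> \<le> (\<Sum>j\<in>J. exp ((z j / s j)\<^sup>2 / 4)) / A"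
    proof -
      have "x\<^sup>2 = (z j / s j)\<^sup>2" unfolding x_def by (rule power2_abs)
      then show ?thesis
        using A finJ j member_le_sum[of j J "\<lambda>j. exp ((z j / s j)\<^sup>2 / 4)"] by (intro divide_right_mono) auto
    qed
    finally have "x\<^sup>2 / 4 \<le> ln A - 1 + (\<Sum>j\<in>J. exp ((z j / s j)\<^sup>2 / 4)) / A" by linarith
    then have "4 / (2 * a) * (x\<^sup>2 / 4) \<le> 4 / (2 * a) * (ln A - 1 + (\<Sum>j\<in>J. exp ((z j / s j)\<^sup>2 / 4)) / A)"
      using a by (intro mult_left_mono) auto
    then show ?thesis using 1 by (simp add: h_def x_def)
  qed
  have maxle: "(MAX j\<in>J. \<bar>z j / s j\<bar>) \<le> h z" for z
    using finJ J le by (subst Max_le_iff) auto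
  have max0: "0 \<le> (MAX j\<in>J. \<bar>z j / s j\<bar>)" for z
    using finJ J by (subst Max_ge_iff) auto
  have mm: "(\<lambda>z. MAX j\<in>J. \<bar>z j / s j\<bar>) \<in> borel_measurable \<gamma>"
    by (rule borel_measurable_Max[OF finJ]) measurable
  show int: "integrable \<gamma> (\<lambda>z. MAX j\<in>J. \<bar>z j / s j\<bar>)"
    by (rule Bochner_Integration.integrable_bound[OF h_int mm])
       (use maxle max0 in \<open>auto intro!: AE_I2 order.trans[OF _ abs_ge_self]\<close>)
  have "(\<integral>z. (MAX j\<in>J. \<bar>z j / s j\<bar>) \<partial>\<gamma>) \<le> (\<integral>z. h z \<partial>\<gamma>)"
    by (intro integral_mono int h_int maxle)
  also have "\<dots> = 4 / (2 * a) * (ln A - 1 + (card J * sqrt 2) / A) + a / 2"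
    unfolding h_def using exp_int prob_space by simp
  also have "\<dots> \<le> 4 / (2 * a) * (ln A) + a / 2"
  proof -
    have "card J \<le> p" using J card_mono[of "{1..p}" J] by simp
    then have "(card J * sqrt 2) / A \<le> 1" using A p3 by (simp add: A_def field_simps)
    then show ?thesis using a by (intro add_right_mono mult_left_mono) auto
  qed
  also have "\<dots> \<le> 4 / (2 * a) * (2 * L) + a / 2"
  proof -
    have "ln A = ln 2 / 2 + L" using p3 by (simp add: A_def L_def ln_mult ln_sqrt)
    moreover have "ln 2 \<le> (1 :: real)" using ln_le_minus_one[of 2] by simp
    ultimately have "ln A \<le> 2 * L" using L by simp
    then show ?thesis using a by (intro add_right_mono mult_left_mono) auto
  qed
  also have "\<dots> = 3 * sqrt L"
  proof -
    have "L = sqrt L * sqrt L" using L by simp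
    then have "4 / (2 * a) * (2 * L) = 2 * sqrt L" using L by (simp add: a_def field_simps)
    then show ?thesis by (simp add: a_def)
  qed
  finally show "(\<integral>z. (MAX j\<in>J. \<bar>z j / s j\<bar>) \<partial>\<gamma>) \<le> 3 * sqrt (ln p)" by (simp add: L_def)
qed

lemma max_anticoncentration_normalized:
  assumes J: "J \<subseteq> {1..p}" "J \<noteq> {}" and sJ: "\<And>j. j \<in> J \<Longrightarrow> s j > 0" and \<eta>: "\<eta> > 0"
  shows "measure \<gamma> {z \<in> space \<gamma>. 0 < (MAX j\<in>J. z j / s j - h j) \<and> (MAX j\<in>J. z j / s j - h j) \<le> \<eta>} \<le> 60 * \<eta> * sqrt (ln p)"
proof -
  have finJ: "finite J" using J finite_subset by blast
  let ?P = "PiM {1..p} (\<lambda>_. std_normal_distribution)"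
  note rep = law_eq_distr
  define g where "g m j = fac m j / s j" for m j
  have unit: "(\<Sum>m=1..p. (g m j)\<^sup>2) = 1" if "j \<in> J" for j
  proof -
    have j: "j \<in> {1..p}" using that J by auto
    have "(\<Sum>m=1..p. (g m j)\<^sup>2) = (\<Sum>m=1..p. fac m j * fac m j) / (s j)\<^sup>2"
      by (simp add: g_def power_divide power2_eq_square sum_divide_distrib)
    also have "\<dots> = 1" using fac[OF j j] sJ[OF that] diag_nonneg[OF j] by (simp add: s_def)
    finally show ?thesis .
  qed
  have lin: "(\<lambda>j\<in>{1..p}. \<Sum>m=1..p. \<xi> m * fac m j) j / s j = (\<Sum>m=1..p. \<xi> m * g m j)" if "j \<in> J" for \<xi> :: "nat \<Rightarrow> real" and j
    using that J by (auto simp: g_def sum_divide_distrib)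
  have [measurable]: "(\<lambda>z. z j / s j) \<in> borel_measurable \<gamma>" if "j \<in> J" for j
    using coord[of j] that J by auto
  have [measurable]: "(\<lambda>z. MAX j\<in>J. z j / s j - h j) \<in> borel_measurable \<gamma>"
    by (rule borel_measurable_Max[OF finJ]) measurable
  have mm: "(\<lambda>z. MAX j\<in>J. \<bar>z j / s j\<bar>) \<in> borel_measurable \<gamma>"
    by (rule borel_measurable_Max[OF finJ]) measurable
  let ?A = "{z \<in> space \<gamma>. 0 < (MAX j\<in>J. z j / s j - h j) \<and> (MAX j\<in>J. z j / s j - h j) \<le> \<eta>}"
  have A: "?A \<in> sets (euclid p)" unfolding sets_\<gamma>[symmetric] by measurable
  have sp: "space \<gamma> = space (euclid p)" by (rule sets_eq_imp_space_eq) simp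
  have "measure \<gamma> ?A = measure ?P ((\<lambda>\<xi>. \<lambda>j\<in>{1..p}. \<Sum>m=1..p. \<xi> m * fac m j) -` ?A \<inter> space ?P)"
    by (subst rep(1), rule measure_distr[OF rep(2) A])
  also have "(\<lambda>\<xi>. \<lambda>j\<in>{1..p}. \<Sum>m=1..p. \<xi> m * fac m j) -` ?A \<inter> space ?P
      = {\<xi> \<in> space ?P. 0 < (MAX j\<in>J. (\<Sum>m=1..p. \<xi> m * g m j) - h j) \<and> (MAX j\<in>J. (\<Sum>m=1..p. \<xi> m * g m j) - h j) \<le> \<eta>}"
    using measurable_space[OF rep(2)] lin by (auto simp: sp cong: image_cong)
  also have "measure ?P \<dots> \<le> 20 * \<eta> * (\<integral>\<xi>. (MAX j\<in>J. \<bar>\<Sum>m=1..p. \<xi> m * g m j\<bar>) \<partial>?P)"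
    by (rule gaussian_max_anticoncentration) (use finJ J unit \<eta> in auto)
  also have "(\<integral>\<xi>. (MAX j\<in>J. \<bar>\<Sum>m=1..p. \<xi> m * g m j\<bar>) \<partial>?P) = (\<integral>z. (MAX j\<in>J. \<bar>z j / s j\<bar>) \<partial>\<gamma>)"
  proof -
    have "(\<lambda>z. MAX j\<in>J. \<bar>z j / s j\<bar>) \<in> borel_measurable (euclid p)" using mm unfolding measurable_cong_sets[OF sets_\<gamma> refl] .
    from integral_distr[OF rep(2) this]
    have I: "(\<integral>z. (MAX j\<in>J. \<bar>z j / s j\<bar>) \<partial>\<gamma>) = (\<integral>\<xi>. (MAX j\<in>J. \<bar>(\<lambda>j\<in>{1..p}. \<Sum>m=1..p. \<xi> m * fac m j) j / s j\<bar>) \<partial>?P)"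
      unfolding rep(1)[symmetric] .
    have "(MAX j\<in>J. \<bar>(\<lambda>j\<in>{1..p}. \<Sum>m=1..p. \<xi> m * fac m j) j / s j\<bar>) = (MAX j\<in>J. \<bar>\<Sum>m=1..p. \<xi> m * g m j\<bar>)" for \<xi>
      by (rule arg_cong[where f=Max], rule image_cong[OF refl], simp only: lin)
    then show ?thesis unfolding I by simp
  qed
  also have "20 * \<eta> * (\<integral>z. (MAX j\<in>J. \<bar>z j / s j\<bar>) \<partial>\<gamma>) \<le> 20 * \<eta> * (3 * sqrt (ln p))"
    using \<eta> by (intro mult_left_mono max_normalized_bound J sJ) auto
  finally show ?thesis by simp
qed

text \<open>Coordinates with $\sigma_j \sqrt{4 \log p} < t$ are handled one at a time: their density at $t$ is at most
  $1/(tp)$.\<close>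
lemma anticoncentration:
  assumes t: "t > 0" and \<epsilon>: "\<epsilon> > 0"
  shows "measure \<gamma> {z \<in> space \<gamma>. t < vec_max p z \<and> vec_max p z \<le> t + \<epsilon>} \<le> 121 * \<epsilon> * ln p / t"
proof -
  define L where "L = ln (real p)"
  have L: "L \<ge> 1" using ln_p by (simp add: L_def)
  define s0 where "s0 = t / sqrt (4 * L)"
  have s0: "s0 > 0" using t L by (simp add: s0_def)
  define J where "J = {j \<in> {1..p}. s0 \<le> s j}"
  have J: "J \<subseteq> {1..p}" "finite J" by (auto simp: J_def)
  have sJ: "s j > 0" if "j \<in> J" for j using that s0 by (auto simp: J_def)
  define \<eta> where "\<eta> = \<epsilon> / s0"
  have \<eta>: "\<eta> > 0" using \<epsilon> s0 by (simp add: \<eta>_def)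
  define A where "A = (if J = {} then {} else {z \<in> space \<gamma>. 0 < (MAX j\<in>J. z j / s j - t / s j) \<and> (MAX j\<in>J. z j / s j - t / s j) \<le> \<eta>})"
  define D where "D j = {z \<in> space \<gamma>. t < z j \<and> z j \<le> t + \<epsilon>}" for j
  have [measurable]: "(\<lambda>z. z j / s j) \<in> borel_measurable \<gamma>" if "j \<in> J" for j
    using coord[of j] that J by auto
  have [measurable]: "(\<lambda>z. MAX j\<in>J. z j / s j - t / s j) \<in> borel_measurable \<gamma>"
    using J by (auto intro!: borel_measurable_Max)
  have A'_meas: "{z \<in> space \<gamma>. 0 < (MAX j\<in>J. z j / s j - t / s j) \<and> (MAX j\<in>J. z j / s j - t / s j) \<le> \<eta>} \<in> sets \<gamma>"
    by measurable
  have A_meas: "A \<in> sets \<gamma>" unfolding A_def by (rule if_split[THEN iffD2]) (use A'_meas in blast)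
  have D_meas: "D j \<in> sets \<gamma>" if "j \<in> {1..p}" for j
    unfolding D_def using coord[OF that] by measurable
  \<comment> \<open>Some coordinate exceeds t. If it belongs to \<open>J\<close>, then after
    division by the standard deviations the maximum over \<open>J\<close> lies in (0, \<eta>],
    because s_j >= s0 there; otherwise that single coordinate lies in (t, t + \<epsilon>].\<close>
  have sub: "{z \<in> space \<gamma>. t < vec_max p z \<and> vec_max p z \<le> t + \<epsilon>} \<subseteq> A \<union> (\<Union>j\<in>{1..p} - J. D j)"
  proof
    fix z assume z: "z \<in> {z \<in> space \<gamma>. t < vec_max p z \<and> vec_max p z \<le> t + \<epsilon>}"
    have ne: "{1..p} \<noteq> {}" using p3 by auto
    have ub: "z j \<le> t + \<epsilon>" if "j \<in> {1..p}" for j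
      using z that Max_ge[of "z ` {1..p}" "z j"] by (auto simp: vec_max_def)
    obtain j where j: "j \<in> {1..p}" "t < z j"
      using z vec_max_attained[of z] by (metis (no_types, lifting) mem_Collect_eq)
    show "z \<in> A \<union> (\<Union>j\<in>{1..p} - J. D j)"
    proof (cases "j \<in> J")
      case False
      then have "z \<in> D j" using j ub z by (simp add: D_def)
      then show ?thesis using j False by blast
    next
      case True
      then have Jne: "J \<noteq> {}" by auto
      have "0 < z j / s j - t / s j" using j sJ[OF True] by (simp add: divide_strict_right_mono)
      also have "\<dots> \<le> (MAX j\<in>J. z j / s j - t / s j)" using J True by (intro Max_ge) auto
      finally have 1: "0 < (MAX j\<in>J. z j / s j - t / s j)" .
      have "z i / s i - t / s i \<le> \<eta>" if "i \<in> J" for i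
      proof -
        have "z i / s i - t / s i = (z i - t) / s i" by (simp add: diff_divide_distrib)
        also have "\<dots> \<le> \<epsilon> / s i" using ub[of i] that J sJ[OF that] by (intro divide_right_mono) auto
        also have "\<dots> \<le> \<epsilon> / s0" using that \<epsilon> s0 by (intro divide_left_mono) (auto simp: J_def)
        finally show ?thesis by (simp add: \<eta>_def)
      qed
      then have "(MAX j\<in>J. z j / s j - t / s j) \<le> \<eta>" using J Jne by simp
      then show ?thesis using 1 z Jne by (simp add: A_def)
    qed
  qed
  have mA: "measure \<gamma> A \<le> 120 * \<epsilon> * L / t"
  proof (cases "J = {}")
    case True
    then show ?thesis using \<epsilon> t L by (simp add: A_def)
  next
    case False
    have "measure \<gamma> A \<le> 60 * \<eta> * sqrt L"
      using max_anticoncentration_normalized[OF J(1) False sJ \<eta>, of "\<lambda>j. t / s j"] False by (simp add: A_def L_def)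
    also have "\<dots> = 60 * \<epsilon> * (2 * sqrt L) * sqrt L / t"
      by (simp add: \<eta>_def s0_def real_sqrt_mult)
    also have "\<dots> = 120 * \<epsilon> * L / t" using L by simp
    finally show ?thesis .
  qed
  have mD: "measure \<gamma> (D j) \<le> \<epsilon> / (t * p)" if j: "j \<in> {1..p} - J" for j
  proof (cases "s j = 0")
    case True
    have "AE z in \<gamma>. z \<notin> D j" using AE_degenerate[of j] True j t by (auto simp: D_def)
    moreover have "{z \<in> space \<gamma>. \<not> z \<notin> D j} = D j" by (auto simp: D_def)
    ultimately have "emeasure \<gamma> (D j) = 0"
      using AE_iff_measurable[of "D j" \<gamma> "\<lambda>z. z \<notin> D j"] D_meas[of j] j by auto
    then have "measure \<gamma> (D j) = 0" by (simp add: measure_def)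
    then show ?thesis using \<epsilon> t by simp
  next
    case False
    have jp: "j \<in> {1..p}" using j by auto
    have sj: "s j > 0" using False s_nonneg[OF jp] by simp
    define h where "h = t / s j"
    have h: "h > 0" using t sj by (simp add: h_def)
    have "s j < t / sqrt (4 * L)" using j by (auto simp: J_def s0_def)
    then have "sqrt (4 * L) \<le> h" using sj L by (simp add: h_def field_simps)
    then have h2: "4 * L \<le> h\<^sup>2" using real_le_lsqrt h by (metis real_sqrt_le_iff real_sqrt_unique less_imp_le real_sqrt_abs abs_of_pos)
    have [measurable]: "(\<lambda>z. z j / s j) \<in> borel_measurable \<gamma>" using coord[OF jp] by measurable
    have "measure \<gamma> (D j) = measure (distr \<gamma> borel (\<lambda>z. z j / s j)) {h<..h + \<epsilon> / s j}"
      using sj by (subst measure_distr) (auto simp: D_def h_def field_simps intro!: arg_cong[where f="measure \<gamma>"])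
    also have "\<dots> \<le> (h + \<epsilon> / s j - h) * exp (- h\<^sup>2 / 2)"
      unfolding marginal[OF jp sj] using h \<epsilon> sj by (intro std_normal_interval) auto
    also have "\<dots> = \<epsilon> / t * (h * exp (- h\<^sup>2 / 2))" using t sj by (simp add: h_def)
    \<comment> \<open>With h <= exp(h^2/4) one half of the Gaussian exponent absorbs the factor h,
      and h^2 >= 4 ln p makes the other half at most 1/p.\<close>
    also have "\<dots> \<le> \<epsilon> / t * (1 / p)"
    proof (intro mult_left_mono)
      have "0 \<le> (h / 2 - 1)\<^sup>2" by simp
      then have "h \<le> 1 + h\<^sup>2 / 4" by (simp add: power2_eq_square algebra_simps)
      also have "\<dots> \<le> exp (h\<^sup>2 / 4)" by (rule exp_ge_add_one_self)
      finally have "h * exp (- h\<^sup>2 / 2) \<le> exp (h\<^sup>2 / 4) * exp (- h\<^sup>2 / 2)" by (intro mult_right_mono) auto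
      also have "\<dots> = exp (- h\<^sup>2 / 4)" by (simp flip: exp_add)
      also have "\<dots> \<le> exp (- L)" using h2 by simp
      also have "\<dots> = 1 / p" using p3 by (simp add: L_def exp_minus inverse_eq_divide)
      finally show "h * exp (- h\<^sup>2 / 2) \<le> 1 / p" .
    qed (use \<epsilon> t in auto)
    finally show ?thesis by simp
  qed
  have "measure \<gamma> {z \<in> space \<gamma>. t < vec_max p z \<and> vec_max p z \<le> t + \<epsilon>} \<le> measure \<gamma> (A \<union> (\<Union>j\<in>{1..p} - J. D j))"
    using sub A_meas D_meas by (intro finite_measure_mono) auto
  also have "\<dots> \<le> measure \<gamma> A + measure \<gamma> (\<Union>j\<in>{1..p} - J. D j)"
    using A_meas D_meas by (intro measure_Un_le) auto
  also have "measure \<gamma> (\<Union>j\<in>{1..p} - J. D j) \<le> (\<Sum>j\<in>{1..p} - J. measure \<gamma> (D j))"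
    using D_meas by (intro measure_UNION_le) auto
  also have "\<dots> \<le> (\<Sum>j\<in>{1..p} - J. \<epsilon> / (t * p))" by (intro sum_mono mD)
  also have "\<dots> = card ({1..p} - J) * (\<epsilon> / (t * p))" by simp
  also have "\<dots> \<le> p * (\<epsilon> / (t * p))"
    using \<epsilon> t card_mono[of "{1..p}" "{1..p} - J"] by (intro mult_right_mono) auto
  also have "\<dots> = \<epsilon> / t" using p3 by simp
  also have "\<dots> \<le> \<epsilon> * L / t" using L \<epsilon> t by (intro divide_right_mono) auto
  \<comment> \<open>The 120 is 60 from the normalised bound times the 2 in sqrt(4 ln p); the extra 1
    collects the at most p small coordinates.\<close>
  finally have "measure \<gamma> {z \<in> space \<gamma>. t < vec_max p z \<and> vec_max p z \<le> t + \<epsilon>} \<le> 120 * \<epsilon> * L / t + \<epsilon> * L / t"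
    using mA by linarith
  then show ?thesis by (simp add: L_def add_divide_distrib[symmetric])
qed

text \<open>Coordinates of zero variance vanish almost surely and are set aside before normalising.
  The others are at most the largest standard deviation times the normalised maximum.\<close>

lemma integrable_vec_max: "integrable \<gamma> (vec_max p)"
  and mean_le: "(\<And>j. j \<in> {1..p} \<Longrightarrow> \<Sigma> j j \<le> \<sigma>2) \<Longrightarrow> (\<integral>z. vec_max p z \<partial>\<gamma>) \<le> 3 * sqrt \<sigma>2 * sqrt (ln p)"
proof -
  define J where "J = {j \<in> {1..p}. s j > 0}"
  have J: "J \<subseteq> {1..p}" "finite J" by (auto simp: J_def)
  have p1: "1 \<in> {1..p}" using p3 by auto
  have deg: "AE z in \<gamma>. \<forall>j\<in>{1..p} - J. z j = 0"
  proof (rule AE_finite_allI)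
    fix j assume j: "j \<in> {1..p} - J"
    show "AE z in \<gamma>. z j = 0"
      by (rule AE_degenerate) (use j s_nonneg[of j] in \<open>auto simp: J_def\<close>)
  qed simp
  define mx where "mx z = (if J = {} then 0 else (MAX j\<in>J. \<bar>z j / s j\<bar>))" for z
  have mx: "integrable \<gamma> mx" "(\<integral>z. mx z \<partial>\<gamma>) \<le> 3 * sqrt (ln p)"
  proof -
    have sJ: "s j > 0" if "j \<in> J" for j using that by (simp add: J_def)
    have "integrable \<gamma> mx \<and> (\<integral>z. mx z \<partial>\<gamma>) \<le> 3 * sqrt (ln p)"
    proof (cases "J = {}")
      case True
      then have "mx = (\<lambda>_. 0)" by (simp add: mx_def[abs_def])
      then show ?thesis using ln_p by simp
    next
      case False
      then have "mx = (\<lambda>z. MAX j\<in>J. \<bar>z j / s j\<bar>)" by (simp add: mx_def[abs_def])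
      then show ?thesis using max_normalized_bound[OF J(1) False sJ] by simp
    qed
    then show "integrable \<gamma> mx" "(\<integral>z. mx z \<partial>\<gamma>) \<le> 3 * sqrt (ln p)" by auto
  qed
  have mx0: "0 \<le> mx z" for z
    using J by (cases "J = {}") (auto simp: mx_def Max_ge_iff)
  have bound: "AE z in \<gamma>. \<bar>vec_max p z\<bar> \<le> c * mx z" if c: "\<And>j. j \<in> {1..p} \<Longrightarrow> s j \<le> c" for c
    using deg
  proof eventually_elim
    case (elim z)
    have c0: "c \<ge> 0" using c[OF p1] s_nonneg[OF p1] by linarith
    have "\<bar>z j\<bar> \<le> c * mx z" if j: "j \<in> {1..p}" for j
    proof (cases "j \<in> J")
      case False
      then show ?thesis using elim j mx0[of z] c0 by simp
    next
      case True
      have "\<bar>z j\<bar> = s j * \<bar>z j / s j\<bar>" using True by (simp add: J_def)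
      also have "\<dots> \<le> c * mx z"
      proof (intro mult_mono c j c0)
        show "\<bar>z j / s j\<bar> \<le> mx z" using True J by (auto simp: mx_def intro!: Max_ge)
      qed simp
      finally show ?thesis .
    qed
    moreover obtain j where "j \<in> {1..p}" "vec_max p z = z j"
      by (rule vec_max_attained)
    ultimately show ?case by simp
  qed
  show int: "integrable \<gamma> (vec_max p)"
  proof (rule Bochner_Integration.integrable_bound[OF integrable_mult_right[OF mx(1), of "Max (s ` {1..p})"]])
    have "AE z in \<gamma>. \<bar>vec_max p z\<bar> \<le> Max (s ` {1..p}) * mx z" by (rule bound) simp
    then show "AE z in \<gamma>. norm (vec_max p z) \<le> norm (Max (s ` {1..p}) * mx z)" by eventually_elim simp
  qed measurable
  assume \<sigma>2: "\<And>j. j \<in> {1..p} \<Longrightarrow> \<Sigma> j j \<le> \<sigma>2"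
  have "(\<integral>z. vec_max p z \<partial>\<gamma>) \<le> (\<integral>z. sqrt \<sigma>2 * mx z \<partial>\<gamma>)"
  proof (rule integral_mono_AE[OF int integrable_mult_right[OF mx(1)]])
    have "AE z in \<gamma>. \<bar>vec_max p z\<bar> \<le> sqrt \<sigma>2 * mx z" by (rule bound) (simp add: s_def \<sigma>2)
    then show "AE z in \<gamma>. vec_max p z \<le> sqrt \<sigma>2 * mx z" by eventually_elim simp
  qed
  also have "\<dots> \<le> sqrt \<sigma>2 * (3 * sqrt (ln p))"
    using mx(2) \<sigma>2[OF p1] diag_nonneg[OF p1] by (auto intro!: mult_left_mono)
  finally show "(\<integral>z. vec_max p z \<partial>\<gamma>) \<le> 3 * sqrt \<sigma>2 * sqrt (ln p)" by simp
qed

end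

section \<open>Gaussian concentration and the lower tail of the maximum\<close>

context softmax
begin

text \<open>At the end of the coupling the two vectors use disjoint coordinates, and each has law
  \<gamma>. Fubini therefore factorises the exponential moment of their difference.\<close>

lemma gaussian_softmax_exponential_law:
  assumes J: "J = {1..p}" and gv: "gaussian_vector p \<Sigma> \<gamma>"
    and var: "\<And>j. j \<in> {1..p} \<Longrightarrow> \<Sigma> j j \<le> \<sigma>2"
  shows "(\<integral>z. exp (r * F z) \<partial>\<gamma>) * (\<integral>z. exp (- r * F z) \<partial>\<gamma>) \<le> exp (r\<^sup>2 * \<sigma>2)"
    and "integrable \<gamma> (\<lambda>z. exp (r * F z))"
proof -
  interpret gaussian_vector p \<Sigma> \<gamma> by fact
  define a where "a m j = (if m \<in> {1..p} then fac m j else 0)" for m j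
  \<comment> \<open>The factorisation is indexed by 1..p, the triples by m < q; index 0 is padded
    with zeros.\<close>
  define q where "q = Suc p"
  have aa: "(\<Sum>m<q. a m j * a m k) = \<Sigma> j k" if "j \<in> {1..p}" "k \<in> {1..p}" for j k
  proof -
    have "(\<Sum>m<q. a m j * a m k) = (\<Sum>m=1..p. a m j * a m k)"
      by (rule sum.mono_neutral_right) (auto simp: q_def a_def)
    also have "\<dots> = (\<Sum>m=1..p. fac m j * fac m k)" by (intro sum.cong) (auto simp: a_def)
    finally show ?thesis using fac that by simp
  qed
  \<comment> \<open>The shared residue class 2 has disappeared from both vectors at s = pi/2. It is
    put into \<open>I1\<close> with coefficient 0 so that the two sets exhaust the index
    range.\<close>
  define I0 where "I0 = {i \<in> {..<3 * q}. i mod 3 = 0}"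
  define I1 where "I1 = {i \<in> {..<3 * q}. i mod 3 \<noteq> 0}"
  define g0 where "g0 i j = (if i mod 3 = 0 then a (i div 3) j else 0)" for i j
  define g1 where "g1 i j = (if i mod 3 = 1 then a (i div 3) j else 0)" for i j
  have fin: "finite I0" "finite I1" and disj: "I0 \<inter> I1 = {}" and un: "I0 \<union> I1 = {..<3 * q}"
    by (auto simp: I0_def I1_def)
  have m3: "Suc (Suc (3 * m)) mod 3 = 2" "Suc (3 * m) mod 3 = 1" "(3 * m) mod 3 = 0" "Suc (Suc (3 * m)) div 3 = m" "Suc (3 * m) div 3 = m" for m :: nat
    by presburger+
  have sum0: "(\<Sum>i\<in>I0. f i * g0 i j) = (\<Sum>m<q. f (3 * m) * a m j)" for f :: "nat \<Rightarrow> real" and j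
  proof -
    have "(\<Sum>i\<in>I0. f i * g0 i j) = (\<Sum>i<3 * q. f i * g0 i j)"
      by (rule sum.mono_neutral_left) (auto simp: I0_def g0_def)
    then show ?thesis unfolding sum_lessThan_triple by (simp add: g0_def m3)
  qed
  have sum1: "(\<Sum>i\<in>I1. f i * g1 i j) = (\<Sum>m<q. f (3 * m + 1) * a m j)" for f :: "nat \<Rightarrow> real" and j
  proof -
    have "(\<Sum>i\<in>I1. f i * g1 i j) = (\<Sum>i<3 * q. f i * g1 i j)"
      by (rule sum.mono_neutral_left) (auto simp: I1_def g1_def)
    then show ?thesis unfolding sum_lessThan_triple by (simp add: g1_def m3)
  qed
  have g0g: "(\<Sum>i\<in>I0. g0 i j * g0 i k) = \<Sigma> j k" if "j \<in> {1..p}" "k \<in> {1..p}" for j k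
    using aa[OF that] sum0[of "\<lambda>i. g0 i j" k] by (simp add: g0_def)
  have g1g: "(\<Sum>i\<in>I1. g1 i j * g1 i k) = \<Sigma> j k" if "j \<in> {1..p}" "k \<in> {1..p}" for j k
    using aa[OF that] sum1[of "\<lambda>i. g1 i j" k] by (simp add: g1_def m3)
  have rep0: "\<gamma> = distr (PiM I0 (\<lambda>_. std_normal_distribution)) (euclid p) (\<lambda>\<xi>. \<lambda>j\<in>{1..p}. \<Sum>m\<in>I0. \<xi> m * g0 m j)"
    "(\<lambda>\<xi>. \<lambda>j\<in>{1..p}. \<Sum>m\<in>I0. \<xi> m * g0 m j) \<in> measurable (PiM I0 (\<lambda>_. std_normal_distribution)) (euclid p)"
    by (rule gaussian_law_eq_distr[OF law fin(1)], rule g0g, assumption+)+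
  have rep1: "\<gamma> = distr (PiM I1 (\<lambda>_. std_normal_distribution)) (euclid p) (\<lambda>\<xi>. \<lambda>j\<in>{1..p}. \<Sum>m\<in>I1. \<xi> m * g1 m j)"
    "(\<lambda>\<xi>. \<lambda>j\<in>{1..p}. \<Sum>m\<in>I1. \<xi> m * g1 m j) \<in> measurable (PiM I1 (\<lambda>_. std_normal_distribution)) (euclid p)"
    by (rule gaussian_law_eq_distr[OF law fin(2)], rule g1g, assumption+)+
  have Fm: "(\<lambda>z. exp (r * F z)) \<in> borel_measurable (euclid p)" for r
  proof -
    have [measurable]: "F \<in> borel_measurable (euclid p)"
      using F_measurable[of "\<lambda>z. z" "euclid p"] J measurable_component_singleton[of _ "{1..p}" "\<lambda>_. borel"] by auto
    show ?thesis by measurable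
  qed
  have Fcong: "F (\<lambda>j\<in>{1..p}. x j) = F x" for x
  proof -
    have "(\<Sum>k\<in>J. exp (b * (\<lambda>j\<in>{1..p}. x j) k)) = (\<Sum>k\<in>J. exp (b * x k))" using J by (intro sum.cong) auto
    then show ?thesis by (simp only: F_def)
  qed
  have E0: "(\<integral>z. exp (r * F z) \<partial>\<gamma>) = (\<integral>\<xi>. exp (r * F (\<lambda>j. \<Sum>m<q. \<xi> (3 * m) * a m j)) \<partial>PiM I0 (\<lambda>_. std_normal_distribution))" for r
    by (subst rep0(1), subst integral_distr[OF rep0(2) Fm]) (simp only: Fcong sum0)
  have E1: "(\<integral>z. exp (r * F z) \<partial>\<gamma>) = (\<integral>\<xi>. exp (r * F (\<lambda>j. \<Sum>m<q. \<xi> (3 * m + 1) * a m j)) \<partial>PiM I1 (\<lambda>_. std_normal_distribution))" for r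
    by (subst rep1(1), subst integral_distr[OF rep1(2) Fm]) (simp only: Fcong sum1)
  show "integrable \<gamma> (\<lambda>z. exp (r * F z))"
    using integrable_exp_softmax[OF fin(1), of r g0]
    by (subst rep0(1), subst integrable_distr_eq[OF rep0(2) Fm]) (simp only: Fcong)
  let ?f = "\<lambda>\<xi>. exp (r * (F (\<lambda>j. \<Sum>m<q. \<xi> (3 * m) * a m j) - F (\<lambda>j. \<Sum>m<q. \<xi> (3 * m + 1) * a m j)))"
  have var': "(\<Sum>m<q. (a m j)\<^sup>2) \<le> \<sigma>2" if "j \<in> J" for j
    using aa[of j j] var[of j] that J by (simp add: power2_eq_square)
  note ex = gaussian_softmax_exponential[where a=a and q=q and r=r, OF var']
  interpret product_prob_space "\<lambda>_. std_normal_distribution" "{..<3 * q}"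
    by (rule product_prob_spaceI) (simp add: prob_space_normal_density)
  have "(\<integral>\<xi>. ?f \<xi> \<partial>PiM {..<3 * q} (\<lambda>_. std_normal_distribution))
      = (\<integral>x. (\<integral>y. ?f (merge I0 I1 (x, y)) \<partial>PiM I1 (\<lambda>_. std_normal_distribution)) \<partial>PiM I0 (\<lambda>_. std_normal_distribution))"
    using product_integral_fold[OF disj fin, of ?f] ex(2) unfolding un by blast
  also have "\<dots> = (\<integral>x. (\<integral>y. exp (r * F (\<lambda>j. \<Sum>m<q. x (3 * m) * a m j)) * exp (- r * F (\<lambda>j. \<Sum>m<q. y (3 * m + 1) * a m j))
      \<partial>PiM I1 (\<lambda>_. std_normal_distribution)) \<partial>PiM I0 (\<lambda>_. std_normal_distribution))"
  proof -
    have "merge I0 I1 (x, y) (3 * m) = x (3 * m)" "merge I0 I1 (x, y) (3 * m + 1) = y (3 * m + 1)" if "m < q" for x y :: "nat \<Rightarrow> real" and m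
      using that m3 by (auto simp: merge_def I0_def I1_def)
    then have "?f (merge I0 I1 (x, y)) = exp (r * F (\<lambda>j. \<Sum>m<q. x (3 * m) * a m j)) * exp (- r * F (\<lambda>j. \<Sum>m<q. y (3 * m + 1) * a m j))" for x y
      by (simp add: right_diff_distrib flip: exp_add)
    then show ?thesis by simp
  qed
  also have "\<dots> = (\<integral>z. exp (r * F z) \<partial>\<gamma>) * (\<integral>z. exp (- r * F z) \<partial>\<gamma>)"
    unfolding E0[of r] E1[of "- r"] by simp
  finally show "(\<integral>z. exp (r * F z) \<partial>\<gamma>) * (\<integral>z. exp (- r * F z) \<partial>\<gamma>) \<le> exp (r\<^sup>2 * \<sigma>2)"
    using ex(1) by simp
qed

end

text \<open>Chernoff's bound for the softmax. The product bound E e^(rF) E e^(-rF) <= exp(r^2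
  \<sigma>2) combined with E e^(rF) >= e^(r \<mu>) controls the negative exponential moment.\<close>

lemma (in gaussian_vector) lower_tail:
  assumes var: "\<And>j. j \<in> {1..p} \<Longrightarrow> \<Sigma> j j \<le> \<sigma>2"
    and \<mu>: "\<mu> = (\<integral>z. vec_max p z \<partial>\<gamma>)" "\<mu> > 0"
  shows "measure \<gamma> {z \<in> space \<gamma>. vec_max p z \<le> \<mu> / 5} \<le> exp (- \<mu>\<^sup>2 / (8 * \<sigma>2))"
proof (cases "\<sigma>2 = 0")
  \<comment> \<open>Division by 0 is 0, so the right-hand side is 1.\<close>
  case True
  then show ?thesis using prob_le_1 by simp
next
  case False
  have "\<sigma>2 \<ge> 0" using var[of 1] diag_nonneg[of 1] p3 by auto
  then have \<sigma>2: "\<sigma>2 > 0" using False by simp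
  \<comment> \<open>The softmax error is \<mu>/20, so a maximum of at most \<mu>/5 forces
    \<open>S.F\<close> to be at most \<mu>/4.\<close>
  define b where "b = 20 * ln p / \<mu>"
  have b: "b > 0" using ln_p \<mu> by (simp add: b_def)
  interpret S: softmax b "{1..p}" by standard (use b p3 in auto)
  \<comment> \<open>The minimiser of r^2 \<sigma>2 - 3 r \<mu> / 4. The resulting factor 9/64
    exceeds 1/8.\<close>
  define r where "r = 3 * \<mu> / (8 * \<sigma>2)"
  have r: "r > 0" using \<mu> \<sigma>2 by (simp add: r_def)
  have gv: "gaussian_vector p \<Sigma> \<gamma>" by unfold_locales
  note ex = S.gaussian_softmax_exponential_law[OF refl gv var, of r]
  note int = S.gaussian_softmax_exponential_law(2)[OF refl gv var]
  have [measurable]: "S.F \<in> borel_measurable \<gamma>"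
    using S.F_measurable[of "\<lambda>z. z" \<gamma>] by auto
  have Fint: "integrable \<gamma> S.F"
  proof (rule Bochner_Integration.integrable_bound[OF Bochner_Integration.integrable_add[OF int[of 1] int[of "-1"]]])
    have "\<bar>y\<bar> \<le> \<bar>exp y + exp (- y)\<bar>" for y :: real
      using exp_ge_add_one_self[of y] exp_ge_add_one_self[of "-y"] exp_gt_zero[of y] exp_gt_zero[of "-y"] by linarith
    then show "AE z in \<gamma>. norm (S.F z) \<le> norm (exp (1 * S.F z) + exp (- 1 * S.F z))"
      by (intro AE_I2) simp
  qed measurable
  have maxF: "vec_max p z \<le> S.F z" for z
    using p3 S.F_ge[of _ z] unfolding vec_max_def by (subst Max_le_iff) auto
  have \<mu>F: "\<mu> \<le> (\<integral>z. S.F z \<partial>\<gamma>)"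
    unfolding \<mu> by (intro integral_mono integrable_vec_max Fint maxF)
  \<comment> \<open>Jensen's inequality through the tangent of the exponential at r \<mu>; the
    softmax has mean at least \<mu> because it dominates the maximum.\<close>
  have low: "exp (r * \<mu>) \<le> (\<integral>z. exp (r * S.F z) \<partial>\<gamma>)"
  proof -
    have "exp (r * \<mu>) \<le> exp (r * \<mu>) * (1 + r * ((\<integral>z. S.F z \<partial>\<gamma>) - \<mu>))"
      using \<mu>F r by simp
    also have "\<dots> = (\<integral>z. exp (r * \<mu>) * (1 + r * (S.F z - \<mu>)) \<partial>\<gamma>)"
      using Fint prob_space by simp
    also have "\<dots> \<le> (\<integral>z. exp (r * S.F z) \<partial>\<gamma>)"
    proof (rule integral_mono)
      show "exp (r * \<mu>) * (1 + r * (S.F z - \<mu>)) \<le> exp (r * S.F z)" for z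
      proof -
        have "exp (r * \<mu>) * (1 + r * (S.F z - \<mu>)) \<le> exp (r * \<mu>) * exp (r * (S.F z - \<mu>))"
          by (intro mult_left_mono exp_ge_add_one_self) simp
        also have "\<dots> = exp (r * S.F z)" by (simp add: algebra_simps flip: exp_add)
        finally show ?thesis .
      qed
    qed (use Fint int in auto)
    finally show ?thesis .
  qed
  have "exp (r * \<mu>) * (\<integral>z. exp (- r * S.F z) \<partial>\<gamma>) \<le> exp (r\<^sup>2 * \<sigma>2)"
    using ex(1) mult_right_mono[OF low, of "\<integral>z. exp (- r * S.F z) \<partial>\<gamma>"] by (simp add: integral_nonneg_AE)
  then have up: "(\<integral>z. exp (- r * S.F z) \<partial>\<gamma>) \<le> exp (r\<^sup>2 * \<sigma>2 - r * \<mu>)"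
    by (simp add: exp_diff field_simps)
  let ?A = "{z \<in> space \<gamma>. vec_max p z \<le> \<mu> / 5}"
  have "?A \<inter> space \<gamma> = ?A" by auto
  then have "measure \<gamma> ?A = (\<integral>z. indicator ?A z \<partial>\<gamma>)" by (simp only: Bochner_Integration.integral_indicator)
  also have "\<dots> \<le> (\<integral>z. exp (r * (\<mu> / 4)) * exp (- r * S.F z) \<partial>\<gamma>)"
  proof (rule integral_mono)
    show "integrable \<gamma> (indicator ?A :: _ \<Rightarrow> real)"
      by (rule integrable_const_bound[where B=1]) (auto simp: indicator_def)
    show "integrable \<gamma> (\<lambda>z. exp (r * (\<mu> / 4)) * exp (- r * S.F z))" using int[of "- r"] by simp
    show "indicator ?A z \<le> exp (r * (\<mu> / 4)) * exp (- r * S.F z)" for z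
    proof (cases "z \<in> ?A")
      case True
      have "z j \<le> \<mu> / 5" if "j \<in> {1..p}" for j
      proof -
        have "z j \<le> vec_max p z" unfolding vec_max_def using that by (intro Max_ge) auto
        then show ?thesis using True by simp
      qed
      then have "S.F z \<le> \<mu> / 5 + ln (card {1..p}) / b" by (rule S.F_le)
      also have "ln (card {1..p}) / b = \<mu> / 20" using \<mu> ln_p by (simp add: b_def)
      finally have "S.F z \<le> \<mu> / 4" by simp
      then have "1 \<le> exp (r * (\<mu> / 4 - S.F z))" using r by simp
      also have "\<dots> = exp (r * (\<mu> / 4)) * exp (- r * S.F z)" by (simp add: algebra_simps flip: exp_add)
      finally show ?thesis using True by simp
    qed (simp add: less_imp_le)
  qed
  also have "\<dots> = exp (r * (\<mu> / 4)) * (\<integral>z. exp (- r * S.F z) \<partial>\<gamma>)" by simp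
  also have "\<dots> \<le> exp (r * (\<mu> / 4)) * exp (r\<^sup>2 * \<sigma>2 - r * \<mu>)" using up by (intro mult_left_mono) auto
  also have "\<dots> = exp (- 9 * \<mu>\<^sup>2 / (64 * \<sigma>2))"
  proof -
    have "r * (\<mu> / 4) + (r\<^sup>2 * \<sigma>2 - r * \<mu>) = - 9 * \<mu>\<^sup>2 / (64 * \<sigma>2)"
      using \<sigma>2 by (simp add: r_def power2_eq_square field_simps)
    then show ?thesis by (simp only: mult_exp_exp)
  qed
  also have "\<dots> \<le> exp (- \<mu>\<^sup>2 / (8 * \<sigma>2))"
    using \<sigma>2 by (simp add: field_simps)
  finally show ?thesis .
qed

section \<open>Lindeberg exchange with three matching moments\<close>

section \<open>Exchange with skewed multiples\<close>

text \<open>Powers are dominated by exponentials via x^4 <= 24 e^|x| and x^2 <= 2 e^|x|. For the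
  truncated moments half of the exponent pays for the power, which enlarges the constants by 2^4 and
  2^2, and the other half yields exp(-a/(2 \<kappa>)).\<close>

lemma exp_moment_bounds:
  fixes y :: "'a \<Rightarrow> real"
  assumes [measurable]: "y \<in> borel_measurable M" and int: "integrable M (\<lambda>x. exp (\<bar>y x\<bar> / \<kappa>))"
    and le: "(\<integral>x. exp (\<bar>y x\<bar> / \<kappa>) \<partial>M) \<le> 2" and \<kappa>: "\<kappa> > 0"
  shows "integrable M (\<lambda>x. \<bar>y x\<bar>)" "integrable M (\<lambda>x. y x ^ 4)" "(\<integral>x. y x ^ 4 \<partial>M) \<le> 48 * \<kappa> ^ 4"
    "integrable M (\<lambda>x. y x ^ 4 * indicator {r. a < \<bar>r\<bar>} (y x))"
    "(\<integral>x. y x ^ 4 * indicator {r. a < \<bar>r\<bar>} (y x) \<partial>M) \<le> 768 * \<kappa> ^ 4 * exp (- a / (2 * \<kappa>))"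
    "integrable M (\<lambda>x. (y x)\<^sup>2 * indicator {r. a < \<bar>r\<bar>} (y x))"
    "(\<integral>x. (y x)\<^sup>2 * indicator {r. a < \<bar>r\<bar>} (y x) \<partial>M) \<le> 16 * \<kappa>\<^sup>2 * exp (- a / (2 * \<kappa>))"
proof -
  have e4: "x ^ 4 \<le> 24 * exp \<bar>x\<bar>" and e2: "x\<^sup>2 \<le> 2 * exp \<bar>x\<bar>" and e1: "\<bar>x\<bar> \<le> exp \<bar>x\<bar>" for x :: real
  proof -
    have "(\<Sum>n<5. \<bar>x\<bar> ^ n / fact n) \<le> exp \<bar>x\<bar>"
      unfolding exp_def by (simp add: scaleR_conv_of_real divide_inverse mult.commute)
        (rule sum_le_suminf, use summable_exp[of "\<bar>x\<bar>"] in \<open>auto simp: mult.commute\<close>)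
    then have "1 + \<bar>x\<bar> + x\<^sup>2 / 2 + \<bar>x\<bar> ^ 3 / 6 + x ^ 4 / 24 \<le> exp \<bar>x\<bar>"
      by (simp add: eval_nat_numeral fact_numeral lessThan_Suc algebra_simps)
    moreover have "0 \<le> \<bar>x\<bar> ^ 3" "0 \<le> x\<^sup>2" "0 \<le> x ^ 4" by auto
    ultimately show "x ^ 4 \<le> 24 * exp \<bar>x\<bar>" "x\<^sup>2 \<le> 2 * exp \<bar>x\<bar>" "\<bar>x\<bar> \<le> exp \<bar>x\<bar>" by linarith+
  qed
  let ?E = "\<lambda>x. exp (\<bar>y x\<bar> / \<kappa>)"
  have dom: "integrable M f \<and> (\<integral>x. f x \<partial>M) \<le> C * 2"
    if [measurable]: "f \<in> borel_measurable M" and f: "\<And>x. 0 \<le> f x" "\<And>x. f x \<le> C * ?E x" and C: "C \<ge> 0" for f C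
  proof
    show i: "integrable M f"
      by (rule Bochner_Integration.integrable_bound[OF integrable_mult_right[OF int, of C]])
         (use f C in \<open>auto intro!: AE_I2\<close>)
    have "(\<integral>x. f x \<partial>M) \<le> (\<integral>x. C * ?E x \<partial>M)"
      using int f by (intro integral_mono i) auto
    also have "\<dots> = C * (\<integral>x. ?E x \<partial>M)" by simp
    also have "\<dots> \<le> C * 2" using le C by (intro mult_left_mono) auto
    finally show "(\<integral>x. f x \<partial>M) \<le> C * 2" .
  qed
  have absdiv: "\<bar>y x / \<kappa>\<bar> = \<bar>y x\<bar> / \<kappa>" for x using \<kappa> by simp
  have "integrable M (\<lambda>x. \<bar>y x\<bar>) \<and> (\<integral>x. \<bar>y x\<bar> \<partial>M) \<le> \<kappa> * 2"
  proof (rule dom)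
    show "\<bar>y x\<bar> \<le> \<kappa> * ?E x" for x using e1[of "y x / \<kappa>"] \<kappa> unfolding absdiv by (simp add: field_simps)
  qed (use \<kappa> in auto)
  then show "integrable M (\<lambda>x. \<bar>y x\<bar>)" by simp
  have "integrable M (\<lambda>x. y x ^ 4) \<and> (\<integral>x. y x ^ 4 \<partial>M) \<le> (24 * \<kappa> ^ 4) * 2"
  proof (rule dom)
    show "y x ^ 4 \<le> 24 * \<kappa> ^ 4 * ?E x" for x
      using e4[of "y x / \<kappa>"] \<kappa> unfolding absdiv by (simp add: field_simps power_divide)
  qed (use \<kappa> in auto)
  then show "integrable M (\<lambda>x. y x ^ 4)" "(\<integral>x. y x ^ 4 \<partial>M) \<le> 48 * \<kappa> ^ 4" by auto
  have half: "\<bar>y x / (2 * \<kappa>)\<bar> = \<bar>y x\<bar> / (2 * \<kappa>)" for x using \<kappa> by simp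
  have tail: "exp (\<bar>y x\<bar> / (2 * \<kappa>)) \<le> exp (- a / (2 * \<kappa>)) * ?E x" if "a < \<bar>y x\<bar>" for x
  proof -
    have "\<bar>y x\<bar> / (2 * \<kappa>) \<le> - a / (2 * \<kappa>) + \<bar>y x\<bar> / \<kappa>" using that \<kappa> by (simp add: field_simps)
    then show ?thesis by (simp flip: exp_add)
  qed
  have "integrable M (\<lambda>x. y x ^ 4 * indicator {r. a < \<bar>r\<bar>} (y x)) \<and>
    (\<integral>x. y x ^ 4 * indicator {r. a < \<bar>r\<bar>} (y x) \<partial>M) \<le> (384 * \<kappa> ^ 4 * exp (- a / (2 * \<kappa>))) * 2"
  proof (rule dom)
    show "y x ^ 4 * indicator {r. a < \<bar>r\<bar>} (y x) \<le> 384 * \<kappa> ^ 4 * exp (- a / (2 * \<kappa>)) * ?E x" for x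
    proof (cases "a < \<bar>y x\<bar>")
      case True
      have "y x ^ 4 \<le> 384 * \<kappa> ^ 4 * exp (\<bar>y x\<bar> / (2 * \<kappa>))"
        using e4[of "y x / (2 * \<kappa>)"] \<kappa> unfolding half by (simp add: field_simps power_divide power_mult_distrib)
      also have "\<dots> \<le> 384 * \<kappa> ^ 4 * (exp (- a / (2 * \<kappa>)) * ?E x)" using tail[OF True] by (intro mult_left_mono) auto
      finally show ?thesis using True by simp
    qed simp
  qed (use \<kappa> in \<open>auto simp: indicator_def\<close>)
  then show "integrable M (\<lambda>x. y x ^ 4 * indicator {r. a < \<bar>r\<bar>} (y x))"
    "(\<integral>x. y x ^ 4 * indicator {r. a < \<bar>r\<bar>} (y x) \<partial>M) \<le> 768 * \<kappa> ^ 4 * exp (- a / (2 * \<kappa>))" by auto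
  have "integrable M (\<lambda>x. (y x)\<^sup>2 * indicator {r. a < \<bar>r\<bar>} (y x)) \<and>
    (\<integral>x. (y x)\<^sup>2 * indicator {r. a < \<bar>r\<bar>} (y x) \<partial>M) \<le> (8 * \<kappa>\<^sup>2 * exp (- a / (2 * \<kappa>))) * 2"
  proof (rule dom)
    show "(y x)\<^sup>2 * indicator {r. a < \<bar>r\<bar>} (y x) \<le> 8 * \<kappa>\<^sup>2 * exp (- a / (2 * \<kappa>)) * ?E x" for x
    proof (cases "a < \<bar>y x\<bar>")
      case True
      have "(y x)\<^sup>2 \<le> 8 * \<kappa>\<^sup>2 * exp (\<bar>y x\<bar> / (2 * \<kappa>))"
        using e2[of "y x / (2 * \<kappa>)"] \<kappa> unfolding half by (simp add: field_simps power_divide power_mult_distrib)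
      also have "\<dots> \<le> 8 * \<kappa>\<^sup>2 * (exp (- a / (2 * \<kappa>)) * ?E x)" using tail[OF True] by (intro mult_left_mono) auto
      finally show ?thesis using True by simp
    qed simp
  qed (use \<kappa> in \<open>auto simp: indicator_def\<close>)
  then show "integrable M (\<lambda>x. (y x)\<^sup>2 * indicator {r. a < \<bar>r\<bar>} (y x))"
    "(\<integral>x. (y x)\<^sup>2 * indicator {r. a < \<bar>r\<bar>} (y x) \<partial>M) \<le> 16 * \<kappa>\<^sup>2 * exp (- a / (2 * \<kappa>))" by auto
qed

lemma integral_swap_bounded:
  fixes f :: "'a \<Rightarrow> 'b \<Rightarrow> real"
  assumes M: "prob_space M" and N: "prob_space N"
    and f: "case_prod f \<in> borel_measurable (M \<Otimes>\<^sub>M N)" and b: "\<And>x y. \<bar>f x y\<bar> \<le> C"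
  shows "(\<integral>x. (\<integral>y. f x y \<partial>N) \<partial>M) = (\<integral>y. (\<integral>x. f x y \<partial>M) \<partial>N)"
proof -
  interpret M: prob_space M by fact
  interpret N: prob_space N by fact
  interpret P: pair_prob_space M N ..
  have "integrable (M \<Otimes>\<^sub>M N) (case_prod f)"
    by (rule P.integrable_const_bound[where B=C, OF _ f]) (use b in auto)
  from P.Fubini_integral[OF this] show ?thesis by simp
qed

lemma borel_measurable_integral_prob:
  fixes f :: "'a \<Rightarrow> 'b \<Rightarrow> real"
  assumes "prob_space Q" "case_prod f \<in> borel_measurable (R \<Otimes>\<^sub>M Q)"
  shows "(\<lambda>x. \<integral>y. f x y \<partial>Q) \<in> borel_measurable R"
proof -
  interpret Q: prob_space Q by fact
  show ?thesis by (rule Q.borel_measurable_lebesgue_integral[OF assms(2)])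
qed

lemma (in prob_space) abs_integral_diff_le:
  fixes f g :: "'a \<Rightarrow> real"
  assumes "integrable M f" "integrable M g" "\<And>x. x \<in> space M \<Longrightarrow> \<bar>f x - g x\<bar> \<le> c"
  shows "\<bar>(\<integral>x. f x \<partial>M) - (\<integral>x. g x \<partial>M)\<bar> \<le> c"
proof -
  have "\<bar>(\<integral>x. f x \<partial>M) - (\<integral>x. g x \<partial>M)\<bar> = \<bar>\<integral>x. f x - g x \<partial>M\<bar>" using assms by simp
  also have "\<dots> \<le> (\<integral>x. \<bar>f x - g x\<bar> \<partial>M)" by (rule integral_abs_bound)
  also have "\<dots> \<le> (\<integral>x. c \<partial>M)" using assms by (intro integral_mono) auto
  finally show ?thesis using prob_space by simp
qed

locale subexponential_laws =
  fixes p :: nat and N :: "nat \<Rightarrow> (nat \<Rightarrow> real) measure" and \<kappa> :: real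
  assumes p3: "p \<ge> 3" and prob_N: "\<And>i. prob_space (N i)" and sets_N: "\<And>i. sets (N i) = sets (euclid p)"
    and \<kappa>: "\<kappa> > 0"
    and centered: "\<And>i j. j \<in> {1..p} \<Longrightarrow> (\<integral>x. x j \<partial>N i) = 0"
    and exp_N: "\<And>i j. j \<in> {1..p} \<Longrightarrow> integrable (N i) (\<lambda>x. exp (\<bar>x j\<bar> / \<kappa>))"
    and exp_le: "\<And>i j. j \<in> {1..p} \<Longrightarrow> (\<integral>x. exp (\<bar>x j\<bar> / \<kappa>) \<partial>N i) \<le> 2"
begin

lemma sets_N' [measurable_cong, simp]: "sets (N i) = sets (euclid p)" by (rule sets_N)

lemma coord [measurable]: "j \<in> {1..p} \<Longrightarrow> (\<lambda>x. x j) \<in> borel_measurable (N i)"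
  using measurable_component_singleton[of j "{1..p}" "\<lambda>_. borel"] by simp

lemmas moments = exp_moment_bounds[OF coord exp_N exp_le \<kappa>]

lemma coord_PiM: "k \<in> I \<Longrightarrow> j \<in> {1..p} \<Longrightarrow> (\<lambda>x. x k j) \<in> borel_measurable (PiM I N)"
  by (rule measurable_compose[OF measurable_component_singleton[of k I N] coord])

lemmas integrable_N_bounded = finite_measure.integrable_const_bound[OF prob_space.finite_measure[OF prob_N]]

sublocale product_prob_space N UNIV
  by (rule product_prob_spaceI) (rule prob_N)

end

text \<open>With \<open>bd_eq\<close> the softmax error ln p / b equals the cutoff width
  \<open>d\<close>. The condition \<open>small\<close> makes the tail factor of a coordinate beyond
  1/(3b) at most 1/p^2, enough for a sum over p coordinates.\<close>

locale smooth_max_laws = smooth_max b "{1..p}" t d B + subexponential_laws p N \<kappa>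
  for b t d B :: real and p :: nat and N \<kappa> +
  assumes bd_eq: "b * d = ln p" and small: "12 * b * \<kappa> * ln p \<le> 1"
begin

definition step_err :: real where
  "step_err = 2 * (3240 * B * (816 * \<kappa> ^ 4 * b ^ 3 / d))"

text \<open>Both expectations are compared with the same cubic Taylor polynomial. Since E e = 0 and
  E e^2 = E e^3 = 1, averaging over \<open>e\<close> removes only the linear term
  \<open>D1 w x\<close>, which has mean 0 under the centred \<open>N i\<close> anyway. What is left
  is twice the remainder.\<close>

lemma exchange_one:
  "\<bar>(\<integral>x. u (\<lambda>j. w j + x j) \<partial>N i) - (\<integral>x. (\<integral>e. u (\<lambda>j. w j + e * x j) \<partial>skew_law) \<partial>N i)\<bar> \<le> step_err"
proof -
  interpret Ni: prob_space "N i" by (rule prob_N)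
  interpret E: prob_space skew_law by (rule prob_space_skew_law)
  \<comment> \<open>Uniform over the multipliers: |e| <= 3 gives e^4 <= 81 and 40 * 81 = 3240, and
    the threshold 1/b for e x becomes 1/(3b) for x.\<close>
  define R where "R x = 3240 * B * (b ^ 3 / d * avg w (\<lambda>j. x j ^ 4)
      + b ^ 4 * (\<Sum>j=1..p. x j ^ 4 * indicator {r. 1 / (3 * b) < \<bar>r\<bar>} (x j)))" for x
  have R_ge: "remainder_bound w (\<lambda>j. e * x j) \<le> R x" if e: "\<bar>e\<bar> \<le> 3" for e x
  proof -
    have e4: "e ^ 4 \<le> 81"
      using power_mono[OF e, of 4] by simp
    have "avg w (\<lambda>j. (e * x j) ^ 4) = e ^ 4 * avg w (\<lambda>j. x j ^ 4)"
      by (simp only: power_mult_distrib avg_cmult)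
    also have "\<dots> \<le> 81 * avg w (\<lambda>j. x j ^ 4)" using e4 by (intro mult_right_mono avg_nonneg) auto
    finally have 1: "avg w (\<lambda>j. (e * x j) ^ 4) \<le> 81 * avg w (\<lambda>j. x j ^ 4)" .
    have 2: "(\<Sum>j=1..p. (e * x j) ^ 4 * indicator {r. b * \<bar>r\<bar> > 1} (e * x j))
        \<le> 81 * (\<Sum>j=1..p. x j ^ 4 * indicator {r. 1 / (3 * b) < \<bar>r\<bar>} (x j))"
      unfolding sum_distrib_left
    proof (rule sum_mono)
      fix j
      show "(e * x j) ^ 4 * indicator {r. b * \<bar>r\<bar> > 1} (e * x j) \<le> 81 * (x j ^ 4 * indicator {r. 1 / (3 * b) < \<bar>r\<bar>} (x j))"
      proof (cases "b * \<bar>e * x j\<bar> > 1")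
        case True
        have "b * \<bar>e * x j\<bar> \<le> b * (3 * \<bar>x j\<bar>)"
          using e b_pos unfolding abs_mult by (intro mult_left_mono mult_right_mono) auto
        then have "1 < b * (3 * \<bar>x j\<bar>)" using True by linarith
        then have "1 / (3 * b) < \<bar>x j\<bar>" using b_pos by (simp add: field_simps)
        moreover have "(e * x j) ^ 4 \<le> 81 * x j ^ 4"
          unfolding power_mult_distrib using e4 by (intro mult_right_mono) auto
        ultimately show ?thesis using True by simp
      next
        case False
        then show ?thesis by (simp add: indicator_def)
      qed
    qed
    have "remainder_bound w (\<lambda>j. e * x j) \<le> 40 * B * (b ^ 3 / d * (81 * avg w (\<lambda>j. x j ^ 4))
        + b ^ 4 * (81 * (\<Sum>j=1..p. x j ^ 4 * indicator {r. 1 / (3 * b) < \<bar>r\<bar>} (x j))))"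
      unfolding remainder_bound_def using 1 2 B_ge_1 b_pos d_pos by (intro mult_left_mono add_mono) auto
    also have "\<dots> = R x" by (simp add: R_def algebra_simps)
    finally show ?thesis .
  qed
  define T where "T j x = x j ^ 4 * indicator {r. 1 / (3 * b) < \<bar>r\<bar>} (x j)" for j and x :: "nat \<Rightarrow> real"
  have R_eq: "R x = 3240 * B * (b ^ 3 / d * (\<Sum>j=1..p. weight w j * x j ^ 4) + b ^ 4 * (\<Sum>j=1..p. T j x))" for x
    by (simp only: R_def avg_def T_def)
  have T_int: "integrable (N i) (T j)" and T_le: "(\<integral>x. T j x \<partial>N i) \<le> 768 * \<kappa> ^ 4 * exp (- (1 / (3 * b)) / (2 * \<kappa>))"
    if "j \<in> {1..p}" for j
    unfolding T_def[abs_def] by (rule moments(4,5)[OF that that that])+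
  have R_int: "integrable (N i) R"
    unfolding R_eq[abs_def]
    by (intro integrable_mult_right Bochner_Integration.integrable_add Bochner_Integration.integrable_sum moments(2) T_int; assumption)
  have R_le: "(\<integral>x. R x \<partial>N i) \<le> step_err / 2"
  proof -
    have "(\<integral>x. R x \<partial>N i) = 3240 * B * (b ^ 3 / d * avg w (\<lambda>j. \<integral>x. x j ^ 4 \<partial>N i)
      + b ^ 4 * (\<Sum>j=1..p. \<integral>x. T j x \<partial>N i))"
    proof -
      have "integrable (N i) (\<lambda>x. \<Sum>j=1..p. weight w j * x j ^ 4)" "integrable (N i) (\<lambda>x. \<Sum>j=1..p. T j x)"
        by (intro integrable_mult_right Bochner_Integration.integrable_sum moments(2) T_int; assumption)+
      moreover have "(\<integral>x. (\<Sum>j=1..p. T j x) \<partial>N i) = (\<Sum>j=1..p. \<integral>x. T j x \<partial>N i)"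
        by (rule Bochner_Integration.integral_sum) (rule T_int)
      moreover have "(\<integral>x. (\<Sum>j=1..p. weight w j * x j ^ 4) \<partial>N i) = (\<Sum>j=1..p. \<integral>x. weight w j * x j ^ 4 \<partial>N i)"
        by (rule Bochner_Integration.integral_sum) (intro integrable_mult_right moments(2); assumption)
      ultimately show ?thesis unfolding R_eq avg_def by simp
    qed
    also have "\<dots> \<le> 3240 * B * (b ^ 3 / d * (48 * \<kappa> ^ 4) + b ^ 4 * (\<Sum>j=1..p. 768 * \<kappa> ^ 4 * (1 / (real p)\<^sup>2)))"
    proof (intro mult_left_mono add_mono avg_le sum_mono)
      show "(\<integral>x. x j ^ 4 \<partial>N i) \<le> 48 * \<kappa> ^ 4" if "j \<in> {1..p}" for j by (rule moments(3)[OF that that that])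
      fix j assume j: "j \<in> {1..p}"
      have "(\<integral>x. T j x \<partial>N i) \<le> 768 * \<kappa> ^ 4 * exp (- (1 / (3 * b)) / (2 * \<kappa>))"
        by (rule T_le[OF j])
      also have "\<dots> \<le> 768 * \<kappa> ^ 4 * (1 / (real p)\<^sup>2)"
      proof (intro mult_left_mono)
        \<comment> \<open>This is \<open>small\<close> rearranged: 1/(6 b \<kappa>) >= 2 ln
          p.\<close>
        have "2 * ln p \<le> 1 / (3 * b) / (2 * \<kappa>)" using small b_pos \<kappa> by (simp add: field_simps)
        then have "exp (- (1 / (3 * b)) / (2 * \<kappa>)) \<le> exp (- (2 * ln p))" by simp
        also have "\<dots> = 1 / (real p)\<^sup>2"
        proof -
          have "exp (2 * ln (real p)) = (real p)\<^sup>2" using p3 by (simp add: exp_double power2_eq_square)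
          then show ?thesis by (simp add: exp_minus inverse_eq_divide)
        qed
        finally show "exp (- (1 / (3 * b)) / (2 * \<kappa>)) \<le> 1 / (real p)\<^sup>2" .
      qed (use \<kappa> in auto)
      finally show "(\<integral>x. T j x \<partial>N i) \<le> 768 * \<kappa> ^ 4 * (1 / (real p)\<^sup>2)" .
    qed (use B_ge_1 b_pos d_pos in auto)
    also have "3240 * B * (b ^ 3 / d * (48 * \<kappa> ^ 4) + b ^ 4 * (\<Sum>j=1..p. 768 * \<kappa> ^ 4 * (1 / (real p)\<^sup>2)))
        = 3240 * B * (b ^ 3 / d * (48 * \<kappa> ^ 4) + b ^ 4 * (768 * \<kappa> ^ 4 / p))"
    proof -
      have "(\<Sum>j=1..p. 768 * \<kappa> ^ 4 * (1 / (real p)\<^sup>2)) = 768 * \<kappa> ^ 4 / p"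
        using p3 by (simp add: power2_eq_square)
      then show ?thesis by (simp only:)
    qed
    \<comment> \<open>Since b d = ln p <= p, the tail contribution b^4 / p is absorbed into b^3 / d;
      afterwards 48 + 768 = 816.\<close>
    also have "3240 * B * (b ^ 3 / d * (48 * \<kappa> ^ 4) + b ^ 4 * (768 * \<kappa> ^ 4 / p)) \<le> 3240 * B * (b ^ 3 / d * (48 * \<kappa> ^ 4) + b ^ 3 / d * (768 * \<kappa> ^ 4))"
    proof (intro mult_left_mono add_left_mono)
      have "ln p \<le> real p" using ln_le_minus_one[of "real p"] p3 by simp
      then have "b / p \<le> 1 / d" using bd_eq d_pos p3 by (simp add: field_simps)
      then have "b ^ 3 * (768 * \<kappa> ^ 4) * (b / p) \<le> b ^ 3 * (768 * \<kappa> ^ 4) * (1 / d)"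
        using b_pos \<kappa> by (intro mult_left_mono) auto
      then show "b ^ 4 * (768 * \<kappa> ^ 4 / p) \<le> b ^ 3 / d * (768 * \<kappa> ^ 4)"
        by (simp add: eval_nat_numeral mult_ac)
    qed (use B_ge_1 in auto)
    also have "\<dots> = step_err / 2" by (simp add: step_err_def field_simps)
    finally show ?thesis .
  qed
  have hom: "D1 w (\<lambda>j. e * x j) = e * D1 w x" "D2 w (\<lambda>j. e * x j) = e\<^sup>2 * D2 w x" "D3 w (\<lambda>j. e * x j) = e ^ 3 * D3 w x" for e x
    unfolding D1_def D2_def D3_def power_mult_distrib avg_cmult
    by (simp_all add: algebra_simps eval_nat_numeral)
  define q where "q x = u w + D2 w x / 2 + D3 w x / 6" for x
  define a where "a x = (\<integral>e. u (\<lambda>j. w j + e * x j) \<partial>skew_law)" for x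
  have [measurable]: "(\<lambda>(x, e). u (\<lambda>j. w j + e * x j)) \<in> borel_measurable (N i \<Otimes>\<^sub>M skew_law)"
    unfolding split_def by (intro u_measurable) measurable
  have a_meas [measurable]: "a \<in> borel_measurable (N i)"
    unfolding a_def[abs_def] by measurable
  have ue_meas: "(\<lambda>e. u (\<lambda>j. w j + e * x j)) \<in> borel_measurable borel" for x :: "nat \<Rightarrow> real"
    by (intro u_measurable) measurable
  have ui: "integrable skew_law (\<lambda>e. u (\<lambda>j. w j + e * x j))" for x :: "nat \<Rightarrow> real"
    by (rule integrable_skew_law[OF ue_meas u_bound])
  have pw: "integrable skew_law (\<lambda>e. e ^ k)" for k
  proof (rule integrable_skew_law[where C="3 ^ k"])
    show "\<bar>x ^ k\<bar> \<le> 3 ^ k" if "\<bar>x\<bar> \<le> 3" for x :: real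
      using that by (simp add: power_abs power_mono)
  qed simp
  note pw1 = pw[of 1, simplified]
  have a_q: "\<bar>a x - q x\<bar> \<le> R x" for x
  proof -
    have Ti: "integrable skew_law (\<lambda>e. u w + e * D1 w x + e\<^sup>2 * D2 w x / 2 + e ^ 3 * D3 w x / 6)"
      using pw pw1 by simp
    have "(\<integral>e. u w + e * D1 w x + e\<^sup>2 * D2 w x / 2 + e ^ 3 * D3 w x / 6 \<partial>skew_law) = q x"
      using pw pw1 E.prob_space by (simp add: q_def skew_law_moments)
    then have eq: "a x - q x = (\<integral>e. u (\<lambda>j. w j + e * x j) - (u w + e * D1 w x + e\<^sup>2 * D2 w x / 2 + e ^ 3 * D3 w x / 6) \<partial>skew_law)"
      unfolding a_def using ui Ti by simp
    have "\<bar>a x - q x\<bar> \<le> (\<integral>e. \<bar>u (\<lambda>j. w j + e * x j) - (u w + e * D1 w x + e\<^sup>2 * D2 w x / 2 + e ^ 3 * D3 w x / 6)\<bar> \<partial>skew_law)"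
      unfolding eq by (rule integral_abs_bound)
    also have "\<dots> \<le> (\<integral>e. R x \<partial>skew_law)"
    proof (rule integral_mono_AE)
      show "AE e in skew_law. \<bar>u (\<lambda>j. w j + e * x j) - (u w + e * D1 w x + e\<^sup>2 * D2 w x / 2 + e ^ 3 * D3 w x / 6)\<bar> \<le> R x"
      proof (rule AE_mp[OF skew_law_bounded], intro AE_I2 impI)
        fix e :: real assume elim: "\<bar>e\<bar> \<le> 3"
        have "\<bar>u (\<lambda>j. w j + e * x j) - u w - e * D1 w x - e\<^sup>2 * D2 w x / 2 - e ^ 3 * D3 w x / 6\<bar>
            \<le> remainder_bound w (\<lambda>j. e * x j)"
        proof -
          have T: "\<bar>u (\<lambda>j. w j + e * x j) - u w - D1 w (\<lambda>j. e * x j) - D2 w (\<lambda>j. e * x j) / 2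
              - D3 w (\<lambda>j. e * x j) / 6\<bar> \<le> remainder_bound w (\<lambda>j. e * x j)"
            by (rule Taylor_u)
          have h: "D1 w (\<lambda>j. e * x j) = e * D1 w x" "D2 w (\<lambda>j. e * x j) = e\<^sup>2 * D2 w x"
            "D3 w (\<lambda>j. e * x j) = e ^ 3 * D3 w x"
            by (rule hom)+
          show ?thesis
            using T
            unfolding h
            by assumption
        qed
        then show "\<bar>u (\<lambda>j. w j + e * x j) - (u w + e * D1 w x + e\<^sup>2 * D2 w x / 2 + e ^ 3 * D3 w x / 6)\<bar> \<le> R x"
          using R_ge[OF elim, of x] by linarith
      qed
    qed (use ui Ti in auto)
    also have "\<dots> = R x" using E.prob_space by simp
    finally show ?thesis .
  qed
  have u_q: "\<bar>u (\<lambda>j. w j + x j) - q x - D1 w x\<bar> \<le> R x" for x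
  proof -
    have "remainder_bound w x \<le> R x" using R_ge[of 1 x] by simp
    then show ?thesis using Taylor_u[of w x] unfolding q_def by linarith
  qed
  have cint: "integrable (N i) (\<lambda>x. x j)" if "j \<in> {1..p}" for j
    using moments(1)[OF that that that, of i] by (simp add: integrable_abs_iff coord[OF that])
  have "integrable (N i) (\<lambda>x. \<Sum>j=1..p. weight w j * x j)"
    by (intro integrable_mult_right Bochner_Integration.integrable_sum cint; assumption)
  then have D1i: "integrable (N i) (\<lambda>x. D1 w x)"
    unfolding D1_def avg_def by (rule integrable_mult_right)
  have "(\<integral>x. (\<Sum>j=1..p. weight w j * x j) \<partial>N i) = (\<Sum>j=1..p. \<integral>x. weight w j * x j \<partial>N i)"
    by (rule Bochner_Integration.integral_sum) (intro integrable_mult_right cint; assumption)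
  also have "\<dots> = 0" by (rule sum.neutral) (simp add: centered)
  finally have D10: "(\<integral>x. D1 w x \<partial>N i) = 0"
    unfolding D1_def avg_def by simp
  have um: "(\<lambda>x. u (\<lambda>j. w j + x j)) \<in> borel_measurable (N i)" by (intro u_measurable) measurable
  have ui': "integrable (N i) (\<lambda>x. u (\<lambda>j. w j + x j))"
    by (rule integrable_N_bounded[where B=B, OF _ um]) (use u_bound in auto)
  have a_b: "\<bar>a x\<bar> \<le> B" for x
  proof -
    have "\<bar>a x\<bar> \<le> (\<integral>e. \<bar>u (\<lambda>j. w j + e * x j)\<bar> \<partial>skew_law)" unfolding a_def by (rule integral_abs_bound)
    also have "\<dots> \<le> (\<integral>e. B \<partial>skew_law)" using ui u_bound by (intro integral_mono) auto
    finally show ?thesis using E.prob_space by simp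
  qed
  have ai: "integrable (N i) a" by (rule integrable_N_bounded[where B=B, OF _ a_meas]) (use a_b in auto)
  have eq: "(\<integral>x. u (\<lambda>j. w j + x j) \<partial>N i) - (\<integral>x. a x \<partial>N i) = (\<integral>x. u (\<lambda>j. w j + x j) - a x - D1 w x \<partial>N i)"
    using ui' ai D1i D10 by simp
  have "\<bar>(\<integral>x. u (\<lambda>j. w j + x j) \<partial>N i) - (\<integral>x. a x \<partial>N i)\<bar> \<le> (\<integral>x. \<bar>u (\<lambda>j. w j + x j) - a x - D1 w x\<bar> \<partial>N i)"
    unfolding eq by (rule integral_abs_bound)
  also have "\<dots> \<le> (\<integral>x. 2 * R x \<partial>N i)"
  proof (rule integral_mono)
    show "\<bar>u (\<lambda>j. w j + x j) - a x - D1 w x\<bar> \<le> 2 * R x" for x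
      using a_q[of x] u_q[of x] by linarith
  qed (use ui' ai D1i R_int in auto)
  also have "\<dots> \<le> step_err" using R_le by simp
  finally show ?thesis by (simp add: a_def)
qed

text \<open>Lindeberg's replacement by induction on the index set, with an arbitrary shift
  \<open>z\<close> so that the summand already split off can be moved into the shift.\<close>

lemma exchange:
  assumes "finite I"
  shows "\<bar>(\<integral>x. u (\<lambda>j. z j + (\<Sum>i\<in>I. x i j)) \<partial>PiM I N)
     - (\<integral>x. (\<integral>e. u (\<lambda>j. z j + (\<Sum>i\<in>I. e i * x i j)) \<partial>PiM I (\<lambda>_. skew_law)) \<partial>PiM I N)\<bar> \<le> card I * step_err"
  using assms
proof (induction I arbitrary: z rule: finite_induct)
  case empty
  have "prob_space (PiM {} N)" "prob_space (PiM {} (\<lambda>_::nat. skew_law))"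
    by (auto intro!: prob_space_PiM prob_N prob_space_skew_law)
  then show ?case by (simp add: prob_space.prob_space)
next
  case (insert k I)
  interpret Sk: product_prob_space "\<lambda>_::nat. skew_law" UNIV
    by (rule product_prob_spaceI) (rule prob_space_skew_law)
  let ?E = "PiM I (\<lambda>_. skew_law)" and ?J = "PiM I N"
  have PE: "prob_space ?E" and PJ: "prob_space ?J" and PE': "prob_space (PiM (insert k I) (\<lambda>_. skew_law))" and PJ': "prob_space (PiM (insert k I) N)"
    by (auto intro!: prob_space_PiM prob_N prob_space_skew_law)
  interpret E: prob_space ?E by (rule PE)
  interpret J: prob_space ?J by (rule PJ)
  interpret E': prob_space "PiM (insert k I) (\<lambda>_. skew_law)" by (rule PE')
  interpret J': prob_space "PiM (insert k I) N" by (rule PJ')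
  interpret Nk: prob_space "N k" by (rule prob_N)
  interpret S: prob_space skew_law by (rule prob_space_skew_law)
  have ub: "\<bar>u x\<bar> \<le> B" for x by (rule u_bound)
  \<comment> \<open>Holds without measurability of \<open>f\<close>, because the integral of a
    non-integrable function is 0.\<close>
  have ib: "\<bar>\<integral>y. f y \<partial>Q\<bar> \<le> B" if "prob_space Q" "\<And>y. \<bar>f y\<bar> \<le> B" for Q :: "'z measure" and f :: "'z \<Rightarrow> real"
  proof -
    interpret Q: prob_space Q by fact
    show ?thesis
    proof (cases "integrable Q f")
      case True
      have "\<bar>\<integral>y. f y \<partial>Q\<bar> \<le> (\<integral>y. \<bar>f y\<bar> \<partial>Q)" by (rule integral_abs_bound)
      also have "\<dots> \<le> (\<integral>y. B \<partial>Q)" using True that by (intro integral_mono) auto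
      finally show ?thesis using Q.prob_space by simp
    qed (use B_ge_1 in \<open>simp add: not_integrable_integral_eq\<close>)
  qed
  have bi: "integrable Q f" if "prob_space Q" "f \<in> borel_measurable Q" "\<And>y. \<bar>f y\<bar> \<le> B" for Q :: "'z measure" and f :: "'z \<Rightarrow> real"
    by (rule finite_measure.integrable_const_bound[where B=B]) (use that in \<open>auto intro: prob_space.finite_measure\<close>)
  have cJ [measurable]: "i \<in> I \<Longrightarrow> j \<in> {1..p} \<Longrightarrow> (\<lambda>x. x i j) \<in> borel_measurable ?J" for i j by (rule coord_PiM)
  have cE [measurable]: "i \<in> I \<Longrightarrow> (\<lambda>e. e i) \<in> borel_measurable ?E" for i
    using measurable_component_singleton[of i I "\<lambda>_. skew_law"] unfolding measurable_cong_sets[OF refl sets_skew_law] by simp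
  have cJ' [measurable]: "i \<in> insert k I \<Longrightarrow> j \<in> {1..p} \<Longrightarrow> (\<lambda>x. x i j) \<in> borel_measurable (PiM (insert k I) N)" for i j by (rule coord_PiM)
  have cE' [measurable]: "i \<in> insert k I \<Longrightarrow> (\<lambda>e. e i) \<in> borel_measurable (PiM (insert k I) (\<lambda>_. skew_law))" for i
    using measurable_component_singleton[of i "insert k I" "\<lambda>_. skew_law"] unfolding measurable_cong_sets[OF refl sets_skew_law] by simp
  define s where "s x j = (\<Sum>i\<in>I. x i j)" for x :: "nat \<Rightarrow> nat \<Rightarrow> real" and j
  define v where "v x e j = (\<Sum>i\<in>I. e i * x i j)" for x :: "nat \<Rightarrow> nat \<Rightarrow> real" and e :: "nat \<Rightarrow> real" and j
  have upd_s: "(\<Sum>i\<in>insert k I. (x(k := y)) i j) = y j + s x j" for x y j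
  proof -
    have "(\<Sum>i\<in>I. (x(k := y)) i j) = s x j" unfolding s_def using insert.hyps by (intro sum.cong) auto
    then show ?thesis using insert.hyps by simp
  qed
  have upd_v: "(\<Sum>i\<in>insert k I. (e(k := c)) i * (x(k := y)) i j) = c * y j + v x e j" for x y e c j
  proof -
    have "(\<Sum>i\<in>I. (e(k := c)) i * (x(k := y)) i j) = v x e j" unfolding v_def using insert.hyps by (intro sum.cong) auto
    then show ?thesis using insert.hyps by simp
  qed
  define A where "A w = (\<integral>x. u (\<lambda>j. w j + s x j) \<partial>?J)" for w
  define D where "D w = (\<integral>x. (\<integral>e. u (\<lambda>j. w j + v x e j) \<partial>?E) \<partial>?J)" for w
  have IH: "\<bar>A w - D w\<bar> \<le> card I * step_err" for w
    using insert.IH[of w] by (simp add: A_def D_def s_def v_def)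
  have m1: "(\<lambda>(y, x). u (\<lambda>j. z j + y j + s x j)) \<in> borel_measurable (N k \<Otimes>\<^sub>M ?J)"
    unfolding split_def s_def by (intro u_measurable) measurable
  have m3: "(\<lambda>(q, e). u (\<lambda>j. z j + fst q j + v (snd q) e j)) \<in> borel_measurable ((N k \<Otimes>\<^sub>M ?J) \<Otimes>\<^sub>M ?E)"
    unfolding split_def v_def by (intro u_measurable) measurable
  have m3': "(\<lambda>(y, e). u (\<lambda>j. z j + y j + v x e j)) \<in> borel_measurable (N k \<Otimes>\<^sub>M ?E)" for x
    unfolding split_def v_def by (intro u_measurable) measurable
  have m4: "(\<lambda>(q, c). u (\<lambda>j. z j + c * fst q j + v x (snd q) j)) \<in> borel_measurable ((N k \<Otimes>\<^sub>M ?E) \<Otimes>\<^sub>M skew_law)" for x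
    unfolding split_def v_def by (intro u_measurable) measurable
  have m5: "(\<lambda>(x, e). u (\<lambda>j. z j + (\<Sum>i\<in>insert k I. e i * x i j))) \<in> borel_measurable (PiM (insert k I) N \<Otimes>\<^sub>M PiM (insert k I) (\<lambda>_. skew_law))"
    unfolding split_def by (intro u_measurable) measurable
  have m6: "(\<lambda>x. u (\<lambda>j. z j + (\<Sum>i\<in>insert k I. x i j))) \<in> borel_measurable (PiM (insert k I) N)"
    by (intro u_measurable) measurable
  have m7: "(\<lambda>(q, y). u (\<lambda>j. z j + v (fst q) (snd q) j + y j)) \<in> borel_measurable ((?J \<Otimes>\<^sub>M ?E) \<Otimes>\<^sub>M N k)"
    unfolding split_def v_def by (intro u_measurable) measurable
  have m8: "(\<lambda>(q, c). u (\<lambda>j. z j + v (fst (fst q)) (snd (fst q)) j + c * snd q j)) \<in> borel_measurable (((?J \<Otimes>\<^sub>M ?E) \<Otimes>\<^sub>M N k) \<Otimes>\<^sub>M skew_law)"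
    unfolding split_def v_def by (intro u_measurable) measurable
  \<comment> \<open>\<open>\<alpha>\<close> integrates the new summand as it is,
    \<open>\<beta>\<close> with its multiplier. Averaging \<open>\<alpha>\<close> over the skewed
    old summands gives the hybrid term: the induction hypothesis connects it to the original sum,
    and \<open>exchange_one\<close> to the fully skewed one.\<close>
  define \<alpha> where "\<alpha> w = (\<integral>y. u (\<lambda>j. w j + y j) \<partial>N k)" for w
  define \<beta> where "\<beta> w = (\<integral>y. (\<integral>c. u (\<lambda>j. w j + c * y j) \<partial>skew_law) \<partial>N k)" for w
  have one: "\<bar>\<alpha> w - \<beta> w\<bar> \<le> step_err" for w unfolding \<alpha>_def \<beta>_def by (rule exchange_one)
  have am: "(\<lambda>(x, e). \<alpha> (\<lambda>j. z j + v x e j)) \<in> borel_measurable (?J \<Otimes>\<^sub>M ?E)"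
    unfolding \<alpha>_def split_def by (rule borel_measurable_integral_prob[OF prob_N m7])
  have bm: "(\<lambda>(x, e). \<beta> (\<lambda>j. z j + v x e j)) \<in> borel_measurable (?J \<Otimes>\<^sub>M ?E)"
  proof -
    have "(\<lambda>(q, y). \<integral>c. u (\<lambda>j. z j + v (fst q) (snd q) j + c * y j) \<partial>skew_law) \<in> borel_measurable ((?J \<Otimes>\<^sub>M ?E) \<Otimes>\<^sub>M N k)"
      unfolding split_def by (rule borel_measurable_integral_prob[OF prob_space_skew_law m8])
    then show ?thesis unfolding \<beta>_def split_def by (rule borel_measurable_integral_prob[OF prob_N, unfolded split_def])
  qed
  have \<alpha>b: "\<bar>\<alpha> w\<bar> \<le> B" and \<beta>b: "\<bar>\<beta> w\<bar> \<le> B" for w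
    unfolding \<alpha>_def \<beta>_def by (intro ib prob_N prob_space_skew_law ub)+
  have first: "(\<integral>x. u (\<lambda>j. z j + (\<Sum>i\<in>insert k I. x i j)) \<partial>PiM (insert k I) N) = (\<integral>y. A (\<lambda>j. z j + y j) \<partial>N k)"
  proof -
    have "(\<integral>x. u (\<lambda>j. z j + (\<Sum>i\<in>insert k I. x i j)) \<partial>PiM (insert k I) N)
      = (\<integral>x. (\<integral>y. u (\<lambda>j. z j + (\<Sum>i\<in>insert k I. (x(k := y)) i j)) \<partial>N k) \<partial>?J)"
      by (rule product_integral_insert[OF insert.hyps bi[OF PJ' m6 ub]])
    also have "\<dots> = (\<integral>x. (\<integral>y. u (\<lambda>j. z j + y j + s x j) \<partial>N k) \<partial>?J)"
      unfolding upd_s by (simp add: add.assoc)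
    also have "\<dots> = (\<integral>y. (\<integral>x. u (\<lambda>j. z j + y j + s x j) \<partial>?J) \<partial>N k)"
      by (rule integral_swap_bounded[OF prob_N PJ m1 ub, symmetric])
    finally show ?thesis by (simp add: A_def)
  qed
  have second: "(\<integral>x. (\<integral>e. u (\<lambda>j. z j + (\<Sum>i\<in>insert k I. e i * x i j)) \<partial>PiM (insert k I) (\<lambda>_. skew_law)) \<partial>PiM (insert k I) N)
      = (\<integral>x. (\<integral>e. \<beta> (\<lambda>j. z j + v x e j) \<partial>?E) \<partial>?J)"
  proof -
    have mi: "(\<lambda>x. \<integral>e. u (\<lambda>j. z j + (\<Sum>i\<in>insert k I. e i * x i j)) \<partial>PiM (insert k I) (\<lambda>_. skew_law)) \<in> borel_measurable (PiM (insert k I) N)"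
      using borel_measurable_integral_prob[OF PE' m5] .
    have "(\<integral>x. (\<integral>e. u (\<lambda>j. z j + (\<Sum>i\<in>insert k I. e i * x i j)) \<partial>PiM (insert k I) (\<lambda>_. skew_law)) \<partial>PiM (insert k I) N)
      = (\<integral>x. (\<integral>y. (\<integral>e. u (\<lambda>j. z j + (\<Sum>i\<in>insert k I. e i * (x(k := y)) i j)) \<partial>PiM (insert k I) (\<lambda>_. skew_law)) \<partial>N k) \<partial>?J)"
      by (rule product_integral_insert[OF insert.hyps bi[OF PJ' mi]]) (intro ib PE' ub)
    also have "\<dots> = (\<integral>x. (\<integral>y. (\<integral>e. (\<integral>c. u (\<lambda>j. z j + (\<Sum>i\<in>insert k I. (e(k := c)) i * (x(k := y)) i j)) \<partial>skew_law) \<partial>?E) \<partial>N k) \<partial>?J)"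
    proof -
      have "(\<integral>e. u (\<lambda>j. z j + (\<Sum>i\<in>insert k I. e i * x i j)) \<partial>PiM (insert k I) (\<lambda>_. skew_law))
        = (\<integral>e. (\<integral>c. u (\<lambda>j. z j + (\<Sum>i\<in>insert k I. (e(k := c)) i * x i j)) \<partial>skew_law) \<partial>?E)" for x :: "nat \<Rightarrow> nat \<Rightarrow> real"
      proof (rule Sk.product_integral_insert[OF insert.hyps])
        have "(\<lambda>e. u (\<lambda>j. z j + (\<Sum>i\<in>insert k I. e i * x i j))) \<in> borel_measurable (PiM (insert k I) (\<lambda>_. skew_law))"
          by (intro u_measurable) measurable
        then show "integrable (PiM (insert k I) (\<lambda>_. skew_law)) (\<lambda>e. u (\<lambda>j. z j + (\<Sum>i\<in>insert k I. e i * x i j)))"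
          by (rule bi[OF PE' _ ub])
      qed
      then show ?thesis by simp
    qed
    also have "\<dots> = (\<integral>x. (\<integral>y. (\<integral>e. (\<integral>c. u (\<lambda>j. z j + c * y j + v x e j) \<partial>skew_law) \<partial>?E) \<partial>N k) \<partial>?J)"
      unfolding upd_v by (simp add: add.assoc)
    also have "\<dots> = (\<integral>x. (\<integral>e. (\<integral>y. (\<integral>c. u (\<lambda>j. z j + c * y j + v x e j) \<partial>skew_law) \<partial>N k) \<partial>?E) \<partial>?J)"
    proof -
      have "(\<lambda>(y, e). \<integral>c. u (\<lambda>j. z j + c * y j + v x e j) \<partial>skew_law) \<in> borel_measurable (N k \<Otimes>\<^sub>M ?E)" for x
        unfolding split_def by (rule borel_measurable_integral_prob[OF prob_space_skew_law m4])
      then have "(\<integral>y. (\<integral>e. (\<integral>c. u (\<lambda>j. z j + c * y j + v x e j) \<partial>skew_law) \<partial>?E) \<partial>N k)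
        = (\<integral>e. (\<integral>y. (\<integral>c. u (\<lambda>j. z j + c * y j + v x e j) \<partial>skew_law) \<partial>N k) \<partial>?E)" for x
        by (rule integral_swap_bounded[where C=B, OF prob_N PE]) (intro ib prob_space_skew_law ub)
      then show ?thesis by simp
    qed
    also have "\<dots> = (\<integral>x. (\<integral>e. \<beta> (\<lambda>j. z j + v x e j) \<partial>?E) \<partial>?J)"
      unfolding \<beta>_def by (simp add: add_ac)
    finally show ?thesis .
  qed
  have third: "(\<integral>x. (\<integral>e. \<alpha> (\<lambda>j. z j + v x e j) \<partial>?E) \<partial>?J) = (\<integral>y. D (\<lambda>j. z j + y j) \<partial>N k)"
  proof -
    have "(\<integral>x. (\<integral>e. \<alpha> (\<lambda>j. z j + v x e j) \<partial>?E) \<partial>?J) = (\<integral>x. (\<integral>e. (\<integral>y. u (\<lambda>j. z j + y j + v x e j) \<partial>N k) \<partial>?E) \<partial>?J)"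
      unfolding \<alpha>_def by (simp add: add_ac)
    also have "\<dots> = (\<integral>x. (\<integral>y. (\<integral>e. u (\<lambda>j. z j + y j + v x e j) \<partial>?E) \<partial>N k) \<partial>?J)"
      using integral_swap_bounded[OF prob_N PE m3' ub] by simp
    also have "\<dots> = (\<integral>y. (\<integral>x. (\<integral>e. u (\<lambda>j. z j + y j + v x e j) \<partial>?E) \<partial>?J) \<partial>N k)"
    proof (rule integral_swap_bounded[OF prob_N PJ, symmetric])
      show "(\<lambda>(y, x). \<integral>e. u (\<lambda>j. z j + y j + v x e j) \<partial>?E) \<in> borel_measurable (N k \<Otimes>\<^sub>M ?J)"
        unfolding split_def by (rule borel_measurable_integral_prob[OF PE m3])
      show "\<bar>\<integral>e. u (\<lambda>j. z j + y j + v x e j) \<partial>?E\<bar> \<le> B" for y x by (intro ib PE ub)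
    qed
    finally show ?thesis by (simp add: D_def)
  qed
  have Am: "(\<lambda>y. A (\<lambda>j. z j + y j)) \<in> borel_measurable (N k)"
    unfolding A_def using borel_measurable_integral_prob[OF PJ m1] .
  have Dm: "(\<lambda>y. D (\<lambda>j. z j + y j)) \<in> borel_measurable (N k)"
  proof -
    have "(\<lambda>(y, x). \<integral>e. u (\<lambda>j. z j + y j + v x e j) \<partial>?E) \<in> borel_measurable (N k \<Otimes>\<^sub>M ?J)"
      unfolding split_def by (rule borel_measurable_integral_prob[OF PE m3])
    then show ?thesis unfolding D_def by (rule borel_measurable_integral_prob[OF PJ])
  qed
  have Ab: "\<bar>A w\<bar> \<le> B" "\<bar>D w\<bar> \<le> B" for w unfolding A_def D_def by (intro ib PJ PE ub)+
  have "\<bar>(\<integral>y. A (\<lambda>j. z j + y j) \<partial>N k) - (\<integral>y. D (\<lambda>j. z j + y j) \<partial>N k)\<bar> \<le> card I * step_err"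
    by (rule prob_space.abs_integral_diff_le[OF prob_N bi[OF prob_N Am Ab(1)] bi[OF prob_N Dm Ab(2)] IH])
  moreover have "\<bar>(\<integral>x. (\<integral>e. \<alpha> (\<lambda>j. z j + v x e j) \<partial>?E) \<partial>?J) - (\<integral>x. (\<integral>e. \<beta> (\<lambda>j. z j + v x e j) \<partial>?E) \<partial>?J)\<bar> \<le> step_err"
  proof (rule J.abs_integral_diff_le)
    show "integrable ?J (\<lambda>x. \<integral>e. \<alpha> (\<lambda>j. z j + v x e j) \<partial>?E)"
      by (rule bi[OF PJ borel_measurable_integral_prob[OF PE am]]) (intro ib PE \<alpha>b)
    show "integrable ?J (\<lambda>x. \<integral>e. \<beta> (\<lambda>j. z j + v x e j) \<partial>?E)"
      by (rule bi[OF PJ borel_measurable_integral_prob[OF PE bm]]) (intro ib PE \<beta>b)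
    fix x assume x: "x \<in> space ?J"
    have ame: "(\<lambda>e. \<alpha> (\<lambda>j. z j + v x e j)) \<in> borel_measurable ?E"
      using measurable_compose[OF measurable_Pair1'[OF x] am] by simp
    have bme: "(\<lambda>e. \<beta> (\<lambda>j. z j + v x e j)) \<in> borel_measurable ?E"
      using measurable_compose[OF measurable_Pair1'[OF x] bm] by simp
    show "\<bar>(\<integral>e. \<alpha> (\<lambda>j. z j + v x e j) \<partial>?E) - (\<integral>e. \<beta> (\<lambda>j. z j + v x e j) \<partial>?E)\<bar> \<le> step_err"
      by (rule E.abs_integral_diff_le[OF bi[OF PE ame \<alpha>b] bi[OF PE bme \<beta>b] one])
  qed
  ultimately have "\<bar>(\<integral>y. A (\<lambda>j. z j + y j) \<partial>N k) - (\<integral>x. (\<integral>e. \<beta> (\<lambda>j. z j + v x e j) \<partial>?E) \<partial>?J)\<bar> \<le> card I * step_err + step_err"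
    unfolding third by linarith
  then show ?case
    unfolding first second using insert.hyps by (simp add: algebra_simps)
qed

end

section \<open>Truncation and exponential moments for the random covariance matrix\<close>

section \<open>Fluctuations of the skewed covariance\<close>

lemma skew_kernel_bounds: "0 \<le> skew_kernel x" "skew_kernel x \<le> 2"
  and skew_kernel_measurable [measurable]: "skew_kernel \<in> borel_measurable borel"
  using skew_law_stein by (auto simp: has_stein_kernel_def)

text \<open>For z = -w < 0 the product (1 - w + w^2)(1 + w + w^2/2) is at least 1, and its second
  factor is at most exp w.\<close>

lemma exp_le_quadratic: "\<bar>z\<bar> \<le> 1 \<Longrightarrow> exp z \<le> 1 + z + z\<^sup>2" for z :: real
proof (cases "z \<ge> 0")
  case True
  assume "\<bar>z\<bar> \<le> 1"
  then show ?thesis using True exp_bound[of z] by simp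
next
  case False
  define w where "w = - z"
  have w: "w > 0" using False by (simp add: w_def)
  have "1 \<le> (1 - w + w\<^sup>2) * (1 + w + w\<^sup>2 / 2)"
  proof -
    have "(1 - w + w\<^sup>2) * (1 + w + w\<^sup>2 / 2) = 1 + (w\<^sup>2 + w ^ 3 + w ^ 4) / 2" by (simp add: field_simps eval_nat_numeral)
    then show ?thesis using w by simp
  qed
  also have "\<dots> \<le> (1 - w + w\<^sup>2) * exp w"
  proof (rule mult_left_mono)
    show "1 + w + w\<^sup>2 / 2 \<le> exp w" using w by (intro exp_lower_Taylor_quadratic) simp
    show "0 \<le> 1 - w + w\<^sup>2" using zero_le_power2[of "1 - w"] w by (simp add: power2_diff)
  qed
  finally have "exp (- w) \<le> 1 - w + w\<^sup>2" by (simp add: exp_minus field_simps)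
  then show ?thesis by (simp add: w_def)
qed

context subexponential_laws
begin

definition clip :: "real \<Rightarrow> nat \<Rightarrow> nat \<Rightarrow> (nat \<Rightarrow> real) \<Rightarrow> real" where
  "clip a j k x = (if \<bar>x j\<bar> \<le> a \<and> \<bar>x k\<bar> \<le> a then x j * x k else 0)"

text \<open>One quantity that dominates the truncation error of the products x_j x_k for all pairs
  (j, k) simultaneously.\<close>

definition tail_sq :: "real \<Rightarrow> (nat \<Rightarrow> real) \<Rightarrow> real" where
  "tail_sq a x = (\<Sum>j=1..p. (x j)\<^sup>2 * indicator {r. a < \<bar>r\<bar>} (x j))"

lemma clip_bound: assumes "0 \<le> a" shows "\<bar>clip a j k x\<bar> \<le> a\<^sup>2"
proof -
  have "\<bar>x j * x k\<bar> \<le> a * a" if "\<bar>x j\<bar> \<le> a" "\<bar>x k\<bar> \<le> a"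
    unfolding abs_mult using that by (intro mult_mono) auto
  then show ?thesis by (auto simp: clip_def power2_eq_square)
qed

lemma clip_sq_le: "(clip a j k x)\<^sup>2 \<le> (x j ^ 4 + x k ^ 4) / 2"
proof -
  have "(x j * x k)\<^sup>2 \<le> (x j ^ 4 + x k ^ 4) / 2"
    using sum_squares_bound[of "(x j)\<^sup>2" "(x k)\<^sup>2"] by (simp add: power_mult_distrib)
  then show ?thesis by (auto simp: clip_def)
qed

lemma clip_measurable [measurable]:
  assumes [measurable]: "j \<in> {1..p}" "k \<in> {1..p}" shows "clip a j k \<in> borel_measurable (N i)"
  unfolding clip_def[abs_def] by measurable

text \<open>If the product is cut off, the larger of its two factors exceeds \<open>a\<close>, and
  the square of that factor dominates the product.\<close>

lemma abs_prod_diff_clip: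
  assumes jk: "j \<in> {1..p}" "k \<in> {1..p}"
  shows "\<bar>x j * x k - clip a j k x\<bar> \<le> tail_sq a x"
proof -
  have T: "(x l)\<^sup>2 * indicator {r. a < \<bar>r\<bar>} (x l) \<le> tail_sq a x" if "l \<in> {1..p}" for l
    unfolding tail_sq_def using that by (intro member_le_sum) auto
  have prod: "\<bar>x j * x k\<bar> \<le> (x l)\<^sup>2" if "\<bar>x j\<bar> \<le> \<bar>x l\<bar>" "\<bar>x k\<bar> \<le> \<bar>x l\<bar>" for l
    using mult_mono[OF that] by (simp add: abs_mult power2_eq_square)
  show ?thesis
  proof (cases "\<bar>x j\<bar> \<le> a \<and> \<bar>x k\<bar> \<le> a")
    case True
    have "0 \<le> tail_sq a x" unfolding tail_sq_def by (intro sum_nonneg) auto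
    then show ?thesis using True by (simp add: clip_def)
  next
    case False
    then have eq: "x j * x k - clip a j k x = x j * x k" by (auto simp: clip_def)
    show ?thesis
    proof (cases "\<bar>x j\<bar> \<le> \<bar>x k\<bar>")
      case True
      then have "a < \<bar>x k\<bar>" using False by linarith
      then show ?thesis using T[OF jk(2)] prod[OF True order_refl] unfolding eq by simp
    next
      case F: False
      then have "a < \<bar>x j\<bar>" using False by linarith
      then show ?thesis using T[OF jk(1)] prod[OF order_refl] F unfolding eq by simp
    qed
  qed
qed

lemma prod_integrable:
  assumes jk: "j \<in> {1..p}" "k \<in> {1..p}" shows "integrable (N i) (\<lambda>x. x j * x k)"
proof (rule Bochner_Integration.integrable_bound)
  interpret prob_space "N i" by (rule prob_N)
  show "integrable (N i) (\<lambda>x. 1 + x j ^ 4 + x k ^ 4)"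
    using moments(2)[OF jk(1) jk(1) jk(1), of i] moments(2)[OF jk(2) jk(2) jk(2), of i] by simp
  show "(\<lambda>x. x j * x k) \<in> borel_measurable (N i)" using coord[OF jk(1)] coord[OF jk(2)] by simp
  have "\<bar>r * s\<bar> \<le> 1 + r ^ 4 + s ^ 4" for r s :: real
  proof -
    have "2 * \<bar>r * s\<bar> \<le> r\<^sup>2 + s\<^sup>2" using sum_squares_bound[of "\<bar>r\<bar>" "\<bar>s\<bar>"] by (simp add: abs_mult)
    moreover have "2 * r\<^sup>2 \<le> 1 + r ^ 4" for r :: real using sum_squares_bound[of "r\<^sup>2" 1] by simp
    moreover have "0 \<le> r ^ 4" "0 \<le> s ^ 4" by auto
    ultimately show ?thesis using \<open>\<And>r. 2 * r\<^sup>2 \<le> 1 + r ^ 4\<close>[of r] \<open>\<And>r. 2 * r\<^sup>2 \<le> 1 + r ^ 4\<close>[of s] by linarith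
  qed
  then show "AE x in N i. norm (x j * x k) \<le> norm (1 + x j ^ 4 + x k ^ 4)"
    by (intro AE_I2) (simp add: abs_of_nonneg add_nonneg_nonneg)
qed

lemma clip_integrable:
  assumes jk: "j \<in> {1..p}" "k \<in> {1..p}" and a: "0 \<le> a"
  shows "integrable (N i) (clip a j k)" "integrable (N i) (\<lambda>x. (clip a j k x)\<^sup>2)"
    "(\<integral>x. (clip a j k x)\<^sup>2 \<partial>N i) \<le> 48 * \<kappa> ^ 4"
    "(\<integral>x. clip a j k x \<partial>N i)\<^sup>2 \<le> (\<integral>x. (clip a j k x)\<^sup>2 \<partial>N i)" "\<bar>\<integral>x. clip a j k x \<partial>N i\<bar> \<le> a\<^sup>2"
proof -
  have m: "clip a j k \<in> borel_measurable (N i)" by (rule clip_measurable[OF jk])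
  show i1: "integrable (N i) (clip a j k)"
    by (rule integrable_N_bounded[OF _ m, where B="a\<^sup>2"]) (simp add: clip_bound[OF a])
  have i4: "integrable (N i) (\<lambda>x. (x j ^ 4 + x k ^ 4) / 2)"
    using moments(2)[OF jk(1) jk(1) jk(1), of i] moments(2)[OF jk(2) jk(2) jk(2), of i] by simp
  show i2: "integrable (N i) (\<lambda>x. (clip a j k x)\<^sup>2)"
    by (rule Bochner_Integration.integrable_bound[OF i4]) (use m clip_sq_le in \<open>auto intro!: AE_I2 order_trans[OF clip_sq_le]\<close>)
  have "(\<integral>x. (clip a j k x)\<^sup>2 \<partial>N i) \<le> (\<integral>x. (x j ^ 4 + x k ^ 4) / 2 \<partial>N i)"
    by (rule integral_mono[OF i2 i4 clip_sq_le])
  also have "\<dots> = ((\<integral>x. x j ^ 4 \<partial>N i) + (\<integral>x. x k ^ 4 \<partial>N i)) / 2"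
    using moments(2)[OF jk(1) jk(1) jk(1), of i] moments(2)[OF jk(2) jk(2) jk(2), of i] by simp
  also have "\<dots> \<le> 48 * \<kappa> ^ 4"
    using moments(3)[OF jk(1) jk(1) jk(1), of i] moments(3)[OF jk(2) jk(2) jk(2), of i] by simp
  finally show "(\<integral>x. (clip a j k x)\<^sup>2 \<partial>N i) \<le> 48 * \<kappa> ^ 4" .
  show "(\<integral>x. clip a j k x \<partial>N i)\<^sup>2 \<le> (\<integral>x. (clip a j k x)\<^sup>2 \<partial>N i)"
  proof -
    have "0 \<le> (\<integral>x. (clip a j k x - (\<integral>x. clip a j k x \<partial>N i))\<^sup>2 \<partial>N i)" by simp
    then show ?thesis using prob_space.variance_eq[OF prob_N i1 i2] by simp
  qed
  have "\<bar>\<integral>x. clip a j k x \<partial>N i\<bar> \<le> (\<integral>x. \<bar>clip a j k x\<bar> \<partial>N i)" by (rule integral_abs_bound)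
  also have "\<dots> \<le> (\<integral>x. a\<^sup>2 \<partial>N i)" using i1 clip_bound[OF a] by (intro integral_mono) auto
  finally show "\<bar>\<integral>x. clip a j k x \<partial>N i\<bar> \<le> a\<^sup>2" using prob_space.prob_space[OF prob_N] by simp
qed

lemma tail_sq_integral: "integrable (N i) (tail_sq a)" "(\<integral>x. tail_sq a x \<partial>N i) \<le> p * (16 * \<kappa>\<^sup>2 * exp (- a / (2 * \<kappa>)))"
proof -
  have int: "integrable (N i) (\<lambda>x. (x j)\<^sup>2 * indicator {r. a < \<bar>r\<bar>} (x j))" if "j \<in> {1..p}" for j
    by (rule moments(6)[OF that that that])
  show "integrable (N i) (tail_sq a)"
    unfolding tail_sq_def[abs_def] by (intro Bochner_Integration.integrable_sum int)
  have "(\<integral>x. tail_sq a x \<partial>N i) = (\<Sum>j=1..p. \<integral>x. (x j)\<^sup>2 * indicator {r. a < \<bar>r\<bar>} (x j) \<partial>N i)"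
    unfolding tail_sq_def by (rule Bochner_Integration.integral_sum) (rule int)
  also have "\<dots> \<le> (\<Sum>j=1..p. 16 * \<kappa>\<^sup>2 * exp (- a / (2 * \<kappa>)))"
    by (intro sum_mono) (rule moments(7); assumption)
  finally show "(\<integral>x. tail_sq a x \<partial>N i) \<le> p * (16 * \<kappa>\<^sup>2 * exp (- a / (2 * \<kappa>)))" by simp
qed

text \<open>The centring is the correct one because the kernel has mean 1 and is independent of the
  data.\<close>

definition centred_cov :: "real \<Rightarrow> nat set \<Rightarrow> nat \<Rightarrow> nat \<Rightarrow> (nat \<Rightarrow> nat \<Rightarrow> real) \<Rightarrow> (nat \<Rightarrow> real) \<Rightarrow> real" where
  "centred_cov a A j k x \<xi> = (\<Sum>i\<in>A. skew_kernel (\<xi> i) * clip a j k (x i) - (\<integral>y. clip a j k y \<partial>N i))"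

lemma centred_term_bound:
  assumes jk: "j \<in> {1..p}" "k \<in> {1..p}" and a: "0 \<le> a"
  shows "\<bar>skew_kernel e * clip a j k y - (\<integral>y. clip a j k y \<partial>N i)\<bar> \<le> 3 * a\<^sup>2"
proof -
  have "\<bar>skew_kernel e * clip a j k y\<bar> \<le> 2 * a\<^sup>2"
    unfolding abs_mult using skew_kernel_bounds[of e] clip_bound[OF a, of j k y] by (intro mult_mono) auto
  then show ?thesis using clip_integrable(5)[OF jk a, of i] by linarith
qed

lemma centred_cov_bound:
  assumes jk: "j \<in> {1..p}" "k \<in> {1..p}" and a: "0 \<le> a"
  shows "\<bar>centred_cov a A j k x \<xi>\<bar> \<le> real (card A) * (3 * a\<^sup>2)"
proof -
  have "(\<Sum>i\<in>A. \<bar>skew_kernel (\<xi> i) * clip a j k (x i) - (\<integral>y. clip a j k y \<partial>N i)\<bar>) \<le> real (card A) * (3 * a\<^sup>2)"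
    by (rule sum_bounded_above) (intro centred_term_bound jk a)
  then show ?thesis unfolding centred_cov_def by (rule order_trans[OF sum_abs])
qed

text \<open>Bernstein's argument: the exponent is at most 1 in absolute value, so exp z <= 1 + z +
  z^2. The linear term integrates to 0, and the quadratic one is at most (8 + 2) * 48 = 480 times
  s^2 \<kappa>^4.\<close>

lemma term_mgf:
  assumes jk: "j \<in> {1..p}" "k \<in> {1..p}" and a: "0 \<le> a" and s: "\<bar>s\<bar> * (3 * a\<^sup>2) \<le> 1"
  defines "\<phi> \<equiv> (\<lambda>i y. \<integral>e. exp (s * (skew_kernel e * clip a j k y - (\<integral>y. clip a j k y \<partial>N i))) \<partial>skew_law)"
  shows "integrable (N i) (\<phi> i)" "(\<integral>y. \<phi> i y \<partial>N i) \<le> exp (480 * s\<^sup>2 * \<kappa> ^ 4)"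
    "integrable skew_law (\<lambda>e. exp (s * (skew_kernel e * clip a j k y - (\<integral>y. clip a j k y \<partial>N i))))"
    "0 \<le> \<phi> i y"
proof -
  interpret E: prob_space skew_law by (rule prob_space_skew_law)
  define c where "c = (\<integral>y. clip a j k y \<partial>N i)"
  have b: "\<bar>s * (skew_kernel e * clip a j k y - c)\<bar> \<le> 1" for e y
  proof -
    have "\<bar>s\<bar> * \<bar>skew_kernel e * clip a j k y - c\<bar> \<le> \<bar>s\<bar> * (3 * a\<^sup>2)"
      unfolding c_def by (intro mult_left_mono centred_term_bound[OF jk a]) auto
    then show ?thesis using s unfolding abs_mult by linarith
  qed
  have eb: "\<bar>exp (s * (skew_kernel e * clip a j k y - c))\<bar> \<le> exp 1" for e y
    using b[of e y] by simp
  have ei: "integrable skew_law (\<lambda>e. exp (s * (skew_kernel e * clip a j k y - c)))" for y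
    by (rule integrable_skew_law[OF _ eb]) measurable
  have cm [measurable]: "clip a j k \<in> borel_measurable (N i)" by (rule clip_measurable[OF jk])
  have \<phi>: "\<phi> i y = (\<integral>e. exp (s * (skew_kernel e * clip a j k y - c)) \<partial>skew_law)" for y
    by (simp add: \<phi>_def c_def)
  have m: "\<phi> i \<in> borel_measurable (N i)"
  proof -
    have "(\<lambda>(y, e). exp (s * (skew_kernel e * clip a j k y - c))) \<in> borel_measurable (N i \<Otimes>\<^sub>M skew_law)"
      unfolding split_def by measurable
    from borel_measurable_integral_prob[OF prob_space_skew_law this] show ?thesis by (simp add: \<phi>[abs_def])
  qed
  have ki: "integrable skew_law skew_kernel"
    by (rule integrable_skew_law[where C=2]) (use skew_kernel_bounds in \<open>auto simp: abs_of_nonneg\<close>)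
  define g where "g y = 1 + s * (clip a j k y - c) + s\<^sup>2 * (8 * (clip a j k y)\<^sup>2 + 2 * c\<^sup>2)" for y
  have \<phi>_le: "\<phi> i y \<le> g y" for y
  proof -
    let ?h = "\<lambda>e. 1 + s * (skew_kernel e * clip a j k y - c) + s\<^sup>2 * (8 * (clip a j k y)\<^sup>2 + 2 * c\<^sup>2)"
    have "exp (s * (skew_kernel e * clip a j k y - c)) \<le> ?h e" for e
    proof -
      have "(skew_kernel e * clip a j k y - c)\<^sup>2 \<le> 2 * (skew_kernel e * clip a j k y)\<^sup>2 + 2 * c\<^sup>2"
        using zero_le_power2[of "skew_kernel e * clip a j k y + c"] by (simp add: power2_sum power2_diff)
      moreover have "(skew_kernel e)\<^sup>2 \<le> 2\<^sup>2"
        using skew_kernel_bounds[of e] by (intro power_mono) auto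
      then have "(skew_kernel e * clip a j k y)\<^sup>2 \<le> 4 * (clip a j k y)\<^sup>2"
        unfolding power_mult_distrib by (intro mult_right_mono) auto
      ultimately have "(skew_kernel e * clip a j k y - c)\<^sup>2 \<le> 8 * (clip a j k y)\<^sup>2 + 2 * c\<^sup>2" by linarith
      then have "s\<^sup>2 * (skew_kernel e * clip a j k y - c)\<^sup>2 \<le> s\<^sup>2 * (8 * (clip a j k y)\<^sup>2 + 2 * c\<^sup>2)"
        by (intro mult_left_mono) auto
      then show ?thesis using exp_le_quadratic[OF b[of e y]] by (simp add: power_mult_distrib)
    qed
    then have "\<phi> i y \<le> (\<integral>e. ?h e \<partial>skew_law)" unfolding \<phi> using ki by (intro integral_mono[OF ei]) auto
    also have "\<dots> = g y" using ki E.prob_space by (simp add: g_def skew_law_moments)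
    finally show ?thesis .
  qed
  show \<phi>0: "0 \<le> \<phi> i y" for y unfolding \<phi> by (intro Bochner_Integration.integral_nonneg) auto
  have gi: "integrable (N i) g" unfolding g_def[abs_def]
    using clip_integrable(1,2)[OF jk a, of i] by simp
  show \<phi>i: "integrable (N i) (\<phi> i)"
    by (rule Bochner_Integration.integrable_bound[OF gi m]) (use \<phi>0 order_trans[OF \<phi>_le abs_ge_self] in \<open>auto intro!: AE_I2\<close>)
  have "(\<integral>y. \<phi> i y \<partial>N i) \<le> (\<integral>y. g y \<partial>N i)" by (rule integral_mono[OF \<phi>i gi \<phi>_le])
  also have "\<dots> = 1 + s\<^sup>2 * (8 * (\<integral>y. (clip a j k y)\<^sup>2 \<partial>N i) + 2 * c\<^sup>2)"
    unfolding g_def using clip_integrable(1,2)[OF jk a, of i] prob_space.prob_space[OF prob_N] by (simp add: c_def[symmetric])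
  also have "\<dots> \<le> 1 + s\<^sup>2 * (480 * \<kappa> ^ 4)"
    using clip_integrable(3,4)[OF jk a, of i] unfolding c_def by (intro add_left_mono mult_left_mono) auto
  also have "\<dots> \<le> exp (480 * s\<^sup>2 * \<kappa> ^ 4)" using exp_ge_add_one_self[of "480 * s\<^sup>2 * \<kappa> ^ 4"] by (simp add: mult_ac)
  finally show "(\<integral>y. \<phi> i y \<partial>N i) \<le> exp (480 * s\<^sup>2 * \<kappa> ^ 4)" .
  show "integrable skew_law (\<lambda>e. exp (s * (skew_kernel e * clip a j k y - (\<integral>y. clip a j k y \<partial>N i))))"
    using ei by (simp add: c_def)
qed

text \<open>Independence makes the moment generating function a product. The Gaussian coordinates in
  \<open>G\<close> integrate to 1; they are carried along so that the measure is the one on which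
  \<open>interpolation\<close> takes place.\<close>

lemma mgf:
  assumes jk: "j \<in> {1..p}" "k \<in> {1..p}" and a: "0 \<le> a" and s: "\<bar>s\<bar> * (3 * a\<^sup>2) \<le> 1"
    and fin: "finite A" "finite G" and disj: "A \<inter> G = {}"
  shows "(\<integral>x. (\<integral>\<xi>. exp (s * centred_cov a A j k x \<xi>) \<partial>PiM (A \<union> G) (\<lambda>m. if m \<in> A then skew_law else std_normal_distribution)) \<partial>PiM A N)
    \<le> exp (480 * s\<^sup>2 * \<kappa> ^ 4) ^ card A"
proof -
  let ?N = "\<lambda>m. if m \<in> A then skew_law else std_normal_distribution"
  interpret P: product_prob_space ?N UNIV
    by (rule product_prob_spaceI) (auto intro: prob_space_skew_law prob_space_normal_density)
  define f where "f i y e = exp (s * (skew_kernel e * clip a j k y - (\<integral>y. clip a j k y \<partial>N i)))" for i y e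
  define \<phi> where "\<phi> i y = (\<integral>e. f i y e \<partial>skew_law)" for i y
  have inner: "(\<integral>\<xi>. exp (s * centred_cov a A j k x \<xi>) \<partial>PiM (A \<union> G) ?N) = (\<Prod>i\<in>A. \<phi> i (x i))" for x
  proof -
    define g where "g m e = (if m \<in> A then f m (x m) e else 1)" for m e
    have "exp (s * centred_cov a A j k x \<xi>) = (\<Prod>m\<in>A \<union> G. g m (\<xi> m))" for \<xi>
    proof -
      have "exp (s * centred_cov a A j k x \<xi>) = (\<Prod>m\<in>A. f m (x m) (\<xi> m))"
        by (simp add: centred_cov_def sum_distrib_left exp_sum fin f_def)
      also have "\<dots> = (\<Prod>m\<in>A. g m (\<xi> m))" by (rule prod.cong) (auto simp: g_def)
      also have "\<dots> = (\<Prod>m\<in>A \<union> G. g m (\<xi> m))"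
        by (rule prod.mono_neutral_left) (use fin in \<open>auto simp: g_def\<close>)
      finally show ?thesis .
    qed
    then have "(\<integral>\<xi>. exp (s * centred_cov a A j k x \<xi>) \<partial>PiM (A \<union> G) ?N) = (\<integral>\<xi>. (\<Prod>m\<in>A \<union> G. g m (\<xi> m)) \<partial>PiM (A \<union> G) ?N)"
      by simp
    also have "\<dots> = (\<Prod>m\<in>A \<union> G. integral\<^sup>L (?N m) (g m))"
    proof (rule P.product_integral_prod)
      fix m assume "m \<in> A \<union> G"
      show "integrable (?N m) (g m)"
      proof (cases "m \<in> A")
        case True
        then show ?thesis using term_mgf(3)[OF jk a s, of "x m" m] by (simp add: g_def[abs_def] f_def)
      next
        case False
        interpret S: prob_space std_normal_distribution by (rule prob_space_normal_density) simp
        show ?thesis using False by (simp add: g_def[abs_def])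
      qed
    qed (use fin in auto)
    also have "\<dots> = (\<Prod>m\<in>A. integral\<^sup>L (?N m) (g m))"
    proof (rule prod.mono_neutral_right)
      interpret S: prob_space std_normal_distribution by (rule prob_space_normal_density) simp
      show "\<forall>i\<in>A \<union> G - A. integral\<^sup>L (?N i) (g i) = 1" using S.prob_space by (simp add: g_def[abs_def])
    qed (use fin in auto)
    also have "\<dots> = (\<Prod>i\<in>A. \<phi> i (x i))" by (rule prod.cong) (auto simp: g_def[abs_def] \<phi>_def)
    finally show ?thesis .
  qed
  have t: "integrable (N i) (\<phi> i)" "(\<integral>y. \<phi> i y \<partial>N i) \<le> exp (480 * s\<^sup>2 * \<kappa> ^ 4)" "0 \<le> \<phi> i y" for i y
    using term_mgf(1,2,4)[OF jk a s] unfolding \<phi>_def[abs_def] f_def[abs_def] by blast+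
  have "(\<integral>x. (\<Prod>i\<in>A. \<phi> i (x i)) \<partial>PiM A N) = (\<Prod>i\<in>A. \<integral>y. \<phi> i y \<partial>N i)"
    by (rule product_integral_prod[OF fin(1)]) (rule t)
  also have "\<dots> \<le> (\<Prod>i\<in>A. exp (480 * s\<^sup>2 * \<kappa> ^ 4))"
    by (rule prod_mono) (auto intro!: t Bochner_Integration.integral_nonneg)
  finally show ?thesis unfolding inner by simp
qed

end

lemma ln_of_nat_ge_1: assumes "3 \<le> p" shows "1 \<le> ln (real p)"
proof -
  have "exp 1 \<le> real p" using exp_le assms by linarith
  then show ?thesis using assms by (subst ln_ge_iff) auto
qed

lemma mixed_coord_measurable:
  assumes "i \<in> A \<union> G"
  shows "(\<lambda>\<xi>. \<xi> i) \<in> borel_measurable (PiM (A \<union> G) (\<lambda>m. if m \<in> A then skew_law else std_normal_distribution))"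
proof -
  have "sets (if i \<in> A then skew_law else std_normal_distribution) = sets borel" by simp
  then show ?thesis
    using measurable_component_singleton[OF assms, of "\<lambda>m. if m \<in> A then skew_law else std_normal_distribution"]
      measurable_cong_sets[OF refl] by blast
qed

context subexponential_laws
begin

lemma centred_cov_measurable:
  assumes jk: "j \<in> {1..p}" "k \<in> {1..p}"
  shows "(\<lambda>(x, \<xi>). centred_cov a A j k x \<xi>) \<in> borel_measurable (PiM A N \<Otimes>\<^sub>M PiM (A \<union> G) (\<lambda>m. if m \<in> A then skew_law else std_normal_distribution))"
proof -
  have [measurable]: "i \<in> A \<Longrightarrow> (\<lambda>x. x i) \<in> measurable (PiM A N) (N i)" for i
    by (rule measurable_component_singleton)
  have [measurable]: "i \<in> A \<Longrightarrow> (\<lambda>\<xi>. \<xi> i) \<in> borel_measurable (PiM (A \<union> G) (\<lambda>m. if m \<in> A then skew_law else std_normal_distribution))" for i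
    by (rule mixed_coord_measurable) simp
  have [measurable]: "clip a j k \<in> borel_measurable (N i)" for i by (rule clip_measurable[OF jk])
  have "(\<lambda>q. clip a j k (fst q i)) \<in> borel_measurable (PiM A N \<Otimes>\<^sub>M PiM (A \<union> G) (\<lambda>m. if m \<in> A then skew_law else std_normal_distribution))" if "i \<in> A" for i
    by (rule measurable_compose[OF _ clip_measurable[OF jk, of a i]]) (use that in measurable)
  moreover have "(\<lambda>q. skew_kernel (snd q i)) \<in> borel_measurable (PiM A N \<Otimes>\<^sub>M PiM (A \<union> G) (\<lambda>m. if m \<in> A then skew_law else std_normal_distribution))" if "i \<in> A" for i
    by (rule measurable_compose[OF _ skew_kernel_measurable]) (use that in measurable)
  ultimately show ?thesis
    unfolding split_def centred_cov_def
    by (intro borel_measurable_sum borel_measurable_diff borel_measurable_times borel_measurable_const)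
qed

lemma cov_deviation:
  assumes jk: "j \<in> {1..p}" "k \<in> {1..p}" and a: "0 \<le> a"
  shows "\<bar>(\<Sum>i\<in>A. skew_kernel (\<xi> i) * x i j * x i k) - (\<Sum>i\<in>A. \<integral>y. y j * y k \<partial>N i)\<bar>
    \<le> \<bar>centred_cov a A j k x \<xi>\<bar> + (2 * (\<Sum>i\<in>A. tail_sq a (x i)) + (\<Sum>i\<in>A. \<integral>y. tail_sq a y \<partial>N i))"
proof -
  have 1: "\<bar>skew_kernel (\<xi> i) * x i j * x i k - skew_kernel (\<xi> i) * clip a j k (x i)\<bar> \<le> 2 * tail_sq a (x i)" for i
  proof -
    have "skew_kernel (\<xi> i) * x i j * x i k - skew_kernel (\<xi> i) * clip a j k (x i) = skew_kernel (\<xi> i) * (x i j * x i k - clip a j k (x i))"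
      by (simp add: algebra_simps)
    also have "\<bar>\<dots>\<bar> \<le> 2 * tail_sq a (x i)"
      unfolding abs_mult using skew_kernel_bounds[of "\<xi> i"] abs_prod_diff_clip[OF jk, of "x i" a] by (intro mult_mono) auto
    finally show ?thesis .
  qed
  have 2: "\<bar>(\<integral>y. y j * y k \<partial>N i) - (\<integral>y. clip a j k y \<partial>N i)\<bar> \<le> (\<integral>y. tail_sq a y \<partial>N i)" for i
  proof -
    have "\<bar>(\<integral>y. y j * y k \<partial>N i) - (\<integral>y. clip a j k y \<partial>N i)\<bar> = \<bar>\<integral>y. y j * y k - clip a j k y \<partial>N i\<bar>"
      using prod_integrable[OF jk] clip_integrable(1)[OF jk a] by simp
    also have "\<dots> \<le> (\<integral>y. \<bar>y j * y k - clip a j k y\<bar> \<partial>N i)" by (rule integral_abs_bound)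
    also have "\<dots> \<le> (\<integral>y. tail_sq a y \<partial>N i)"
      using prod_integrable[OF jk] clip_integrable(1)[OF jk a] tail_sq_integral(1) abs_prod_diff_clip[OF jk]
      by (intro integral_mono) auto
    finally show ?thesis .
  qed
  have "(\<Sum>i\<in>A. skew_kernel (\<xi> i) * x i j * x i k) - (\<Sum>i\<in>A. \<integral>y. y j * y k \<partial>N i)
    = centred_cov a A j k x \<xi> + (\<Sum>i\<in>A. skew_kernel (\<xi> i) * x i j * x i k - skew_kernel (\<xi> i) * clip a j k (x i))
      - (\<Sum>i\<in>A. (\<integral>y. y j * y k \<partial>N i) - (\<integral>y. clip a j k y \<partial>N i))"
    by (simp add: centred_cov_def sum_subtractf)
  moreover have "\<bar>\<Sum>i\<in>A. skew_kernel (\<xi> i) * x i j * x i k - skew_kernel (\<xi> i) * clip a j k (x i)\<bar> \<le> (\<Sum>i\<in>A. 2 * tail_sq a (x i))"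
    by (rule order_trans[OF sum_abs sum_mono]) (rule 1)
  moreover have "\<bar>\<Sum>i\<in>A. (\<integral>y. y j * y k \<partial>N i) - (\<integral>y. clip a j k y \<partial>N i)\<bar> \<le> (\<Sum>i\<in>A. \<integral>y. tail_sq a y \<partial>N i)"
    by (rule order_trans[OF sum_abs sum_mono]) (rule 2)
  ultimately show ?thesis by (simp add: sum_distrib_left[symmetric])
qed

text \<open>The largest entry is controlled by summing exponentials over all pairs and both signs,
  and the truncation error by \<open>tail_sq\<close>. The bound \<open>R\<close> is an explicit sum
  rather than a maximum, so that its integrability is immediate; the size condition on
  \<open>A\<close> makes the truncation level large enough to beat the factor p.\<close>

lemma covariance_fluctuation:
  assumes fin: "finite A" "finite G" and disj: "A \<inter> G = {}" and big: "4096 * ln p ^ 5 \<le> card A"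
  defines "P \<equiv> PiM (A \<union> G) (\<lambda>m. if m \<in> A then skew_law else std_normal_distribution)"
  obtains R where "\<And>x. integrable P (R x)"
    "\<And>x \<xi> j k. j \<in> {1..p} \<Longrightarrow> k \<in> {1..p} \<Longrightarrow>
       \<bar>(\<Sum>i\<in>A. skew_kernel (\<xi> i) * x i j * x i k) - (\<Sum>i\<in>A. \<integral>y. y j * y k \<partial>N i)\<bar> \<le> R x \<xi>"
    "integrable (PiM A N) (\<lambda>x. \<integral>\<xi>. R x \<xi> \<partial>P)"
    "(\<integral>x. (\<integral>\<xi>. R x \<xi> \<partial>P) \<partial>PiM A N) \<le> 6627 * \<kappa>\<^sup>2 * sqrt (card A * ln p)"
proof -
  \<comment> \<open>Here n = q^2 l, so the target \<kappa>^2 sqrt(n ln p) is \<kappa>^2 q l. The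
    truncation level a = L \<kappa> satisfies a^2 = \<kappa>^2 q / 4, and the exponential parameter
    \<open>la\<close> = 1/(\<kappa>^2 q) then gives 3 a^2 la = 3/4 <= 1, as \<open>mgf\<close>
    demands.\<close>
  define n l q L where "n = real (card A)" and "l = ln (real p)" and "q = sqrt (n / l)" and "L = sqrt q / 2"
  have l1: "l \<ge> 1" unfolding l_def by (rule ln_of_nat_ge_1[OF p3])
  have n_big: "4096 * l ^ 5 \<le> n" using big by (simp add: l_def n_def)
  have "0 < 4096 * l ^ 5" using l1 by simp
  then have n0: "n > 0" using n_big by linarith
  have q0: "q > 0" using n0 l1 by (simp add: q_def)
  have q2: "q\<^sup>2 = n / l" using n0 l1 by (simp add: q_def)
  then have nq: "n = q * q * l" using l1 by (simp add: field_simps power2_eq_square)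
  have L2: "4 * L\<^sup>2 = q" using q0 by (simp add: L_def power_divide)
  have L0: "L > 0" using q0 by (simp add: L_def)
  \<comment> \<open>4096 = 8^4: the size condition reads (8 l)^4 <= n/l = q^2, and two square roots
    give 8 l <= sqrt q = 2 L.\<close>
  have Ll: "4 * l \<le> L"
  proof -
    have "((8 * l)\<^sup>2)\<^sup>2 \<le> n / l" using n_big l1 by (simp add: field_simps eval_nat_numeral)
    then have "(8 * l)\<^sup>2 \<le> q" unfolding q_def by (rule real_le_rsqrt)
    then have "8 * l \<le> sqrt q" by (rule real_le_rsqrt)
    then show ?thesis by (simp add: L_def)
  qed
  define a where "a = L * \<kappa>"
  have a0: "a > 0" using L0 \<kappa> by (simp add: a_def)
  define la where "la = 1 / (\<kappa>\<^sup>2 * q)"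
  have la0: "la > 0" using \<kappa> q0 by (simp add: la_def)
  have a2: "a\<^sup>2 = \<kappa>\<^sup>2 * q / 4" using L2 by (simp add: a_def power_mult_distrib field_simps)
  have la3: "\<bar>la\<bar> * (3 * a\<^sup>2) \<le> 1" "\<bar>- la\<bar> * (3 * a\<^sup>2) \<le> 1" using q0 \<kappa> unfolding a2 by (simp_all add: la_def field_simps)
  define E where "E = exp (480 * la\<^sup>2 * \<kappa> ^ 4) ^ card A"
  define Q where "Q = 2 * (real p)\<^sup>2 * E"
  have Q0: "Q > 0" using p3 by (simp add: Q_def E_def)
  have lnQ: "ln Q \<le> 3 * l + 480 * la\<^sup>2 * \<kappa> ^ 4 * n"
  proof -
    have "ln Q = ln 2 + 2 * l + 480 * la\<^sup>2 * \<kappa> ^ 4 * n"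
      using p3 by (simp add: Q_def E_def ln_mult ln_realpow l_def n_def)
    moreover have "ln (2::real) \<le> 1" using ln_le_minus_one[of "2::real"] by simp
    ultimately show ?thesis using l1 by linarith
  qed
  define W where "W x \<xi> = (\<Sum>j=1..p. \<Sum>k=1..p. exp (la * centred_cov a A j k x \<xi>) + exp (- la * centred_cov a A j k x \<xi>))" for x \<xi>
  define T where "T x = (\<Sum>i\<in>A. tail_sq a (x i))" for x :: "nat \<Rightarrow> nat \<Rightarrow> real"
  define T0 where "T0 = (\<Sum>i\<in>A. \<integral>y. tail_sq a y \<partial>N i)"
  \<comment> \<open>For each entry S the logarithm is linearised at \<open>Q\<close>: la |S| <= ln Q
    - 1 + exp(la |S|)/Q. Since \<open>Q\<close> bounds the mean of \<open>W\<close>, only ln Q / la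
    and the tails survive in expectation.\<close>
  define R where "R x \<xi> = (ln Q - 1 + W x \<xi> / Q) / la + (2 * T x + T0)" for x \<xi>
  interpret PX: prob_space P
    unfolding P_def by (rule prob_space_PiM) (auto intro: prob_space_skew_law prob_space_normal_density)
  interpret PN: prob_space "PiM A N" by (rule prob_space_PiM) (rule prob_N)
  have Em: "(\<lambda>(x, \<xi>). exp (s * centred_cov a A j k x \<xi>)) \<in> borel_measurable (PiM A N \<Otimes>\<^sub>M P)"
    if "j \<in> {1..p}" "k \<in> {1..p}" for j k s
    using centred_cov_measurable[OF that, of a A G] unfolding P_def split_def by measurable
  have xsp: "(\<lambda>\<xi>. exp (s * centred_cov a A j k x \<xi>)) \<in> borel_measurable P" if "j \<in> {1..p}" "k \<in> {1..p}" for j k s x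
  proof -
    have [measurable]: "i \<in> A \<Longrightarrow> (\<lambda>\<xi>. \<xi> i) \<in> borel_measurable P" for i
      unfolding P_def by (rule mixed_coord_measurable) simp
    have "(\<lambda>\<xi>. skew_kernel (\<xi> i)) \<in> borel_measurable P" if "i \<in> A" for i
      by (rule measurable_compose[OF _ skew_kernel_measurable]) (use that in measurable)
    then have "(\<lambda>\<xi>. centred_cov a A j k x \<xi>) \<in> borel_measurable P"
      unfolding centred_cov_def by (intro borel_measurable_sum borel_measurable_diff borel_measurable_times borel_measurable_const)
    then show ?thesis by measurable
  qed
  define C where "C = exp (la * (real (card A) * (3 * a\<^sup>2)))"
  have eb: "\<bar>exp (s * centred_cov a A j k x \<xi>)\<bar> \<le> C" if jk: "j \<in> {1..p}" "k \<in> {1..p}" and s: "\<bar>s\<bar> \<le> la" for j k x \<xi> s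
  proof -
    have "\<bar>s * centred_cov a A j k x \<xi>\<bar> \<le> la * (real (card A) * (3 * a\<^sup>2))"
      unfolding abs_mult using centred_cov_bound[OF jk, of a A x \<xi>] a0 s la0 by (intro mult_mono) auto
    then show ?thesis unfolding C_def by (simp add: abs_le_iff)
  qed
  have ei: "integrable P (\<lambda>\<xi>. exp (s * centred_cov a A j k x \<xi>))" if jk: "j \<in> {1..p}" "k \<in> {1..p}" and s: "\<bar>s\<bar> \<le> la" for j k x s
    by (rule PX.integrable_const_bound[where B=C, OF _ xsp[OF jk]]) (use eb[OF jk s] in auto)
  have eii: "integrable (PiM A N) (\<lambda>x. \<integral>\<xi>. exp (s * centred_cov a A j k x \<xi>) \<partial>P)" if jk: "j \<in> {1..p}" "k \<in> {1..p}" and s: "\<bar>s\<bar> \<le> la" for j k s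
  proof (rule PN.integrable_const_bound[where B=C])
    show "(\<lambda>x. \<integral>\<xi>. exp (s * centred_cov a A j k x \<xi>) \<partial>P) \<in> borel_measurable (PiM A N)"
      by (rule borel_measurable_integral_prob[OF PX.prob_space_axioms Em[OF jk]])
    have "(\<integral>\<xi>. exp (s * centred_cov a A j k x \<xi>) \<partial>P) \<le> C" for x
      by (rule PX.integral_le_const[OF ei[OF jk s]]) (use eb[OF jk s] in auto)
    then show "AE x in PiM A N. norm (\<integral>\<xi>. exp (s * centred_cov a A j k x \<xi>) \<partial>P) \<le> C" by simp
  qed
  have sl: "\<bar>la\<bar> \<le> la" "\<bar>- la\<bar> \<le> la" using la0 by auto
  have Wi: "integrable P (W x)" for x
    unfolding W_def[abs_def] by (intro Bochner_Integration.integrable_sum Bochner_Integration.integrable_add ei sl)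
  define V where "V x = (\<Sum>j=1..p. \<Sum>k=1..p. (\<integral>\<xi>. exp (la * centred_cov a A j k x \<xi>) \<partial>P) + (\<integral>\<xi>. exp (- la * centred_cov a A j k x \<xi>) \<partial>P))" for x
  have WV: "(\<integral>\<xi>. W x \<xi> \<partial>P) = V x" for x
  proof -
    have "(\<integral>\<xi>. W x \<xi> \<partial>P) = (\<Sum>j=1..p. \<integral>\<xi>. (\<Sum>k=1..p. exp (la * centred_cov a A j k x \<xi>) + exp (- la * centred_cov a A j k x \<xi>)) \<partial>P)"
      unfolding W_def by (rule Bochner_Integration.integral_sum) (intro Bochner_Integration.integrable_sum Bochner_Integration.integrable_add ei sl)
    also have "\<dots> = (\<Sum>j=1..p. \<Sum>k=1..p. \<integral>\<xi>. exp (la * centred_cov a A j k x \<xi>) + exp (- la * centred_cov a A j k x \<xi>) \<partial>P)"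
      by (rule sum.cong[OF refl], rule Bochner_Integration.integral_sum) (intro Bochner_Integration.integrable_add ei sl)
    also have "\<dots> = V x"
      unfolding V_def by (rule sum.cong[OF refl], rule sum.cong[OF refl], rule Bochner_Integration.integral_add) (intro ei sl; assumption)+
    finally show ?thesis .
  qed
  have Vi: "integrable (PiM A N) V"
    unfolding V_def[abs_def] by (intro Bochner_Integration.integrable_sum Bochner_Integration.integrable_add eii sl)
  have Vle: "(\<integral>x. V x \<partial>PiM A N) \<le> Q"
  proof -
    have "(\<integral>x. V x \<partial>PiM A N) = (\<Sum>j=1..p. \<integral>x. (\<Sum>k=1..p. (\<integral>\<xi>. exp (la * centred_cov a A j k x \<xi>) \<partial>P) + (\<integral>\<xi>. exp (- la * centred_cov a A j k x \<xi>) \<partial>P)) \<partial>PiM A N)"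
      unfolding V_def by (rule Bochner_Integration.integral_sum) (intro Bochner_Integration.integrable_sum Bochner_Integration.integrable_add eii sl)
    also have "\<dots> = (\<Sum>j=1..p. \<Sum>k=1..p. \<integral>x. (\<integral>\<xi>. exp (la * centred_cov a A j k x \<xi>) \<partial>P) + (\<integral>\<xi>. exp (- la * centred_cov a A j k x \<xi>) \<partial>P) \<partial>PiM A N)"
      by (rule sum.cong[OF refl], rule Bochner_Integration.integral_sum) (intro Bochner_Integration.integrable_add eii sl)
    also have "\<dots> \<le> (\<Sum>j=1..p. \<Sum>k=1..p. 2 * E)"
    proof (intro sum_mono)
      fix j k assume jk: "j \<in> {1..p}" "k \<in> {1..p}"
      have "(\<integral>x. (\<integral>\<xi>. exp (la * centred_cov a A j k x \<xi>) \<partial>P) + (\<integral>\<xi>. exp (- la * centred_cov a A j k x \<xi>) \<partial>P) \<partial>PiM A N)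
        = (\<integral>x. (\<integral>\<xi>. exp (la * centred_cov a A j k x \<xi>) \<partial>P) \<partial>PiM A N) + (\<integral>x. (\<integral>\<xi>. exp (- la * centred_cov a A j k x \<xi>) \<partial>P) \<partial>PiM A N)"
        by (rule Bochner_Integration.integral_add) (intro eii jk sl)+
      also have "\<dots> \<le> E + E"
        using mgf[OF jk less_imp_le[OF a0] la3(1) fin disj] mgf[OF jk less_imp_le[OF a0] la3(2) fin disj]
        unfolding P_def E_def by (intro add_mono) simp_all
      finally show "(\<integral>x. (\<integral>\<xi>. exp (la * centred_cov a A j k x \<xi>) \<partial>P) + (\<integral>\<xi>. exp (- la * centred_cov a A j k x \<xi>) \<partial>P) \<partial>PiM A N) \<le> 2 * E"
        by simp
    qed
    also have "\<dots> = Q" by (simp add: Q_def power2_eq_square)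
    finally show ?thesis .
  qed
  have Tci: "integrable (PiM A N) (\<lambda>x. tail_sq a (x i))" and Tce: "(\<integral>x. tail_sq a (x i) \<partial>PiM A N) = (\<integral>y. tail_sq a y \<partial>N i)" if i: "i \<in> A" for i
  proof -
    have D: "distr (PiM A N) (N i) (\<lambda>x. x i) = N i" by (rule distr_PiM_component[OF prob_N i])
    have cm: "(\<lambda>x. x i) \<in> measurable (PiM A N) (N i)" by (rule measurable_component_singleton[OF i])
    have tm: "tail_sq a \<in> borel_measurable (N i)" using tail_sq_integral(1) by (rule borel_measurable_integrable)
    show "integrable (PiM A N) (\<lambda>x. tail_sq a (x i))"
      using integrable_distr_eq[OF cm tm] tail_sq_integral(1)[of i a] unfolding D by simp
    show "(\<integral>x. tail_sq a (x i) \<partial>PiM A N) = (\<integral>y. tail_sq a y \<partial>N i)"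
      using integral_distr[OF cm tm] unfolding D by simp
  qed
  have Ti: "integrable (PiM A N) T" unfolding T_def[abs_def] by (intro Bochner_Integration.integrable_sum Tci)
  have Te: "(\<integral>x. T x \<partial>PiM A N) = T0"
  proof -
    have "(\<integral>x. T x \<partial>PiM A N) = (\<Sum>i\<in>A. \<integral>x. tail_sq a (x i) \<partial>PiM A N)"
      unfolding T_def by (rule Bochner_Integration.integral_sum) (rule Tci)
    also have "\<dots> = T0" unfolding T0_def by (rule sum.cong[OF refl]) (rule Tce)
    finally show ?thesis .
  qed
  have T0_le: "T0 \<le> 2048 * \<kappa>\<^sup>2 * (q * l)"
  proof -
    \<comment> \<open>The tail factor exp(-L/2) is h * h. One h absorbs p because L >= 4 l; the
      other turns n = 4 L^2 q l into at most 128 q l because L^2 <= 32 exp(L/4).\<close>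
    define h where "h = exp (- (L / 4))"
    have h0: "h > 0" by (simp add: h_def)
    have "T0 \<le> (\<Sum>i\<in>A. p * (16 * \<kappa>\<^sup>2 * exp (- a / (2 * \<kappa>))))"
      unfolding T0_def by (intro sum_mono tail_sq_integral(2))
    also have "\<dots> = 16 * \<kappa>\<^sup>2 * (n * (p * exp (- a / (2 * \<kappa>))))" by (simp add: n_def)
    also have "exp (- a / (2 * \<kappa>)) = h * h"
      using \<kappa> by (simp add: a_def h_def flip: exp_add)
    also have "16 * \<kappa>\<^sup>2 * (n * (p * (h * h))) \<le> 16 * \<kappa>\<^sup>2 * (128 * (q * l))"
    proof (intro mult_left_mono)
      have "real p = exp l" using p3 by (simp add: l_def)
      then have "p * h \<le> 1" using Ll by (simp add: h_def flip: exp_add)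
      then have "n * (p * (h * h)) \<le> n * h"
        using n0 h0 by (simp add: mult.assoc[symmetric])
      also have "\<dots> = (q * l) * (4 * L\<^sup>2 * h)" unfolding L2 by (subst nq) (simp add: mult_ac)
      also have "\<dots> \<le> (q * l) * 128"
      proof (intro mult_left_mono)
        have "1 + L / 4 + (L / 4)\<^sup>2 / 2 \<le> exp (L / 4)" using L0 by (intro exp_lower_Taylor_quadratic) auto
        then have "L\<^sup>2 \<le> 32 * exp (L / 4)" using L0 by (simp add: power_divide)
        then show "4 * L\<^sup>2 * h \<le> 128" by (simp add: h_def exp_minus field_simps)
      qed (use q0 l1 in auto)
      finally show "n * (p * (h * h)) \<le> 128 * (q * l)" by simp
    qed auto
    finally show ?thesis by simp
  qed
  have R1: "integrable P (R x)" for x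
    unfolding R_def[abs_def] using Wi[of x] by simp
  have RV: "(\<integral>\<xi>. R x \<xi> \<partial>P) = (ln Q - 1 + V x / Q) / la + (2 * T x + T0)" for x
    unfolding R_def using Wi[of x] by (simp add: WV PX.prob_space)
  have R3: "integrable (PiM A N) (\<lambda>x. \<integral>\<xi>. R x \<xi> \<partial>P)"
    unfolding RV using Vi Ti by simp
  have ql: "sqrt (card A * ln p) = q * l"
  proof -
    have "card A * ln p = (q * l)\<^sup>2"
      using nq by (simp add: n_def l_def power2_eq_square mult_ac)
    then show ?thesis using q0 l1 by simp
  qed
  have R4: "(\<integral>x. (\<integral>\<xi>. R x \<xi> \<partial>P) \<partial>PiM A N) \<le> 6627 * \<kappa>\<^sup>2 * sqrt (card A * ln p)"
  proof -
    have "(\<integral>x. (\<integral>\<xi>. R x \<xi> \<partial>P) \<partial>PiM A N) = (ln Q - 1 + (\<integral>x. V x \<partial>PiM A N) / Q) / la + 3 * T0"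
      unfolding RV using Vi Ti by (simp add: Te PN.prob_space)
    also have "\<dots> \<le> ln Q / la + 3 * T0"
      using Vle Q0 la0 by (intro add_right_mono divide_right_mono) auto
    \<comment> \<open>The constants: 3 + 480 = 483 from ln Q and 3 * 2048 = 6144 from the tails,
      together 6627.\<close>
    also have "\<dots> \<le> (3 * l + 480 * la\<^sup>2 * \<kappa> ^ 4 * n) / la + 3 * (2048 * \<kappa>\<^sup>2 * (q * l))"
      using lnQ T0_le la0 by (intro add_mono divide_right_mono mult_left_mono) auto
    also have "(3 * l + 480 * la\<^sup>2 * \<kappa> ^ 4 * n) / la = 483 * \<kappa>\<^sup>2 * (q * l)"
      unfolding la_def nq using \<kappa> q0 by (simp add: field_simps eval_nat_numeral)
    finally show ?thesis unfolding ql by (simp add: algebra_simps)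
  qed
  have R2: "\<bar>(\<Sum>i\<in>A. skew_kernel (\<xi> i) * x i j * x i k) - (\<Sum>i\<in>A. \<integral>y. y j * y k \<partial>N i)\<bar> \<le> R x \<xi>"
    if jk: "j \<in> {1..p}" "k \<in> {1..p}" for x \<xi> j k
  proof -
    let ?S = "centred_cov a A j k x \<xi>"
    have W_ge: "exp (la * ?S) + exp (- la * ?S) \<le> W x \<xi>"
    proof -
      have "exp (la * ?S) + exp (- la * ?S) \<le> (\<Sum>k=1..p. exp (la * centred_cov a A j k x \<xi>) + exp (- la * centred_cov a A j k x \<xi>))"
        by (rule member_le_sum[OF jk(2)]) (auto intro: add_nonneg_nonneg)
      also have "\<dots> \<le> W x \<xi>" unfolding W_def
        by (rule member_le_sum[OF jk(1)]) (auto intro!: sum_nonneg add_nonneg_nonneg)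
      finally show ?thesis .
    qed
    have "exp (la * \<bar>?S\<bar>) \<le> W x \<xi>"
    proof (cases "?S \<ge> 0")
      case True
      then show ?thesis using W_ge exp_gt_zero[of "- la * ?S"] unfolding abs_of_nonneg[OF True] by linarith
    next
      case False
      then have "la * \<bar>?S\<bar> = - la * ?S" by simp
      then show ?thesis using W_ge exp_gt_zero[of "la * ?S"] by (simp del: exp_gt_zero)
    qed
    then have "exp (la * \<bar>?S\<bar>) / Q \<le> W x \<xi> / Q" using Q0 by (intro divide_right_mono) auto
    moreover have "1 + (la * \<bar>?S\<bar> - ln Q) \<le> exp (la * \<bar>?S\<bar> - ln Q)" by (rule exp_ge_add_one_self)
    then have "1 + (la * \<bar>?S\<bar> - ln Q) \<le> exp (la * \<bar>?S\<bar>) / Q" using Q0 by (simp add: exp_diff)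
    ultimately have "la * \<bar>?S\<bar> \<le> ln Q - 1 + W x \<xi> / Q" by linarith
    then have "\<bar>?S\<bar> \<le> (ln Q - 1 + W x \<xi> / Q) / la" using la0 by (simp add: field_simps)
    moreover have "\<bar>(\<Sum>i\<in>A. skew_kernel (\<xi> i) * x i j * x i k) - (\<Sum>i\<in>A. \<integral>y. y j * y k \<partial>N i)\<bar> \<le> \<bar>?S\<bar> + (2 * T x + T0)"
      unfolding T_def T0_def by (rule cov_deviation[OF jk less_imp_le[OF a0]])
    ultimately show ?thesis unfolding R_def by linarith
  qed
  show ?thesis by (rule that[OF R1 R2 R3 R4])
qed

end

section \<open>Sandwiching distribution functions between smooth expectations\<close>

section \<open>From smooth functions to distribution functions\<close>

lemma (in softmax) F_cong: "(\<And>j. j \<in> J \<Longrightarrow> x j = y j) \<Longrightarrow> F x = F y"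
  unfolding F_def by (simp cong: sum.cong)

lemma vec_max_le_iff: "p \<ge> 1 \<Longrightarrow> vec_max p v \<le> c \<longleftrightarrow> (\<forall>j\<in>{1..p}. v j \<le> c)"
  unfolding vec_max_def by (subst Max_le_iff) auto

lemma vec_max_set_measurable:
  assumes "p \<ge> 1" "\<And>j. j \<in> {1..p} \<Longrightarrow> (\<lambda>\<omega>. f \<omega> j) \<in> borel_measurable M"
  shows "{\<omega> \<in> space M. vec_max p (f \<omega>) \<le> c} \<in> sets M"
proof -
  have "{\<omega> \<in> space M. f \<omega> j \<le> c} \<in> sets M" if "j \<in> {1..p}" for j
    using assms(2)[OF that] by measurable
  then have "{\<omega> \<in> space M. \<forall>j\<in>{1..p}. f \<omega> j \<le> c} \<in> sets M"
    by (intro sets.sets_Collect_finite_All) auto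
  then show ?thesis using vec_max_le_iff[OF assms(1)] by simp
qed

context smooth_max_laws
begin

lemma u_cong: "(\<And>j. j \<in> {1..p} \<Longrightarrow> x j = y j) \<Longrightarrow> u x = u y"
  unfolding u_def using F_cong[of x y] by simp

text \<open>If the maximum is at most t - d, the softmax is at most t and u = 1; if it exceeds t +
  d, so does the softmax and u = 0. The first claim uses ln p / b = d.\<close>

lemma u_sandwich:
  fixes M :: "'z measure"
  assumes M: "prob_space M" and f: "\<And>j. j \<in> {1..p} \<Longrightarrow> (\<lambda>\<omega>. f \<omega> j) \<in> borel_measurable M"
  shows "measure M {\<omega> \<in> space M. vec_max p (f \<omega>) \<le> t - d} \<le> (\<integral>\<omega>. u (f \<omega>) \<partial>M)"
    "(\<integral>\<omega>. u (f \<omega>) \<partial>M) \<le> measure M {\<omega> \<in> space M. vec_max p (f \<omega>) \<le> t + d}"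
proof -
  interpret MX: prob_space M by fact
  have p1: "p \<ge> 1" using p3 by simp
  have um: "(\<lambda>\<omega>. u (f \<omega>)) \<in> borel_measurable M" by (rule u_measurable) (rule f)
  have ui: "integrable M (\<lambda>\<omega>. u (f \<omega>))"
    by (rule MX.integrable_const_bound[OF _ um, where B=B]) (use u_bound in auto)
  have u01: "0 \<le> u x" "u x \<le> 1" for x unfolding u_def psi_def using cutoff_range by simp_all
  have one: "u x = 1" if "vec_max p x \<le> t - d" for x
  proof -
    have "F x \<le> (t - d) + ln (card {1..p}) / b"
      using that vec_max_le_iff[OF p1, of x "t - d"] by (intro F_le) auto
    also have "\<dots> = t" using b_pos unfolding card_atLeastAtMost by (simp add: bd_eq[symmetric])
    finally have "(F x - t) / d \<le> 0" using d_pos by (simp add: divide_le_0_iff)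
    then show ?thesis unfolding u_def psi_def by (simp add: cutoff_eq_1)
  qed
  have zero: "u x = 0" if "\<not> vec_max p x \<le> t + d" for x
  proof -
    have "\<not> (\<forall>j\<in>{1..p}. x j \<le> t + d)" using that unfolding vec_max_le_iff[OF p1] .
    then obtain j where j: "j \<in> {1..p}" and "\<not> x j \<le> t + d" by blast
    then have "t + d < F x" using F_ge[OF j, of x] by linarith
    then have "(F x - t) / d \<ge> 1" using d_pos by (simp add: field_simps)
    then show ?thesis unfolding u_def psi_def by (simp add: cutoff_eq_0)
  qed
  have S: "{\<omega> \<in> space M. vec_max p (f \<omega>) \<le> c} \<in> sets M" for c by (rule vec_max_set_measurable[OF p1 f])
  have ii: "integrable M (indicator {\<omega> \<in> space M. vec_max p (f \<omega>) \<le> c} :: 'z \<Rightarrow> real)" for c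
    by (rule integrable_real_indicator[OF S]) (simp add: MX.emeasure_eq_measure)
  have "measure M {\<omega> \<in> space M. vec_max p (f \<omega>) \<le> t - d} = (\<integral>\<omega>. indicator {\<omega> \<in> space M. vec_max p (f \<omega>) \<le> t - d} \<omega> \<partial>M)"
    using S by simp
  also have "\<dots> \<le> (\<integral>\<omega>. u (f \<omega>) \<partial>M)"
    by (rule integral_mono[OF ii ui]) (use one u01 in \<open>auto simp: indicator_def\<close>)
  finally show "measure M {\<omega> \<in> space M. vec_max p (f \<omega>) \<le> t - d} \<le> (\<integral>\<omega>. u (f \<omega>) \<partial>M)" .
  have "(\<integral>\<omega>. u (f \<omega>) \<partial>M) \<le> (\<integral>\<omega>. indicator {\<omega> \<in> space M. vec_max p (f \<omega>) \<le> t + d} \<omega> \<partial>M)"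
    by (rule integral_mono[OF ui ii]) (use zero u01 in \<open>auto simp: indicator_def\<close>)
  also have "\<dots> = measure M {\<omega> \<in> space M. vec_max p (f \<omega>) \<le> t + d}" using S by simp
  finally show "(\<integral>\<omega>. u (f \<omega>) \<partial>M) \<le> measure M {\<omega> \<in> space M. vec_max p (f \<omega>) \<le> t + d}" .
qed

text \<open>\<open>exchange\<close> passes from the data to skewed multiples, and
  \<open>interpolation\<close>, applied for each fixed array x, passes on to the Gaussian vector.
  The error of the latter is then averaged over x.\<close>

lemma smooth_comparison:
  assumes GV: "gaussian_vector p \<Sigma> \<gamma>"
    and cov: "\<And>j k. j \<in> {1..p} \<Longrightarrow> k \<in> {1..p} \<Longrightarrow> \<Sigma> j k = (\<Sum>i=1..n. \<integral>y. y j * y k \<partial>N i)"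
    and n: "n \<ge> 1" and big: "4096 * ln p ^ 5 \<le> n"
  shows "\<bar>(\<integral>x. u (\<lambda>j. \<Sum>i=1..n. x i j) \<partial>PiM {1..n} N) - (\<integral>z. u z \<partial>\<gamma>)\<bar>
    \<le> n * step_err + 3 * B * b / d * (6627 * \<kappa>\<^sup>2 * sqrt (n * ln p))"
proof -
  interpret GV: gaussian_vector p \<Sigma> \<gamma> by fact
  \<comment> \<open>The multipliers occupy 1..n and the Gaussian coordinates the next p indices, so
    that one product space carries both; \<open>m - n\<close> below undoes the shift.\<close>
  define A G where "A = {1..n}" and "G = {n+1..n+p}"
  have fin: "finite A" "finite G" and disj: "A \<inter> G = {}" and A0: "A \<noteq> {}" and G0: "G \<noteq> {}"
    using n p3 by (auto simp: A_def G_def)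
  have cardA: "card A = n" by (simp add: A_def)
  define N' where "N' = (\<lambda>m. if m \<in> A then skew_law else std_normal_distribution)"
  let ?P = "PiM (A \<union> G) N'"
  interpret Q: product_prob_space N' UNIV
    by (rule product_prob_spaceI) (auto simp: N'_def intro: prob_space_skew_law prob_space_normal_density)
  have PE: "prob_space (PiM A (\<lambda>_. skew_law))" by (rule prob_space_PiM) (rule prob_space_skew_law)
  have PJ: "prob_space (PiM A N)" by (rule prob_space_PiM) (rule prob_N)
  obtain R where R: "\<And>x. integrable ?P (R x)"
    "\<And>x \<xi> j k. j \<in> {1..p} \<Longrightarrow> k \<in> {1..p} \<Longrightarrow>
       \<bar>(\<Sum>i\<in>A. skew_kernel (\<xi> i) * x i j * x i k) - (\<Sum>i\<in>A. \<integral>y. y j * y k \<partial>N i)\<bar> \<le> R x \<xi>"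
    "integrable (PiM A N) (\<lambda>x. \<integral>\<xi>. R x \<xi> \<partial>?P)"
    "(\<integral>x. (\<integral>\<xi>. R x \<xi> \<partial>?P) \<partial>PiM A N) \<le> 6627 * \<kappa>\<^sup>2 * sqrt (card A * ln p)"
    using covariance_fluctuation[OF fin disj, folded N'_def] big unfolding cardA by blast
  define g where "g m = GV.fac (m - n)" for m
  have fac_shift: "(\<Sum>m\<in>G. g m j * g m k) = \<Sigma> j k" if "j \<in> {1..p}" "k \<in> {1..p}" for j k
  proof -
    have "(\<Sum>m\<in>G. g m j * g m k) = (\<Sum>m=1..p. GV.fac m j * GV.fac m k)"
      unfolding g_def G_def by (rule sum.reindex_bij_witness[of _ "\<lambda>m. m + n" "\<lambda>m. m - n"]) auto
    then show ?thesis using GV.fac[OF that] by simp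
  qed
  have eP: "PiM A (\<lambda>_. skew_law) = PiM A N'" "PiM G (\<lambda>_. std_normal_distribution) = PiM G N'"
    using disj by (auto intro!: PiM_cong simp: N'_def)
  have skew_end: "(\<integral>e. u (\<lambda>j. \<Sum>i\<in>A. e i * x i j) \<partial>PiM A (\<lambda>_. skew_law)) = (\<integral>\<xi>. u (\<lambda>j. \<Sum>i\<in>A. \<xi> i * x i j) \<partial>?P)" for x :: "nat \<Rightarrow> nat \<Rightarrow> real"
  proof -
    have [measurable]: "i \<in> A \<Longrightarrow> (\<lambda>e. e i) \<in> borel_measurable (PiM A N')" for i
      using mixed_coord_measurable[of i A "{}"] by (simp add: N'_def)
    have m: "(\<lambda>e. u (\<lambda>j. \<Sum>i\<in>A. e i * x i j)) \<in> borel_measurable (PiM A N')"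
      by (intro u_measurable) measurable
    have D: "PiM A N' = distr ?P (PiM A N') (\<lambda>f. restrict f A)"
      by (rule Q.distr_restrict) (use fin A0 in auto)
    have rm: "(\<lambda>f. restrict f A) \<in> measurable ?P (PiM A N')" by (rule measurable_restrict_subset) auto
    have "(\<integral>e. u (\<lambda>j. \<Sum>i\<in>A. e i * x i j) \<partial>PiM A N') = (\<integral>f. u (\<lambda>j. \<Sum>i\<in>A. restrict f A i * x i j) \<partial>?P)"
      by (subst D) (rule integral_distr[OF rm m])
    then show ?thesis unfolding eP by simp
  qed
  have gauss_end: "(\<integral>z. u z \<partial>\<gamma>) = (\<integral>\<xi>. u (\<lambda>j. \<Sum>m\<in>G. \<xi> m * g m j) \<partial>?P)"
  proof -
    let ?h = "\<lambda>\<xi>. \<lambda>j\<in>{1..p}. \<Sum>m\<in>G. \<xi> m * g m j"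
    note GL = gaussian_law_eq_distr[OF GV.law fin(2), where g=g, OF fac_shift, unfolded eP]
    have u\<gamma>: "u \<in> borel_measurable (euclid p)"
      using u_measurable[of "\<lambda>z. z" "euclid p"] measurable_component_singleton[of _ "{1..p}" "\<lambda>_. borel"] by simp
    have uh: "u (?h \<xi>) = u (\<lambda>j. \<Sum>m\<in>G. \<xi> m * g m j)" for \<xi> by (rule u_cong) simp
    have hm: "?h \<in> measurable (PiM G N') (euclid p)" by (rule GL(2)) assumption+
    have \<gamma>: "\<gamma> = distr (PiM G N') (euclid p) ?h" by (rule GL(1)) assumption+
    have D: "PiM G N' = distr ?P (PiM G N') (\<lambda>f. restrict f G)"
      by (rule Q.distr_restrict) (use fin G0 in auto)
    have rm: "(\<lambda>f. restrict f G) \<in> measurable ?P (PiM G N')" by (rule measurable_restrict_subset) auto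
    have "(\<integral>z. u z \<partial>\<gamma>) = (\<integral>\<xi>. u (?h \<xi>) \<partial>PiM G N')"
      by (subst \<gamma>) (rule integral_distr[OF hm u\<gamma>])
    also have "\<dots> = (\<integral>f. u (?h (restrict f G)) \<partial>?P)"
      by (subst D) (rule integral_distr[OF rm measurable_compose[OF hm u\<gamma>]])
    also have "\<dots> = (\<integral>\<xi>. u (\<lambda>j. \<Sum>m\<in>G. \<xi> m * g m j) \<partial>?P)" unfolding uh by simp
    finally show ?thesis .
  qed
  \<comment> \<open>The conditional expectation of the skewed sum given the data x.\<close>
  define a where "a x = (\<integral>e. u (\<lambda>j. \<Sum>i\<in>A. e i * x i j) \<partial>PiM A (\<lambda>_. skew_law))" for x :: "nat \<Rightarrow> nat \<Rightarrow> real"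
  have inter: "\<bar>a x - (\<integral>z. u z \<partial>\<gamma>)\<bar> \<le> 3 * B * b / d * (\<integral>\<xi>. R x \<xi> \<partial>?P)" for x
  proof -
    define v where "v m = (if m \<in> A then x m else g m)" for m
    have vA: "(\<Sum>m\<in>A. \<xi> m * v m j) = (\<Sum>i\<in>A. \<xi> i * x i j)" for \<xi> j by (rule sum.cong) (auto simp: v_def)
    have vG: "(\<Sum>m\<in>G. \<xi> m * v m j) = (\<Sum>i\<in>G. \<xi> i * g i j)" for \<xi> j
      by (rule sum.cong) (use disj in \<open>auto simp: v_def\<close>)
    have "\<bar>(\<integral>\<xi>. u (\<lambda>j. \<Sum>m\<in>A. \<xi> m * v m j) \<partial>?P) - (\<integral>\<xi>. u (\<lambda>j. \<Sum>m\<in>G. \<xi> m * v m j) \<partial>?P)\<bar>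
      \<le> 3 * B * b / d * (\<integral>\<xi>. R x \<xi> \<partial>?P)"
      unfolding N'_def
    proof (rule interpolation[OF fin disj R(1)[of x, unfolded N'_def]])
      fix \<xi> j k assume jk: "j \<in> {1..p}" "k \<in> {1..p}"
      have "(\<Sum>m\<in>A. skew_kernel (\<xi> m) * v m j * v m k) = (\<Sum>i\<in>A. skew_kernel (\<xi> i) * x i j * x i k)"
        by (rule sum.cong) (auto simp: v_def)
      moreover have "(\<Sum>m\<in>G. v m j * v m k) = (\<Sum>m\<in>G. g m j * g m k)"
        by (rule sum.cong) (use disj in \<open>auto simp: v_def\<close>)
      moreover have "\<dots> = (\<Sum>i\<in>A. \<integral>y. y j * y k \<partial>N i)"
        using fac_shift[OF jk] cov[OF jk] by (simp add: A_def)
      ultimately show "\<bar>(\<Sum>m\<in>A. skew_kernel (\<xi> m) * v m j * v m k) - (\<Sum>m\<in>G. v m j * v m k)\<bar> \<le> R x \<xi>"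
        using R(2)[OF jk, of \<xi> x] by simp
    qed
    then show ?thesis unfolding vA vG a_def skew_end gauss_end .
  qed
  have am: "a \<in> borel_measurable (PiM A N)"
  proof -
    have [measurable]: "i \<in> A \<Longrightarrow> j \<in> {1..p} \<Longrightarrow> (\<lambda>x. x i j) \<in> borel_measurable (PiM A N)" for i j by (rule coord_PiM)
    have [measurable]: "i \<in> A \<Longrightarrow> (\<lambda>e. e i) \<in> borel_measurable (PiM A (\<lambda>_. skew_law))" for i
      using measurable_component_singleton[of i A "\<lambda>_. skew_law"] unfolding measurable_cong_sets[OF refl sets_skew_law] by simp
    have "(\<lambda>(x, e). u (\<lambda>j. \<Sum>i\<in>A. e i * x i j)) \<in> borel_measurable (PiM A N \<Otimes>\<^sub>M PiM A (\<lambda>_. skew_law))"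
      unfolding split_def by (intro u_measurable) measurable
    from borel_measurable_integral_prob[OF PE this] show ?thesis by (simp add: a_def[abs_def])
  qed
  have ab: "\<bar>a x\<bar> \<le> B" for x
  proof (cases "integrable (PiM A (\<lambda>_. skew_law)) (\<lambda>e. u (\<lambda>j. \<Sum>i\<in>A. e i * x i j))")
    case True
    have "\<bar>a x\<bar> \<le> (\<integral>e. \<bar>u (\<lambda>j. \<Sum>i\<in>A. e i * x i j)\<bar> \<partial>PiM A (\<lambda>_. skew_law))" unfolding a_def by (rule integral_abs_bound)
    also have "\<dots> \<le> (\<integral>e. B \<partial>PiM A (\<lambda>_. skew_law))"
      using True u_bound prob_space.finite_measure[OF PE] by (intro integral_mono) (auto intro: finite_measure.integrable_const)
    finally show ?thesis using prob_space.prob_space[OF PE] by simp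
  qed (use B_ge_1 in \<open>simp add: a_def not_integrable_integral_eq\<close>)
  have ai: "integrable (PiM A N) a"
    by (rule finite_measure.integrable_const_bound[OF prob_space.finite_measure[OF PJ] _ am, where B=B]) (use ab in auto)
  have "\<bar>(\<integral>x. a x \<partial>PiM A N) - (\<integral>z. u z \<partial>\<gamma>)\<bar> = \<bar>\<integral>x. a x - (\<integral>z. u z \<partial>\<gamma>) \<partial>PiM A N\<bar>"
    using ai prob_space.prob_space[OF PJ] prob_space.finite_measure[OF PJ] by (simp add: finite_measure.integrable_const)
  also have "\<dots> \<le> (\<integral>x. \<bar>a x - (\<integral>z. u z \<partial>\<gamma>)\<bar> \<partial>PiM A N)" by (rule integral_abs_bound)
  also have "\<dots> \<le> (\<integral>x. 3 * B * b / d * (\<integral>\<xi>. R x \<xi> \<partial>?P) \<partial>PiM A N)"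
    using ai R(3) inter prob_space.finite_measure[OF PJ]
    by (intro integral_mono) (auto simp: finite_measure.integrable_const)
  also have "\<dots> = 3 * B * b / d * (\<integral>x. (\<integral>\<xi>. R x \<xi> \<partial>?P) \<partial>PiM A N)" by (rule integral_mult_right_zero)
  also have "\<dots> \<le> 3 * B * b / d * (6627 * \<kappa>\<^sup>2 * sqrt (card A * ln p))"
    using R(4) B_ge_1 b_pos d_pos by (intro mult_left_mono) auto
  finally have 2: "\<bar>(\<integral>x. a x \<partial>PiM A N) - (\<integral>z. u z \<partial>\<gamma>)\<bar> \<le> 3 * B * b / d * (6627 * \<kappa>\<^sup>2 * sqrt (n * ln p))"
    unfolding cardA .
  have 1: "\<bar>(\<integral>x. u (\<lambda>j. \<Sum>i\<in>A. x i j) \<partial>PiM A N) - (\<integral>x. a x \<partial>PiM A N)\<bar> \<le> n * step_err"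
    using exchange[OF fin(1), of "\<lambda>_. 0"] unfolding cardA a_def by simp
  show ?thesis using 1 2 unfolding A_def by linarith
qed

definition total_err :: "nat \<Rightarrow> real" where
  "total_err n = n * step_err + 3 * B * b / d * (6627 * \<kappa>\<^sup>2 * sqrt (n * ln p))"

lemma distribution_sandwich:
  assumes GV: "gaussian_vector p \<Sigma> \<gamma>"
    and cov: "\<And>j k. j \<in> {1..p} \<Longrightarrow> k \<in> {1..p} \<Longrightarrow> \<Sigma> j k = (\<Sum>i=1..n. \<integral>y. y j * y k \<partial>N i)"
    and n: "n \<ge> 1" and big: "4096 * ln p ^ 5 \<le> n"
  defines "S \<equiv> (\<lambda>c. measure (PiM {1..n} N) {x \<in> space (PiM {1..n} N). vec_max p (\<lambda>j. \<Sum>i=1..n. x i j) \<le> c})"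
    and "Z \<equiv> (\<lambda>c. measure \<gamma> {z \<in> space \<gamma>. vec_max p z \<le> c})"
  shows "S (t - d) \<le> Z (t + d) + total_err n" "Z (t - d) \<le> S (t + d) + total_err n"
proof -
  interpret GV: gaussian_vector p \<Sigma> \<gamma> by fact
  have PJ: "prob_space (PiM {1..n} N)" by (rule prob_space_PiM) (rule prob_N)
  have m: "(\<lambda>x. \<Sum>i=1..n. x i j) \<in> borel_measurable (PiM {1..n} N)" if "j \<in> {1..p}" for j
    by (intro borel_measurable_sum coord_PiM that)
  note 1 = u_sandwich[OF PJ, where f="\<lambda>x j. \<Sum>i=1..n. x i j", OF m]
    and 2 = u_sandwich[OF GV.prob_space_axioms, where f="\<lambda>z. z", OF GV.coord]
  have 3: "\<bar>(\<integral>x. u (\<lambda>j. \<Sum>i=1..n. x i j) \<partial>PiM {1..n} N) - (\<integral>z. u z \<partial>\<gamma>)\<bar> \<le> total_err n"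
    unfolding total_err_def by (rule smooth_comparison[OF GV _ n big]) (rule cov)
  show "S (t - d) \<le> Z (t + d) + total_err n" "Z (t - d) \<le> S (t + d) + total_err n"
    using 1 2 3 unfolding S_def Z_def by linarith+
qed

end

text \<open>Smoothing brackets the distribution function of the sum between values of the Gaussian
  one at t - 2d and t + 2d. At levels from \<mu>/5 upwards anti-concentration closes the gap; lower
  levels are reduced to \<mu>/5 by monotonicity.\<close>

lemma distribution_comparison:
  assumes L: "smooth_max_laws b d B p N \<kappa>" and GV: "gaussian_vector p \<Sigma> \<gamma>"
    and cov: "\<And>j k. j \<in> {1..p} \<Longrightarrow> k \<in> {1..p} \<Longrightarrow> \<Sigma> j k = (\<Sum>i=1..n. \<integral>y. y j * y k \<partial>N i)"
    and n: "n \<ge> 1" and big: "4096 * ln p ^ 5 \<le> n"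
    and var: "\<And>j. j \<in> {1..p} \<Longrightarrow> \<Sigma> j j \<le> \<sigma>2"
    and \<mu>: "\<mu> = (\<integral>z. vec_max p z \<partial>\<gamma>)" "\<mu> > 0" and d: "20 * d \<le> \<mu>"
  defines "\<epsilon> \<equiv> n * (2 * (3240 * B * (816 * \<kappa> ^ 4 * b ^ 3 / d))) + 3 * B * b / d * (6627 * \<kappa>\<^sup>2 * sqrt (n * ln p))"
    and "S \<equiv> (\<lambda>c. measure (PiM {1..n} N) {x \<in> space (PiM {1..n} N). vec_max p (\<lambda>j. \<Sum>i=1..n. x i j) \<le> c})"
    and "Z \<equiv> (\<lambda>c. measure \<gamma> {z \<in> space \<gamma>. vec_max p z \<le> c})"
  shows "\<bar>Z t - S t\<bar> \<le> exp (- \<mu>\<^sup>2 / (8 * \<sigma>2)) + 2420 * d * ln p / \<mu> + \<epsilon>"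
proof -
  interpret GV: gaussian_vector p \<Sigma> \<gamma> by fact
  interpret L0: smooth_max_laws b 0 d B p N \<kappa> by (rule L)
  have d0: "d > 0" by (rule L0.d_pos)
  have l0: "ln (real p) > 0" using GV.p3 by simp
  interpret PJ: prob_space "PiM {1..n} N" by (rule prob_space_PiM) (rule L0.prob_N)
  have m: "(\<lambda>x. \<Sum>i=1..n. x i j) \<in> borel_measurable (PiM {1..n} N)" if "j \<in> {1..p}" for j
    by (intro borel_measurable_sum L0.coord_PiM that)
  have p1: "p \<ge> 1" using GV.p3 by simp
  have Sm: "{x \<in> space (PiM {1..n} N). vec_max p (\<lambda>j. \<Sum>i=1..n. x i j) \<le> c} \<in> sets (PiM {1..n} N)" for c
    by (rule vec_max_set_measurable[OF p1 m])
  have Zm: "{z \<in> space \<gamma>. vec_max p z \<le> c} \<in> sets \<gamma>" for c by measurable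
  have S_mono: "S c \<le> S c'" if "c \<le> c'" for c c'
    unfolding S_def by (rule PJ.finite_measure_mono[OF _ Sm]) (use that in auto)
  have Z_mono: "Z c \<le> Z c'" if "c \<le> c'" for c c'
    unfolding Z_def by (rule GV.finite_measure_mono[OF _ Zm]) (use that in auto)
  have S0: "0 \<le> S c" "0 \<le> Z c" for c by (auto simp: S_def Z_def)
  \<comment> \<open>The smoothing is centred at t + d for the upper and at t - d for the lower
    estimate, so that one end of each sandwich is exactly t.\<close>
  have up: "S t \<le> Z (t + 2 * d) + \<epsilon>" and lo: "Z (t - 2 * d) \<le> S t + \<epsilon>" for t
  proof -
    interpret L1: smooth_max_laws b "t + d" d B p N \<kappa> by (rule L)
    have "L1.total_err n = \<epsilon>" unfolding L1.total_err_def L1.step_err_def \<epsilon>_def ..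
    then show "S t \<le> Z (t + 2 * d) + \<epsilon>"
      using L1.distribution_sandwich(1)[OF GV cov n big] by (simp add: S_def Z_def add.assoc)
    interpret L2: smooth_max_laws b "t - d" d B p N \<kappa> by (rule L)
    have "L2.total_err n = \<epsilon>" unfolding L2.total_err_def L2.step_err_def \<epsilon>_def ..
    then show "Z (t - 2 * d) \<le> S t + \<epsilon>"
      using L2.distribution_sandwich(2)[OF GV cov n big] by (simp add: S_def Z_def)
  qed
  \<comment> \<open>An interval of length 2d at a level of at least \<mu>/10 gives 121 * 2 * 10 =
    2420. By 20 d <= \<mu>, the point t - 2d stays above \<mu>/10 whenever t >= \<mu>/5.\<close>
  have ac: "Z (c + 2 * d) - Z c \<le> 2420 * d * ln p / \<mu>" if c: "\<mu> / 10 \<le> c" for c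
  proof -
    have c0: "c > 0" using c \<mu> by linarith
    have "Z (c + 2 * d) - Z c = measure \<gamma> ({z \<in> space \<gamma>. vec_max p z \<le> c + 2 * d} - {z \<in> space \<gamma>. vec_max p z \<le> c})"
      unfolding Z_def using d0 by (intro GV.finite_measure_Diff[symmetric] Zm) auto
    also have "{z \<in> space \<gamma>. vec_max p z \<le> c + 2 * d} - {z \<in> space \<gamma>. vec_max p z \<le> c}
      = {z \<in> space \<gamma>. c < vec_max p z \<and> vec_max p z \<le> c + 2 * d}" by auto
    also have "measure \<gamma> \<dots> \<le> 121 * (2 * d) * ln p / c" by (rule GV.anticoncentration) (use c0 d0 in auto)
    also have "\<dots> \<le> 121 * (2 * d) * ln p / (\<mu> / 10)"
      using c \<mu> d0 l0 by (intro divide_left_mono mult_pos_pos c0) auto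
    finally show ?thesis by simp
  qed
  have main: "\<bar>Z t - S t\<bar> \<le> 2420 * d * ln p / \<mu> + \<epsilon>" if t: "\<mu> / 5 \<le> t" for t
  proof -
    have "Z (t + 2 * d) - Z t \<le> 2420 * d * ln p / \<mu>" by (rule ac) (use t \<mu> in linarith)
    moreover have "Z (t - 2 * d + 2 * d) - Z (t - 2 * d) \<le> 2420 * d * ln p / \<mu>" by (rule ac) (use t \<mu> d in linarith)
    ultimately show ?thesis using up[of t] lo[of t] by simp
  qed
  have low: "Z (\<mu> / 5) \<le> exp (- \<mu>\<^sup>2 / (8 * \<sigma>2))" unfolding Z_def by (rule GV.lower_tail[OF var \<mu>])
  show ?thesis
  proof (cases "\<mu> / 5 \<le> t")
    case True
    then show ?thesis using main[OF True] exp_ge_zero[of "- \<mu>\<^sup>2 / (8 * \<sigma>2)"] by linarith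
  next
    \<comment> \<open>Both values at t lie between 0 and those at \<mu>/5, where the Gaussian one is
      at most the lower-tail bound and the other differs from it by at most the bound of
      \<open>main\<close>.\<close>
    case False
    then have "S t \<le> S (\<mu> / 5)" "Z t \<le> Z (\<mu> / 5)" using S_mono Z_mono by auto
    then show ?thesis using main[of "\<mu> / 5"] low S0[of t] by linarith
  qed
qed

section \<open>Balancing the error terms\<close>

section \<open>Choice of the smoothing scale\<close>

context subexponential_laws
begin

lemma second_moment_le: assumes j: "j \<in> {1..p}" shows "(\<integral>x. x j * x j \<partial>N i) \<le> 49 * \<kappa>\<^sup>2"
proof -
  have m4: "integrable (N i) (\<lambda>x. x j ^ 4)" "(\<integral>x. x j ^ 4 \<partial>N i) \<le> 48 * \<kappa> ^ 4"
    by (rule moments(2)[OF j j j], rule moments(3)[OF j j j])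
  have "y * y \<le> y ^ 4 / \<kappa>\<^sup>2 + \<kappa>\<^sup>2" for y
  proof -
    have "2 * y\<^sup>2 * \<kappa>\<^sup>2 \<le> y ^ 4 + \<kappa> ^ 4" using sum_squares_bound[of "y\<^sup>2" "\<kappa>\<^sup>2"] by simp
    moreover have "0 \<le> y\<^sup>2 * \<kappa>\<^sup>2" by simp
    ultimately have "y\<^sup>2 * \<kappa>\<^sup>2 \<le> y ^ 4 + \<kappa> ^ 4" by linarith
    then show ?thesis using \<kappa> by (simp add: field_simps eval_nat_numeral)
  qed
  then have "(\<integral>x. x j * x j \<partial>N i) \<le> (\<integral>x. x j ^ 4 / \<kappa>\<^sup>2 + \<kappa>\<^sup>2 \<partial>N i)"
    using m4 prob_space.finite_measure[OF prob_N]
    by (intro integral_mono prod_integrable j) (auto simp: finite_measure.integrable_const)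
  also have "\<dots> = (\<integral>x. x j ^ 4 \<partial>N i) / \<kappa>\<^sup>2 + \<kappa>\<^sup>2"
    using m4 prob_space.finite_measure[OF prob_N] prob_space.prob_space[OF prob_N]
    by (simp add: finite_measure.integrable_const)
  also have "\<dots> \<le> 48 * \<kappa> ^ 4 / \<kappa>\<^sup>2 + \<kappa>\<^sup>2" using m4 by (intro add_right_mono divide_right_mono) auto
  also have "\<dots> = 49 * \<kappa>\<^sup>2" using \<kappa> by (simp add: eval_nat_numeral field_simps)
  finally show ?thesis .
qed

text \<open>Independence and centring remove the mixed terms with different indices.\<close>

lemma second_moment_sum:
  assumes I: "finite I" and jk: "j \<in> {1..p}" "k \<in> {1..p}"
  shows "(\<integral>x. (\<Sum>i\<in>I. x i j) * (\<Sum>i\<in>I. x i k) \<partial>PiM I N) = (\<Sum>i\<in>I. \<integral>y. y j * y k \<partial>N i)"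
proof -
  have c: "integrable (N i) (\<lambda>y. y j)" if "j \<in> {1..p}" for i j
    using moments(1)[OF that that that, of i] by (simp add: integrable_abs_iff coord[OF that])
  \<comment> \<open>Writes x_i,j x_l,k as a product over all coordinates, so that one product
    formula serves both i = l and i distinct from l.\<close>
  define f where "f i l m y = (if m = i then y j else 1) * (if m = l then y k else (1::real))" for i l m :: nat and y :: "nat \<Rightarrow> real"
  have fi: "integrable (N m) (f i l m)" for i l m
    using c[OF jk(1)] c[OF jk(2)] prod_integrable[OF jk] prob_space.finite_measure[OF prob_N]
    by (cases "m = i"; cases "m = l") (simp_all add: f_def[abs_def] finite_measure.integrable_const)
  have prod: "(\<Prod>m\<in>I. f i l m (x m)) = x i j * x l k" if "i \<in> I" "l \<in> I" for i l x
    using that I unfolding f_def prod.distrib by (simp add: prod.delta')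
  have int: "integrable (PiM I N) (\<lambda>x. x i j * x l k)" if "i \<in> I" "l \<in> I" for i l
    using product_integrable_prod[OF I, of "f i l"] fi prod[OF that] by simp
  have val: "(\<integral>x. x i j * x l k \<partial>PiM I N) = (if i = l then \<integral>y. y j * y k \<partial>N i else 0)" if "i \<in> I" "l \<in> I" for i l
  proof -
    have eq: "(\<integral>x. x i j * x l k \<partial>PiM I N) = (\<Prod>m\<in>I. integral\<^sup>L (N m) (f i l m))"
      using product_integral_prod[OF I, of "f i l"] fi prod[OF that] by simp
    show ?thesis
    proof (cases "i = l")
      case True
      have v: "integral\<^sup>L (N m) (f i l m) = (if m = i then \<integral>y. y j * y k \<partial>N i else 1)" for m
        using True prob_space.prob_space[OF prob_N] by (simp add: f_def[abs_def])
      show ?thesis unfolding eq v using True that I by simp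
    next
      case False
      then have "integral\<^sup>L (N i) (f i l i) = 0" using centered[OF jk(1)] by (simp add: f_def[abs_def])
      then show ?thesis using False that I unfolding eq by (auto intro!: prod_zero)
    qed
  qed
  have "(\<integral>x. (\<Sum>i\<in>I. x i j) * (\<Sum>i\<in>I. x i k) \<partial>PiM I N) = (\<integral>x. (\<Sum>i\<in>I. \<Sum>l\<in>I. x i j * x l k) \<partial>PiM I N)"
    by (simp add: sum_product)
  also have "\<dots> = (\<Sum>i\<in>I. \<integral>x. (\<Sum>l\<in>I. x i j * x l k) \<partial>PiM I N)"
    by (rule Bochner_Integration.integral_sum) (intro Bochner_Integration.integrable_sum int)
  also have "\<dots> = (\<Sum>i\<in>I. \<Sum>l\<in>I. \<integral>x. x i j * x l k \<partial>PiM I N)"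
    by (intro sum.cong refl Bochner_Integration.integral_sum int)
  also have "\<dots> = (\<Sum>i\<in>I. \<Sum>l\<in>I. if i = l then \<integral>y. y j * y k \<partial>N i else 0)"
    by (intro sum.cong refl val)
  also have "\<dots> = (\<Sum>i\<in>I. \<integral>y. y j * y k \<partial>N i)" using I by simp
  finally show ?thesis .
qed

lemma gaussian_vectorI:
  assumes law: "centered_gaussian_law p \<Sigma> \<gamma>"
    and cov: "\<And>j k. j \<in> {1..p} \<Longrightarrow> k \<in> {1..p} \<Longrightarrow> \<Sigma> j k = (\<Sum>i=1..n. \<integral>y. y j * y k \<partial>N i)"
  shows "gaussian_vector p \<Sigma> \<gamma>"
proof
  show "3 \<le> p" by (rule p3)
  show "centered_gaussian_law p \<Sigma> \<gamma>" by (rule law)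
  show "\<Sigma> j k = \<Sigma> k j" if "j \<in> {1..p}" "k \<in> {1..p}" for j k
    using cov[OF that] cov[OF that(2,1)] by (simp add: mult.commute)
  fix t :: "nat \<Rightarrow> real"
  have int: "integrable (N i) (\<lambda>y. t j * (y j * y k) * t k)" if "j \<in> {1..p}" "k \<in> {1..p}" for i j k
    using prod_integrable[OF that, of i] by simp
  have one: "(\<Sum>j=1..p. \<Sum>k=1..p. t j * (\<integral>y. y j * y k \<partial>N i) * t k) = (\<integral>y. (\<Sum>j=1..p. t j * y j)\<^sup>2 \<partial>N i)" for i
  proof -
    have "(\<integral>y. (\<Sum>j=1..p. t j * y j)\<^sup>2 \<partial>N i) = (\<integral>y. (\<Sum>j=1..p. \<Sum>k=1..p. t j * (y j * y k) * t k) \<partial>N i)"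
      by (simp add: power2_eq_square sum_product mult_ac)
    also have "\<dots> = (\<Sum>j=1..p. \<integral>y. (\<Sum>k=1..p. t j * (y j * y k) * t k) \<partial>N i)"
      by (rule Bochner_Integration.integral_sum) (intro Bochner_Integration.integrable_sum int)
    also have "\<dots> = (\<Sum>j=1..p. \<Sum>k=1..p. \<integral>y. t j * (y j * y k) * t k \<partial>N i)"
      by (intro sum.cong refl Bochner_Integration.integral_sum int)
    also have "\<dots> = (\<Sum>j=1..p. \<Sum>k=1..p. t j * (\<integral>y. y j * y k \<partial>N i) * t k)" by simp
    finally show ?thesis by simp
  qed
  have "(\<Sum>j=1..p. \<Sum>k=1..p. t j * \<Sigma> j k * t k)
      = (\<Sum>j=1..p. \<Sum>k=1..p. \<Sum>i=1..n. t j * (\<integral>y. y j * y k \<partial>N i) * t k)"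
  proof (intro sum.cong refl)
    fix j k assume "j \<in> {1..p}" "k \<in> {1..p}"
    then show "t j * \<Sigma> j k * t k = (\<Sum>i=1..n. t j * (\<integral>y. y j * y k \<partial>N i) * t k)"
      by (simp only: cov sum_distrib_left sum_distrib_right)
  qed
  also have "\<dots> = (\<Sum>j=1..p. \<Sum>i=1..n. \<Sum>k=1..p. t j * (\<integral>y. y j * y k \<partial>N i) * t k)"
    by (rule sum.cong[OF refl], rule sum.swap)
  also have "\<dots> = (\<Sum>i=1..n. \<Sum>j=1..p. \<Sum>k=1..p. t j * (\<integral>y. y j * y k \<partial>N i) * t k)"
    by (rule sum.swap)
  also have "\<dots> = (\<Sum>i=1..n. \<integral>y. (\<Sum>j=1..p. t j * y j)\<^sup>2 \<partial>N i)" unfolding one ..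
  also have "\<dots> \<ge> 0" by (intro sum_nonneg) simp
  finally show "0 \<le> (\<Sum>j=1..p. \<Sum>k=1..p. t j * \<Sigma> j k * t k)" .
qed

end

text \<open>With r the second term of the bound and d = r \<mu> / ln p, the errors are multiples of
  r (anti-concentration), r^3 / r^2 (covariance) and r^6 / r^4 (exchange). The side conditions of
  the comparison follow once r is small.\<close>

lemma gaussian_approximation_rate:
  fixes K \<mu> \<sigma>2 B :: real and n p :: nat
  assumes n: "n \<ge> 1" and K: "K \<ge> 1" and SL: "subexponential_laws p N (2 * K / sqrt n)"
    and law: "centered_gaussian_law p \<Sigma> \<gamma>"
    and cov: "\<And>j k. j \<in> {1..p} \<Longrightarrow> k \<in> {1..p} \<Longrightarrow> \<Sigma> j k = (\<Sum>i=1..n. \<integral>y. y j * y k \<partial>N i)"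
    and var: "\<And>j. j \<in> {1..p} \<Longrightarrow> \<Sigma> j j \<le> \<sigma>2"
    and \<mu>: "\<mu> = (\<integral>z. vec_max p z \<partial>\<gamma>)" "\<mu> > 0"
    and B: "B \<ge> 1" "\<And>k x. k \<le> 4 \<Longrightarrow> \<bar>cutoff k x\<bar> \<le> B"
  shows "\<bar>measure \<gamma> {z \<in> space \<gamma>. vec_max p z \<le> t} - measure (PiM {1..n} N) {x \<in> space (PiM {1..n} N). vec_max p (\<lambda>j. \<Sum>i=1..n. x i j) \<le> t}\<bar>
    \<le> 10 ^ 8 * B * (exp (- \<mu>\<^sup>2 / (8 * \<sigma>2)) + \<mu> powr (-2/3) * (K ^ 4 * ln p ^ 7 / n) powr (1/6))"
    (is "\<bar>?Z - ?S\<bar> \<le> _")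
proof -
  interpret SL: subexponential_laws p N "2 * K / sqrt n" by fact
  have GV: "gaussian_vector p \<Sigma> \<gamma>" by (rule SL.gaussian_vectorI[OF law]) (rule cov)
  interpret GV: gaussian_vector p \<Sigma> \<gamma> by (rule GV)
  interpret PJ: prob_space "PiM {1..n} N" by (rule prob_space_PiM) (rule SL.prob_N)
  define h m r where "h = sqrt (ln (real p))" and "m = sqrt (real n)"
    and "r = \<mu> powr (-2/3) * (K ^ 4 * ln p ^ 7 / n) powr (1/6)"
  define e where "e = exp (- \<mu>\<^sup>2 / (8 * \<sigma>2))"
  have l1: "ln (real p) \<ge> 1" by (rule ln_of_nat_ge_1[OF SL.p3])
  have h1: "h \<ge> 1" and m0: "m > 0" using l1 n by (auto simp: h_def m_def)
  have lh: "ln (real p) = h\<^sup>2" and nm: "real n = m\<^sup>2" using l1 by (auto simp: h_def m_def)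
  have K0: "K > 0" and h0: "h > 0" using K h1 by auto
  have r0: "r > 0" unfolding r_def using \<mu> K0 l1 n by simp
  \<comment> \<open>A sixth power clears the fractional exponents; with h^2 = ln p and m^2 = n the
    remaining work is arithmetic of powers.\<close>
  have r6: "r ^ 6 = (K\<^sup>2 * h ^ 7 / (\<mu>\<^sup>2 * m))\<^sup>2"
  proof -
    have "(\<mu> powr (-2/3)) ^ 6 = \<mu> powr (real 6 * (-2/3))" using \<mu>(2) by (subst powr_power) (auto simp: mult.commute)
    also have "real 6 * (-2/3) = - 4" by simp
    also have "\<mu> powr (- 4) = 1 / \<mu> ^ 4" using \<mu>(2) by (simp add: powr_minus_divide powr_numeral)
    finally have 1: "(\<mu> powr (-2/3)) ^ 6 = 1 / \<mu> ^ 4" .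
    have w: "K ^ 4 * ln p ^ 7 / n > 0" using K0 l1 n by simp
    have "(w powr (1/6)) ^ 6 = w" if "w > 0" for w :: real
      using powr_power[of w "1/6" 6] that by simp
    from this[OF w] have 2: "((K ^ 4 * ln p ^ 7 / n) powr (1/6)) ^ 6 = K ^ 4 * ln p ^ 7 / n" .
    have "r ^ 6 = 1 / \<mu> ^ 4 * (K ^ 4 * ln p ^ 7 / n)"
      unfolding r_def power_mult_distrib[of "\<mu> powr (-2/3)"] 1 2 ..
    then show ?thesis unfolding lh nm
      by (simp add: power_divide power_mult_distrib flip: power_mult)
  qed
  have r3: "r ^ 3 = K\<^sup>2 * h ^ 7 / (\<mu>\<^sup>2 * m)"
  proof (rule power2_eq_imp_eq)
    show "(r ^ 3)\<^sup>2 = (K\<^sup>2 * h ^ 7 / (\<mu>\<^sup>2 * m))\<^sup>2" unfolding r6[symmetric] by (simp flip: power_mult)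
  qed (use r0 h0 m0 K0 in auto)
  have "\<bar>?Z - ?S\<bar> \<le> 10 ^ 8 * B * (e + r)"
  proof (cases "r \<le> 1 / 50")
    \<comment> \<open>The right-hand side exceeds 1, so there is nothing to compare.\<close>
    case False
    have "\<bar>?Z - ?S\<bar> \<le> 1"
      using GV.prob_le_1 PJ.prob_le_1 measure_nonneg by (smt (verit))
    also have "1 \<le> (10 ^ 8 * B) * (e + r)"
    proof -
      have "1 / 50 \<le> e + r" using False exp_ge_zero[of "- \<mu>\<^sup>2 / (8 * \<sigma>2)"] unfolding e_def by linarith
      then have "1 * (1 / 50) \<le> B * (e + r)" using B(1) by (intro mult_mono) auto
      then show ?thesis by simp
    qed
    finally show ?thesis .
  next
    case r: True
    \<comment> \<open>\<open>d\<close> makes the anti-concentration error d ln p / \<mu> equal to r,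
      and \<open>b\<close> is forced by b d = ln p.\<close>
    define d b \<kappa> where "d = r * \<mu> / h\<^sup>2" and "b = h ^ 4 / (r * \<mu>)" and "\<kappa> = 2 * K / m"
    have \<kappa>_eq: "2 * K / sqrt n = \<kappa>" by (simp add: \<kappa>_def m_def)
    have d0: "d > 0" and b0: "b > 0" using r0 \<mu> h0 by (auto simp: d_def b_def)
    have bd: "b * d = h\<^sup>2" using r0 \<mu>(2) h0 by (simp add: b_def d_def field_simps eval_nat_numeral)
    \<comment> \<open>The variances are at most 49 * (2K)^2 = (14 K)^2, and the mean of the maximum
      is at most three times the largest standard deviation times sqrt(ln p).\<close>
    have \<mu>_le: "\<mu> \<le> 42 * K * h"
    proof -
      have "\<Sigma> j j \<le> 196 * K\<^sup>2" if j: "j \<in> {1..p}" for j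
      proof -
        have "\<Sigma> j j \<le> (\<Sum>i=1..n. 49 * (2 * K / sqrt n)\<^sup>2)"
          unfolding cov[OF j j] by (intro sum_mono SL.second_moment_le j)
        also have "\<dots> = 196 * K\<^sup>2" using n by (simp add: power_divide power_mult_distrib)
        finally show ?thesis .
      qed
      from GV.mean_le[OF this] have "\<mu> \<le> 3 * sqrt (196 * K\<^sup>2) * sqrt (ln p)" unfolding \<mu>(1) by simp
      also have "sqrt (196 * K\<^sup>2) = 14 * K" using K0 real_sqrt_unique[of "14 * K" "196 * K\<^sup>2"] by (simp add: power_mult_distrib)
      finally show ?thesis by (simp add: h_def)
    qed
    \<comment> \<open>A small r forces n to be large: inserting \<mu> <= 42 K h into r^3 = K^2 h^7 /
      (\<mu>^2 m) gives h^5 <= m * 42^2 / 50^3.\<close>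
    have hm: "64 * h ^ 5 \<le> m"
    proof -
      have "K\<^sup>2 * h ^ 7 = r ^ 3 * m * \<mu>\<^sup>2" using r3 \<mu>(2) m0 by (simp add: field_simps)
      also have "\<dots> \<le> (1 / 50) ^ 3 * m * (42 * K * h)\<^sup>2"
        using r r0 m0 \<mu>_le \<mu>(2) by (intro mult_mono power_mono) auto
      finally have "(K\<^sup>2 * h\<^sup>2) * h ^ 5 \<le> (K\<^sup>2 * h\<^sup>2) * (m * 1764 / 125000)"
        by (simp add: power_mult_distrib eval_nat_numeral mult_ac)
      then have "h ^ 5 \<le> m * 1764 / 125000" by (rule mult_left_le_imp_le) (use K0 h0 in simp)
      then show ?thesis using m0 by simp
    qed
    have big: "4096 * ln p ^ 5 \<le> n"
    proof -
      have "(64 * h ^ 5)\<^sup>2 \<le> m\<^sup>2" using hm h0 by (intro power_mono) auto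
      then show ?thesis unfolding lh nm by (simp add: power_mult_distrib flip: power_mult)
    qed
    \<comment> \<open>After squaring, r^3 can be substituted and everything collapses to r h^5 / m,
      which is at most 1/3200, below 1/24^2.\<close>
    have small: "12 * b * \<kappa> * ln p \<le> 1"
    proof -
      have eq: "12 * b * \<kappa> * ln p = 24 * (K * h ^ 6 / (r * \<mu> * m))"
        unfolding lh b_def \<kappa>_def using r0 \<mu>(2) m0 by (simp add: field_simps eval_nat_numeral)
      have "(K * h ^ 6 / (r * \<mu> * m))\<^sup>2 = (K\<^sup>2 * h ^ 7 / (\<mu>\<^sup>2 * m)) * h ^ 5 / (r\<^sup>2 * m)"
        using r0 \<mu>(2) m0 by (simp add: field_simps eval_nat_numeral)
      also have "\<dots> = r * (h ^ 5 / m)" unfolding r3[symmetric] using r0 m0 by (simp add: field_simps eval_nat_numeral)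
      also have "\<dots> \<le> (1 / 50) * (1 / 64)"
        using r r0 hm m0 h0 by (intro mult_mono) (auto simp: field_simps)
      also have "\<dots> \<le> (1 / 24)\<^sup>2" by (simp add: power2_eq_square)
      finally have "K * h ^ 6 / (r * \<mu> * m) \<le> 1 / 24" by (rule power2_le_imp_le) simp
      then show ?thesis unfolding eq by linarith
    qed
    have SM: "smooth_max_laws b d B p N \<kappa>"
    proof -
      interpret SL': subexponential_laws p N \<kappa> using SL unfolding \<kappa>_eq .
      show ?thesis
      proof
        show "0 < b" "0 < d" "1 \<le> B" "finite {1..p}" by (fact b0 d0 B(1) finite_atLeastAtMost)+
        show "{1..p} \<noteq> {}" using SL.p3 by simp
        show "1 \<le> b * d" using bd l1 lh by simp
        show "\<bar>cutoff k x\<bar> \<le> B" if "k \<le> 4" for k x by (rule B(2)[OF that])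
        show "b * d = ln p" using bd lh by simp
        show "12 * b * \<kappa> * ln p \<le> 1" by (rule small)
      qed
    qed
    have "20 * r \<le> 1 * 1" using r by simp
    also have "\<dots> \<le> h * h" using h1 by (intro mult_mono) auto
    finally have "20 * r \<le> h\<^sup>2" by (simp add: power2_eq_square)
    then have d20: "20 * d \<le> \<mu>" using \<mu>(2) h0 by (simp add: d_def field_simps)
    have "\<bar>?Z - ?S\<bar> \<le> e + 2420 * d * ln p / \<mu>
        + (n * (2 * (3240 * B * (816 * \<kappa> ^ 4 * b ^ 3 / d))) + 3 * B * b / d * (6627 * \<kappa>\<^sup>2 * sqrt (n * ln p)))"
      unfolding e_def by (rule distribution_comparison[OF SM GV _ n big var \<mu> d20]) (rule cov)
    also have "2420 * d * ln p / \<mu> = 2420 * r" unfolding lh d_def using \<mu>(2) h0 by simp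
    \<comment> \<open>84602880 = 2 * 3240 * 816 * 2^4, the last factor from \<kappa>^4; likewise
      79524 below is 3 * 6627 * 2^2.\<close>
    also have "n * (2 * (3240 * B * (816 * \<kappa> ^ 4 * b ^ 3 / d))) = 84602880 * B * ((K\<^sup>2 * h ^ 7 / (\<mu>\<^sup>2 * m))\<^sup>2 / r ^ 4)"
      unfolding nm \<kappa>_def b_def d_def using \<mu>(2) h0 m0 r0 by (simp add: field_simps eval_nat_numeral)
    also have "(K\<^sup>2 * h ^ 7 / (\<mu>\<^sup>2 * m))\<^sup>2 / r ^ 4 = r * r" unfolding r6[symmetric] using r0 by (simp add: eval_nat_numeral)
    also have "3 * B * b / d * (6627 * \<kappa>\<^sup>2 * sqrt (n * ln p)) = 79524 * B * ((K\<^sup>2 * h ^ 7 / (\<mu>\<^sup>2 * m)) / r\<^sup>2)"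
    proof -
      have "sqrt (n * ln p) = m * h" unfolding m_def h_def by (rule real_sqrt_mult)
      then show ?thesis unfolding \<kappa>_def b_def d_def using \<mu>(2) h0 m0 r0 by (simp add: field_simps eval_nat_numeral)
    qed
    also have "(K\<^sup>2 * h ^ 7 / (\<mu>\<^sup>2 * m)) / r\<^sup>2 = r" unfolding r3[symmetric] using r0 by (simp add: eval_nat_numeral)
    \<comment> \<open>With r^2 <= r and B >= 1 the coefficients 2420, 84602880 and 79524 add up to
      less than 10^8.\<close>
    also have "e + 2420 * r + (84602880 * B * (r * r) + 79524 * B * r) \<le> 10 ^ 8 * B * e + 10 ^ 8 * B * r"
    proof -
      have "1 * r \<le> B * r" "1 * e \<le> B * e" using B(1) r0 by (intro mult_right_mono; simp add: e_def)+
      moreover have "B * (r * r) \<le> B * (r * 1)" using B(1) r r0 by (intro mult_left_mono) auto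
      moreover have "0 \<le> B * e" using B(1) by (simp add: e_def)
      moreover have p8: "(10::real) ^ 8 = 100000000" by simp
      ultimately show ?thesis using r0 unfolding p8 mult.assoc mult_1 mult_1_right by linarith
    qed
    finally show ?thesis by (simp add: algebra_simps)
  qed
  then show ?thesis unfolding e_def r_def .
qed

section \<open>From random vectors on a sample space to their laws\<close>

section \<open>Passage to the laws of the vectors\<close>

text \<open>Working with 2K instead of K avoids asking whether the infimum is attained: some
  admissible c lies below 2K, and the moment decreases in c. This is the 2 in \<kappa> = 2K / sqrt
  n.\<close>

lemma psi1_norm_exp_moment:
  assumes m [measurable]: "\<xi> \<in> borel_measurable M" and le: "psi1_norm M \<xi> \<le> ereal K" and K: "K > 0"
  shows "integrable M (\<lambda>\<omega>. exp (\<bar>\<xi> \<omega>\<bar> / (2 * K)))" "(\<integral>\<omega>. exp (\<bar>\<xi> \<omega>\<bar> / (2 * K)) \<partial>M) \<le> 2"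
proof -
  have "Inf {ereal c | c. c > 0 \<and> (\<integral>\<^sup>+ \<omega>. ennreal (exp (\<bar>\<xi> \<omega>\<bar> / c)) \<partial>M) \<le> 2} < ereal (2 * K)"
    by (rule le_less_trans[OF le[unfolded psi1_norm_def]]) (use K in simp)
  then obtain c where c: "c > 0" "(\<integral>\<^sup>+ \<omega>. ennreal (exp (\<bar>\<xi> \<omega>\<bar> / c)) \<partial>M) \<le> 2" "c < 2 * K"
    unfolding Inf_less_iff by auto
  have "(\<integral>\<^sup>+ \<omega>. ennreal (exp (\<bar>\<xi> \<omega>\<bar> / (2 * K))) \<partial>M) \<le> (\<integral>\<^sup>+ \<omega>. ennreal (exp (\<bar>\<xi> \<omega>\<bar> / c)) \<partial>M)"
    using c by (intro nn_integral_mono ennreal_leI) (simp add: divide_left_mono)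
  with c have le2: "(\<integral>\<^sup>+ \<omega>. ennreal (exp (\<bar>\<xi> \<omega>\<bar> / (2 * K))) \<partial>M) \<le> 2" by simp
  then have lt: "(\<integral>\<^sup>+ \<omega>. ennreal (exp (\<bar>\<xi> \<omega>\<bar> / (2 * K))) \<partial>M) < \<infinity>"
    by (rule le_less_trans) simp
  show i: "integrable M (\<lambda>\<omega>. exp (\<bar>\<xi> \<omega>\<bar> / (2 * K)))"
    by (rule integrableI_nonneg) (use lt in auto)
  show "(\<integral>\<omega>. exp (\<bar>\<xi> \<omega>\<bar> / (2 * K)) \<partial>M) \<le> 2"
    using nn_integral_eq_integral[OF i] le2 by (simp flip: ennreal_numeral)
qed

lemma vec_max_cong: "(\<And>j. j \<in> {1..p} \<Longrightarrow> v j = w j) \<Longrightarrow> vec_max p v = vec_max p w"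
  unfolding vec_max_def by (metis (no_types, lifting) image_cong)

text \<open>The estimate depends on the independent vectors through the product of the laws of X_i /
  sqrt n only. These laws satisfy the assumptions of \<open>gaussian_approximation_rate\<close>, and
  the bound is uniform in t.\<close>

lemma gaussian_max_approx:
  assumes B: "B \<ge> 1" "\<And>k x. k \<le> 4 \<Longrightarrow> \<bar>cutoff k x\<bar> \<le> B"
  shows "gaussian_max_approx_const TYPE('a) (10 ^ 8 * B)"
  unfolding gaussian_max_approx_const_def
proof (intro allI impI)
  fix n p :: nat and K :: real and M :: "'a measure" and X :: "nat \<Rightarrow> 'a \<Rightarrow> nat \<Rightarrow> real"
    and \<gamma> \<Sigma> and \<sigma>max \<mu> :: real
  assume n: "3 \<le> n" and p: "3 \<le> p" and K: "1 \<le> K" and M: "prob_space M"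
    and indep: "prob_space.indep_vars M (\<lambda>_. euclid p) X {1..n}"
    and mean: "\<forall>i\<in>{1..n}. \<forall>j\<in>{1..p}. (\<integral>\<omega>. X i \<omega> j \<partial>M) = 0"
    and psi1: "\<forall>i\<in>{1..n}. \<forall>j\<in>{1..p}. psi1_norm M (\<lambda>\<omega>. X i \<omega> j) \<le> ereal K"
    and \<Sigma>: "\<Sigma> = second_moment M (scaled_sum n X)" and \<sigma>: "\<sigma>max = sqrt (MAX j\<in>{1..p}. \<Sigma> j j)"
    and law: "centered_gaussian_law p \<Sigma> \<gamma>" and \<mu>: "\<mu> = (\<integral>z. vec_max p z \<partial>\<gamma>)" "0 < \<mu>"
  interpret prob_space M by fact
  define m where "m = sqrt (real n)"
  have m0: "m > 0" using n by (simp add: m_def)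
  have Xm: "X i \<in> measurable M (euclid p)" if "i \<in> {1..n}" for i using indep that by (auto simp: indep_vars_def)
  have Xc: "(\<lambda>\<omega>. X i \<omega> j) \<in> borel_measurable M" if "i \<in> {1..n}" "j \<in> {1..p}" for i j
    using measurable_compose[OF Xm[OF that(1)] measurable_component_singleton[OF that(2)]] .
  define s :: "(nat \<Rightarrow> real) \<Rightarrow> nat \<Rightarrow> real" where "s = (\<lambda>y. \<lambda>j\<in>{1..p}. y j / m)"
  have sm: "s \<in> measurable (euclid p) (euclid p)" unfolding s_def
    by (rule measurable_restrict) (intro borel_measurable_divide measurable_component_singleton borel_measurable_const)
  define Y where "Y i \<omega> = s (X i \<omega>)" for i \<omega>
  have Ym: "Y i \<in> measurable M (euclid p)" if "i \<in> {1..n}" for i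
    unfolding Y_def by (rule measurable_compose[OF Xm[OF that] sm])
  have indepY: "indep_vars (\<lambda>_. euclid p) Y {1..n}"
    unfolding Y_def[abs_def] by (rule indep_vars_compose2[OF indep]) (rule sm)
  \<comment> \<open>Outside 1..n any centred law with the exponential bound would do; the point mass
    at 0 is the simplest.\<close>
  define N where "N i = (if i \<in> {1..n} then distr M (euclid p) (Y i) else return (euclid p) (\<lambda>j\<in>{1..p}. 0))" for i
  \<comment> \<open>Independence enters here: the joint law of the rescaled vectors is the product
    of their laws.\<close>
  have PN: "PiM {1..n} N = distr M (PiM {1..n} (\<lambda>_. euclid p)) (\<lambda>\<omega>. \<lambda>i\<in>{1..n}. Y i \<omega>)"
  proof -
    have "PiM {1..n} N = PiM {1..n} (\<lambda>i. distr M (euclid p) (Y i))"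
      by (rule PiM_cong) (auto simp: N_def)
    then show ?thesis using indep_vars_iff_distr_eq_PiM'[of "{1..n}" Y "\<lambda>_. euclid p"] Ym indepY n by simp
  qed
  have zero: "(\<lambda>j\<in>{1..p}. 0::real) \<in> space (euclid p)" by (simp add: space_PiM)
  have coord: "(\<lambda>y. y j) \<in> borel_measurable (euclid p)" if "j \<in> {1..p}" for j
    using measurable_component_singleton[OF that, of "\<lambda>_. borel"] .
  have sets_N: "sets (N i) = sets (euclid p)" for i by (simp add: N_def)
  have SL: "subexponential_laws p N (2 * K / sqrt n)"
  proof (rule subexponential_laws.intro)
    show "3 \<le> p" by (rule p)
    show "prob_space (N i)" for i
    proof (cases "i \<in> {1..n}")
      case True
      then show ?thesis unfolding N_def if_P[OF True] by (intro prob_space_distr Ym)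
    next
      case False
      then show ?thesis unfolding N_def if_not_P[OF False] by (intro prob_space_return zero)
    qed
    show "sets (N i) = sets (euclid p)" for i by (rule sets_N)
    show "0 < 2 * K / sqrt n" using K n by simp
    fix i j assume j: "j \<in> {1..p}"
    have em: "(\<lambda>y. exp (\<bar>y j\<bar> / (2 * K / sqrt n))) \<in> borel_measurable (euclid p)" using coord[OF j] by simp
    show "(\<integral>x. x j \<partial>N i) = 0"
    proof (cases "i \<in> {1..n}")
      case True
      have "(\<integral>x. x j \<partial>N i) = (\<integral>\<omega>. X i \<omega> j / m \<partial>M)"
        using True j by (simp only: N_def if_True integral_distr[OF Ym[OF True] coord[OF j]]) (simp add: Y_def s_def)
      then show ?thesis using mean True j by simp
    next
      case False
      then show ?thesis unfolding N_def if_not_P[OF False] using integral_return[OF zero coord[OF j]] j by simp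
    qed
    have "integrable (N i) (\<lambda>x. exp (\<bar>x j\<bar> / (2 * K / sqrt n))) \<and> (\<integral>x. exp (\<bar>x j\<bar> / (2 * K / sqrt n)) \<partial>N i) \<le> 2"
    proof (cases "i \<in> {1..n}")
      case True
      have eq: "\<bar>Y i \<omega> j\<bar> / (2 * K / sqrt n) = \<bar>X i \<omega> j\<bar> / (2 * K)" for \<omega>
        using j m0 by (simp add: Y_def s_def m_def[symmetric] abs_div)
      have "psi1_norm M (\<lambda>\<omega>. X i \<omega> j) \<le> ereal K" using psi1 True j by blast
      note E = psi1_norm_exp_moment[OF Xc[OF True j] this]
      show ?thesis
        unfolding N_def if_P[OF True] integrable_distr_eq[OF Ym[OF True] em] integral_distr[OF Ym[OF True] em] eq
        using E K by simp
    next
      case False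
      interpret R: prob_space "return (euclid p) (\<lambda>j\<in>{1..p}. 0::real)" by (rule prob_space_return[OF zero])
      have "integrable (return (euclid p) (\<lambda>j\<in>{1..p}. 0)) (\<lambda>x. exp (\<bar>x j\<bar> / (2 * K / sqrt n)))"
      proof (rule R.integrable_const_bound[where B=1])
        show "AE x in return (euclid p) (\<lambda>j\<in>{1..p}. 0). norm (exp (\<bar>x j\<bar> / (2 * K / sqrt n))) \<le> 1"
          using j coord[OF j] zero by (subst AE_return) auto
      qed (use em in simp)
      then show ?thesis unfolding N_def if_not_P[OF False] using integral_return[OF zero em] j by simp
    qed
    then show "integrable (N i) (\<lambda>x. exp (\<bar>x j\<bar> / (2 * K / sqrt n)))" "(\<integral>x. exp (\<bar>x j\<bar> / (2 * K / sqrt n)) \<partial>N i) \<le> 2"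
      by blast+
  qed
  interpret SL: subexponential_laws p N "2 * K / sqrt n" by (rule SL)
  define W where "W \<omega> = (\<lambda>i\<in>{1..n}. Y i \<omega>)" for \<omega>
  have Wm: "W \<in> measurable M (PiM {1..n} (\<lambda>_. euclid p))"
    unfolding W_def by (rule measurable_restrict) (rule Ym)
  have setsP: "sets (PiM {1..n} N) = sets (PiM {1..n} (\<lambda>_. euclid p))" by (rule sets_PiM_cong) (simp_all add: sets_N)
  have PW: "PiM {1..n} N = distr M (PiM {1..n} (\<lambda>_. euclid p)) W" unfolding PN W_def ..
  have sumW: "(\<Sum>i=1..n. W \<omega> i j) = scaled_sum n X \<omega> j" if "j \<in> {1..p}" for \<omega> j
  proof -
    have "(\<Sum>i=1..n. W \<omega> i j) = (\<Sum>i=1..n. X i \<omega> j / m)"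
      by (rule sum.cong) (use that in \<open>auto simp: W_def Y_def s_def\<close>)
    then show ?thesis by (simp add: scaled_sum_def m_def sum_divide_distrib)
  qed
  have cov: "\<Sigma> j k = (\<Sum>i=1..n. \<integral>y. y j * y k \<partial>N i)" if jk: "j \<in> {1..p}" "k \<in> {1..p}" for j k
  proof -
    have mm: "(\<lambda>x. (\<Sum>i=1..n. x i j) * (\<Sum>i=1..n. x i k)) \<in> borel_measurable (PiM {1..n} (\<lambda>_. euclid p))"
      unfolding measurable_cong_sets[OF setsP[symmetric] refl]
      by (intro borel_measurable_times borel_measurable_sum SL.coord_PiM jk)
    have "(\<integral>x. (\<Sum>i=1..n. x i j) * (\<Sum>i=1..n. x i k) \<partial>PiM {1..n} N) = (\<integral>\<omega>. scaled_sum n X \<omega> j * scaled_sum n X \<omega> k \<partial>M)"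
      unfolding PW integral_distr[OF Wm mm] sumW[OF jk(1)] sumW[OF jk(2)] ..
    then show ?thesis
      using SL.second_moment_sum[of "{1..n}", OF _ jk] by (simp add: \<Sigma> second_moment_def)
  qed
  have var: "\<Sigma> j j \<le> \<sigma>max\<^sup>2" if "j \<in> {1..p}" for j
  proof -
    have le: "\<Sigma> j j \<le> (MAX j\<in>{1..p}. \<Sigma> j j)" using that by (intro Max_ge) auto
    have "0 \<le> \<Sigma> j j" by (simp add: \<Sigma> second_moment_def)
    then have "\<sigma>max\<^sup>2 = (MAX j\<in>{1..p}. \<Sigma> j j)" unfolding \<sigma> using le by (intro real_sqrt_pow2) simp
    then show ?thesis using le by simp
  qed
  have dist: "measure (PiM {1..n} N) {x \<in> space (PiM {1..n} N). vec_max p (\<lambda>j. \<Sum>i=1..n. x i j) \<le> t}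
      = measure M {\<omega> \<in> space M. vec_max p (scaled_sum n X \<omega>) \<le> t}" for t
  proof -
    have "(\<lambda>x. \<Sum>i=1..n. x i j) \<in> borel_measurable (PiM {1..n} (\<lambda>_. euclid p))" if "j \<in> {1..p}" for j
      unfolding measurable_cong_sets[OF setsP[symmetric] refl] by (intro borel_measurable_sum SL.coord_PiM that)
    then have S: "{x \<in> space (PiM {1..n} (\<lambda>_. euclid p)). vec_max p (\<lambda>j. \<Sum>i=1..n. x i j) \<le> t} \<in> sets (PiM {1..n} (\<lambda>_. euclid p))"
      using p by (intro vec_max_set_measurable) auto
    have "vec_max p (\<lambda>j. \<Sum>i=1..n. W \<omega> i j) = vec_max p (scaled_sum n X \<omega>)" for \<omega>
      by (rule vec_max_cong) (rule sumW)
    then have "W -` {x \<in> space (PiM {1..n} (\<lambda>_. euclid p)). vec_max p (\<lambda>j. \<Sum>i=1..n. x i j) \<le> t} \<inter> space M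
        = {\<omega> \<in> space M. vec_max p (scaled_sum n X \<omega>) \<le> t}"
      using measurable_space[OF Wm] by auto
    then show ?thesis unfolding PW using measure_distr[OF Wm S] by simp
  qed
  have "\<bar>measure \<gamma> {z \<in> space \<gamma>. vec_max p z \<le> t} - measure M {\<omega> \<in> space M. vec_max p (scaled_sum n X \<omega>) \<le> t}\<bar>
    \<le> 10 ^ 8 * B * (exp (- \<mu>\<^sup>2 / (8 * \<sigma>max\<^sup>2)) + \<mu> powr (-2/3) * (K ^ 4 * ln (real p) ^ 7 / real n) powr (1/6))" for t
    unfolding dist[symmetric]
    by (rule gaussian_approximation_rate[OF _ K SL law _ _ \<mu> B])
      (use n in simp, rule cov, assumption+, rule var, assumption+)
  then show "(SUP t. \<bar>measure \<gamma> {z \<in> space \<gamma>. vec_max p z \<le> t} - measure M {\<omega> \<in> space M. vec_max p (scaled_sum n X \<omega>) \<le> t}\<bar>)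
    \<le> 10 ^ 8 * B * (exp (- \<mu>\<^sup>2 / (8 * \<sigma>max\<^sup>2)) + \<mu> powr (-2/3) * (K ^ 4 * ln (real p) ^ 7 / real n) powr (1/6))"
    by (intro cSUP_least) auto
qed

text \<open>Only the joint law of the vectors matters, and the coordinate maps on arrays realise it.\<close>

lemma gaussian_max_approx_const_transfer:
  assumes C: "gaussian_max_approx_const TYPE(nat \<Rightarrow> nat \<Rightarrow> real) C"
  shows "gaussian_max_approx_const TYPE('a) C"
  unfolding gaussian_max_approx_const_def
proof (intro allI impI)
  fix n p :: nat and K :: real and M :: "'a measure" and X :: "nat \<Rightarrow> 'a \<Rightarrow> nat \<Rightarrow> real"
    and \<gamma> \<Sigma> and \<sigma>max \<mu> :: real
  assume n: "3 \<le> n" and p: "3 \<le> p" and K: "1 \<le> K" and M: "prob_space M"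
    and indep: "prob_space.indep_vars M (\<lambda>_. euclid p) X {1..n}"
    and mean: "\<forall>i\<in>{1..n}. \<forall>j\<in>{1..p}. (\<integral>\<omega>. X i \<omega> j \<partial>M) = 0"
    and psi1: "\<forall>i\<in>{1..n}. \<forall>j\<in>{1..p}. psi1_norm M (\<lambda>\<omega>. X i \<omega> j) \<le> ereal K"
    and \<Sigma>: "\<Sigma> = second_moment M (scaled_sum n X)" and \<sigma>: "\<sigma>max = sqrt (MAX j\<in>{1..p}. \<Sigma> j j)"
    and law: "centered_gaussian_law p \<Sigma> \<gamma>" and \<mu>: "\<mu> = (\<integral>z. vec_max p z \<partial>\<gamma>)" "0 < \<mu>"
    and rate: "K\<^sup>2 * (ln (real p)) powr (1/2) * (ln (real n))\<^sup>2 \<le> sqrt (real n)"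
  interpret prob_space M by fact
  let ?Q = "PiM {1..n} (\<lambda>_. euclid p)"
  define W where "W \<omega> = (\<lambda>i\<in>{1..n}. X i \<omega>)" for \<omega>
  define X' :: "nat \<Rightarrow> (nat \<Rightarrow> nat \<Rightarrow> real) \<Rightarrow> nat \<Rightarrow> real" where "X' i x = x i" for i x
  define M' where "M' = distr M ?Q W"
  have Xm: "X i \<in> measurable M (euclid p)" if "i \<in> {1..n}" for i using indep that by (auto simp: indep_vars_def)
  have Wm: "W \<in> measurable M ?Q" unfolding W_def by (rule measurable_restrict) (rule Xm)
  have X'm: "X' i \<in> measurable ?Q (euclid p)" if "i \<in> {1..n}" for i
    unfolding X'_def using that by (rule measurable_component_singleton)
  have X'W: "X' i (W \<omega>) = X i \<omega>" if "i \<in> {1..n}" for i \<omega> using that by (simp add: X'_def W_def)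
  \<comment> \<open>A point of the product space equals the constant \<open>undefined\<close>
    outside 1..p, so those coordinates are measurable as well. This matters because \<Sigma> is
    compared below as a function of all index pairs.\<close>
  have X'c: "(\<lambda>x. X' i x j) \<in> borel_measurable ?Q" if i: "i \<in> {1..n}" for i j
  proof (cases "j \<in> {1..p}")
    case True
    then show ?thesis using measurable_compose[OF X'm[OF i] measurable_component_singleton[OF True]] by simp
  next
    case False
    have "X' i x j = undefined" if "x \<in> space ?Q" for x
    proof -
      have "X' i x \<in> space (euclid p)" using measurable_space[OF X'm[OF i] that] .
      then have "X' i x \<in> extensional {1..p}" by (auto simp: space_PiM PiE_def)
      then show ?thesis using False by (rule extensional_arb)
    qed
    then show ?thesis by (subst measurable_cong[where g="\<lambda>_. undefined"]) auto
  qed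
  interpret M': prob_space M' unfolding M'_def by (rule prob_space_distr[OF Wm])
  have sets_M': "sets M' = sets ?Q" by (simp add: M'_def)
  have X'm': "X' i \<in> measurable M' (euclid p)" if "i \<in> {1..n}" for i
    using X'm[OF that] unfolding measurable_cong_sets[OF sets_M' refl] .
  have distr_X': "distr M' (euclid p) (X' i) = distr M (euclid p) (X i)" if "i \<in> {1..n}" for i
    unfolding M'_def distr_distr[OF X'm[OF that] Wm] by (rule distr_cong) (simp_all add: X'W[OF that])
  \<comment> \<open>The coordinate maps have the joint law of \<open>W\<close>, a product with the
    same marginals; for random vectors this product form is equivalent to independence.\<close>
  have "M'.indep_vars (\<lambda>_. euclid p) X' {1..n}"
  proof -
    have "distr M' ?Q (\<lambda>x. \<lambda>i\<in>{1..n}. X' i x) = distr M' ?Q (\<lambda>x. x)"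
    proof (rule distr_cong[OF refl refl])
      fix x assume "x \<in> space M'"
      then have "x \<in> extensional {1..n}" by (simp add: M'_def space_PiM PiE_def)
      then show "(\<lambda>i\<in>{1..n}. X' i x) = x" unfolding X'_def by (rule extensional_restrict)
    qed
    also have "\<dots> = distr M ?Q W" using distr_id2[OF sets_M'[symmetric]] by (simp add: M'_def)
    also have "\<dots> = PiM {1..n} (\<lambda>i. distr M (euclid p) (X i))"
      using indep_vars_iff_distr_eq_PiM'[of "{1..n}" X "\<lambda>_. euclid p"] Xm indep n unfolding W_def by simp
    also have "\<dots> = PiM {1..n} (\<lambda>i. distr M' (euclid p) (X' i))"
      by (rule PiM_cong[OF refl]) (rule distr_X'[symmetric])
    finally show ?thesis
      using M'.indep_vars_iff_distr_eq_PiM'[of "{1..n}" X' "\<lambda>_. euclid p"] X'm' n by simp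
  qed
  moreover have "\<forall>i\<in>{1..n}. \<forall>j\<in>{1..p}. (\<integral>x. X' i x j \<partial>M') = 0"
  proof (intro ballI)
    fix i j assume i: "i \<in> {1..n}" and j: "j \<in> {1..p}"
    have "(\<integral>x. X' i x j \<partial>M') = (\<integral>\<omega>. X i \<omega> j \<partial>M)"
      unfolding M'_def integral_distr[OF Wm X'c[OF i]] X'W[OF i] ..
    then show "(\<integral>x. X' i x j \<partial>M') = 0" using mean i j by simp
  qed
  moreover have "\<forall>i\<in>{1..n}. \<forall>j\<in>{1..p}. psi1_norm M' (\<lambda>x. X' i x j) \<le> ereal K"
  proof (intro ballI)
    fix i j assume i: "i \<in> {1..n}" and j: "j \<in> {1..p}"
    have m: "(\<lambda>x. ennreal (exp (\<bar>X' i x j\<bar> / c))) \<in> borel_measurable (distr M ?Q W)" for c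
      unfolding measurable_distr_eq1 using X'c[OF i] by measurable
    have "psi1_norm M' (\<lambda>x. X' i x j) = psi1_norm M (\<lambda>\<omega>. X i \<omega> j)"
      unfolding psi1_norm_def M'_def nn_integral_distr[OF Wm m] X'W[OF i] ..
    then show "psi1_norm M' (\<lambda>x. X' i x j) \<le> ereal K" using psi1 i j by simp
  qed
  moreover have SW: "scaled_sum n X' (W \<omega>) = scaled_sum n X \<omega>" for \<omega>
    unfolding scaled_sum_def using X'W by (intro ext) simp
  have Sm: "(\<lambda>x. scaled_sum n X' x j) \<in> borel_measurable ?Q" for j
    unfolding scaled_sum_def by (intro borel_measurable_times borel_measurable_sum X'c borel_measurable_const)
  have "\<Sigma> = second_moment M' (scaled_sum n X')"
  proof (intro ext)
    fix j k
    show "\<Sigma> j k = second_moment M' (scaled_sum n X') j k"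
      unfolding \<Sigma> second_moment_def M'_def integral_distr[OF Wm borel_measurable_times[OF Sm[of j] Sm[of k]]] SW ..
  qed
  moreover have "measure M' {x \<in> space M'. vec_max p (scaled_sum n X' x) \<le> t} = measure M {\<omega> \<in> space M. vec_max p (scaled_sum n X \<omega>) \<le> t}" for t
  proof -
    have S: "{x \<in> space ?Q. vec_max p (scaled_sum n X' x) \<le> t} \<in> sets ?Q"
      by (rule vec_max_set_measurable) (use p Sm in auto)
    have "W -` {x \<in> space ?Q. vec_max p (scaled_sum n X' x) \<le> t} \<inter> space M = {\<omega> \<in> space M. vec_max p (scaled_sum n X \<omega>) \<le> t}"
      using measurable_space[OF Wm] by (auto simp: SW)
    then show ?thesis unfolding M'_def using measure_distr[OF Wm S] by simp
  qed
  ultimately show "(SUP t. \<bar>measure \<gamma> {z \<in> space \<gamma>. vec_max p z \<le> t} - measure M {\<omega> \<in> space M. vec_max p (scaled_sum n X \<omega>) \<le> t}\<bar>)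
    \<le> C * (exp (- \<mu>\<^sup>2 / (8 * \<sigma>max\<^sup>2)) + \<mu> powr (-2/3) * (K ^ 4 * ln (real p) ^ 7 / real n) powr (1/6))"
    using C[unfolded gaussian_max_approx_const_def, rule_format, of n p K M' X' \<Sigma> \<sigma>max \<gamma> \<mu>]
      n p K M'.prob_space_axioms \<sigma> law \<mu> rate by simp
qed

(* HOL cannot quantify over the type of the sample space inside the scope of C, so an existential
   over C alone would let C depend on 'a. The constant is therefore obtained once, on the type of
   arrays (nat => nat => real), where every array X can be realised, and the second conjunct
   says that the same constant then serves every other sample space. *)
theorem corollary13:
  "(\<exists>C>0. gaussian_max_approx_const TYPE(nat \<Rightarrow> nat \<Rightarrow> real) C) \<and>
   (\<forall>C. gaussian_max_approx_const TYPE(nat \<Rightarrow> nat \<Rightarrow> real) C \<longrightarrow>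
        gaussian_max_approx_const TYPE('a) C)"
proof
  obtain B where B: "B \<ge> 1" "\<And>k x. k \<le> 4 \<Longrightarrow> \<bar>cutoff k x\<bar> \<le> B"
    using cutoff_bounded by blast
  have "gaussian_max_approx_const TYPE(nat \<Rightarrow> nat \<Rightarrow> real) (10 ^ 8 * B)"
    by (rule gaussian_max_approx) (fact B)+
  then show "\<exists>C>0. gaussian_max_approx_const TYPE(nat \<Rightarrow> nat \<Rightarrow> real) C"
    using B(1) by (intro exI[of _ "10 ^ 8 * B"]) auto
  show "\<forall>C. gaussian_max_approx_const TYPE(nat \<Rightarrow> nat \<Rightarrow> real) C \<longrightarrow> gaussian_max_approx_const TYPE('a) C"
    using gaussian_max_approx_const_transfer by blast
qed

end
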